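(* Let $L$ be an operator on $L^2(\mathbb R^n)$ satisfying conditions (A1) and (A2) (recalled in the context) for some $1\le p_0<q_0\le\infty$, $\epsilon>0$ and $\kappa>0$. Let $p_0<p<q<q_0$ and $\alpha=n\left(\frac1p-\frac1q\right)$. Let $\mu,\lambda$ be two weights, put $u=\mu^{\frac{p_0p}{p_0-p}}$ and $v=\lambda^{\frac{q_0q}{q_0-q}}$, and suppose that $u,v\in A_\infty$ and $(u,v)\in A^{\frac{\alpha}{n}-\frac1{p_0}+\frac1{q_0}}_{\frac1{p_0}-\frac1p,\ \frac1q-\frac1{q_0}}$. Then, for all $f\in L^\infty_c(\mathbb R^n)$, $$\|L^{-\alpha/\kappa}f\|_{L^q(\lambda^q)}\lesssim [u,v]_{A^{\frac{\alpha}{n}-\frac1{p_0}+\frac1{q_0}}_{\frac1{p_0}-\frac1p,\ \frac1q-\frac1{q_0}}}\left([u]_{A_\infty}^{\frac1q}+[v]_{A_\infty}^{\frac1{p'}}\right)\|f\|_{L^p(\mu^p)} .$$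
   Context: Cubes $Q\subset\mathbb R^n$ have sides parallel to the axes and sidelength $\ell(Q)$; $\lambda Q$ is the concentric dilate. $\fint_E f=\frac1{|E|}\int_E f$. For an exponent equal to $\infty$, $L^\infty$ averages are essential suprema; $p'$ is the conjugate exponent. When $q_0=\infty$, $1/q_0=0$ and $\frac{q_0q}{q_0-q}$ is read as $q$. $L_c^\infty(\mathbb R^n)$ is the set of bounded compactly supported functions. Conditions on $L$. (A1): $L$ is a closed densely defined operator of type $\omega$ in $L^2(\mathbb R^n)$ with $0\le\omega<\pi/2$, i.e. its spectrum lies in $\{\lambda\in\mathbb C:|\arg\lambda|\le\omega\}$ and for each $\mu>\omega$ there is $C_\mu$ with $\|(L-\xi I)^{-1}\|\le C_\mu/|\xi|$ for all $\xi$ with $|\arg\xi|\ge\mu$; hence there is a holomorphic semigroup $e^{-zL}$, $|\arg z|<\pi/2-\omega$. Moreover $L$ has a bounded $H_\infty$-functional calculus on $L^2(\mathbb R^n)$. (A2) for $p_0,q_0,\epsilon,\kappa$: for all $p_0\le p\le q\le q_0$, $t>0$ and $k\in\{0,1,2,\dots\}$, $$\|(tL)^ke^{-tL}\|_{L^p\to L^q}\le C_{k,p,q}\,t^{-\frac n\kappa(\frac1p-\frac1q)},$$ and $$\Big(\fint_Q|(tL)^ke^{-tL}f|^q\Big)^{1/q}\le C_{k,p,q}\max\Big\{\Big(\tfrac{3^j\ell(Q)}{t^{1/\kappa}}\Big)^n,\Big(\tfrac{3^j\ell(Q)}{t^{1/\kappa}}\Big)^{n/p}\Big\}\Big(1+\tfrac{t^{1/\kappa}}{\ell(Q)}\Big)^{n/q}\Big(1+\tfrac{3^j\ell(Q)}{t^{1/\kappa}}\Big)^{-n-\epsilon}\Big(\fint_{S_j(Q)}|f|^p\Big)^{1/p}$$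 for all cubes $Q$, all $j\ge2$ and all $f\in L^p(S_j(Q))$, where $S_j(Q)=3^jQ\setminus3^{j-1}Q$ for $j\ge1$. Fractional power: for $0<\alpha<n$, $L^{-\alpha/\kappa}=\frac1{\Gamma(\alpha/\kappa)}\int_0^\infty s^{\alpha/\kappa}e^{-sL}\frac{ds}{s}$. Weights: a weight is a non-negative locally integrable function (positive a.e., so that negative powers make sense); $w(Q)=\int_Qw$; $\|f\|_{L^p(w)}=(\int|f|^pw)^{1/p}$. $[w]_{A_\infty}=\sup_Q\frac1{w(Q)}\int_QM(w\chi_Q)$ with $M$ the Hardy–Littlewood maximal function, and $w\in A_\infty$ means $[w]_{A_\infty}<\infty$. For $a,\beta,\gamma\in\mathbb R$, $(u,v)\in A^{a}_{\beta,\gamma}$ means $[u,v]_{A^{a}_{\beta,\gamma}}:=\sup_Q|Q|^{a}u(Q)^\beta v(Q)^\gamma<\infty$, the supremum over all cubes. $A\lesssim B$ means $A\le CB$ with $C$ depending only on $n,p,q,p_0,q_0$ and $L$ (with its data in (A1), (A2)), not on $f$ or the weights. *)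

theory Defs
  imports "HOL-Analysis.Analysis" "HOL-Probability.Essential_Supremum"
begin

section \<open>Lebesgue norms\<close>

text \<open>Exponents that may be infinite have type \<^typ>\<open>ennreal\<close>; \<open>rcp p\<close> is the real
  number $1/p$, with $1/\infty = 0$. The power \<open>epow\<close> is meant for exponents \<open>r > 0\<close> only.\<close>

definition rcp :: "ennreal \<Rightarrow> real" where
  "rcp p = enn2real (inverse p)"

definition epow :: "ennreal \<Rightarrow> real \<Rightarrow> ennreal" where
  "epow x r = (if x = \<infinity> then \<infinity> else ennreal (enn2real x powr r))"

definition Lnorm :: "'a measure \<Rightarrow> ennreal \<Rightarrow> ('a \<Rightarrow> 'b::real_normed_vector) \<Rightarrow> ennreal" where
  "Lnorm M p f =
    (if p = \<infinity> then esssup M (\<lambda>x. ennreal (norm (f x)))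
     else epow (\<integral>\<^sup>+ x. ennreal (norm (f x) powr enn2real p) \<partial>M) (1 / enn2real p))"

text \<open>Elements of $L^p(\mathbb R^n)$ are represented by functions; everything below is
  insensitive to modification on null sets.\<close>

type_synonym 'n cfun = "real^'n \<Rightarrow> complex"

definition Lp :: "ennreal \<Rightarrow> 'n::finite cfun set" where
  "Lp p = {f \<in> borel_measurable lebesgue. Lnorm lebesgue p f < \<infinity>}"

abbreviation L2 :: "'n::finite cfun set" where
  "L2 \<equiv> Lp 2"

abbreviation L2norm :: "'n::finite cfun \<Rightarrow> ennreal" where
  "L2norm f \<equiv> Lnorm lebesgue 2 f"

definition L2inner :: "'n::finite cfun \<Rightarrow> 'n cfun \<Rightarrow> complex" where
  "L2inner f h = (LINT x|lebesgue. f x * cnj (h x))"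

definition Linf_c :: "'n::finite cfun set" where
  "Linf_c = {f \<in> borel_measurable lebesgue.
     bounded (range f) \<and> (\<exists>K. compact K \<and> (\<forall>x. x \<notin> K \<longrightarrow> f x = 0))}"

section \<open>Cubes\<close>

definition cube :: "real^'n::finite \<Rightarrow> real \<Rightarrow> (real^'n) set" where
  "cube c l = cbox (c - (\<chi> i. l / 2)) (c + (\<chi> i. l / 2))"

text \<open>\<open>annulus j c l\<close> is $S_j(Q)$ for the cube $Q$ with centre \<open>c\<close> and sidelength \<open>l\<close>.\<close>

definition annulus :: "nat \<Rightarrow> real^'n::finite \<Rightarrow> real \<Rightarrow> (real^'n) set" where
  "annulus j c l = cube c (3 ^ j * l) - cube c (3 ^ (j - 1) * l)"

text \<open>$(\frac1{|E|}\int_E|f|^p)^{1/p}$, respectively the essential supremum over \<open>E\<close>.\<close>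

definition Lavg :: "ennreal \<Rightarrow> (real^'n::finite) set \<Rightarrow> 'n cfun \<Rightarrow> ennreal" where
  "Lavg p E f = Lnorm (uniform_measure lebesgue E) p f"

section \<open>Operators in $L^2$\<close>

text \<open>A possibly unbounded operator is given by its graph, a set of pairs of representatives
  that is closed under equality almost everywhere.\<close>

type_synonym 'n oper = "('n cfun \<times> 'n cfun) set"

definition linear_operator :: "'n::finite oper \<Rightarrow> bool" where
  "linear_operator L \<longleftrightarrow>
     L \<subseteq> L2 \<times> L2 \<and>
     (\<forall>(f, g)\<in>L. \<forall>f'\<in>L2. \<forall>g'\<in>L2.
        (AE x in lebesgue. f' x = f x) \<and> (AE x in lebesgue. g' x = g x) \<longrightarrow> (f', g') \<in> L) \<and>
     (\<lambda>x. 0, \<lambda>x. 0) \<in> L \<and>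
     (\<forall>(f, g)\<in>L. \<forall>(f', g')\<in>L. (\<lambda>x. f x + f' x, \<lambda>x. g x + g' x) \<in> L) \<and>
     (\<forall>(f, g)\<in>L. \<forall>a. (\<lambda>x. a * f x, \<lambda>x. a * g x) \<in> L) \<and>
     (\<forall>f g g'. (f, g) \<in> L \<and> (f, g') \<in> L \<longrightarrow> (AE x in lebesgue. g x = g' x))"

definition closed_operator :: "'n::finite oper \<Rightarrow> bool" where
  "closed_operator L \<longleftrightarrow>
     (\<forall>F G. \<forall>f\<in>L2. \<forall>g\<in>L2.
        (\<forall>k::nat. (F k, G k) \<in> L) \<and>
        (\<lambda>k. L2norm (\<lambda>x. F k x - f x)) \<longlonglongrightarrow> 0 \<and>
        (\<lambda>k. L2norm (\<lambda>x. G k x - g x)) \<longlonglongrightarrow> 0 \<longrightarrow> (f, g) \<in> L)"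

definition densely_defined :: "'n::finite oper \<Rightarrow> bool" where
  "densely_defined L \<longleftrightarrow>
     (\<forall>f\<in>L2. \<forall>e>0. \<exists>h\<in>Domain L. L2norm (\<lambda>x. f x - h x) < ennreal e)"

text \<open>For a linear relation this says that it is (the graph of) a bounded operator defined on
  all of $L^2$ with norm at most \<open>C\<close>; single-valuedness almost everywhere follows from the
  norm bound.\<close>

definition bounded_graph :: "'n::finite oper \<Rightarrow> real \<Rightarrow> bool" where
  "bounded_graph R C \<longleftrightarrow>
     (\<forall>f\<in>L2. \<exists>g. (f, g) \<in> R) \<and> (\<forall>(f, g)\<in>R. L2norm g \<le> ennreal C * L2norm f)"

text \<open>The graph of $(L-\xi I)^{-1}$.\<close>

definition resolvent_graph :: "'n::finite oper \<Rightarrow> complex \<Rightarrow> 'n oper" where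
  "resolvent_graph L \<xi> =
     {(g, f). g \<in> L2 \<and> (\<exists>h. (f, h) \<in> L \<and> (AE x in lebesgue. g x = h x - \<xi> * f x))}"

definition spectrum :: "'n::finite oper \<Rightarrow> complex set" where
  "spectrum L = {\<xi>. \<not> (\<exists>C. bounded_graph (resolvent_graph L \<xi>) C)}"

definition resolvent :: "'n::finite oper \<Rightarrow> complex \<Rightarrow> 'n cfun \<Rightarrow> 'n cfun" where
  "resolvent L \<xi> g = (SOME f. (g, f) \<in> resolvent_graph L \<xi>)"

text \<open>As \<^term>\<open>Arg 0 = 0\<close>, the closed sector contains \<open>0\<close>, and \<open>0 < \<omega>'\<close> excludes \<open>\<xi> = 0\<close> in
  the resolvent estimate.\<close>

definition of_type :: "real \<Rightarrow> 'n::finite oper \<Rightarrow> bool" where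
  "of_type \<omega> L \<longleftrightarrow>
     linear_operator L \<and> closed_operator L \<and> densely_defined L \<and>
     spectrum L \<subseteq> {z. \<bar>Arg z\<bar> \<le> \<omega>} \<and>
     (\<forall>\<omega>'>\<omega>. \<exists>C. \<forall>\<xi>. \<omega>' \<le> \<bar>Arg \<xi>\<bar> \<longrightarrow>
        bounded_graph (resolvent_graph L \<xi>) (C / norm \<xi>))"

section \<open>The $H_\infty$ functional calculus\<close>

definition sector :: "real \<Rightarrow> complex set" where
  "sector \<nu> = {z. z \<noteq> 0 \<and> \<bar>Arg z\<bar> < \<nu>}"

text \<open>The graph of
  $\psi(L) = \frac1{2\pi i}\int_\Gamma (L-\zeta I)^{-1}\psi(\zeta)\,d\zeta$, where $\Gamma$ is the
  boundary of the sector of half-angle \<open>\<theta>\<close>, oriented clockwise around the spectrum: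
  outwards along $e^{i\theta}$ and inwards along $e^{-i\theta}$. The $L^2$-valued integral is taken weakly; it converges absolutely for
  \<open>\<psi>\<close> decaying like a power of $|\zeta|$ at \<open>0\<close> and of $|\zeta|^{-1}$ at $\infty$.\<close>

definition psi_calc :: "'n::finite oper \<Rightarrow> real \<Rightarrow> (complex \<Rightarrow> complex) \<Rightarrow> 'n oper" where
  "psi_calc L \<theta> \<psi> =
     {(f, g). f \<in> L2 \<and> g \<in> L2 \<and>
       (\<forall>h\<in>L2. L2inner g h = 1 / (2 * of_real pi * \<i>) *
          (LBINT r:{0<..}.
             \<psi> (of_real r * cis \<theta>) * cis \<theta> *
               L2inner (resolvent L (of_real r * cis \<theta>) f) h
           - \<psi> (of_real r * cis (- \<theta>)) * cis (- \<theta>) *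
               L2inner (resolvent L (of_real r * cis (- \<theta>)) f) h))}"

text \<open>McIntosh's definition $b(L) = \psi(L)^{-1}(b\psi)(L)$ with $\psi(z) = z(1+z)^{-2}$.\<close>

definition Hinf_calc :: "'n::finite oper \<Rightarrow> real \<Rightarrow> (complex \<Rightarrow> complex) \<Rightarrow> 'n oper" where
  "Hinf_calc L \<theta> b =
     psi_calc L \<theta> (\<lambda>z. b z * (z / (1 + z)\<^sup>2)) O (psi_calc L \<theta> (\<lambda>z. z / (1 + z)\<^sup>2))\<inverse>"

text \<open>When \<open>L\<close> is injective, $b(L)$ is single-valued and this is the boundedness of $b(L)$ with
  $\|b(L)\| \le C\|b\|_\infty$. Injectivity is not assumed; without it $b(L)$ is a relation, and
  some value obeying the bound is required.\<close>

definition bounded_Hinf_calculus :: "real \<Rightarrow> 'n::finite oper \<Rightarrow> bool" where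
  "bounded_Hinf_calculus \<omega> L \<longleftrightarrow>
     (\<exists>\<theta> \<nu> C. \<omega> < \<theta> \<and> \<theta> < \<nu> \<and> \<nu> < pi \<and>
       (\<forall>b B. b holomorphic_on sector \<nu> \<and> (\<forall>z\<in>sector \<nu>. norm (b z) \<le> B) \<longrightarrow>
          (\<forall>f\<in>L2. \<exists>g. (f, g) \<in> Hinf_calc L \<theta> b \<and> L2norm g \<le> ennreal (C * B) * L2norm f)))"

definition cond_A1 :: "'n::finite oper \<Rightarrow> bool" where
  "cond_A1 L \<longleftrightarrow>
     (\<exists>\<omega>. 0 \<le> \<omega> \<and> \<omega> < pi / 2 \<and> of_type \<omega> L \<and> bounded_Hinf_calculus \<omega> L)"

section \<open>The semigroup and the fractional powers\<close>

text \<open>\<open>T\<close> is a strongly continuous semigroup on $L^2$ whose generator is \<open>-L\<close>.\<close>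

definition semigroup_of :: "'n::finite oper \<Rightarrow> (real \<Rightarrow> 'n cfun \<Rightarrow> 'n cfun) \<Rightarrow> bool" where
  "semigroup_of L T \<longleftrightarrow>
     (\<forall>t\<ge>0. (\<forall>f\<in>L2. T t f \<in> L2) \<and>
        (\<forall>f\<in>L2. \<forall>g\<in>L2. AE x in lebesgue. T t (\<lambda>y. f y + g y) x = T t f x + T t g x) \<and>
        (\<forall>f\<in>L2. \<forall>a. AE x in lebesgue. T t (\<lambda>y. a * f y) x = a * T t f x) \<and>
        (\<exists>C. \<forall>f\<in>L2. L2norm (T t f) \<le> ennreal C * L2norm f)) \<and>
     (\<forall>f\<in>L2. AE x in lebesgue. T 0 f x = f x) \<and>
     (\<forall>s\<ge>0. \<forall>t\<ge>0. \<forall>f\<in>L2. AE x in lebesgue. T (s + t) f x = T s (T t f) x) \<and>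
     (\<forall>f\<in>L2. ((\<lambda>t. L2norm (\<lambda>x. T t f x - f x)) \<longlongrightarrow> 0) (at_right 0)) \<and>
     (\<forall>f g. (f, g) \<in> L \<longleftrightarrow>
        f \<in> L2 \<and> g \<in> L2 \<and>
        ((\<lambda>t. L2norm (\<lambda>x. (f x - T t f x) / of_real t - g x)) \<longlongrightarrow> 0) (at_right 0))"

text \<open>$e^{-tL}$. Such a semigroup exists for \<open>L\<close> as in \<open>cond_A1\<close>, and is unique up to equality
  almost everywhere of each $e^{-tL}f$; the same applies to the choice in \<open>heat_deriv\<close>.\<close>

definition heat :: "'n::finite oper \<Rightarrow> real \<Rightarrow> 'n cfun \<Rightarrow> 'n cfun" where
  "heat L = (SOME T. semigroup_of L T)"

definition scale_op :: "real \<Rightarrow> 'n::finite oper \<Rightarrow> 'n oper" where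
  "scale_op t L = {(f, \<lambda>x. of_real t * g x) | f g. (f, g) \<in> L}"

text \<open>$(tL)^k e^{-tL} f$.\<close>

definition heat_deriv :: "'n::finite oper \<Rightarrow> nat \<Rightarrow> real \<Rightarrow> 'n cfun \<Rightarrow> 'n cfun" where
  "heat_deriv L k t f = (SOME g. (heat L t f, g) \<in> scale_op t L ^^ k)"

text \<open>The operators being defined on $L^2$, their $L^p$-to-$L^q$ bounds are, as usual, required on
  the subspace $L^2\cap L^p$.\<close>

definition cond_A2 ::
  "'n::finite oper \<Rightarrow> ennreal \<Rightarrow> ennreal \<Rightarrow> real \<Rightarrow> real \<Rightarrow> bool" where
  "cond_A2 L p0 q0 \<epsilon> \<kappa> \<longleftrightarrow>
     (\<forall>p q k. p0 \<le> p \<and> p \<le> q \<and> q \<le> q0 \<longrightarrow>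
       (\<exists>C::real. \<forall>t>0.
          (\<forall>f \<in> L2 \<inter> Lp p.
             Lnorm lebesgue q (heat_deriv L k t f)
             \<le> ennreal (C * t powr (- (real CARD('n) / \<kappa>) * (rcp p - rcp q)))
               * Lnorm lebesgue p f) \<and>
          (\<forall>c l j. 0 < l \<and> 2 \<le> j \<longrightarrow>
             (\<forall>f \<in> L2 \<inter> Lp p. (\<forall>x. x \<notin> annulus j c l \<longrightarrow> f x = 0) \<longrightarrow>
                Lavg q (cube c l) (heat_deriv L k t f)
                \<le> ennreal (C *
                     max ((3 ^ j * l / t powr (1 / \<kappa>)) powr real CARD('n))
                         ((3 ^ j * l / t powr (1 / \<kappa>)) powr (real CARD('n) * rcp p)) *
                     (1 + t powr (1 / \<kappa>) / l) powr (real CARD('n) * rcp q) *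
                     (1 + 3 ^ j * l / t powr (1 / \<kappa>)) powr (- real CARD('n) - \<epsilon>))
                  * Lavg p (annulus j c l) f))))"

text \<open>\<open>g\<close> is $\frac1{\Gamma(a)}\int_0^\infty s^{a} e^{-sL}f\,\frac{ds}s$, the function-valued
  integral being understood weakly, i.e. tested against all $\varphi\in L^\infty_c$. This
  determines \<open>g\<close> up to equality almost everywhere, and does not require the integral to
  converge in $L^2$ (under \<open>cond_A2\<close> it converges in $L^r$ for suitable \<open>r\<close>).\<close>

definition is_frac_power ::
  "'n::finite oper \<Rightarrow> real \<Rightarrow> 'n cfun \<Rightarrow> 'n cfun \<Rightarrow> bool" where
  "is_frac_power L a f g \<longleftrightarrow>
     g \<in> borel_measurable lebesgue \<and>
     (\<forall>c l. set_integrable lebesgue (cube c l) g) \<and>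
     (\<forall>\<phi>\<in>Linf_c.
        set_integrable lborel {0<..}
          (\<lambda>s. of_real (s powr (a - 1)) * (LINT x|lebesgue. heat L s f x * \<phi> x)) \<and>
        (LINT x|lebesgue. g x * \<phi> x) =
          1 / of_real (Gamma a) *
          (LBINT s:{0<..}. of_real (s powr (a - 1)) * (LINT x|lebesgue. heat L s f x * \<phi> x)))"

text \<open>$L^{-a}f$.\<close>

definition neg_power :: "'n::finite oper \<Rightarrow> real \<Rightarrow> 'n cfun \<Rightarrow> 'n cfun" where
  "neg_power L a f = (SOME g. is_frac_power L a f g)"

section \<open>Weights\<close>

definition weight :: "(real^'n::finite \<Rightarrow> real) \<Rightarrow> bool" where
  "weight w \<longleftrightarrow> w \<in> borel_measurable lebesgue \<and> (\<forall>x. 0 \<le> w x) \<and>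
     (AE x in lebesgue. 0 < w x) \<and> (\<forall>c l. set_integrable lebesgue (cube c l) w)"

definition wmeasure :: "(real^'n::finite \<Rightarrow> real) \<Rightarrow> (real^'n) set \<Rightarrow> real" where
  "wmeasure w E = (LINT x:E|lebesgue. w x)"

text \<open>$\|f\|_{L^p(w)}$.\<close>

definition wnorm :: "real \<Rightarrow> (real^'n::finite \<Rightarrow> real) \<Rightarrow> 'n cfun \<Rightarrow> ennreal" where
  "wnorm p w f = epow (\<integral>\<^sup>+ x. ennreal (norm (f x) powr p * w x) \<partial>lebesgue) (1 / p)"

definition HL_maximal :: "(real^'n::finite \<Rightarrow> real) \<Rightarrow> real^'n \<Rightarrow> ennreal" where
  "HL_maximal f x =
     (SUP (c, l) \<in> {(c, l). 0 < l \<and> x \<in> cube c l}.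
        (\<integral>\<^sup>+ y \<in> cube c l. ennreal \<bar>f y\<bar> \<partial>lebesgue) / emeasure lebesgue (cube c l))"

definition Ainf_const :: "(real^'n::finite \<Rightarrow> real) \<Rightarrow> ennreal" where
  "Ainf_const w =
     (SUP (c, l) \<in> {(c, l). 0 < l}.
        (\<integral>\<^sup>+ x \<in> cube c l. HL_maximal (\<lambda>y. w y * indicator (cube c l) y) x \<partial>lebesgue)
        / ennreal (wmeasure w (cube c l)))"

definition A_inf :: "(real^'n::finite \<Rightarrow> real) \<Rightarrow> bool" where
  "A_inf w \<longleftrightarrow> weight w \<and> Ainf_const w < \<infinity>"

text \<open>The characteristic $[u,v]_{A^a_{\beta,\gamma}}$.\<close>

definition pair_const ::
  "real \<Rightarrow> real \<Rightarrow> real \<Rightarrow> (real^'n::finite \<Rightarrow> real) \<Rightarrow> (real^'n \<Rightarrow> real) \<Rightarrow> ennreal" where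
  "pair_const a \<beta> \<gamma> u v =
     (SUP (c, l) \<in> {(c, l). 0 < l}.
        ennreal (measure lebesgue (cube c l) powr a *
          wmeasure u (cube c l) powr \<beta> * wmeasure v (cube c l) powr \<gamma>))"

text \<open>The exponent $\frac{q_0q}{q_0-q}$, read as \<open>q\<close> when $q_0=\infty$.\<close>

definition v_exponent :: "ennreal \<Rightarrow> real \<Rightarrow> real" where
  "v_exponent q0 q =
     (if q0 = \<infinity> then q else enn2real q0 * q / (enn2real q0 - q))"

end

theory Submission
  imports Defs "HOL-Complex_Analysis.Complex_Analysis" "HOL-Real_Asymp.Real_Asymp"
begin

text \<open>By duality it suffices to bound
  $\int_0^\infty t^{\alpha/\kappa-1}\int|e^{-tL}f|\,|\varphi|\,dx\,dt$. For $t^{1/\kappa}$ comparable to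
  $3^k$, decompose space into triadic cells $Q$ of side $3^k$ and $f$ into its restrictions to $3Q$ and
  the annuli $S_j(Q)$; the bounds (A2) with $k=0$ and $(p,q)=(p_0,q_0)$ decay like $3^{-j\epsilon}$, and
  $3^{j+1}Q$ lies in a cell of one of the $2^n$ grids shifted by $\tau\in\{0,\frac12\}^n$, all of which
  are nested. This leaves, for each grid, the sum
  $\sum_R |R|^a(\int_R|f|^{p_0})^{1/p_0}(\int_R|\varphi|^{q_0'})^{1/q_0'}$ over all its cells $R$, with
  $a=\frac\alpha n-\frac1{p_0}+\frac1{q_0}$.

  To bound it, sort the cells by the sizes of $|R|^au(R)^\beta v(R)^\gamma$, of the running maximum over
  larger cells of the average of $|f|^{p_0}/u$ with respect to $u$, and of the corresponding maximum
  for $\varphi$ and $v$. Within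
  one class the sum is dominated by its maximal cells, at each of which one of the two running maxima
  jumps. If the second one jumps, Hoelder's inequality and the dyadic maximal theorem for $v$ reduce
  matters to $\sum_{Q\subseteq R}u(Q)^{q/p}\lesssim[u]_{A_\infty}u(R)^{q/p}$. This follows from the
  $A_\infty$ condition, because a cell $Q$ lying $d$ generations below $R$ has
  $d\,u(Q)\le\frac32[u]_{A_\infty}u(R)$. The other case is symmetric.

  That $e^{-tL}$ exists is proved by integrating the resolvent along a hyperbola, and that
  $L^{-\alpha/\kappa}f$ exists follows from the same estimate with $u=v=1$.\<close>

section \<open>Generation of semigroups by sectorial operators\<close>

lemma exp_abs_integrable:
  fixes d :: real
  assumes "0 < d"
  shows "(\<lambda>s. exp (- d * \<bar>s\<bar>)) integrable_on UNIV"
proof -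
  have 1: "(\<lambda>s. exp (- d * s)) absolutely_integrable_on {0..}"
    by (intro nonnegative_absolutely_integrable_1 integrable_on_exp_minus_to_infinity assms) auto
  have im: "uminus ` {..0::real} \<subseteq> {0..}" "uminus ` {0..} \<subseteq> {..0::real}" by auto
  have "(\<lambda>s. exp (- d * (- s))) absolutely_integrable_on {..0}"
    using 1 has_absolute_integral_reflect_real[OF im, of "\<lambda>s. exp (- d * s)" "integral {0..} (\<lambda>s. exp (- d * s))"]
    by simp
  then have "(\<lambda>s. exp (- d * \<bar>s\<bar>)) integrable_on {..0}"
    by (intro integrable_eq[OF set_lebesgue_integral_eq_integral(1)]) auto
  moreover have "(\<lambda>s. exp (- d * \<bar>s\<bar>)) integrable_on {0..}"
    using 1 by (intro integrable_eq[OF set_lebesgue_integral_eq_integral(1)]) auto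
  moreover have "negligible ({..0} \<inter> {0..} :: real set)"
    by (rule negligible_subset[of "{0}"]) auto
  moreover have "{..0} \<union> {0..} = (UNIV :: real set)" by auto
  ultimately show ?thesis
    by (metis integrable_Un)
qed

lemma exp_decay_integral:
  fixes g :: "real \<Rightarrow> 'b::banach"
  assumes "0 < d" "continuous_on UNIV g" "\<And>s. norm (g s) \<le> B * exp (- d * \<bar>s\<bar>)"
  shows "g integrable_on UNIV"
    and "norm (integral UNIV g) \<le> B * integral UNIV (\<lambda>s::real. exp (- d * \<bar>s\<bar>))"
proof -
  have i: "(\<lambda>s. B * exp (- d * \<bar>s\<bar>)) integrable_on UNIV"
    using integrable_on_cmult_left[OF exp_abs_integrable[OF assms(1)]] by simp
  show "g integrable_on UNIV"
  proof (rule integrable_on_all_intervals_UNIV[OF _ assms(3) i])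
    show "g integrable_on cbox a b" for a b
      by (rule integrable_continuous) (use assms(2) continuous_on_subset in blast)
  qed
  then have "norm (integral UNIV g) \<le> integral UNIV (\<lambda>s. B * exp (- d * \<bar>s\<bar>))"
    by (rule Henstock_Kurzweil_Integration.integral_norm_bound_integral[OF _ i]) (use assms(3) in auto)
  then show "norm (integral UNIV g) \<le> B * integral UNIV (\<lambda>s::real. exp (- d * \<bar>s\<bar>))"
    by simp
qed

lemma integral_derivative_UNIV:
  fixes f :: "real \<Rightarrow> 'b::banach"
  assumes d: "\<And>s. (f has_vector_derivative f' s) (at s)"
    and i: "f' integrable_on UNIV"
    and l: "((\<lambda>N. f N - f (- N)) \<longlongrightarrow> l) at_top"
  shows "integral UNIV f' = l"
proof -
  have ftc: "integral {- N..N} f' = f N - f (- N)" if "0 < N" for N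
    using that by (intro integral_unique fundamental_theorem_of_calculus)
       (auto intro: has_vector_derivative_at_within d)
  have "((\<lambda>N. f N - f (- N)) \<longlongrightarrow> integral UNIV f') at_top"
  proof (rule tendstoI)
    fix e :: real assume "0 < e"
    then obtain B where B: "B > 0" "\<And>x y. ball 0 B \<subseteq> cbox x y \<Longrightarrow>
       norm (integral (cbox x y) f' - integral UNIV f') < e"
      using i has_integral_alt'[of f' "integral UNIV f'" UNIV] by (auto simp: has_integral_integral)
    have "dist (f N - f (- N)) (integral UNIV f') < e" if "N \<ge> B" for N
    proof -
      have "ball 0 B \<subseteq> cbox (- N) N"
        using that by (auto simp: dist_real_def)
      from B(2)[OF this] ftc[of N] that B(1) show ?thesis
        by (simp add: dist_norm)
    qed
    then show "\<forall>\<^sub>F N in at_top. dist (f N - f (- N)) (integral UNIV f') < e"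
      using eventually_at_top_linorder by blast
  qed
  then show ?thesis
    using l tendsto_unique trivial_limit_at_top_linorder by blast
qed

definition curve :: "real \<Rightarrow> real \<Rightarrow> complex" where
  "curve d s = Complex (d * sqrt (1 + s\<^sup>2) - 1) s"

definition curve' :: "real \<Rightarrow> real \<Rightarrow> complex" where
  "curve' d s = Complex (d * s / sqrt (1 + s\<^sup>2)) 1"

lemma one_plus_sq_pos: "0 < 1 + (s::real)\<^sup>2"
  by (meson add_pos_nonneg zero_le_power2 zero_less_one)

lemma sqrt_one_plus_sq: "\<bar>s\<bar> \<le> sqrt (1 + s\<^sup>2)" "sqrt (1 + s\<^sup>2) \<le> 1 + \<bar>s\<bar>"
proof -
  show "\<bar>s\<bar> \<le> sqrt (1 + s\<^sup>2)"
    by (intro real_le_rsqrt) (auto simp: power2_abs)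
  show "sqrt (1 + s\<^sup>2) \<le> 1 + \<bar>s\<bar>"
    by (intro real_le_lsqrt) (auto simp: power2_eq_square algebra_simps)
qed

lemma continuous_curve: "continuous_on UNIV (curve d)"
  unfolding curve_def complex_eq_cancel_iff2 Complex_eq by (intro continuous_intros)

lemma continuous_curve': "continuous_on UNIV (curve' d)"
proof -
  have "sqrt (1 + s\<^sup>2) \<noteq> 0" for s :: real using one_plus_sq_pos[of s] by simp
  then show ?thesis
    unfolding curve'_def Complex_eq by (intro continuous_intros) auto
qed

lemma curve_deriv: "(curve d has_vector_derivative curve' d s) (at s)"
proof -
  have "((\<lambda>s. d * sqrt (1 + s\<^sup>2) - 1) has_real_derivative d * s / sqrt (1 + s\<^sup>2)) (at s)"
    using one_plus_sq_pos[of s] by (auto intro!: derivative_eq_intros simp: field_simps)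
  then have "((\<lambda>s. complex_of_real (d * sqrt (1 + s\<^sup>2) - 1)) has_vector_derivative
      complex_of_real (d * s / sqrt (1 + s\<^sup>2))) (at s)"
    by (intro has_vector_derivative_of_real)
      (simp add: has_real_derivative_iff_has_vector_derivative)
  moreover have "((\<lambda>s. \<i> * complex_of_real s) has_vector_derivative \<i>) (at s)"
    by (auto intro!: derivative_eq_intros)
  ultimately show ?thesis
    unfolding curve_def curve'_def Complex_eq
    using has_vector_derivative_add by fastforce
qed

lemma norm_curve'_le: assumes "0 < d" "d < 1" shows "norm (curve' d s) \<le> 2"
proof -
  have "\<bar>s\<bar> / sqrt (1 + s\<^sup>2) \<le> 1"
    using sqrt_one_plus_sq(1)[of s] one_plus_sq_pos[of s] by (simp add: divide_le_eq_1_pos)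
  then have "\<bar>d * s / sqrt (1 + s\<^sup>2)\<bar> \<le> 1"
    using assms mult_mono[of d 1 "\<bar>s\<bar> / sqrt (1 + s\<^sup>2)" 1] by (simp add: abs_mult)
  then show ?thesis
    using cmod_le[of "curve' d s"] by (simp add: curve'_def)
qed

lemma norm_curve_ge:
  assumes "0 < d" "d < 1"
  shows "\<bar>s\<bar> \<le> norm (curve d s)" and "(1 - d) / 2 \<le> norm (curve d s)"
proof -
  show 1: "\<bar>s\<bar> \<le> norm (curve d s)"
    using abs_Im_le_cmod[of "curve d s"] by (simp add: curve_def)
  have "1 - d - d * \<bar>s\<bar> \<le> - Re (curve d s)"
    using mult_left_mono[OF sqrt_one_plus_sq(2)[of s], of d] assms by (simp add: curve_def algebra_simps)
  also have "\<dots> \<le> norm (curve d s)"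
    using abs_Re_le_cmod[of "curve d s"] by linarith
  finally have "1 - d \<le> norm (curve d s) + d * \<bar>s\<bar>" by simp
  also have "d * \<bar>s\<bar> \<le> 1 * norm (curve d s)" using 1 assms by (intro mult_mono) auto
  finally show "(1 - d) / 2 \<le> norm (curve d s)" by simp
qed

lemma curve_nz: "0 < d \<Longrightarrow> d < 1 \<Longrightarrow> curve d s \<noteq> 0"
  using norm_curve_ge(2)[of d s] by auto

lemma curve_Re_le: assumes "0 < d" "d < 1" shows "Re (curve d s) < d * \<bar>Im (curve d s)\<bar>"
  using mult_left_mono[OF sqrt_one_plus_sq(2)[of s], of d] assms by (simp add: curve_def algebra_simps)

definition kern :: "real \<Rightarrow> real \<Rightarrow> complex" where
  "kern d s = exp (- curve d s) * curve' d s"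

lemma continuous_kern: "continuous_on UNIV (kern d)"
  unfolding kern_def by (intro continuous_intros continuous_curve continuous_curve')

lemma norm_exp_curve: assumes "0 < d" shows "norm (exp (- curve d s)) \<le> exp 1 * exp (- d * \<bar>s\<bar>)"
proof -
  have "- Re (curve d s) \<le> 1 + - d * \<bar>s\<bar>"
    using mult_left_mono[OF sqrt_one_plus_sq(1)[of s], of d] assms by (simp add: curve_def)
  then have "exp (- Re (curve d s)) \<le> exp (1 + - d * \<bar>s\<bar>)"
    by (subst exp_le_cancel_iff)
  also have "\<dots> = exp 1 * exp (- d * \<bar>s\<bar>)" by (rule exp_add)
  finally show ?thesis by simp
qed

lemma norm_kern: assumes "0 < d" "d < 1" shows "norm (kern d s) \<le> 2 * exp 1 * exp (- d * \<bar>s\<bar>)"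
  unfolding kern_def norm_mult
  using mult_mono[OF norm_exp_curve[OF assms(1)] norm_curve'_le[OF assms]] by (simp add: mult_ac)

lemma Ln_uminus_upper: "0 < Im z \<Longrightarrow> Ln (- z) = Ln z - \<i> * of_real pi"
  and Ln_uminus_lower: "Im z < 0 \<Longrightarrow> Ln (- z) = Ln z + \<i> * of_real pi"
  by (subst Ln_minus; force)+

lemma exp_div_primitive:
  obtains g :: "complex \<Rightarrow> complex"
  where "\<And>z. z \<noteq> 0 \<Longrightarrow> (g has_field_derivative (exp (- z) - 1) / z) (at z)"
proof -
  define f :: "complex \<Rightarrow> complex" where "f z = (if z = 0 then - 1 else (exp (- z) - 1) / z)" for z
  have d: "f field_differentiable at z" if "z \<noteq> 0" for z
  proof -
    have "((\<lambda>z. (exp (- z) - 1) / z) has_field_derivative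
        ((- exp (- z)) * z - (exp (- z) - 1) * 1) / (z * z)) (at z)"
      using that by (auto intro!: derivative_eq_intros)
    then have "(f has_field_derivative ((- exp (- z)) * z - (exp (- z) - 1) * 1) / (z * z)) (at z)"
      by (rule has_field_derivative_transform_within_open[of _ _ _ "- {0}"])
        (use that in \<open>auto simp: f_def\<close>)
    then show ?thesis
      unfolding field_differentiable_def by blast
  qed
  have 0: "isCont f 0"
  proof -
    have "((\<lambda>z::complex. exp (- z)) has_field_derivative - 1) (at 0)"
      by (auto intro!: derivative_eq_intros)
    then have "((\<lambda>z::complex. (exp (- z) - 1) / z) \<longlongrightarrow> - 1) (at 0)"
      by (simp add: has_field_derivative_iff)
    then have "(f \<longlongrightarrow> - 1) (at 0)"
      by (rule Lim_transform_within[of _ _ _ _ 1]) (auto simp: f_def)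
    then show ?thesis
      by (simp add: isCont_def f_def[of 0])
  qed
  have c: "continuous_on UNIV f"
  proof (intro continuous_at_imp_continuous_on ballI)
    show "isCont f z" for z
      using 0 field_differentiable_imp_continuous_at[OF d, of z] by (cases "z = 0") auto
  qed
  obtain g where g: "\<And>z. z \<in> UNIV \<Longrightarrow> (g has_field_derivative f z) (at z within UNIV)"
    using holomorphic_convex_primitive[of UNIV "{0}" f, OF _ _ c] d by fastforce
  have "(g has_field_derivative (exp (- z) - 1) / z) (at z)" if "z \<noteq> 0" for z
    using g[of z] that by (simp add: f_def)
  then show thesis by (rule that)
qed

lemma integral_kern_div_curve:
  assumes d: "0 < d" "d < 1"
  shows "integral UNIV (\<lambda>s. kern d s / curve d s) = - (2 * of_real pi * \<i>)"
proof -
  obtain g :: "complex \<Rightarrow> complex"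
    where g: "\<And>z. z \<noteq> 0 \<Longrightarrow> (g has_field_derivative (exp (- z) - 1) / z) (at z)"
    by (rule exp_div_primitive) blast
  define F where "F s = g (curve d s) + Ln (- curve d s)" for s
  define H where "H z = g z + Ln z" for z
  show ?thesis
  proof (rule integral_derivative_UNIV)
    show "(F has_vector_derivative kern d s / curve d s) (at s)" for s
    proof -
      have nz: "- curve d s \<notin> \<real>\<^sub>\<le>\<^sub>0"
        using curve_Re_le[OF d, of s] curve_nz[OF d, of s]
        by (auto simp: complex_nonpos_Reals_iff complex_eq_iff)
      have "((\<lambda>z. g z + Ln (- z)) has_field_derivative exp (- curve d s) / curve d s) (at (curve d s))"
        using nz curve_nz[OF d, of s]
        by (auto intro!: derivative_eq_intros g simp: field_simps)
      from field_vector_diff_chain_at[OF curve_deriv this]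
      show ?thesis by (simp add: F_def[abs_def] kern_def o_def mult_ac)
    qed
    show "(\<lambda>s. kern d s / curve d s) integrable_on UNIV"
    proof (rule exp_decay_integral(1)[OF d(1)])
      show "continuous_on UNIV (\<lambda>s. kern d s / curve d s)"
        by (intro continuous_intros continuous_kern continuous_curve) (use curve_nz[OF d] in auto)
      show "norm (kern d s / curve d s) \<le> (2 * exp 1 / ((1 - d) / 2)) * exp (- d * \<bar>s\<bar>)" for s
        using frac_le[OF _ norm_kern[OF d, of s] _ norm_curve_ge(2)[OF d, of s]] d
        by (simp add: norm_divide)
    qed
    have diff: "F N - F (- N) = H (curve d N) - H (curve d (- N)) - 2 * of_real pi * \<i>" if "N > 0" for N
    proof -
      have "Im (curve d N) > 0" "Im (curve d (- N)) < 0" using that by (auto simp: curve_def)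
      then show ?thesis
        by (simp add: F_def H_def Ln_uminus_upper Ln_uminus_lower)
    qed
    have bound: "norm (H (curve d N) - H (curve d (- N))) \<le> exp (1 - d * N) * (2 * N)"
      if N: "N > 0" "d * N > 2" for N
    proof -
      define X where "X = d * sqrt (1 + N\<^sup>2) - 1"
      have X: "d * N - 1 \<le> X" using mult_left_mono[OF sqrt_one_plus_sq(1)[of N], of d] d N
        by (simp add: X_def)
      have X1: "1 < X" using X N by simp
      have "norm (H (curve d N) - H (curve d (- N))) \<le> exp (1 - d * N) * norm (curve d N - curve d (- N))"
      proof (rule field_differentiable_bound[of "{z. Re z = X}" H "\<lambda>z. exp (- z) / z"])
        show "convex {z. Re z = X}"
          by (intro convexI) (auto simp flip: distrib_right)
        show "(H has_field_derivative exp (- z) / z) (at z within {z. Re z = X})" if "z \<in> {z. Re z = X}" for z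
        proof -
          have "z \<notin> \<real>\<^sub>\<le>\<^sub>0" "z \<noteq> 0" using that X1 by (auto simp: complex_nonpos_Reals_iff)
          then have "(H has_field_derivative exp (- z) / z) (at z)"
            unfolding H_def by (auto intro!: derivative_eq_intros g simp: field_simps)
          then show ?thesis by (rule has_field_derivative_at_within)
        qed
        show "norm (exp (- z) / z) \<le> exp (1 - d * N)" if "z \<in> {z. Re z = X}" for z
        proof -
          have "1 \<le> norm z" using that X1 complex_Re_le_cmod[of z] by simp
          then have "exp (- X) / norm z \<le> exp (- X)"
            by (simp add: divide_le_eq mult_le_cancel_left1)
          also have "\<dots> \<le> exp (1 - d * N)" using X by simp
          finally show ?thesis using that by (simp add: norm_divide)
        qed
        show "curve d N \<in> {z. Re z = X}" "curve d (- N) \<in> {z. Re z = X}"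
          by (auto simp: curve_def X_def)
      qed
      also have "curve d N - curve d (- N) = Complex 0 (2 * N)"
        by (simp add: curve_def complex_eq_iff)
      also have "norm (Complex 0 (2 * N)) = 2 * N" using N by (simp add: cmod_def real_sqrt_mult)
      finally show ?thesis .
    qed
    have "((\<lambda>N. H (curve d N) - H (curve d (- N))) \<longlongrightarrow> 0) at_top"
    proof (rule Lim_null_comparison)
      show "\<forall>\<^sub>F N in at_top. norm (H (curve d N) - H (curve d (- N))) \<le> exp (1 - d * N) * (2 * N)"
      proof (rule eventually_mono[OF eventually_gt_at_top[of "2 / d"]])
        fix N assume "2 / d < N"
        then have "2 < d * N" using d by (simp add: field_simps)
        moreover from this have "0 < N" using d by (metis less_trans zero_less_mult_pos zero_less_numeral)
        ultimately show "norm (H (curve d N) - H (curve d (- N))) \<le> exp (1 - d * N) * (2 * N)"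
          by (intro bound)
      qed
      show "((\<lambda>N. exp (1 - d * N) * (2 * N)) \<longlongrightarrow> 0) at_top"
        using d(1) by real_asymp
    qed
    from tendsto_diff[OF this tendsto_const[of "2 * of_real pi * \<i>"]]
    have "((\<lambda>N. H (curve d N) - H (curve d (- N)) - 2 * of_real pi * \<i>) \<longlongrightarrow> - (2 * of_real pi * \<i>)) at_top"
      by simp
    then show "((\<lambda>N. F N - F (- N)) \<longlongrightarrow> - (2 * of_real pi * \<i>)) at_top"
    proof (rule Lim_transform_eventually)
      show "\<forall>\<^sub>F N in at_top. H (curve d N) - H (curve d (- N)) - 2 * of_real pi * \<i> = F N - F (- N)"
        using eventually_gt_at_top[of 0] by (rule eventually_mono) (simp only: diff)
    qed
  qed
qed

lemma has_vector_derivative_Lim: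
  "(f has_vector_derivative D) (at x) \<longleftrightarrow> ((\<lambda>y. (f y - f x) /\<^sub>R (y - x)) \<longlongrightarrow> D) (at x)"
proof -
  have "norm ((f y - f x) /\<^sub>R (y - x) - D) = norm (f y - f x - (y - x) *\<^sub>R D) / norm (y - x)"
    if "y \<noteq> x" for y
  proof -
    have "(f y - f x) /\<^sub>R (y - x) - D = (f y - f x - (y - x) *\<^sub>R D) /\<^sub>R (y - x)"
      using that by (simp add: scaleR_diff_right)
    then show ?thesis by (simp add: divide_inverse mult.commute)
  qed
  then have "((\<lambda>y. norm (f y - f x - (y - x) *\<^sub>R D) / norm (y - x)) \<longlongrightarrow> 0) (at x) \<longleftrightarrow>
     ((\<lambda>y. norm ((f y - f x) /\<^sub>R (y - x) - D)) \<longlongrightarrow> 0) (at x)"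
    by (intro Lim_cong_within) auto
  then show ?thesis
    unfolding has_vector_derivative_def has_derivative_iff_norm
    by (simp add: tendsto_norm_zero_iff Lim_null[symmetric] bounded_linear_scaleR_left)
qed

locale sectorial_graph =
  fixes sc :: "complex \<Rightarrow> 'a::banach \<Rightarrow> 'a" and G :: "('a \<times> 'a) set" and d C :: real
  assumes d: "0 < d" "d < 1"
    and sc_add_right: "sc a (x + y) = sc a x + sc a y"
    and sc_add_left: "sc (a + b) x = sc a x + sc b x"
    and sc_sc: "sc a (sc b x) = sc (a * b) x"
    and sc_real: "sc (of_real r) x = r *\<^sub>R x"
    and norm_sc: "norm (sc a x) = norm a * norm x"
    and G_add: "(x, y) \<in> G \<Longrightarrow> (x', y') \<in> G \<Longrightarrow> (x + x', y + y') \<in> G"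
    and G_sc: "(x, y) \<in> G \<Longrightarrow> (sc a x, sc a y) \<in> G"
    and G_sv: "(x, y) \<in> G \<Longrightarrow> (x, y') \<in> G \<Longrightarrow> y = y'"
    and dense: "0 < e \<Longrightarrow> \<exists>y w. (y, w) \<in> G \<and> norm (x - y) < e"
    and res_ex: "0 < t \<Longrightarrow> \<exists>y w. (y, w) \<in> G \<and> t *\<^sub>R w - sc (curve d s) y = x"
    and res_bd: "0 < t \<Longrightarrow> (y, w) \<in> G \<Longrightarrow>
      norm (curve d s) * norm y \<le> C * norm (t *\<^sub>R w - sc (curve d s) y)"
begin

lemma sc_scaleR: "sc a (r *\<^sub>R x) = r *\<^sub>R sc a x"
proof -
  have "sc a (r *\<^sub>R x) = sc a (sc (of_real r) x)" by (simp only: sc_real)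
  also have "\<dots> = sc (of_real r) (sc a x)" unfolding sc_sc by (simp only: mult.commute)
  finally show ?thesis by (simp only: sc_real)
qed

lemma sc_bb: "bounded_bilinear sc"
proof (rule bounded_bilinear.intro)
  show "sc (r *\<^sub>R a) x = r *\<^sub>R sc a x" for r a x
    unfolding scaleR_conv_of_real sc_sc[symmetric] by (rule sc_real)
  show "\<exists>K. \<forall>a x. norm (sc a x) \<le> norm a * norm x * K"
    by (rule exI[of _ 1]) (simp add: norm_sc)
qed (simp_all add: sc_add_right sc_add_left sc_scaleR)

sublocale sc: bounded_bilinear sc by (rule sc_bb)

lemma sc_1 [simp]: "sc 1 x = x"
  using sc_real[of 1 x] by simp

lemma G_scaleR: "(x, y) \<in> G \<Longrightarrow> (r *\<^sub>R x, r *\<^sub>R y) \<in> G"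
  using G_sc[of x y "of_real r"] by (simp add: sc_real)

lemma G_diff: "(x, y) \<in> G \<Longrightarrow> (x', y') \<in> G \<Longrightarrow> (x - x', y - y') \<in> G"
  using G_add[OF _ G_scaleR[of x' y' "- 1"], of x y] by simp

definition z :: "real \<Rightarrow> complex" where "z = curve d"

definition Q :: "real \<Rightarrow> real \<Rightarrow> 'a \<Rightarrow> 'a" where
  "Q t s x = (SOME y. \<exists>w. (y, w) \<in> G \<and> t *\<^sub>R w - sc (z s) y = x)"

definition W :: "real \<Rightarrow> real \<Rightarrow> 'a \<Rightarrow> 'a" where
  "W t s x = (x + sc (z s) (Q t s x)) /\<^sub>R t"

definition C1 :: real where "C1 = \<bar>C\<bar> * (2 / (1 - d))"

lemma z_nz: "z s \<noteq> 0"
  using curve_nz[OF d] by (simp add: z_def)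

lemma C1_nonneg: "0 \<le> C1"
  using d by (simp add: C1_def)

lemma norm_le_C1:
  assumes "norm (z s) * norm y \<le> C * N" "0 \<le> N" shows "norm y \<le> C1 * N"
proof -
  have "(1 - d) / 2 * norm y \<le> norm (z s) * norm y"
    unfolding z_def by (intro mult_right_mono norm_curve_ge(2) d) auto
  also have "\<dots> \<le> \<bar>C\<bar> * N" using assms(1) mult_right_mono[OF abs_ge_self[of C] assms(2)] by linarith
  finally show ?thesis using d by (simp add: C1_def field_simps)
qed

context
  fixes t :: real assumes t: "0 < t"
begin

lemma Q_G: "(Q t s x, W t s x) \<in> G"
  and W_Q: "t *\<^sub>R W t s x - sc (z s) (Q t s x) = x"
proof -
  have "\<exists>w. (Q t s x, w) \<in> G \<and> t *\<^sub>R w - sc (z s) (Q t s x) = x"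
    unfolding Q_def by (rule someI_ex) (use res_ex[OF t, of s x] in \<open>simp add: z_def\<close>)
  then obtain w where w: "(Q t s x, w) \<in> G" "t *\<^sub>R w - sc (z s) (Q t s x) = x" by blast
  then have "x + sc (z s) (Q t s x) = t *\<^sub>R w" by (metis diff_add_cancel)
  then have "W t s x = w" using t by (simp add: W_def)
  then show "(Q t s x, W t s x) \<in> G" "t *\<^sub>R W t s x - sc (z s) (Q t s x) = x" using w by auto
qed

lemma Q_eq: assumes "(y, w) \<in> G" "t *\<^sub>R w - sc (z s) y = x" shows "Q t s x = y"
proof -
  have 1: "(Q t s x - y, W t s x - w) \<in> G" by (rule G_diff[OF Q_G assms(1)])
  have "t *\<^sub>R (W t s x - w) - sc (z s) (Q t s x - y) = 0"
    using W_Q[of s x] assms(2) by (simp add: sc.diff_right scaleR_diff_right algebra_simps)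
  then have "norm (Q t s x - y) \<le> C1 * 0"
    using res_bd[OF t 1, of s] by (intro norm_le_C1[of s]) (auto simp: z_def)
  then show ?thesis by simp
qed

lemma Q_add: "Q t s (x + y) = Q t s x + Q t s y"
  by (rule Q_eq[OF G_add[OF Q_G Q_G]])
    (use W_Q[of s x] W_Q[of s y] in \<open>simp add: sc_add_right algebra_simps\<close>)

lemma Q_sc: "Q t s (sc a x) = sc a (Q t s x)"
proof (rule Q_eq[OF G_sc[OF Q_G]])
  have "t *\<^sub>R sc a (W t s x) - sc (z s) (sc a (Q t s x)) = sc a (t *\<^sub>R W t s x - sc (z s) (Q t s x))"
    by (simp add: sc.diff_right sc_scaleR sc_sc mult.commute)
  then show "t *\<^sub>R sc a (W t s x) - sc (z s) (sc a (Q t s x)) = sc a x" by (simp only: W_Q)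
qed

lemma Q_scaleR: "Q t s (r *\<^sub>R x) = r *\<^sub>R Q t s x"
  using Q_sc[of s "of_real r" x] by (simp add: sc_real)

lemma Q_diff: "Q t s (x - y) = Q t s x - Q t s y"
  using Q_add[of s x "(- 1) *\<^sub>R y"] Q_scaleR[of s "- 1" y] by simp

lemma Q_bound': "norm (z s) * norm (Q t s x) \<le> C * norm x"
  using res_bd[OF t Q_G, of s s x] W_Q[of s x] by (simp add: z_def)

lemma Q_bound: "norm (Q t s x) \<le> C1 * norm x"
  by (rule norm_le_C1[OF Q_bound']) auto

lemma Q_bl: "bounded_linear (Q t s)"
  by (rule bounded_linear_intro[of _ C1]) (simp_all add: Q_add Q_scaleR Q_bound mult.commute[of _ C1])

lemma W_bound: "norm (W t s x) \<le> (1 + \<bar>C\<bar>) / t * norm x"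
proof -
  have "norm (x + sc (z s) (Q t s x)) \<le> norm x + \<bar>C\<bar> * norm x"
    using Q_bound'[of s x] norm_triangle_ineq[of x "sc (z s) (Q t s x)"]
      mult_right_mono[OF abs_ge_self[of C] norm_ge_zero[of x]]
    by (simp add: norm_sc)
  then have "norm (x + sc (z s) (Q t s x)) / t \<le> (norm x + \<bar>C\<bar> * norm x) / t"
    using t by (intro divide_right_mono) auto
  also have "norm (x + sc (z s) (Q t s x)) / t = norm (W t s x)"
    using t unfolding W_def norm_scaleR by (simp add: divide_inverse mult.commute)
  also have "(norm x + \<bar>C\<bar> * norm x) / t = (1 + \<bar>C\<bar>) / t * norm x"
    by (simp add: distrib_right)
  finally show ?thesis .
qed

lemma QW: assumes "(y, w) \<in> G" shows "Q t s w = W t s y"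
proof -
  have "Q t s (t *\<^sub>R w - sc (z s) y) = y" by (rule Q_eq[OF assms refl])
  then have "t *\<^sub>R Q t s w - sc (z s) (Q t s y) = y" by (simp add: Q_diff Q_scaleR Q_sc)
  then have "t *\<^sub>R Q t s w = t *\<^sub>R W t s y" using W_Q[of s y] by (simp add: algebra_simps)
  then show ?thesis using t by simp
qed

lemma Q_inv: assumes "(y, w) \<in> G" shows "Q t s y = sc (1 / z s) (t *\<^sub>R Q t s w - y)"
proof -
  have "t *\<^sub>R Q t s w - y = sc (z s) (Q t s y)"
    using W_Q[of s y] unfolding QW[OF assms] by (simp add: algebra_simps)
  then show ?thesis using z_nz[of s] by (simp add: sc_sc)
qed

lemma Q_resolvent: "Q t s x - Q t s' x = sc (z s - z s') (Q t s' (Q t s x))"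
proof -
  have "Q t s' (x + sc (z s - z s') (Q t s x)) = Q t s x"
    by (rule Q_eq[OF Q_G]) (use W_Q[of s x] in \<open>simp add: sc.diff_left algebra_simps\<close>)
  then show ?thesis by (simp add: Q_add Q_sc algebra_simps)
qed

lemma continuous_z: "continuous_on UNIV z"
  unfolding z_def by (rule continuous_curve)

lemma Q_Lim: "((\<lambda>s'. Q t s' x) \<longlongrightarrow> Q t s x) (at s)"
proof (rule LIM_zero_cancel, rule Lim_null_comparison)
  show "\<forall>\<^sub>F s' in at s. norm (Q t s' x - Q t s x) \<le> norm (z s' - z s) * (C1 * (C1 * norm x))"
  proof (intro always_eventually allI)
    fix s'
    have "norm (Q t s (Q t s' x)) \<le> C1 * (C1 * norm x)"
      using Q_bound[of s "Q t s' x"] mult_left_mono[OF Q_bound[of s' x] C1_nonneg] by linarith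
    then show "norm (Q t s' x - Q t s x) \<le> norm (z s' - z s) * (C1 * (C1 * norm x))"
      unfolding Q_resolvent[of s' x s] norm_sc by (intro mult_left_mono) auto
  qed
  have "(z \<longlongrightarrow> z s) (at s)"
    using continuous_z by (simp add: continuous_on_def)
  from tendsto_mult_left_zero[OF tendsto_norm_zero[OF LIM_zero[OF this]]]
  show "((\<lambda>s'. norm (z s' - z s) * (C1 * (C1 * norm x))) \<longlongrightarrow> 0) (at s)" .
qed

lemma Q_cont: "continuous_on UNIV (\<lambda>s. Q t s x)"
  by (simp add: continuous_on_def Q_Lim)

lemma W_cont: "continuous_on UNIV (\<lambda>s. W t s x)"
  unfolding W_def by (intro continuous_intros sc.continuous_on continuous_z Q_cont)

lemma QQ_cont: "continuous_on UNIV (\<lambda>s. Q t s (Q t s x))"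
  unfolding continuous_on_eq_continuous_at[OF open_UNIV]
proof (intro ballI, unfold continuous_def, simp)
  fix s :: real
  have "((\<lambda>s'. Q t s' (Q t s' x - Q t s x) + Q t s' (Q t s x)) \<longlongrightarrow> 0 + Q t s (Q t s x)) (at s)"
  proof (rule tendsto_add[OF _ Q_Lim], rule Lim_null_comparison)
    show "\<forall>\<^sub>F s' in at s. norm (Q t s' (Q t s' x - Q t s x)) \<le> C1 * norm (Q t s' x - Q t s x)"
      by (simp add: Q_bound)
    show "((\<lambda>s'. C1 * norm (Q t s' x - Q t s x)) \<longlongrightarrow> 0) (at s)"
      by (intro tendsto_mult_right_zero tendsto_norm_zero LIM_zero Q_Lim)
  qed
  then show "((\<lambda>s. Q t s (Q t s x)) \<longlongrightarrow> Q t s (Q t s x)) (at s)"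
    by (simp add: Q_add[symmetric])
qed

lemma Q_deriv: "((\<lambda>s. Q t s x) has_vector_derivative sc (curve' d s) (Q t s (Q t s x))) (at s)"
  unfolding has_vector_derivative_Lim
proof -
  have z: "((\<lambda>s'. (z s' - z s) /\<^sub>R (s' - s)) \<longlongrightarrow> curve' d s) (at s)"
    using curve_deriv[of d s] unfolding has_vector_derivative_Lim z_def .
  have "((\<lambda>s'. sc ((z s' - z s) /\<^sub>R (s' - s)) (Q t s (Q t s' x))) \<longlongrightarrow>
     sc (curve' d s) (Q t s (Q t s x))) (at s)"
    by (intro sc.tendsto z bounded_linear.tendsto[OF Q_bl] Q_Lim)
  then show "((\<lambda>s'. (Q t s' x - Q t s x) /\<^sub>R (s' - s)) \<longlongrightarrow>
     sc (curve' d s) (Q t s (Q t s x))) (at s)"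
    by (simp add: Q_resolvent[of _ x s] sc.scaleR_left)
qed

end

lemma Q_diff_time:
  assumes t: "0 < t" "0 < t'"
  shows "Q t' s x - Q t s x = - (t' - t) *\<^sub>R W t' s (Q t s x)"
proof -
  have "Q t' s (x + (t' - t) *\<^sub>R W t s x) = Q t s x"
    by (rule Q_eq[OF t(2) Q_G[OF t(1)]]) (use W_Q[OF t(1), of s x] in \<open>simp add: algebra_simps\<close>)
  moreover have "Q t' s (W t s x) = W t' s (Q t s x)"
    by (rule QW[OF t(2) Q_G[OF t(1)]])
  ultimately have "Q t' s x + (t' - t) *\<^sub>R W t' s (Q t s x) = Q t s x"
    by (simp only: Q_add[OF t(2)] Q_scaleR[OF t(2)])
  then have "Q t s x - Q t' s x = (t' - t) *\<^sub>R W t' s (Q t s x)"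
    by (metis add_diff_cancel_left')
  then show ?thesis
    by (metis minus_diff_eq scaleR_minus_left)
qed

end

context sectorial_graph
begin

definition I :: "(real \<Rightarrow> 'a) \<Rightarrow> 'a" where
  "I g = sc (1 / (2 * of_real pi * \<i>)) (integral UNIV (\<lambda>s. sc (kern d s) (g s)))"

definition K :: real where
  "K = norm (1 / (2 * of_real pi * \<i>)) * (2 * exp 1 * integral UNIV (\<lambda>s::real. exp (- d * \<bar>s\<bar>)))"

definition good :: "(real \<Rightarrow> 'a) \<Rightarrow> bool" where
  "good g \<longleftrightarrow> continuous_on UNIV g \<and> (\<exists>B. \<forall>s. norm (g s) \<le> B)"

lemma kern_integrand:
  assumes "continuous_on UNIV g" "\<And>s. norm (g s) \<le> B"
  shows "(\<lambda>s. sc (kern d s) (g s)) integrable_on UNIV"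
    and "norm (integral UNIV (\<lambda>s. sc (kern d s) (g s))) \<le>
      (2 * exp 1 * B) * integral UNIV (\<lambda>s::real. exp (- d * \<bar>s\<bar>))"
proof -
  have c: "continuous_on UNIV (\<lambda>s. sc (kern d s) (g s))"
    by (intro sc.continuous_on continuous_kern assms)
  have b: "norm (sc (kern d s) (g s)) \<le> (2 * exp 1 * B) * exp (- d * \<bar>s\<bar>)" for s
  proof -
    have "norm (kern d s) * norm (g s) \<le> (2 * exp 1 * exp (- d * \<bar>s\<bar>)) * B"
      using norm_kern[OF d, of s] assms(2)[of s] by (intro mult_mono) auto
    then show ?thesis by (simp add: norm_sc mult_ac)
  qed
  show "(\<lambda>s. sc (kern d s) (g s)) integrable_on UNIV"
    by (rule exp_decay_integral(1)[OF d(1) c b])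
  show "norm (integral UNIV (\<lambda>s. sc (kern d s) (g s))) \<le>
      (2 * exp 1 * B) * integral UNIV (\<lambda>s::real. exp (- d * \<bar>s\<bar>))"
    by (rule exp_decay_integral(2)[OF d(1) c b])
qed

lemma good_integrable: "good g \<Longrightarrow> (\<lambda>s. sc (kern d s) (g s)) integrable_on UNIV"
  unfolding good_def using kern_integrand(1) by blast

lemma I_bound: assumes "good g" "\<And>s. norm (g s) \<le> B" shows "norm (I g) \<le> K * B"
proof -
  have "norm (I g) = norm (1 / (2 * of_real pi * \<i>)) * norm (integral UNIV (\<lambda>s. sc (kern d s) (g s)))"
    unfolding I_def by (rule norm_sc)
  also have "\<dots> \<le> norm (1 / (2 * of_real pi * \<i>)) *
      ((2 * exp 1 * B) * integral UNIV (\<lambda>s::real. exp (- d * \<bar>s\<bar>)))"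
    using assms by (intro mult_left_mono kern_integrand) (auto simp: good_def)
  also have "\<dots> = K * B" by (simp add: K_def mult_ac)
  finally show ?thesis .
qed

lemma K_nonneg: "0 \<le> K"
  unfolding K_def by (intro mult_nonneg_nonneg integral_nonneg exp_abs_integrable d) auto

lemma good_add: assumes "good f" "good g" shows "good (\<lambda>s. f s + g s)"
proof -
  obtain A B where "\<And>s. norm (f s) \<le> A" "\<And>s. norm (g s) \<le> B"
    using assms by (auto simp: good_def)
  then have "norm (f s + g s) \<le> A + B" for s by (intro norm_triangle_mono)
  moreover have "continuous_on UNIV (\<lambda>s. f s + g s)"
    using assms by (intro continuous_on_add) (simp_all add: good_def)
  ultimately show ?thesis unfolding good_def by blast
qed

lemma good_linear: assumes "good g" "bounded_linear h" shows "good (\<lambda>s. h (g s))"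
proof -
  obtain B where B: "\<And>s. norm (g s) \<le> B" using assms by (auto simp: good_def)
  obtain M where M: "0 \<le> M" "\<And>x. norm (h x) \<le> norm x * M"
    using bounded_linear.nonneg_bounded[OF assms(2)] by blast
  have "norm (h (g s)) \<le> B * M" for s
    using M(2)[of "g s"] mult_right_mono[OF B M(1)] by (rule order_trans)
  moreover have "continuous_on UNIV (\<lambda>s. h (g s))"
    using assms by (auto simp: good_def intro: bounded_linear.continuous_on[OF assms(2)])
  ultimately show ?thesis unfolding good_def by blast
qed

lemma good_scaleR: "good g \<Longrightarrow> good (\<lambda>s. r *\<^sub>R g s)"
  by (rule good_linear[OF _ bounded_linear_scaleR_right])

lemma good_sc: "good g \<Longrightarrow> good (\<lambda>s. sc a (g s))"
  by (rule good_linear[OF _ sc.bounded_linear_right])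

lemma good_diff: "good f \<Longrightarrow> good g \<Longrightarrow> good (\<lambda>s. f s - g s)"
  using good_add[OF _ good_scaleR[of g "- 1"], of f] by simp

lemma I_add: "good f \<Longrightarrow> good g \<Longrightarrow> I (\<lambda>s. f s + g s) = I f + I g"
  unfolding I_def by (simp add: sc_add_right integral_add good_integrable)

lemma I_linear:
  assumes "good g" "bounded_linear h" "\<And>a x. h (sc a x) = sc a (h x)"
  shows "I (\<lambda>s. h (g s)) = h (I g)"
  using integral_linear[OF good_integrable[OF assms(1)] assms(2)]
  by (simp add: I_def assms(3) o_def)

lemma I_sc: "good g \<Longrightarrow> I (\<lambda>s. sc a (g s)) = sc a (I g)"
  by (rule I_linear[OF _ sc.bounded_linear_right]) (simp_all add: sc_sc mult.commute)

lemma I_scaleR: "good g \<Longrightarrow> I (\<lambda>s. r *\<^sub>R g s) = r *\<^sub>R I g"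
  using I_sc[of g "of_real r"] by (simp add: sc_real)

lemma I_diff: "good f \<Longrightarrow> good g \<Longrightarrow> I (\<lambda>s. f s - g s) = I f - I g"
  using I_add[OF _ good_scaleR[of g "- 1"], of f] I_scaleR[of g "- 1"] by simp

lemma G_iff_Q: "0 < t \<Longrightarrow> (y, w) \<in> G \<longleftrightarrow> Q t s (t *\<^sub>R w - sc (z s) y) = y"
proof
  assume t: "0 < t" and e: "Q t s (t *\<^sub>R w - sc (z s) y) = y"
  have "t *\<^sub>R W t s (t *\<^sub>R w - sc (z s) y) - sc (z s) y = t *\<^sub>R w - sc (z s) y"
    using W_Q[OF t, of s "t *\<^sub>R w - sc (z s) y"] unfolding e .
  then have "W t s (t *\<^sub>R w - sc (z s) y) = w" using t by simp
  then show "(y, w) \<in> G" using Q_G[OF t, of s "t *\<^sub>R w - sc (z s) y"] by (simp add: e)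
qed (rule Q_eq; simp)

lemma I_G:
  assumes "\<And>s. (g s, h s) \<in> G" "good g" "good h"
  shows "(I g, I h) \<in> G"
proof -
  have 1: "good (\<lambda>s. 1 *\<^sub>R h s - sc (z 0) (g s))"
    by (intro good_diff good_scaleR good_sc assms)
  have "Q 1 0 (1 *\<^sub>R I h - sc (z 0) (I g)) = Q 1 0 (I (\<lambda>s. 1 *\<^sub>R h s - sc (z 0) (g s)))"
    by (subst I_diff) (simp_all add: I_sc good_sc assms)
  also have "\<dots> = I (\<lambda>s. Q 1 0 (1 *\<^sub>R h s - sc (z 0) (g s)))"
    by (rule I_linear[symmetric, OF 1 Q_bl]) (simp_all add: Q_sc)
  also have "(\<lambda>s. Q 1 0 (1 *\<^sub>R h s - sc (z 0) (g s))) = g"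
    using G_iff_Q[of 1 _ _ 0] assms(1) by (intro ext) simp
  finally show ?thesis using G_iff_Q[of 1 _ _ 0] by simp
qed

lemma G_closed:
  assumes "\<And>k. (f k, g k) \<in> G" "(f \<longlongrightarrow> x) F" "(g \<longlongrightarrow> y) F" "F \<noteq> bot"
  shows "(x, y) \<in> G"
proof -
  have "((\<lambda>k. Q 1 0 (1 *\<^sub>R g k - sc (z 0) (f k))) \<longlongrightarrow> Q 1 0 (1 *\<^sub>R y - sc (z 0) x)) F"
    by (intro bounded_linear.tendsto[OF Q_bl] tendsto_intros sc.tendsto assms) auto
  moreover have "(\<lambda>k. Q 1 0 (1 *\<^sub>R g k - sc (z 0) (f k))) = f"
    using G_iff_Q[of 1 _ _ 0] assms(1) by (intro ext) simp
  ultimately have "Q 1 0 (1 *\<^sub>R y - sc (z 0) x) = x"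
    using assms(2,4) tendsto_unique by fastforce
  then show ?thesis using G_iff_Q[of 1 _ _ 0] by simp
qed

definition U :: "real \<Rightarrow> 'a \<Rightarrow> 'a" where "U t x = I (\<lambda>s. Q t s x)"
definition LU :: "real \<Rightarrow> 'a \<Rightarrow> 'a" where "LU t x = I (\<lambda>s. W t s x)"

lemma good_Q: "0 < t \<Longrightarrow> good (\<lambda>s. Q t s x)"
  unfolding good_def using Q_cont Q_bound by blast

lemma good_W: "0 < t \<Longrightarrow> good (\<lambda>s. W t s x)"
  unfolding good_def using W_cont W_bound by blast

lemma good_QQ: "0 < t \<Longrightarrow> good (\<lambda>s. Q t s (Q t s x))"
  unfolding good_def using QQ_cont
  by (intro conjI exI[of _ "C1 * (C1 * norm x)"] allI
    order_trans[OF Q_bound mult_left_mono[OF Q_bound C1_nonneg]]) auto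

text \<open>Integration by parts: $\frac{d}{ds}\bigl(e^{-z}Q\bigr)=-z'e^{-z}Q+z'e^{-z}Q^2$.\<close>

lemma I_QQ: assumes t: "0 < t" shows "I (\<lambda>s. Q t s (Q t s x)) = U t x"
proof -
  let ?f = "\<lambda>s. sc (exp (- z s)) (Q t s x)"
  let ?f' = "\<lambda>s. sc (kern d s) (Q t s (Q t s x)) - sc (kern d s) (Q t s x)"
  have e: "((\<lambda>s. exp (- z s)) has_vector_derivative - kern d s) (at s)" for s
  proof -
    have "((\<lambda>w. exp (- w)) has_field_derivative - exp (- z s)) (at (z s))"
      by (auto intro!: derivative_eq_intros)
    from field_vector_diff_chain_at[OF curve_deriv[of d s, folded z_def] this]
    show ?thesis by (simp add: o_def kern_def z_def mult.commute)
  qed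
  have "integral UNIV ?f' = 0"
  proof (rule integral_derivative_UNIV[of ?f])
    show "(?f has_vector_derivative ?f' s) (at s)" for s
    proof -
      have "(?f has_vector_derivative
        sc (exp (- z s)) (sc (curve' d s) (Q t s (Q t s x))) + sc (- kern d s) (Q t s x)) (at s)"
        by (rule sc.has_vector_derivative[OF e Q_deriv[OF t]])
      then show ?thesis by (simp add: sc_sc kern_def z_def sc.minus_left)
    qed
    show "?f' integrable_on UNIV"
      by (intro integrable_diff good_integrable good_Q good_QQ t)
    have lim: "(?f \<longlongrightarrow> 0) F" if "filterlim (\<lambda>s. \<bar>s\<bar>) at_top F" for F
    proof (rule Lim_null_comparison)
      show "\<forall>\<^sub>F s in F. norm (?f s) \<le> exp 1 * exp (- d * \<bar>s\<bar>) * (C1 * norm x)"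
        unfolding norm_sc z_def
        by (intro always_eventually allI mult_mono norm_exp_curve d Q_bound t) auto
      have "((\<lambda>r. exp (- d * r)) \<longlongrightarrow> 0) at_top" using d(1) by real_asymp
      from filterlim_compose[OF this that]
      show "((\<lambda>s. exp 1 * exp (- d * \<bar>s\<bar>) * (C1 * norm x)) \<longlongrightarrow> 0) F"
        by (intro tendsto_mult_left_zero tendsto_mult_right_zero)
    qed
    have "((\<lambda>N. ?f N - ?f (- N)) \<longlongrightarrow> 0 - 0) at_top"
    proof (rule tendsto_diff)
      show "(?f \<longlongrightarrow> 0) at_top"
        by (rule lim) (rule filterlim_abs_real)
      show "((\<lambda>N. ?f (- N)) \<longlongrightarrow> 0) at_top"
        by (rule filterlim_compose[OF lim[of at_bot] filterlim_uminus_at_bot_at_top])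
          (simp add: filterlim_at_bot_mirror filterlim_abs_real)
    qed
    then show "((\<lambda>N. ?f N - ?f (- N)) \<longlongrightarrow> 0) at_top" by simp
  qed
  then have "integral UNIV (\<lambda>s. sc (kern d s) (Q t s (Q t s x))) = integral UNIV (\<lambda>s. sc (kern d s) (Q t s x))"
    by (simp add: integral_diff good_integrable good_Q good_QQ t)
  then show ?thesis by (simp add: I_def U_def)
qed

context
  fixes t :: real assumes t: "0 < t"
begin

lemma U_G: "(U t x, LU t x) \<in> G"
  unfolding U_def LU_def by (intro I_G Q_G good_Q good_W t)

lemma LU_eq: assumes "(x, w) \<in> G" shows "LU t x = U t w"
  unfolding LU_def U_def by (simp add: QW[OF t assms])

lemma U_bound: "norm (U t x) \<le> K * C1 * norm x"
  using I_bound[OF good_Q[OF t], of x "C1 * norm x"] Q_bound[OF t] by (simp add: U_def mult.assoc)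

lemma U_add: "U t (x + y) = U t x + U t y"
  unfolding U_def by (simp add: Q_add[OF t] I_add good_Q t)

lemma U_sc: "U t (sc a x) = sc a (U t x)"
  unfolding U_def by (simp add: Q_sc[OF t] I_sc good_Q t)

lemma U_scaleR: "U t (r *\<^sub>R x) = r *\<^sub>R U t x"
  using U_sc[of "of_real r" x] by (simp add: sc_real)

lemma U_diff: "U t (x - y) = U t x - U t y"
  using U_add[of x "(- 1) *\<^sub>R y"] U_scaleR[of "- 1" y] by simp

lemma U_bl: "bounded_linear (U t)"
  by (rule bounded_linear_intro[of _ "K * C1"])
    (simp_all add: U_add U_scaleR U_bound mult.commute[of _ "K * C1"])

lemma LU_QQ: "LU t x = I (\<lambda>s. W t s (Q t s x))"
proof (rule G_sv[OF U_G])
  have "good (\<lambda>s. W t s (Q t s x))"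
    unfolding good_def
  proof
    show "continuous_on UNIV (\<lambda>s. W t s (Q t s x))"
      unfolding W_def by (intro continuous_intros sc.continuous_on continuous_z[OF t] Q_cont QQ_cont t)
    have "norm (W t s (Q t s x)) \<le> (1 + \<bar>C\<bar>) / t * (C1 * norm x)" for s
      using W_bound[OF t, of s "Q t s x"] mult_left_mono[OF Q_bound[OF t, of s x], of "(1 + \<bar>C\<bar>) / t"] t
      by simp
    then show "\<exists>B. \<forall>s. norm (W t s (Q t s x)) \<le> B" by blast
  qed
  from I_G[OF Q_G[OF t] good_QQ[OF t] this]
  show "(U t x, I (\<lambda>s. W t s (Q t s x))) \<in> G" by (simp add: I_QQ[OF t])
qed

end

end

context sectorial_graph
begin

definition Lt :: "real \<Rightarrow> real" where "Lt t = K * (C1 * ((1 + \<bar>C\<bar>) / t))"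

lemma U_Lipschitz:
  assumes t: "0 < t" "0 < t'"
  shows "norm (U t' x - U t x) \<le> \<bar>t' - t\<bar> * Lt t * norm x"
proof -
  have b: "norm (- (t' - t) *\<^sub>R W t' s (Q t s x)) \<le> \<bar>t' - t\<bar> * (C1 * ((1 + \<bar>C\<bar>) / t * norm x))" for s
  proof -
    have "W t' s (Q t s x) = Q t' s (W t s x)" by (rule QW[symmetric, OF t(2) Q_G[OF t(1)]])
    also have "norm \<dots> \<le> C1 * ((1 + \<bar>C\<bar>) / t * norm x)"
      by (rule order_trans[OF Q_bound[OF t(2)] mult_left_mono[OF W_bound[OF t(1)] C1_nonneg]])
    finally show ?thesis unfolding norm_scaleR abs_minus_cancel by (intro mult_left_mono) auto
  qed
  have "U t' x - U t x = I (\<lambda>s. Q t' s x - Q t s x)"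
    unfolding U_def by (simp add: I_diff good_Q t)
  also have "norm \<dots> \<le> K * (\<bar>t' - t\<bar> * (C1 * ((1 + \<bar>C\<bar>) / t * norm x)))"
    by (rule I_bound[OF good_diff[OF good_Q[OF t(2)] good_Q[OF t(1)]]])
      (use b in \<open>simp only: Q_diff_time[OF t]\<close>)
  finally show ?thesis by (simp add: Lt_def mult_ac)
qed

lemma U_diff2:
  assumes t: "0 < t" "0 < t'"
  shows "norm (U t' x - U t x + (t' - t) *\<^sub>R LU t x) \<le> (t' - t)\<^sup>2 * (Lt t * ((1 + \<bar>C\<bar>) / t)) * norm x"
proof -
  have gW: "good (\<lambda>s. W t s (Q t s x))"
  proof -
    have "good (\<lambda>s. Q t s (W t s x))"
      unfolding good_def
    proof
      show "\<exists>B. \<forall>s. norm (Q t s (W t s x)) \<le> B"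
        by (intro exI[of _ "C1 * ((1 + \<bar>C\<bar>) / t * norm x)"] allI
          order_trans[OF Q_bound[OF t(1)] mult_left_mono[OF W_bound[OF t(1)] C1_nonneg]])
      show "continuous_on UNIV (\<lambda>s. Q t s (W t s x))"
        unfolding QW[OF t(1) Q_G[OF t(1)]] unfolding W_def
        by (intro continuous_intros sc.continuous_on continuous_z[OF t(1)] Q_cont QQ_cont t)
    qed
    then show ?thesis unfolding QW[OF t(1) Q_G[OF t(1)]] .
  qed
  have b: "norm (Q t' s x - Q t s x + (t' - t) *\<^sub>R W t s (Q t s x)) \<le>
    (t' - t)\<^sup>2 * (C1 * ((1 + \<bar>C\<bar>) / t * ((1 + \<bar>C\<bar>) / t * norm x)))" for s
  proof -
    let ?w = "W t s x"
    have "W t' s (Q t s x) = Q t' s ?w" "W t s (Q t s x) = Q t s ?w"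
      by (rule QW[symmetric, OF _ Q_G[OF t(1)]]; fact)+
    then have "Q t' s x - Q t s x + (t' - t) *\<^sub>R W t s (Q t s x) = - (t' - t) *\<^sub>R (Q t' s ?w - Q t s ?w)"
      by (simp add: Q_diff_time[OF t, of s x] algebra_simps)
    also have "\<dots> = (t' - t)\<^sup>2 *\<^sub>R W t' s (Q t s ?w)"
      by (simp only: Q_diff_time[OF t, of s ?w] scaleR_scaleR power2_eq_square minus_mult_minus)
    also have "W t' s (Q t s ?w) = Q t' s (W t s ?w)"
      by (rule QW[symmetric, OF t(2) Q_G[OF t(1)]])
    also have "norm ((t' - t)\<^sup>2 *\<^sub>R \<dots>) = (t' - t)\<^sup>2 * norm (Q t' s (W t s ?w))" by simp
    also have "\<dots> \<le> (t' - t)\<^sup>2 * (C1 * ((1 + \<bar>C\<bar>) / t * ((1 + \<bar>C\<bar>) / t * norm x)))"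
      using t by (intro mult_left_mono order_trans[OF Q_bound[OF t(2)]] order_trans[OF W_bound[OF t(1)]]
          W_bound C1_nonneg) auto
    finally show ?thesis .
  qed
  have "U t' x - U t x + (t' - t) *\<^sub>R LU t x = I (\<lambda>s. (Q t' s x - Q t s x) + (t' - t) *\<^sub>R W t s (Q t s x))"
    unfolding LU_QQ[OF t(1)] U_def
    by (subst I_add) (simp_all add: I_diff I_scaleR good_diff good_scaleR good_Q t gW)
  also have "norm \<dots> \<le> K * ((t' - t)\<^sup>2 * (C1 * ((1 + \<bar>C\<bar>) / t * ((1 + \<bar>C\<bar>) / t * norm x))))"
    by (rule I_bound[OF good_add[OF good_diff[OF good_Q[OF t(2)] good_Q[OF t(1)]] good_scaleR[OF gW]] b])
  finally show ?thesis by (simp add: Lt_def mult_ac)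
qed

lemma Lim_quadratic:
  fixes f :: "real \<Rightarrow> 'a"
  assumes "\<forall>\<^sub>F y in at x. norm (f y - f x - (y - x) *\<^sub>R D) \<le> (y - x)\<^sup>2 * M"
  shows "(f has_vector_derivative D) (at x)"
  unfolding has_vector_derivative_Lim
proof (rule LIM_zero_cancel, rule Lim_null_comparison)
  show "\<forall>\<^sub>F y in at x. norm ((f y - f x) /\<^sub>R (y - x) - D) \<le> \<bar>y - x\<bar> * M"
    using assms eventually_neq_at_within[of x]
  proof eventually_elim
    case (elim y)
    have cancel: "a * a * M / a = a * M" if "a \<noteq> 0" for a :: real using that by simp
    have "(f y - f x) /\<^sub>R (y - x) - D = (f y - f x - (y - x) *\<^sub>R D) /\<^sub>R (y - x)"
      using elim(2) by (simp add: scaleR_diff_right)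
    also have "norm \<dots> = norm (f y - f x - (y - x) *\<^sub>R D) / \<bar>y - x\<bar>"
      by (simp add: divide_inverse mult.commute)
    also have "\<dots> \<le> ((y - x)\<^sup>2 * M) / \<bar>y - x\<bar>"
      by (intro divide_right_mono elim) auto
    also have "(y - x)\<^sup>2 = \<bar>y - x\<bar> * \<bar>y - x\<bar>" by (simp flip: power2_eq_square)
    also have "(\<bar>y - x\<bar> * \<bar>y - x\<bar>) * M / \<bar>y - x\<bar> = \<bar>y - x\<bar> * M"
      by (rule cancel) (use elim(2) in simp)
    finally show ?case .
  qed
  have "((\<lambda>y. \<bar>y - x\<bar> * M) \<longlongrightarrow> \<bar>x - x\<bar> * M) (at x)" by (intro tendsto_intros)
  then show "((\<lambda>y. \<bar>y - x\<bar> * M) \<longlongrightarrow> 0) (at x)" by simp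
qed

lemma U_deriv:
  assumes t: "0 < t" shows "((\<lambda>t. U t x) has_vector_derivative - LU t x) (at t)"
proof (rule Lim_quadratic)
  have "\<forall>\<^sub>F y in at t. 0 < y"
    using order_tendstoD(1)[OF tendsto_ident_at t] .
  then show "\<forall>\<^sub>F y in at t. norm (U y x - U t x - (y - t) *\<^sub>R - LU t x) \<le>
      (y - t)\<^sup>2 * ((Lt t * ((1 + \<bar>C\<bar>) / t)) * norm x)"
    by eventually_elim (use U_diff2[OF t] in \<open>simp add: mult.assoc\<close>)
qed

lemma U_Lim: assumes t: "0 < t" shows "((\<lambda>t. U t x) \<longlongrightarrow> U t x) (at t)"
  using has_vector_derivative_continuous[OF U_deriv[OF t]] by (simp add: continuous_within)

lemma I_inv_z: "I (\<lambda>s. sc (1 / z s) x) = - x"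
proof -
  have i: "(\<lambda>s. kern d s / z s) integrable_on UNIV"
  proof (rule ccontr)
    assume "\<not> (\<lambda>s. kern d s / z s) integrable_on UNIV"
    then have "integral UNIV (\<lambda>s. kern d s / z s) = 0" by (rule not_integrable_integral)
    then show False using integral_kern_div_curve[OF d] by (simp add: z_def)
  qed
  have "integral UNIV (\<lambda>s. sc (kern d s / z s) x) = sc (integral UNIV (\<lambda>s. kern d s / z s)) x"
    using integral_linear[OF i sc.bounded_linear_left[of x]] by (simp add: o_def)
  then show ?thesis
    using integral_kern_div_curve[OF d] by (simp add: I_def sc_sc z_def sc.minus_left sc.minus_right)
qed

lemma U_near_0:
  assumes t: "0 < t" and G: "(x, w) \<in> G"
  shows "norm (U t x - x) \<le> t * (K * (2 / (1 - d) * (C1 * norm w)))"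
proof -
  have iz: "norm (1 / z s) \<le> 2 / (1 - d)" for s
    using norm_curve_ge(2)[OF d, of s] d frac_le[of 1 1 "(1 - d) / 2" "norm (z s)"]
    by (simp add: z_def norm_divide)
  have cz: "continuous_on UNIV (\<lambda>s. 1 / z s)"
    by (intro continuous_intros continuous_z[OF t]) (use z_nz in auto)
  have g1: "good (\<lambda>s. sc (1 / z s) (Q t s w))"
    unfolding good_def
  proof
    show "continuous_on UNIV (\<lambda>s. sc (1 / z s) (Q t s w))"
      by (intro sc.continuous_on cz Q_cont t)
    have "norm (sc (1 / z s) (Q t s w)) \<le> 2 / (1 - d) * (C1 * norm w)" for s
      unfolding norm_sc using d by (intro mult_mono iz Q_bound t) auto
    then show "\<exists>B. \<forall>s. norm (sc (1 / z s) (Q t s w)) \<le> B" by blast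
  qed
  have g2: "good (\<lambda>s. sc (1 / z s) x)"
    unfolding good_def
  proof
    show "continuous_on UNIV (\<lambda>s. sc (1 / z s) x)"
      by (intro sc.continuous_on cz continuous_on_const)
    have "norm (sc (1 / z s) x) \<le> 2 / (1 - d) * norm x" for s
      unfolding norm_sc by (intro mult_right_mono iz) auto
    then show "\<exists>B. \<forall>s. norm (sc (1 / z s) x) \<le> B" by blast
  qed
  have "U t x = I (\<lambda>s. t *\<^sub>R sc (1 / z s) (Q t s w) - sc (1 / z s) x)"
    unfolding U_def by (subst Q_inv[OF t G]) (simp add: sc.diff_right sc_scaleR)
  also have "\<dots> = t *\<^sub>R I (\<lambda>s. sc (1 / z s) (Q t s w)) + x"
    by (simp add: I_diff g1 g2 good_scaleR I_scaleR I_inv_z)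
  finally have "norm (U t x - x) = t * norm (I (\<lambda>s. sc (1 / z s) (Q t s w)))"
    using t by simp
  also have "norm (sc (1 / z s) (Q t s w)) \<le> 2 / (1 - d) * (C1 * norm w)" for s
    unfolding norm_sc using d by (intro mult_mono iz Q_bound t) auto
  then have "t * norm (I (\<lambda>s. sc (1 / z s) (Q t s w))) \<le> t * (K * (2 / (1 - d) * (C1 * norm w)))"
    using t by (intro mult_left_mono I_bound g1) auto
  finally show ?thesis .
qed

lemma U_tendsto_0: "((\<lambda>t. U t x) \<longlongrightarrow> x) (at_right 0)"
proof (rule tendstoI)
  fix e :: real assume e: "0 < e"
  define M where "M = K * C1"
  have M: "0 \<le> M" unfolding M_def by (intro mult_nonneg_nonneg K_nonneg C1_nonneg)
  obtain y w where yw: "(y, w) \<in> G" "norm (x - y) < e / (2 * (M + 1))"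
    using dense[of "e / (2 * (M + 1))" x] e M by auto
  have "((\<lambda>t. t * (K * (2 / (1 - d) * (C1 * norm w)))) \<longlongrightarrow> 0 * (K * (2 / (1 - d) * (C1 * norm w)))) (at_right 0)"
    by (intro tendsto_intros)
  then have "\<forall>\<^sub>F t in at_right 0. t * (K * (2 / (1 - d) * (C1 * norm w))) < e / 2"
    using e by (intro order_tendstoD(2)) auto
  moreover have "\<forall>\<^sub>F t::real in at_right 0. 0 < t" by (simp add: eventually_at_right_less)
  ultimately show "\<forall>\<^sub>F t in at_right 0. dist (U t x) x < e"
  proof eventually_elim
    case (elim t)
    have "(M + 1) * norm (x - y) \<le> (M + 1) * (e / (2 * (M + 1)))"
      using yw(2) M by (intro mult_left_mono) auto
    also have "\<dots> = e / 2"
      using M by (simp add: divide_simps)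
    finally have f: "(M + 1) * norm (x - y) + e / 2 \<le> e" by simp
    have "U t x - x = U t (x - y) + (U t y - y) - (x - y)"
      by (simp add: U_diff elim)
    also have "norm \<dots> \<le> norm (U t (x - y)) + norm (U t y - y) + norm (x - y)"
      using norm_triangle_ineq4[of "U t (x - y) + (U t y - y)" "x - y"]
        norm_triangle_ineq[of "U t (x - y)" "U t y - y"] by linarith
    also have "\<dots> < M * norm (x - y) + e / 2 + norm (x - y)"
      using U_bound[OF elim(2), of "x - y"] U_near_0[OF elim(2) yw(1)] elim(1)
      by (simp add: M_def)
    also have "M * norm (x - y) + e / 2 + norm (x - y) = (M + 1) * norm (x - y) + e / 2"
      by (simp add: algebra_simps)
    also note f
    finally show ?case by (simp add: dist_norm)
  qed
qed

lemma U_semigroup: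
  assumes s: "0 < s" and t: "0 < t"
  shows "U (s + t) x = U t (U s x)"
proof -
  define T where "T = s + t"
  define \<phi> where "\<phi> r = U (T - r) (U r x)" for r
  have deriv: "(\<phi> has_vector_derivative 0) (at r)" if r: "r \<in> {0<..<T}" for r
  proof (rule Lim_quadratic)
    define y w where "y = U r x" and "w = LU r x"
    have r0: "0 < r" "0 < T - r" using r by auto
    have G: "(y, w) \<in> G" unfolding y_def w_def by (rule U_G[OF r0(1)])
    define A where "A = Lt (T - r) * norm w + K * C1 * (Lt r * ((1 + \<bar>C\<bar>) / r) * norm x) +
      Lt (T - r) * ((1 + \<bar>C\<bar>) / (T - r)) * norm y"
    have "\<forall>\<^sub>F r' in at r. r' \<in> {0<..<T}"
      using r by (intro eventually_at_in_open') auto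
    then show "\<forall>\<^sub>F r' in at r. norm (\<phi> r' - \<phi> r - (r' - r) *\<^sub>R 0) \<le> (r' - r)\<^sup>2 * A"
    proof eventually_elim
      case (elim r')
      define h where "h = r' - r"
      have r'0: "0 < r'" "0 < T - r'" using elim by auto
      define e1 where "e1 = U r' x - y + h *\<^sub>R w"
      define e2 where "e2 = U (T - r') y - U (T - r) y + (- h) *\<^sub>R U (T - r) w"
      have e1: "norm e1 \<le> h\<^sup>2 * (Lt r * ((1 + \<bar>C\<bar>) / r) * norm x)"
        unfolding e1_def y_def w_def h_def using U_diff2[OF r0(1) r'0(1), of x] by (simp add: mult.assoc)
      have e2: "norm e2 \<le> h\<^sup>2 * (Lt (T - r) * ((1 + \<bar>C\<bar>) / (T - r)) * norm y)"
        unfolding e2_def h_def LU_eq[OF r0(2) G, symmetric]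
        using U_diff2[OF r0(2) r'0(2), of y] by (simp add: mult.assoc power2_commute)
      have e3: "norm (U (T - r') w - U (T - r) w) \<le> \<bar>h\<bar> * (Lt (T - r) * norm w)"
        using U_Lipschitz[OF r0(2) r'0(2), of w] by (simp add: h_def mult.assoc abs_minus_commute)
      have "U r' x = y - h *\<^sub>R w + e1" by (simp add: e1_def)
      then have "\<phi> r' = U (T - r') y - h *\<^sub>R U (T - r') w + U (T - r') e1"
        by (simp only: \<phi>_def U_add[OF r'0(2)] U_diff[OF r'0(2)] U_scaleR[OF r'0(2)])
      then have "\<phi> r' - \<phi> r = - h *\<^sub>R (U (T - r') w - U (T - r) w) + U (T - r') e1 + e2"
        by (simp add: \<phi>_def e2_def y_def scaleR_diff_right)
      also have "norm \<dots> \<le> norm (- h *\<^sub>R (U (T - r') w - U (T - r) w)) + norm (U (T - r') e1) + norm e2"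
        by (intro order_trans[OF norm_triangle_ineq] add_mono norm_triangle_ineq order_refl)
      also have "\<dots> \<le> \<bar>h\<bar> * (\<bar>h\<bar> * (Lt (T - r) * norm w)) + K * C1 * (h\<^sup>2 * (Lt r * ((1 + \<bar>C\<bar>) / r) * norm x)) +
         h\<^sup>2 * (Lt (T - r) * ((1 + \<bar>C\<bar>) / (T - r)) * norm y)"
      proof (intro add_mono e2)
        show "norm (- h *\<^sub>R (U (T - r') w - U (T - r) w)) \<le> \<bar>h\<bar> * (\<bar>h\<bar> * (Lt (T - r) * norm w))"
          using e3 by (simp add: mult_left_mono)
        show "norm (U (T - r') e1) \<le> K * C1 * (h\<^sup>2 * (Lt r * ((1 + \<bar>C\<bar>) / r) * norm x))"
          by (intro order_trans[OF U_bound[OF r'0(2)]] mult_left_mono e1 mult_nonneg_nonneg K_nonneg C1_nonneg)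
      qed
      also have "\<dots> = h\<^sup>2 * A"
        by (simp add: A_def distrib_left mult_ac power2_eq_square flip: abs_mult)
      finally show ?case by (simp add: h_def)
    qed
  qed
  obtain c where c: "\<And>r. r \<in> {0<..<T} \<Longrightarrow> \<phi> r = c"
    using has_vector_derivative_zero_constant[of "{0<..<T}" \<phi>] deriv has_vector_derivative_at_within
    by (metis convex_real_interval(8))
  have T: "0 < T" using s t by (simp add: T_def)
  have ev: "\<forall>\<^sub>F r in at_right 0. r \<in> {0<..<T}"
    using T eventually_at_right_real by blast
  have "((\<lambda>r. U (T - r) (U r x - x)) \<longlongrightarrow> 0) (at_right 0)"
  proof (rule Lim_null_comparison)
    show "\<forall>\<^sub>F r in at_right 0. norm (U (T - r) (U r x - x)) \<le> K * C1 * norm (U r x - x)"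
      using ev by eventually_elim (auto intro: U_bound)
    show "((\<lambda>r. K * C1 * norm (U r x - x)) \<longlongrightarrow> 0) (at_right 0)"
      by (intro tendsto_mult_right_zero tendsto_norm_zero LIM_zero U_tendsto_0)
  qed
  moreover have "((\<lambda>r. U (T - r) x) \<longlongrightarrow> U T x) (at_right 0)"
  proof -
    have "isCont (\<lambda>t. U t x) T" using U_Lim[OF T] by (simp add: isCont_def)
    moreover have "((\<lambda>r. T - r) \<longlongrightarrow> T - 0) (at_right 0)" by (intro tendsto_intros)
    ultimately show ?thesis using isCont_tendsto_compose by fastforce
  qed
  ultimately have "((\<lambda>r. U (T - r) (U r x - x) + U (T - r) x) \<longlongrightarrow> 0 + U T x) (at_right 0)"
    by (rule tendsto_add)
  moreover have "\<forall>\<^sub>F r in at_right 0. U (T - r) (U r x - x) + U (T - r) x = c"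
    using ev
  proof eventually_elim
    case (elim r)
    then have "U (T - r) (U r x - x) + U (T - r) x = \<phi> r" by (simp add: U_diff \<phi>_def)
    then show ?case using c[OF elim] by simp
  qed
  ultimately have "((\<lambda>r. c) \<longlongrightarrow> U T x) (at_right (0::real))"
    by (simp add: tendsto_cong)
  then have "c = U T x" by (simp add: tendsto_const_iff)
  moreover have "\<phi> s = c" using c[of s] s t by (simp add: T_def)
  ultimately show ?thesis by (simp add: \<phi>_def T_def)
qed

lemma U_generator:
  "(x, w) \<in> G \<longleftrightarrow> ((\<lambda>t. (x - U t x) /\<^sub>R t) \<longlongrightarrow> w) (at_right 0)"
proof
  assume G: "(x, w) \<in> G"
  show "((\<lambda>t. (x - U t x) /\<^sub>R t) \<longlongrightarrow> w) (at_right 0)"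
  proof (rule tendstoI)
    fix e :: real assume e: "0 < e"
    have "\<forall>\<^sub>F r in at_right 0. dist (U r w) w < e / 2"
      using tendstoD[OF U_tendsto_0, of "e / 2" w] e by simp
    then obtain b where b: "0 < b" "\<And>r. 0 < r \<Longrightarrow> r < b \<Longrightarrow> dist (U r w) w < e / 2"
      unfolding eventually_at_right_field by auto
    show "\<forall>\<^sub>F t in at_right 0. dist ((x - U t x) /\<^sub>R t) w < e"
      unfolding eventually_at_right_field
    proof (intro exI[of _ b] conjI allI impI b)
      fix t :: real assume t: "0 < t" "t < b"
      define f where "f r = (if r = 0 then x else U r x) + r *\<^sub>R w" for r
      have "norm (f t - f 0) \<le> (e / 2) * t - (e / 2) * 0"
      proof (rule differentiable_bound_general[of 0 t f "\<lambda>r. (e / 2) * r" "\<lambda>r. w - U r w" "\<lambda>_. e / 2"])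
        show "continuous_on {0..t} f"
          unfolding continuous_on_eq_continuous_within
        proof
          fix r assume r: "r \<in> {0..t}"
          have "((\<lambda>r. if r = 0 then x else U r x) \<longlongrightarrow> (if r = 0 then x else U r x)) (at r within {0..t})"
          proof (cases "r = 0")
            case True
            have "((\<lambda>r. U r x) \<longlongrightarrow> x) (at 0 within {0..t})"
              using U_tendsto_0[of x] t by (simp add: at_within_Icc_at_right)
            then have "((\<lambda>r. if r = 0 then x else U r x) \<longlongrightarrow> x) (at 0 within {0..t})"
              by (rule Lim_transform_eventually) (auto simp: eventually_at_filter)
            then show ?thesis using True by simp
          next
            case False
            then have r: "0 < r" using r by auto
            have "((\<lambda>r. U r x) \<longlongrightarrow> U r x) (at r within {0..t})"
              using U_Lim[OF r] tendsto_within_subset by blast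
            moreover have "\<forall>\<^sub>F r' in at r within {0..t}. U r' x = (if r' = 0 then x else U r' x)"
              using order_tendstoD(1)[OF tendsto_ident_at r] by eventually_elim auto
            ultimately show ?thesis using r by (simp add: tendsto_cong)
          qed
          then show "continuous (at r within {0..t}) f"
            unfolding continuous_within f_def by (intro tendsto_intros)
        qed
        show "(f has_vector_derivative w - U r w) (at r)" if "0 < r" "r < t" for r
        proof -
          have "((\<lambda>r. U r x + r *\<^sub>R w) has_vector_derivative - LU r x + 1 *\<^sub>R w) (at r)"
            using that by (intro has_vector_derivative_add U_deriv)
              (auto intro!: derivative_eq_intros)
          then have "((\<lambda>r. U r x + r *\<^sub>R w) has_vector_derivative w - U r w) (at r)"
            using LU_eq[OF that(1) G] by simp
          then show ?thesis
            by (rule has_vector_derivative_transform_within_open[of _ _ _ "{0<..}"])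
              (use that in \<open>auto simp: f_def\<close>)
        qed
        show "norm (w - U r w) \<le> e / 2" if "0 < r" "r < t" for r
          using b(2)[of r] that t by (simp add: dist_norm norm_minus_commute)
      qed (use t in \<open>auto intro!: continuous_intros derivative_eq_intros\<close>)
      then have "norm (U t x - x + t *\<^sub>R w) \<le> e / 2 * t" using t by (simp add: f_def algebra_simps)
      then have "norm (U t x - x + t *\<^sub>R w) / t \<le> e / 2 * t / t"
        using t by (intro divide_right_mono) auto
      moreover have "(x - U t x) /\<^sub>R t - w = (- (1 / t)) *\<^sub>R (U t x - x + t *\<^sub>R w)"
        using t by (simp add: algebra_simps divide_inverse)
      then have "dist ((x - U t x) /\<^sub>R t) w = norm (U t x - x + t *\<^sub>R w) / t"
        using t unfolding dist_norm by (simp only: norm_scaleR) simp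
      ultimately have "dist ((x - U t x) /\<^sub>R t) w \<le> e / 2"
        using t by simp
      then show "dist ((x - U t x) /\<^sub>R t) w < e" using e by simp
    qed
  qed
next
  assume lim: "((\<lambda>t. (x - U t x) /\<^sub>R t) \<longlongrightarrow> w) (at_right 0)"
  have LU: "LU r x = U r w" if r: "0 < r" for r
  proof -
    have "((\<lambda>t. U r ((x - U t x) /\<^sub>R t)) \<longlongrightarrow> U r w) (at_right 0)"
      by (rule bounded_linear.tendsto[OF U_bl[OF r] lim])
    moreover have l2: "((\<lambda>t. (U r x - U (r + t) x) /\<^sub>R t) \<longlongrightarrow> LU r x) (at_right 0)"
    proof -
      have "((\<lambda>h. (U (r + h) x - U r x) /\<^sub>R h) \<longlongrightarrow> - LU r x) (at 0)"
        using U_deriv[OF r, of x] unfolding has_vector_derivative_Lim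
        by (subst (asm) LIM_offset_zero_iff) (simp_all add: add.commute)
      then have "((\<lambda>h. (U (r + h) x - U r x) /\<^sub>R h) \<longlongrightarrow> - LU r x) (at_right 0)"
        by (rule filterlim_mono) (simp_all add: at_le)
      from tendsto_minus[OF this] show ?thesis by (simp flip: scaleR_minus_right)
    qed
    have ev: "\<forall>\<^sub>F t in at_right 0. U r ((x - U t x) /\<^sub>R t) = (U r x - U (r + t) x) /\<^sub>R t"
    proof -
      have "\<forall>\<^sub>F t::real in at_right 0. 0 < t" by (simp add: eventually_at_right_less)
      then show ?thesis
        by eventually_elim (use r in \<open>simp add: U_scaleR U_diff U_semigroup[symmetric] add.commute\<close>)
    qed
    have "((\<lambda>t. U r ((x - U t x) /\<^sub>R t)) \<longlongrightarrow> LU r x) (at_right 0)"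
      unfolding tendsto_cong[OF ev] by (rule l2)
    ultimately show ?thesis
      using tendsto_unique[OF trivial_limit_at_right_real] by blast
  qed
  let ?r = "\<lambda>k. inverse (of_nat (Suc k)) :: real"
  have G: "(U (?r k) x, U (?r k) w) \<in> G" for k
    using U_G[of "?r k" x] LU[of "?r k"] by simp
  have r: "filterlim ?r (at_right 0) sequentially"
    unfolding filterlim_at by (intro conjI LIMSEQ_inverse_real_of_nat) auto
  have lims: "(\<lambda>k. U (?r k) y) \<longlonglongrightarrow> y" for y
    by (rule filterlim_compose[OF U_tendsto_0 r])
  show "(x, w) \<in> G"
    by (rule G_closed[OF G lims lims]) simp
qed

lemma generates:
  obtains T M where
    "\<And>t x y. 0 \<le> t \<Longrightarrow> T t (x + y) = T t x + T t y"
    "\<And>t a x. 0 \<le> t \<Longrightarrow> T t (sc a x) = sc a (T t x)"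
    "\<And>t x. 0 \<le> t \<Longrightarrow> norm (T t x) \<le> M * norm x"
    "\<And>x. T 0 x = x"
    "\<And>s t x. 0 \<le> s \<Longrightarrow> 0 \<le> t \<Longrightarrow> T (s + t) x = T s (T t x)"
    "\<And>x. ((\<lambda>t. T t x) \<longlongrightarrow> x) (at_right 0)"
    "\<And>x y. (x, y) \<in> G \<longleftrightarrow> ((\<lambda>t. (x - T t x) /\<^sub>R t) \<longlongrightarrow> y) (at_right 0)"
proof
  define T where "T t = (if t = 0 then id else U t)" for t :: real
  have T: "T t = U t" if "0 < t" for t using that by (simp add: T_def)
  have ev: "\<forall>\<^sub>F t in at_right 0. T t x = U t x" for x
    using eventually_at_right_less by eventually_elim (simp add: T)
  have cases: "t = 0 \<or> 0 < t" if "0 \<le> t" for t :: real using that by auto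
  show "T t (x + y) = T t x + T t y" if "0 \<le> t" for t x y
    using cases[OF that] by (auto simp: T_def U_add)
  show "T t (sc a x) = sc a (T t x)" if "0 \<le> t" for t a x
    using cases[OF that] by (auto simp: T_def U_sc)
  show "norm (T t x) \<le> (K * C1 + 1) * norm x" if "0 \<le> t" for t x
    using cases[OF that]
  proof
    assume "t = 0"
    then show ?thesis
      using mult_right_mono[of 0 "K * C1" "norm x"] K_nonneg C1_nonneg by (simp add: T_def distrib_right)
  next
    assume "0 < t"
    then show ?thesis using U_bound[of t x] by (simp add: T distrib_right add_increasing2)
  qed
  show "T 0 x = x" for x by (simp add: T_def)
  show "T (s + t) x = T s (T t x)" if "0 \<le> s" "0 \<le> t" for s t x
    using cases[OF that(1)] cases[OF that(2)] U_semigroup[of t s x]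
    by (auto simp: T_def add.commute)
  show "((\<lambda>t. T t x) \<longlongrightarrow> x) (at_right 0)" for x
    unfolding tendsto_cong[OF ev] by (rule U_tendsto_0)
  have ev': "\<forall>\<^sub>F t in at_right 0. (x - T t x) /\<^sub>R t = (x - U t x) /\<^sub>R t" for x
    using ev[of x] by eventually_elim simp
  show "(x, y) \<in> G \<longleftrightarrow> ((\<lambda>t. (x - T t x) /\<^sub>R t) \<longlongrightarrow> y) (at_right 0)" for x y
    unfolding tendsto_cong[OF ev'] by (rule U_generator)
qed

end

section \<open>The space $L^2$ of functions modulo null sets\<close>

lemma enn2real_2 [simp]: "enn2real 2 = 2"
  using enn2real_ennreal[of 2] by simp

lemma L2norm_alt: "L2norm f = epow (\<integral>\<^sup>+x. ennreal ((norm (f x))\<^sup>2) \<partial>lebesgue) (1/2)"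
proof -
  have "norm (f x) powr 2 = (norm (f x))\<^sup>2" for x
    by (cases "f x = 0") (simp_all add: powr_numeral)
  then show ?thesis by (simp add: Lnorm_def)
qed

lemma L2_iff: "f \<in> L2 \<longleftrightarrow> f \<in> borel_measurable lebesgue \<and> integrable lebesgue (\<lambda>x. (norm (f x))\<^sup>2)"
proof -
  have "integrable lebesgue (\<lambda>x. (norm (f x))\<^sup>2) \<longleftrightarrow> (\<integral>\<^sup>+x. ennreal ((norm (f x))\<^sup>2) \<partial>lebesgue) < \<infinity>"
    if "f \<in> borel_measurable lebesgue"
    using that by (subst integrable_iff_bounded) auto
  then show ?thesis
    by (auto simp: Lp_def L2norm_alt epow_def less_top)
qed

definition nrm2 :: "'n::finite cfun \<Rightarrow> real" where
  "nrm2 f = sqrt (LINT x|lebesgue. (norm (f x))\<^sup>2)"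

lemma nrm2_nonneg: "0 \<le> nrm2 f"
  by (simp add: nrm2_def)

lemma nrm2_sq: "(nrm2 f)\<^sup>2 = (LINT x|lebesgue. (norm (f x))\<^sup>2)"
  by (simp add: nrm2_def)

lemma L2norm_eq: assumes "f \<in> L2" shows "L2norm f = ennreal (nrm2 f)"
proof -
  have "(\<integral>\<^sup>+x. ennreal ((norm (f x))\<^sup>2) \<partial>lebesgue) = ennreal (LINT x|lebesgue. (norm (f x))\<^sup>2)"
    using assms by (intro nn_integral_eq_integral) (auto simp: L2_iff)
  then show ?thesis
    by (simp add: L2norm_alt epow_def nrm2_def powr_half_sqrt)
qed

lemma L2_measurable: "f \<in> L2 \<Longrightarrow> f \<in> borel_measurable lebesgue"
  by (simp add: L2_iff)

lemma L2_bound: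
  assumes "f \<in> borel_measurable lebesgue" "integrable lebesgue g" "\<And>x. (norm (f x))\<^sup>2 \<le> g x"
  shows "f \<in> L2"
  unfolding L2_iff
  using assms by (intro conjI Bochner_Integration.integrable_bound[OF assms(2)]) (auto intro!: AE_I2 order_trans[OF _ abs_ge_self])

lemma norm_add_sq_le:
  fixes u v :: "'b::real_normed_vector" assumes "0 < c"
  shows "(norm (u + v))\<^sup>2 \<le> (1 + c) * (norm u)\<^sup>2 + (1 + 1 / c) * (norm v)\<^sup>2"
proof -
  have "(norm (u + v))\<^sup>2 \<le> (norm u + norm v)\<^sup>2"
    by (intro power_mono norm_triangle_ineq) auto
  also have "\<dots> \<le> (1 + c) * (norm u)\<^sup>2 + (1 + 1 / c) * (norm v)\<^sup>2"
  proof -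
    have "0 \<le> (c * norm u - norm v)\<^sup>2 / c" using assms by simp
    also have "\<dots> = c * (norm u)\<^sup>2 - 2 * norm u * norm v + (norm v)\<^sup>2 / c"
      using assms by (simp add: power2_eq_square field_simps)
    finally show ?thesis by (simp add: power2_eq_square algebra_simps)
  qed
  finally show ?thesis .
qed

lemma L2_add: assumes "f \<in> L2" "g \<in> L2" shows "(\<lambda>x. f x + g x) \<in> L2"
proof (rule L2_bound)
  show "(norm (f x + g x))\<^sup>2 \<le> (1 + 1) * (norm (f x))\<^sup>2 + (1 + 1 / 1) * (norm (g x))\<^sup>2" for x
    by (rule norm_add_sq_le) simp
qed (use assms in \<open>auto simp: L2_iff\<close>)

lemma L2_cmult: assumes "f \<in> L2" shows "(\<lambda>x. a * f x) \<in> L2"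
  using assms by (auto simp: L2_iff norm_mult power_mult_distrib)

lemma L2_uminus: assumes "f \<in> L2" shows "(\<lambda>x. - f x) \<in> L2"
  using L2_cmult[OF assms, of "- 1"] by simp

lemma L2_diff: assumes "f \<in> L2" "g \<in> L2" shows "(\<lambda>x. f x - g x) \<in> L2"
  using L2_add[OF assms(1) L2_uminus[OF assms(2)]] by simp

lemma L2_zero: "(\<lambda>x. 0) \<in> L2"
  by (simp add: L2_iff)

lemma nrm2_cong: "f \<in> L2 \<Longrightarrow> g \<in> L2 \<Longrightarrow> (AE x in lebesgue. f x = g x) \<Longrightarrow> nrm2 f = nrm2 g"
  unfolding nrm2_def L2_iff by (intro arg_cong[of _ _ sqrt] integral_cong_AE) auto

lemma nrm2_cmult: "nrm2 (\<lambda>x. a * f x) = norm a * nrm2 f"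
  by (simp add: nrm2_def norm_mult power_mult_distrib real_sqrt_mult)

lemma nrm2_zero: assumes "f \<in> L2" shows "nrm2 f = 0 \<longleftrightarrow> (AE x in lebesgue. f x = 0)"
  using assms integral_nonneg_eq_0_iff_AE[of lebesgue "\<lambda>x. (norm (f x))\<^sup>2"]
  by (simp add: nrm2_def L2_iff)

lemma nrm2_add: assumes "f \<in> L2" "g \<in> L2" shows "nrm2 (\<lambda>x. f x + g x) \<le> nrm2 f + nrm2 g"
proof (cases "nrm2 f = 0 \<or> nrm2 g = 0")
  case True
  then show ?thesis
  proof
    assume "nrm2 f = 0"
    then have "AE x in lebesgue. f x = 0" using nrm2_zero assms by blast
    then have "nrm2 (\<lambda>x. f x + g x) = nrm2 g"
      by (intro nrm2_cong L2_add assms) (auto elim: eventually_mono)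
    then show ?thesis using nrm2_nonneg[of f] by simp
  next
    assume "nrm2 g = 0"
    then have "AE x in lebesgue. g x = 0" using nrm2_zero assms by blast
    then have "nrm2 (\<lambda>x. f x + g x) = nrm2 f"
      by (intro nrm2_cong L2_add assms) (auto elim: eventually_mono)
    then show ?thesis using nrm2_nonneg[of g] by simp
  qed
next
  case False
  define a b where "a = nrm2 f" and "b = nrm2 g"
  have ab: "0 < a" "0 < b" using False nrm2_nonneg[of f] nrm2_nonneg[of g] by (auto simp: a_def b_def)
  have "(nrm2 (\<lambda>x. f x + g x))\<^sup>2 \<le>
    (LINT x|lebesgue. (1 + b / a) * (norm (f x))\<^sup>2 + (1 + 1 / (b / a)) * (norm (g x))\<^sup>2)"
    unfolding nrm2_sq
    using L2_add[OF assms] assms ab by (intro integral_mono norm_add_sq_le) (auto simp: L2_iff)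
  also have "\<dots> = (1 + b / a) * a\<^sup>2 + (1 + 1 / (b / a)) * b\<^sup>2"
    using assms by (simp add: a_def b_def nrm2_sq L2_iff)
  also have "\<dots> = (a + b)\<^sup>2"
  proof -
    have "b / a * a\<^sup>2 = a * b" "1 / (b / a) * b\<^sup>2 = a * b"
      using ab by (simp_all add: power2_eq_square)
    then show ?thesis unfolding distrib_right power2_sum by simp
  qed
  finally have "nrm2 (\<lambda>x. f x + g x) \<le> a + b"
    by (rule power2_le_imp_le) (use ab in simp)
  then show ?thesis by (simp add: a_def b_def)
qed

definition l2rel :: "'n::finite cfun \<Rightarrow> 'n cfun \<Rightarrow> bool" where
  "l2rel f g \<longleftrightarrow> f \<in> L2 \<and> g \<in> L2 \<and> (AE x in lebesgue. f x = g x)"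

quotient_type 'n l2 = "'n::finite cfun" / partial: l2rel
proof (rule part_equivpI)
  show "\<exists>f::'n cfun. l2rel f f" using L2_zero by (auto simp: l2rel_def)
  show "symp (l2rel :: 'n cfun \<Rightarrow> _)" by (rule sympI) (auto simp: l2rel_def elim: eventually_mono)
  show "transp (l2rel :: 'n cfun \<Rightarrow> _)"
  proof (rule transpI)
    fix f g h :: "'n cfun" assume "l2rel f g" "l2rel g h"
    moreover from this have "AE x in lebesgue. f x = h x"
      unfolding l2rel_def by (auto elim: eventually_elim2)
    ultimately show "l2rel f h" by (simp add: l2rel_def)
  qed
qed

instantiation l2 :: (finite) real_vector
begin

lift_definition zero_l2 :: "'a l2" is "\<lambda>x. 0" by (simp add: l2rel_def L2_zero)
lift_definition plus_l2 :: "'a l2 \<Rightarrow> 'a l2 \<Rightarrow> 'a l2" is "\<lambda>f g x. f x + g x"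
  by (auto simp: l2rel_def L2_add elim: eventually_elim2)
lift_definition minus_l2 :: "'a l2 \<Rightarrow> 'a l2 \<Rightarrow> 'a l2" is "\<lambda>f g x. f x - g x"
  by (auto simp: l2rel_def L2_diff elim: eventually_elim2)
lift_definition uminus_l2 :: "'a l2 \<Rightarrow> 'a l2" is "\<lambda>f x. - f x"
  by (auto simp: l2rel_def L2_uminus elim: eventually_mono)
lift_definition scaleR_l2 :: "real \<Rightarrow> 'a l2 \<Rightarrow> 'a l2" is "\<lambda>r f x. of_real r * f x"
  by (auto simp: l2rel_def L2_cmult elim: eventually_mono)
instance
proof
  fix x y z :: "'a l2" and a b :: real
  show "x + y + z = x + (y + z)" by transfer (auto simp: l2rel_def L2_add algebra_simps)
  show "x + y = y + x" by transfer (auto simp: l2rel_def L2_add algebra_simps)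
  show "0 + x = x" by transfer (auto simp: l2rel_def)
  show "- x + x = 0" by transfer (auto simp: l2rel_def L2_zero)
  show "x - y = x + - y" by transfer (auto simp: l2rel_def L2_diff)
  show "a *\<^sub>R (x + y) = a *\<^sub>R x + a *\<^sub>R y"
    by transfer (auto simp: l2rel_def L2_add L2_cmult ring_distribs)
  show "(a + b) *\<^sub>R x = a *\<^sub>R x + b *\<^sub>R x"
    by transfer (auto simp: l2rel_def L2_add L2_cmult ring_distribs)
  show "a *\<^sub>R b *\<^sub>R x = (a * b) *\<^sub>R x"
    by transfer (auto simp: l2rel_def L2_cmult mult.assoc)
  show "1 *\<^sub>R x = x" by transfer (auto simp: l2rel_def)
qed

end

instantiation l2 :: (finite) real_normed_vector
begin

lift_definition norm_l2 :: "'a l2 \<Rightarrow> real" is nrm2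
  by (auto simp: l2rel_def nrm2_cong)
definition sgn_l2 :: "'a l2 \<Rightarrow> 'a l2" where "sgn_l2 x = x /\<^sub>R norm x"
definition dist_l2 :: "'a l2 \<Rightarrow> 'a l2 \<Rightarrow> real" where "dist_l2 x y = norm (x - y)"
definition uniformity_l2 :: "('a l2 \<times> 'a l2) filter" where
  "uniformity_l2 = (INF e\<in>{0<..}. principal {(x, y). dist x y < e})"
definition open_l2 :: "'a l2 set \<Rightarrow> bool" where
  "open_l2 S = (\<forall>x\<in>S. \<forall>\<^sub>F (x', y) in uniformity. x' = x \<longrightarrow> y \<in> S)"

instance
proof
  fix x y :: "'a l2" and a :: real
  show "norm x = 0 \<longleftrightarrow> x = 0"
    by transfer (auto simp: l2rel_def L2_zero nrm2_zero)
  show "norm (x + y) \<le> norm x + norm y" by transfer (auto simp: l2rel_def nrm2_add)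
  show "norm (a *\<^sub>R x) = \<bar>a\<bar> * norm x" by transfer (simp add: nrm2_cmult)
qed (simp_all add: sgn_l2_def dist_l2_def uniformity_l2_def open_l2_def)

end

lift_definition csc :: "complex \<Rightarrow> 'n::finite l2 \<Rightarrow> 'n l2" is "\<lambda>a f x. a * f x"
  by (auto simp: l2rel_def L2_cmult elim: eventually_mono)

lemma abs_l2_eq: "f \<in> L2 \<Longrightarrow> g \<in> L2 \<Longrightarrow> abs_l2 f = abs_l2 g \<longleftrightarrow> (AE x in lebesgue. f x = g x)"
  using Quotient3_rel[OF Quotient3_l2, of f g] by (simp add: l2rel_def)

lemma l2_rep: obtains f where "f \<in> L2" "x = abs_l2 f"
  using Quotient3_rep_reflp[OF Quotient3_l2, of x] Quotient3_abs_rep[OF Quotient3_l2, of x]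
  by (metis l2rel_def)

lemma abs_l2_add: "f \<in> L2 \<Longrightarrow> g \<in> L2 \<Longrightarrow> abs_l2 f + abs_l2 g = abs_l2 (\<lambda>x. f x + g x)"
  by (rule plus_l2.abs_eq) (auto simp: l2rel_def)
lemma abs_l2_diff: "f \<in> L2 \<Longrightarrow> g \<in> L2 \<Longrightarrow> abs_l2 f - abs_l2 g = abs_l2 (\<lambda>x. f x - g x)"
  by (rule minus_l2.abs_eq) (auto simp: l2rel_def)
lemma abs_l2_csc: "f \<in> L2 \<Longrightarrow> csc a (abs_l2 f) = abs_l2 (\<lambda>x. a * f x)"
  by (rule csc.abs_eq) (auto simp: l2rel_def)
lemma abs_l2_scaleR: "f \<in> L2 \<Longrightarrow> a *\<^sub>R (abs_l2 f) = abs_l2 (\<lambda>x. of_real a * f x)"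
  by (rule scaleR_l2.abs_eq) (auto simp: l2rel_def)
lemma norm_abs_l2: "f \<in> L2 \<Longrightarrow> norm (abs_l2 f) = nrm2 f"
  by (rule norm_l2.abs_eq) (auto simp: l2rel_def)

lemma L2norm_abs: "f \<in> L2 \<Longrightarrow> L2norm f = ennreal (norm (abs_l2 f))"
  by (simp add: L2norm_eq norm_abs_l2)

lemma ennreal_le_suminf: "F k \<le> suminf (F :: nat \<Rightarrow> ennreal)"
  using sum_le_suminf[of F "{k}"] by simp

lemma L2_complete_aux:
  fixes g :: "nat \<Rightarrow> 'n::finite cfun"
  assumes g: "\<And>k. g k \<in> L2"
    and fast: "\<And>k. (nrm2 (\<lambda>x. g (Suc k) x - g k x))\<^sup>2 \<le> (1/8) ^ k"
  shows "AE x in lebesgue. convergent (\<lambda>k. g k x)"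
proof -
  have [measurable]: "g k \<in> borel_measurable lebesgue" for k using g L2_measurable by blast
  let ?d = "\<lambda>k x. (norm (g (Suc k) x - g k x))\<^sup>2"
  have d: "(\<integral>\<^sup>+x. ennreal (2 ^ k * ?d k x) \<partial>lebesgue) \<le> ennreal ((1/4) ^ k)" for k
  proof -
    have "(\<integral>\<^sup>+x. ennreal (?d k x) \<partial>lebesgue) = ennreal ((nrm2 (\<lambda>x. g (Suc k) x - g k x))\<^sup>2)"
      unfolding nrm2_sq using L2_diff[OF g[of "Suc k"] g[of k]]
      by (intro nn_integral_eq_integral) (auto simp: L2_iff)
    also have "\<dots> \<le> ennreal ((1/8) ^ k)" by (intro ennreal_leI fast)
    finally have "ennreal (2 ^ k) * (\<integral>\<^sup>+x. ennreal (?d k x) \<partial>lebesgue) \<le> ennreal (2 ^ k) * ennreal ((1/8) ^ k)"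
      by (rule mult_left_mono) simp
    also have "ennreal (2 ^ k) * (\<integral>\<^sup>+x. ennreal (?d k x) \<partial>lebesgue) = (\<integral>\<^sup>+x. ennreal (2 ^ k * ?d k x) \<partial>lebesgue)"
      by (subst nn_integral_cmult[symmetric]) (auto simp: ennreal_mult)
    also have "ennreal (2 ^ k) * ennreal ((1/8) ^ k) = ennreal ((1/4) ^ k)"
      by (simp flip: ennreal_mult power_mult_distrib)
    finally show ?thesis .
  qed
  have "(\<integral>\<^sup>+x. (\<Sum>k. ennreal (2 ^ k * ?d k x)) \<partial>lebesgue) = (\<Sum>k. \<integral>\<^sup>+x. ennreal (2 ^ k * ?d k x) \<partial>lebesgue)"
    by (rule nn_integral_suminf) measurable
  also have "\<dots> \<le> (\<Sum>k. ennreal ((1/4) ^ k))"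
    by (intro suminf_le d) auto
  also have "\<dots> = ennreal (\<Sum>k. (1/4) ^ k)"
    by (rule suminf_ennreal2) (auto intro: summable_geometric)
  also have "\<dots> < \<infinity>" by simp
  finally have "AE x in lebesgue. (\<Sum>k. ennreal (2 ^ k * ?d k x)) \<noteq> \<infinity>"
    by (intro nn_integral_PInf_AE) auto
  then show ?thesis
  proof eventually_elim
    case (elim x)
    define S where "S = enn2real (\<Sum>k. ennreal (2 ^ k * ?d k x))"
    have S0: "0 \<le> S" unfolding S_def by (rule enn2real_nonneg)
    have S: "2 ^ k * ?d k x \<le> S" for k
    proof -
      have "ennreal (2 ^ k * ?d k x) \<le> (\<Sum>k. ennreal (2 ^ k * ?d k x))"
        by (rule ennreal_le_suminf)
      also have "\<dots> = ennreal S"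
        unfolding S_def by (rule ennreal_enn2real[symmetric]) (use elim in \<open>simp only: less_top infinity_ennreal_def\<close>)
      finally show ?thesis using ennreal_le_iff[of S] S0 by blast
    qed
    have "norm (g (Suc k) x - g k x) \<le> sqrt S * (sqrt (1/2)) ^ k" for k
    proof (rule power2_le_imp_le)
      have "(norm (g (Suc k) x - g k x))\<^sup>2 \<le> S * (1/2) ^ k"
        using S[of k] by (simp add: field_simps power_one_over)
      also have "\<dots> = (sqrt S)\<^sup>2 * ((sqrt (1/2))\<^sup>2) ^ k" by (simp add: S0)
      also have "\<dots> = (sqrt S * (sqrt (1/2)) ^ k)\<^sup>2"
        by (simp only: power_mult_distrib power_mult[symmetric] mult.commute[of 2])
      finally show "(norm (g (Suc k) x - g k x))\<^sup>2 \<le> (sqrt S * (sqrt (1/2)) ^ k)\<^sup>2" .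
    qed (simp add: S0)
    moreover have sq: "summable (\<lambda>k. sqrt S * (sqrt (1/2)) ^ k)"
      by (intro summable_mult summable_geometric) simp
    ultimately have "summable (\<lambda>k. g (Suc k) x - g k x)"
      using summable_comparison_test'[OF sq, of 0 "\<lambda>k. g (Suc k) x - g k x"] by simp
    then have "convergent (\<lambda>n. \<Sum>k<n. g (Suc k) x - g k x)"
      by (simp only: summable_iff_convergent)
    then have "convergent (\<lambda>n. g n x - g 0 x)"
      by (simp only: sum_lessThan_telescope[of "\<lambda>n. g n x"])
    then show ?case by (simp only: convergent_diff_const_right_iff)
  qed
qed

instance l2 :: (finite) banach
proof
  fix X :: "nat \<Rightarrow> 'a l2" assume X: "Cauchy X"
  have "\<forall>k. \<exists>N. \<forall>m\<ge>N. \<forall>n\<ge>N. dist (X m) (X n) < sqrt ((1/8) ^ k)"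
    by (intro allI metric_CauchyD[OF X]) simp
  from choice[OF this]
  obtain N where N: "\<And>k m n. N k \<le> m \<Longrightarrow> N k \<le> n \<Longrightarrow> dist (X m) (X n) < sqrt ((1/8) ^ k)"
    by auto
  define r where "r k = (\<Sum>i\<le>k. N i) + k" for k
  have r: "strict_mono r" by (rule strict_mono_Suc_iff[THEN iffD2]) (simp add: r_def)
  have rN: "N k \<le> r k" for k
    using member_le_sum[of k "{..k}" N] by (simp add: r_def)
  have "\<forall>k. \<exists>g. g \<in> L2 \<and> X (r k) = abs_l2 g" by (meson l2_rep)
  from choice[OF this] obtain g where g: "\<And>k. g k \<in> L2" "\<And>k. X (r k) = abs_l2 (g k)" by auto
  have [measurable]: "g k \<in> borel_measurable lebesgue" for k using g L2_measurable by blast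
  have dist: "dist (X (r m)) (X (r n)) = nrm2 (\<lambda>x. g m x - g n x)" for m n
    by (simp add: dist_norm g abs_l2_diff norm_abs_l2 L2_diff)
  have AE: "AE x in lebesgue. convergent (\<lambda>k. g k x)"
  proof (rule L2_complete_aux[OF g(1)])
    fix k
    have "nrm2 (\<lambda>x. g (Suc k) x - g k x) \<le> sqrt ((1/8) ^ k)"
      unfolding dist[symmetric] using r[THEN strict_monoD, of k "Suc k"] rN[of k]
      by (intro less_imp_le[OF N]) auto
    then have "(nrm2 (\<lambda>x. g (Suc k) x - g k x))\<^sup>2 \<le> (sqrt ((1/8) ^ k))\<^sup>2"
      by (intro power_mono nrm2_nonneg)
    then show "(nrm2 (\<lambda>x. g (Suc k) x - g k x))\<^sup>2 \<le> (1/8) ^ k" by simp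
  qed
  define h where "h x = lim (\<lambda>k. g k x)" for x
  have [measurable]: "h \<in> borel_measurable lebesgue" unfolding h_def by measurable
  have lim: "AE x in lebesgue. (\<lambda>k. g k x) \<longlonglongrightarrow> h x"
    using AE by eventually_elim (simp add: h_def convergent_LIMSEQ_iff)
  have fatou: "(\<integral>\<^sup>+x. ennreal ((norm (g k x - h x))\<^sup>2) \<partial>lebesgue) \<le> ennreal ((1/8) ^ k)" for k
  proof -
    have "AE x in lebesgue. ennreal ((norm (g k x - h x))\<^sup>2) = liminf (\<lambda>m. ennreal ((norm (g k x - g m x))\<^sup>2))"
      using lim
    proof eventually_elim
      case (elim x)
      have "(\<lambda>m. ennreal ((norm (g k x - g m x))\<^sup>2)) \<longlonglongrightarrow> ennreal ((norm (g k x - h x))\<^sup>2)"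
        by (intro tendsto_intros elim tendsto_ennrealI)
      from lim_imp_Liminf[OF _ this] show ?case by simp
    qed
    then have "(\<integral>\<^sup>+x. ennreal ((norm (g k x - h x))\<^sup>2) \<partial>lebesgue) =
        (\<integral>\<^sup>+x. liminf (\<lambda>m. ennreal ((norm (g k x - g m x))\<^sup>2)) \<partial>lebesgue)"
      by (rule nn_integral_cong_AE)
    also have "\<dots> \<le> liminf (\<lambda>m. \<integral>\<^sup>+x. ennreal ((norm (g k x - g m x))\<^sup>2) \<partial>lebesgue)"
      by (rule nn_integral_liminf) measurable
    also have "\<dots> \<le> ennreal ((1/8) ^ k)"
    proof (rule order_trans[OF Liminf_mono Liminf_const[THEN eq_refl]])
      show "\<forall>\<^sub>F m in sequentially. (\<integral>\<^sup>+x. ennreal ((norm (g k x - g m x))\<^sup>2) \<partial>lebesgue) \<le> ennreal ((1/8) ^ k)"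
        using eventually_ge_at_top[of k]
      proof eventually_elim
        case (elim m)
        have "nrm2 (\<lambda>x. g k x - g m x) \<le> sqrt ((1/8) ^ k)"
          unfolding dist[symmetric] using r[THEN strict_mono_leD, OF elim] rN[of k]
          by (intro less_imp_le[OF N]) auto
        then have "(nrm2 (\<lambda>x. g k x - g m x))\<^sup>2 \<le> (sqrt ((1/8) ^ k))\<^sup>2"
          by (intro power_mono nrm2_nonneg)
        moreover have "(\<integral>\<^sup>+x. ennreal ((norm (g k x - g m x))\<^sup>2) \<partial>lebesgue) = ennreal ((nrm2 (\<lambda>x. g k x - g m x))\<^sup>2)"
          unfolding nrm2_sq using L2_diff[OF g(1)[of k] g(1)[of m]]
          by (intro nn_integral_eq_integral) (auto simp: L2_iff)
        ultimately show ?case by (simp add: ennreal_leI)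
      qed
    qed simp
    finally show ?thesis .
  qed
  have d: "(\<lambda>x. g k x - h x) \<in> L2" for k
    unfolding L2_iff using fatou[of k]
    by (auto simp: integrable_iff_bounded intro: le_less_trans)
  have "(\<lambda>x. g 0 x - (g 0 x - h x)) \<in> L2" by (rule L2_diff[OF g(1) d])
  then have h: "h \<in> L2" by simp
  have b: "norm (X (r k) - abs_l2 h) \<le> sqrt ((1/8) ^ k)" for k
  proof -
    have "ennreal ((nrm2 (\<lambda>x. g k x - h x))\<^sup>2) \<le> ennreal ((1/8) ^ k)"
      using fatou[of k] nn_integral_eq_integral[of lebesgue "\<lambda>x. (norm (g k x - h x))\<^sup>2"] d[of k]
      by (simp add: L2_iff nrm2_sq)
    then have "(nrm2 (\<lambda>x. g k x - h x))\<^sup>2 \<le> (1/8) ^ k" by (subst (asm) ennreal_le_iff) auto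
    then show ?thesis
      by (simp add: g h abs_l2_diff norm_abs_l2 L2_diff real_le_rsqrt)
  qed
  have l: "(\<lambda>k. sqrt ((1/8) ^ k)) \<longlonglongrightarrow> 0"
    using tendsto_real_sqrt[OF LIMSEQ_power_zero[of "1/8 :: real"]] by simp
  have "(\<lambda>k. X (r k) - abs_l2 h) \<longlonglongrightarrow> 0"
    by (rule Lim_null_comparison[OF always_eventually l]) (simp add: b)
  then have "(X \<circ> r) \<longlonglongrightarrow> abs_l2 h" by (simp only: o_def LIM_zero_iff)
  from Cauchy_converges_subseq[OF X r this] show "convergent X"
    by (rule convergentI)
qed

lemma csc_simps:
  "csc a (x + y) = csc a x + csc a y"
  "csc (a + b) x = csc a x + csc b x"
  "csc a (csc b x) = csc (a * b) x"
  "csc (of_real r) x = r *\<^sub>R x"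
  "norm (csc a x) = norm a * norm x"
proof -
  show "csc a (x + y) = csc a x + csc a y"
    by transfer (auto simp: l2rel_def L2_add L2_cmult ring_distribs)
  show "csc (a + b) x = csc a x + csc b x"
    by transfer (auto simp: l2rel_def L2_add L2_cmult ring_distribs)
  show "csc a (csc b x) = csc (a * b) x"
    by transfer (auto simp: l2rel_def L2_cmult mult.assoc)
  show "csc (of_real r) x = r *\<^sub>R x"
    by transfer (auto simp: l2rel_def L2_cmult)
  show "norm (csc a x) = norm a * norm x"
    by transfer (simp add: nrm2_cmult)
qed

lemma csc_1 [simp]: "csc 1 x = x"
  using csc_simps(4)[of 1 x] by simp

lemma Arg_ge_of_Re_le:
  assumes "z \<noteq> 0" "0 < \<theta>" "\<theta> < pi / 2" "Re z < (cos \<theta> / 2) * \<bar>Im z\<bar>"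
  shows "\<theta> \<le> \<bar>Arg z\<bar>"
proof (rule ccontr)
  assume "\<not> \<theta> \<le> \<bar>Arg z\<bar>"
  then have "cos \<theta> < cos \<bar>Arg z\<bar>"
    using assms by (intro cos_monotone_0_pi) auto
  then have "norm z * cos \<theta> < norm z * cos (Arg z)"
    using assms(1) by simp
  also have "norm z * cos (Arg z) = Re z"
    using arg_cong[OF rcis_cmod_Arg[of z], of Re] by simp
  finally have 1: "norm z * cos \<theta> < Re z" .
  have "0 < cos \<theta>" using assms by (intro cos_gt_zero_pi) auto
  then have "(cos \<theta> / 2) * \<bar>Im z\<bar> \<le> cos \<theta> * norm z"
    using abs_Im_le_cmod[of z] by (intro mult_mono) auto
  then show False using 1 assms(4) by (simp add: mult.commute)
qed

lemma semigroup_exists: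
  fixes L :: "'n::finite oper"
  assumes "cond_A1 L"
  shows "\<exists>T. semigroup_of L T"
proof -
  obtain \<omega> where \<omega>: "0 \<le> \<omega>" "\<omega> < pi / 2" "of_type \<omega> L"
    using assms unfolding cond_A1_def by blast
  define \<theta> where "\<theta> = (\<omega> + pi / 2) / 2"
  have \<theta>: "\<omega> < \<theta>" "0 < \<theta>" "\<theta> < pi / 2" using \<omega>(1,2) by (auto simp: \<theta>_def)
  have lin: "linear_operator L" and dns: "densely_defined L"
    using \<omega>(3) unfolding of_type_def by auto
  obtain C where C: "\<And>\<xi>. \<theta> \<le> \<bar>Arg \<xi>\<bar> \<Longrightarrow> bounded_graph (resolvent_graph L \<xi>) (C / norm \<xi>)"
    using \<omega>(3) \<theta>(1) unfolding of_type_def by blast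
  have LL2: "f \<in> L2 \<and> g \<in> L2" if "(f, g) \<in> L" for f g
    using lin that unfolding linear_operator_def by blast
  have L_cong: "(f', g') \<in> L" if "(f, g) \<in> L" "f' \<in> L2" "g' \<in> L2" "AE x in lebesgue. f' x = f x"
    "AE x in lebesgue. g' x = g x" for f g f' g'
    using lin that unfolding linear_operator_def by blast
  have L_add: "(\<lambda>x. f x + f' x, \<lambda>x. g x + g' x) \<in> L" if "(f, g) \<in> L" "(f', g') \<in> L" for f g f' g'
    using lin that unfolding linear_operator_def by blast
  have L_sc: "(\<lambda>x. a * f x, \<lambda>x. a * g x) \<in> L" if "(f, g) \<in> L" for f g a
    using lin that unfolding linear_operator_def by blast
  have L_sv: "AE x in lebesgue. g x = g' x" if "(f, g) \<in> L" "(f, g') \<in> L" for f g g'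
    using lin that unfolding linear_operator_def by blast
  define G where "G = {(abs_l2 f, abs_l2 g) | f g. (f, g) \<in> L}"
  have GI: "(abs_l2 f, abs_l2 g) \<in> G" if "(f, g) \<in> L" for f g
    using that by (auto simp: G_def)
  have GE: "\<exists>f g. (f, g) \<in> L \<and> f \<in> L2 \<and> g \<in> L2 \<and> x = abs_l2 f \<and> y = abs_l2 g" if "(x, y) \<in> G" for x y
    using that LL2 unfolding G_def by blast
  have G_iff: "(abs_l2 f, abs_l2 g) \<in> G \<longleftrightarrow> (f, g) \<in> L" if fg: "f \<in> L2" "g \<in> L2" for f g
  proof
    assume "(abs_l2 f, abs_l2 g) \<in> G"
    from GE[OF this] obtain f' g' where *: "(f', g') \<in> L" "f' \<in> L2" "g' \<in> L2"
      "abs_l2 f = abs_l2 f'" "abs_l2 g = abs_l2 g'" by blast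
    show "(f, g) \<in> L"
      by (rule L_cong[OF *(1) fg]) (use * abs_l2_eq fg in \<open>blast+\<close>)
  qed (rule GI)
  define d where "d = cos \<theta> / 2"
  have "0 < cos \<theta>" using \<theta> by (intro cos_gt_zero_pi) auto
  moreover have "cos \<theta> < 2" by (rule le_less_trans[OF cos_le_one]) simp
  ultimately have d: "0 < d" "d < 1" by (simp_all add: d_def)
  have Arg: "\<theta> \<le> \<bar>Arg (curve d s / of_real t)\<bar>" if "0 < t" for s t
  proof (rule Arg_ge_of_Re_le[OF _ \<theta>(2,3)])
    show "curve d s / of_real t \<noteq> 0" using curve_nz[OF d, of s] that by simp
    have "Re (curve d s) / t < d * \<bar>Im (curve d s)\<bar> / t"
      using curve_Re_le[OF d, of s] that by (rule divide_strict_right_mono)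
    then show "Re (curve d s / of_real t) < cos \<theta> / 2 * \<bar>Im (curve d s / of_real t)\<bar>"
      using that by (simp add: d_def abs_divide Re_divide_of_real Im_divide_of_real)
  qed
  interpret sectorial_graph csc G d "\<bar>C\<bar>"
  proof (rule sectorial_graph.intro)
    show "0 < d" "d < 1" by (fact d)+
    fix x y x' y' :: "'n l2" and a b :: complex and r :: real
    show "csc a (x + y) = csc a x + csc a y" "csc (a + b) x = csc a x + csc b x"
      "csc a (csc b x) = csc (a * b) x" "csc (of_real r) x = r *\<^sub>R x"
      "norm (csc a x) = norm a * norm x"
      by (rule csc_simps)+
    show "(x + x', y + y') \<in> G" if 1: "(x, y) \<in> G" and 2: "(x', y') \<in> G"
    proof -
      obtain f g where f: "(f, g) \<in> L" "f \<in> L2" "g \<in> L2" "x = abs_l2 f" "y = abs_l2 g" using GE[OF 1] by blast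
      obtain f' g' where f': "(f', g') \<in> L" "f' \<in> L2" "g' \<in> L2" "x' = abs_l2 f'" "y' = abs_l2 g'" using GE[OF 2] by blast
      show ?thesis using GI[OF L_add[OF f(1) f'(1)]] by (simp add: f f' abs_l2_add)
    qed
    show "(csc a x, csc a y) \<in> G" if 1: "(x, y) \<in> G"
    proof -
      obtain f g where f: "(f, g) \<in> L" "f \<in> L2" "g \<in> L2" "x = abs_l2 f" "y = abs_l2 g" using GE[OF 1] by blast
      show ?thesis using GI[OF L_sc[OF f(1)]] by (simp add: f abs_l2_csc)
    qed
    show "y = y'" if 1: "(x, y) \<in> G" and 2: "(x, y') \<in> G"
    proof -
      obtain f g where f: "(f, g) \<in> L" "f \<in> L2" "g \<in> L2" "x = abs_l2 f" "y = abs_l2 g" using GE[OF 1] by blast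
      obtain g' where g': "g' \<in> L2" "y' = abs_l2 g'" by (rule l2_rep)
      have "(f, g') \<in> L" using 2 G_iff[OF f(2) g'(1)] by (simp add: f g')
      from L_sv[OF f(1) this] show ?thesis by (simp add: f g' abs_l2_eq)
    qed
    show "\<exists>y w. (y, w) \<in> G \<and> norm (x - y) < e" if e: "0 < e" for x e
    proof -
      obtain f where f: "f \<in> L2" "x = abs_l2 f" by (rule l2_rep)
      obtain h g where h: "(h, g) \<in> L" "L2norm (\<lambda>x. f x - h x) < ennreal e"
        using dns f(1) e unfolding densely_defined_def by blast
      have h2: "h \<in> L2" using LL2[OF h(1)] by blast
      have "norm (x - abs_l2 h) < e"
        using h(2) e by (simp add: f abs_l2_diff h2 L2norm_abs L2_diff ennreal_less_iff)
      then show ?thesis using GI[OF h(1)] by blast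
    qed
    show "\<exists>y w. (y, w) \<in> G \<and> t *\<^sub>R w - csc (curve d s) y = x" if t: "0 < t" for t s x
    proof -
      let ?\<xi> = "curve d s / of_real t"
      obtain g where g: "g \<in> L2" "x = abs_l2 g" by (rule l2_rep)
      obtain f where "(g, f) \<in> resolvent_graph L ?\<xi>"
        using C[OF Arg[OF t, of s]] g(1) unfolding bounded_graph_def by blast
      then obtain h where h: "(f, h) \<in> L" "AE x in lebesgue. g x = h x - ?\<xi> * f x"
        unfolding resolvent_graph_def by blast
      have fh: "f \<in> L2" "h \<in> L2" using LL2[OF h(1)] by auto
      let ?y = "csc (1 / of_real t) (abs_l2 f)" and ?w = "csc (1 / of_real t) (abs_l2 h)"
      have "(?y, ?w) \<in> G" using GI[OF L_sc[OF h(1), of "1 / of_real t"]] by (simp add: abs_l2_csc fh)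
      moreover have "t *\<^sub>R ?w - csc (curve d s) ?y = abs_l2 h - csc ?\<xi> (abs_l2 f)"
        using t by (simp add: csc_simps(3) flip: csc_simps(4))
      moreover have "abs_l2 h - csc ?\<xi> (abs_l2 f) = x"
        using h(2) unfolding g(2) abs_l2_csc[OF fh(1)] abs_l2_diff[OF fh(2) L2_cmult[OF fh(1)]]
        unfolding abs_l2_eq[OF L2_diff[OF fh(2) L2_cmult[OF fh(1)]] g(1)]
        by (rule eventually_mono) simp
      ultimately show ?thesis by auto
    qed
    show "norm (curve d s) * norm y \<le> \<bar>C\<bar> * norm (t *\<^sub>R w - csc (curve d s) y)"
      if t: "0 < t" and G: "(y, w) \<in> G" for t s y w
    proof -
      let ?\<xi> = "curve d s / of_real t"
      obtain f h where f: "(f, h) \<in> L" "f \<in> L2" "h \<in> L2" "y = abs_l2 f" "w = abs_l2 h" using GE[OF G] by blast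
      define g where "g x = h x - ?\<xi> * f x" for x
      have g: "g \<in> L2" unfolding g_def by (intro L2_diff L2_cmult f)
      have "(g, f) \<in> resolvent_graph L ?\<xi>"
        unfolding resolvent_graph_def using g f(1) by (auto simp: g_def)
      then have "L2norm f \<le> ennreal (C / norm ?\<xi>) * L2norm g"
        using C[OF Arg[OF t, of s]] unfolding bounded_graph_def by blast
      also have "\<dots> \<le> ennreal (\<bar>C\<bar> / norm ?\<xi>) * L2norm g"
        by (intro mult_right_mono ennreal_leI divide_right_mono) auto
      finally have "ennreal (norm (abs_l2 f)) \<le> ennreal (\<bar>C\<bar> / norm ?\<xi> * norm (abs_l2 g))"
        unfolding L2norm_abs[OF f(2)] L2norm_abs[OF g] by (subst ennreal_mult) auto
      then have *: "norm (abs_l2 f) \<le> \<bar>C\<bar> / norm ?\<xi> * norm (abs_l2 g)"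
        by (rule ennreal_le_iff[THEN iffD1, rotated]) simp
      have ge: "t *\<^sub>R w - csc (curve d s) y = t *\<^sub>R abs_l2 g"
      proof -
        have "abs_l2 g = abs_l2 h - csc ?\<xi> (abs_l2 f)"
          unfolding g_def abs_l2_csc[OF f(2)] abs_l2_diff[OF f(3) L2_cmult[OF f(2)]] ..
        moreover have "t *\<^sub>R csc ?\<xi> (abs_l2 f) = csc (curve d s) (abs_l2 f)"
          using t by (simp add: csc_simps(3) flip: csc_simps(4))
        ultimately show ?thesis by (simp add: f scaleR_diff_right)
      qed
      have nz: "0 < norm (curve d s)" using curve_nz[OF d, of s] by simp
      have "norm (curve d s) * norm (abs_l2 f) \<le> norm (curve d s) * (\<bar>C\<bar> / norm ?\<xi> * norm (abs_l2 g))"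
        by (rule mult_left_mono[OF *]) simp
      also have "\<dots> = \<bar>C\<bar> * (t * norm (abs_l2 g))"
        using t nz by (simp add: norm_divide)
      finally show ?thesis using t unfolding ge by (simp add: f(4))
    qed
  qed
  obtain T M where T:
    "\<And>t x y. 0 \<le> t \<Longrightarrow> T t (x + y) = T t x + T t y"
    "\<And>t a x. 0 \<le> t \<Longrightarrow> T t (csc a x) = csc a (T t x)"
    "\<And>t x. 0 \<le> t \<Longrightarrow> norm (T t x) \<le> M * norm x"
    "\<And>x. T 0 x = x"
    "\<And>s t x. 0 \<le> s \<Longrightarrow> 0 \<le> t \<Longrightarrow> T (s + t) x = T s (T t x)"
    "\<And>x. ((\<lambda>t. T t x) \<longlongrightarrow> x) (at_right 0)"
    "\<And>x y. (x, y) \<in> G \<longleftrightarrow> ((\<lambda>t. (x - T t x) /\<^sub>R t) \<longlongrightarrow> y) (at_right 0)"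
    using generates by blast
  define S :: "real \<Rightarrow> 'n cfun \<Rightarrow> 'n cfun"
    where "S t f = (SOME g. g \<in> L2 \<and> abs_l2 g = T t (abs_l2 f))" for t f
  have S: "S t f \<in> L2" "abs_l2 (S t f) = T t (abs_l2 f)" for t f
  proof -
    have "\<exists>g. g \<in> L2 \<and> abs_l2 g = T t (abs_l2 f)" using l2_rep[of "T t (abs_l2 f)"] by metis
    from someI_ex[OF this] show "S t f \<in> L2" "abs_l2 (S t f) = T t (abs_l2 f)"
      by (simp_all add: S_def)
  qed
  have "semigroup_of L S"
    unfolding semigroup_of_def
  proof (intro conjI allI impI ballI)
    fix t :: real assume t: "0 \<le> t"
    show "S t f \<in> L2" for f by (rule S)
    show "AE x in lebesgue. S t (\<lambda>y. f y + g y) x = S t f x + S t g x" if "f \<in> L2" "g \<in> L2" for f g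
    proof -
      have "abs_l2 (S t (\<lambda>y. f y + g y)) = abs_l2 (\<lambda>x. S t f x + S t g x)"
        using T(1)[OF t] by (simp add: S that flip: abs_l2_add)
      then show ?thesis by (subst (asm) abs_l2_eq) (simp_all add: S L2_add)
    qed
    show "AE x in lebesgue. S t (\<lambda>y. a * f y) x = a * S t f x" if "f \<in> L2" for f a
    proof -
      have "abs_l2 (S t (\<lambda>y. a * f y)) = abs_l2 (\<lambda>x. a * S t f x)"
        using T(2)[OF t] by (simp add: S that flip: abs_l2_csc)
      then show ?thesis by (subst (asm) abs_l2_eq) (simp_all add: S L2_cmult)
    qed
    show "\<exists>C. \<forall>f\<in>L2. L2norm (S t f) \<le> ennreal C * L2norm f"
    proof (intro exI ballI)
      fix f :: "'n cfun" assume f: "f \<in> L2"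
      have "norm (T t (abs_l2 f)) \<le> \<bar>M\<bar> * norm (abs_l2 f)"
        using T(3)[OF t, of "abs_l2 f"] mult_right_mono[OF abs_ge_self[of M] norm_ge_zero[of "abs_l2 f"]]
        by linarith
      then show "L2norm (S t f) \<le> ennreal \<bar>M\<bar> * L2norm f"
        by (simp add: L2norm_abs S f ennreal_leI flip: ennreal_mult)
    qed
  next
    show "AE x in lebesgue. S 0 f x = f x" if "f \<in> L2" for f
      using S[of 0 f] that abs_l2_eq[of "S 0 f" f] by (simp add: T)
    show "AE x in lebesgue. S (s + t) f x = S s (S t f) x" if "0 \<le> s" "0 \<le> t" "f \<in> L2" for s t f
      using S[of "s + t" f] S[of s "S t f"] abs_l2_eq[of "S (s + t) f" "S s (S t f)"] T(5)[OF that(1,2), of "abs_l2 f"]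
      by (simp add: S)
    show "((\<lambda>t. L2norm (\<lambda>x. S t f x - f x)) \<longlongrightarrow> 0) (at_right 0)" if "f \<in> L2" for f
    proof -
      have "L2norm (\<lambda>x. S t f x - f x) = ennreal (norm (T t (abs_l2 f) - abs_l2 f))" for t
        by (simp add: L2norm_abs L2_diff S that flip: abs_l2_diff)
      moreover have "((\<lambda>t. ennreal (norm (T t (abs_l2 f) - abs_l2 f))) \<longlongrightarrow> ennreal 0) (at_right 0)"
        by (intro tendsto_ennrealI tendsto_norm_zero LIM_zero T)
      ultimately show ?thesis by simp
    qed
    fix f g :: "'n cfun"
    have nm: "L2norm (\<lambda>x. (f x - S t f x) / of_real t - g x) =
        ennreal (norm ((abs_l2 f - T t (abs_l2 f)) /\<^sub>R t - abs_l2 g))" if "f \<in> L2" "g \<in> L2" for t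
    proof -
      have 1: "(\<lambda>x. of_real (inverse t) * (f x - S t f x)) \<in> L2" by (intro L2_cmult L2_diff that S)
      have 2: "(\<lambda>x. (f x - S t f x) / of_real t - g x) = (\<lambda>x. of_real (inverse t) * (f x - S t f x) - g x)"
        by (simp add: divide_inverse mult.commute)
      have "abs_l2 (\<lambda>x. of_real (inverse t) * (f x - S t f x) - g x) =
          abs_l2 (\<lambda>x. of_real (inverse t) * (f x - S t f x)) - abs_l2 g"
        by (rule abs_l2_diff[OF 1 that(2), symmetric])
      also have "abs_l2 (\<lambda>x. of_real (inverse t) * (f x - S t f x)) = abs_l2 (\<lambda>x. f x - S t f x) /\<^sub>R t"
        by (rule abs_l2_scaleR[symmetric]) (intro L2_diff that S)
      also have "abs_l2 (\<lambda>x. f x - S t f x) = abs_l2 f - T t (abs_l2 f)"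
        using abs_l2_diff[OF that(1) S(1)] by (simp add: S)
      finally show ?thesis
        unfolding 2 using L2norm_abs[OF L2_diff[OF 1 that(2)]] by simp
    qed
    show "(f, g) \<in> L \<longleftrightarrow> f \<in> L2 \<and> g \<in> L2 \<and>
      ((\<lambda>t. L2norm (\<lambda>x. (f x - S t f x) / of_real t - g x)) \<longlongrightarrow> 0) (at_right 0)"
    proof (cases "f \<in> L2 \<and> g \<in> L2")
      case True
      then have "((\<lambda>t. L2norm (\<lambda>x. (f x - S t f x) / of_real t - g x)) \<longlongrightarrow> 0) (at_right 0) \<longleftrightarrow>
        ((\<lambda>t. ennreal (norm ((abs_l2 f - T t (abs_l2 f)) /\<^sub>R t - abs_l2 g))) \<longlongrightarrow> ennreal 0) (at_right 0)"
        by (simp add: nm)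
      also have "\<dots> \<longleftrightarrow> ((\<lambda>t. norm ((abs_l2 f - T t (abs_l2 f)) /\<^sub>R t - abs_l2 g)) \<longlongrightarrow> 0) (at_right 0)"
        by (rule tendsto_ennreal_iff) auto
      also have "\<dots> \<longleftrightarrow> ((\<lambda>t. (abs_l2 f - T t (abs_l2 f)) /\<^sub>R t) \<longlongrightarrow> abs_l2 g) (at_right 0)"
        by (simp only: tendsto_norm_zero_iff LIM_zero_iff)
      also have "\<dots> \<longleftrightarrow> (f, g) \<in> L"
        using G_iff[of f g] True by (simp only: T(7)[symmetric])
      finally show ?thesis using True by blast
    qed (use LL2 in blast)
  qed
  then show ?thesis by blast
qed

lemma semigroup_heat: "cond_A1 L \<Longrightarrow> semigroup_of L (heat L)"
  unfolding heat_def by (rule someI_ex[of "semigroup_of L", OF semigroup_exists])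

section \<open>Bilinear sums over trees of cells\<close>

lemma weighted_am_gm3:
  fixes a b c :: real
  assumes "0 < a" "0 < b" "0 < c" "0 \<le> \<alpha>" "0 \<le> \<beta>" "0 \<le> \<gamma>" "\<alpha> + \<beta> + \<gamma> = 1"
  shows "a powr \<alpha> * b powr \<beta> * c powr \<gamma> \<le> \<alpha> * a + \<beta> * b + \<gamma> * c"
proof -
  define m where "m = \<alpha> * a + \<beta> * b + \<gamma> * c"
  have nn: "0 \<le> \<alpha> * a" "0 \<le> \<beta> * b" "0 \<le> \<gamma> * c" using assms by auto
  have "0 < m"
  proof -
    have "0 < \<alpha> \<or> 0 < \<beta> \<or> 0 < \<gamma>" using assms by linarith
    then have "0 < \<alpha> * a \<or> 0 < \<beta> * b \<or> 0 < \<gamma> * c" using assms(1-3) by auto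
    then show ?thesis using nn unfolding m_def by linarith
  qed
  have l: "\<delta> * ln y \<le> \<delta> * (ln m + y / m - 1)" if "0 < y" "0 \<le> \<delta>" for y \<delta> :: real
  proof (rule mult_left_mono[OF _ that(2)])
    show "ln y \<le> ln m + y / m - 1"
      using ln_le_minus_one[of "y / m"] that \<open>0 < m\<close> by (simp add: ln_div)
  qed
  have "\<alpha> * ln a + \<beta> * ln b + \<gamma> * ln c \<le>
    \<alpha> * (ln m + a / m - 1) + \<beta> * (ln m + b / m - 1) + \<gamma> * (ln m + c / m - 1)"
    by (intro add_mono l assms)
  also have "\<dots> = (\<alpha> + \<beta> + \<gamma>) * (ln m - 1) + (\<alpha> * a + \<beta> * b + \<gamma> * c) / m"
    by (simp add: algebra_simps add_divide_distrib)
  also have "\<dots> = (\<alpha> + \<beta> + \<gamma>) * (ln m - 1) + m / m"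
    by (simp only: m_def)
  also have "\<dots> = ln m" using assms(7) \<open>0 < m\<close> by simp
  finally have "exp (\<alpha> * ln a + \<beta> * ln b + \<gamma> * ln c) \<le> exp (ln m)" by simp
  then show ?thesis using assms \<open>0 < m\<close> by (simp add: powr_def exp_add m_def)
qed

lemma sum_powr3_le:
  fixes x y z :: "'c \<Rightarrow> real"
  assumes fin: "finite I" and pos: "\<And>i. i \<in> I \<Longrightarrow> 0 < x i \<and> 0 < y i \<and> 0 < z i"
    and X: "sum x I \<le> X" "sum y I \<le> Y" "sum z I \<le> Z" "0 < X" "0 < Y" "0 < Z"
    and e: "0 \<le> s" "0 \<le> t" "0 \<le> w" "1 \<le> s + t + w"
  shows "(\<Sum>i\<in>I. x i powr s * y i powr t * z i powr w) \<le> X powr s * Y powr t * Z powr w"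
proof -
  define \<sigma> where "\<sigma> = s + t + w"
  have \<sigma>: "1 \<le> \<sigma>" using e by (simp add: \<sigma>_def)
  let ?P = "X powr s * Y powr t * Z powr w"
  have step: "x i powr s * y i powr t * z i powr w \<le>
      ?P * (s / \<sigma> * (x i / X) + t / \<sigma> * (y i / Y) + w / \<sigma> * (z i / Z))" if i: "i \<in> I" for i
  proof -
    have le: "0 < x i" "0 < y i" "0 < z i" "x i \<le> X" "y i \<le> Y" "z i \<le> Z"
      using pos[OF i] X member_le_sum[OF i _ fin, of x] member_le_sum[OF i _ fin, of y]
        member_le_sum[OF i _ fin, of z] pos by (force intro: less_imp_le)+
    have r: "(c / D) powr \<delta> \<le> (c / D) powr (\<delta> / \<sigma>)" if "0 < c" "c \<le> D" "0 \<le> \<delta>" for c D \<delta> :: real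
      using that \<sigma> by (intro powr_mono') (auto simp: divide_le_eq mult_le_cancel_left1)
    have "(x i / X) powr s * (y i / Y) powr t * (z i / Z) powr w
      \<le> (x i / X) powr (s / \<sigma>) * (y i / Y) powr (t / \<sigma>) * (z i / Z) powr (w / \<sigma>)"
      by (intro mult_mono r le e mult_nonneg_nonneg powr_ge_zero)
    also have "\<dots> \<le> s / \<sigma> * (x i / X) + t / \<sigma> * (y i / Y) + w / \<sigma> * (z i / Z)"
      using le X e \<sigma> by (intro weighted_am_gm3) (auto simp: \<sigma>_def simp flip: add_divide_distrib)
    finally have "?P * ((x i / X) powr s * (y i / Y) powr t * (z i / Z) powr w) \<le>
      ?P * (s / \<sigma> * (x i / X) + t / \<sigma> * (y i / Y) + w / \<sigma> * (z i / Z))"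
      by (intro mult_left_mono) auto
    moreover have "?P * ((x i / X) powr s * (y i / Y) powr t * (z i / Z) powr w) =
      x i powr s * y i powr t * z i powr w"
      using le X by (simp add: powr_divide)
    ultimately show ?thesis by simp
  qed
  have "(\<Sum>i\<in>I. x i powr s * y i powr t * z i powr w) \<le>
    (\<Sum>i\<in>I. ?P * (s / \<sigma> * (x i / X) + t / \<sigma> * (y i / Y) + w / \<sigma> * (z i / Z)))"
    by (rule sum_mono[OF step])
  also have "\<dots> = ?P * (s / \<sigma> * (sum x I / X) + t / \<sigma> * (sum y I / Y) + w / \<sigma> * (sum z I / Z))"
    by (simp only: sum_distrib_left[symmetric] sum.distrib sum_divide_distrib[symmetric])
  also have "\<dots> \<le> ?P * (s / \<sigma> * 1 + t / \<sigma> * 1 + w / \<sigma> * 1)"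
    using X e \<sigma> by (intro mult_left_mono add_mono) auto
  also have "s / \<sigma> * 1 + t / \<sigma> * 1 + w / \<sigma> * 1 = 1"
    using \<sigma> by (simp add: \<sigma>_def flip: add_divide_distrib)
  finally show ?thesis by simp
qed

lemma sum_powr_le_powr_sum:
  fixes x :: "'c \<Rightarrow> real"
  assumes "finite I" "\<And>i. i \<in> I \<Longrightarrow> 0 < x i" "sum x I \<le> X" "0 < X" "1 \<le> s"
  shows "(\<Sum>i\<in>I. x i powr s) \<le> X powr s"
proof -
  have "(\<Sum>i\<in>I. x i powr s) = (\<Sum>i\<in>I. x i powr s * x i powr 0 * x i powr 0)"
    using assms(2) by (intro sum.cong HOL.refl) force
  also have "\<dots> \<le> X powr s * X powr 0 * X powr 0"
    using assms by (intro sum_powr3_le) auto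
  finally show ?thesis using assms by simp
qed

lemma Holder_sum:
  fixes x y :: "'c \<Rightarrow> real"
  assumes "finite I" "\<And>i. i \<in> I \<Longrightarrow> 0 < x i" "\<And>i. i \<in> I \<Longrightarrow> 0 < y i"
    and pq: "0 < p" "0 < q" "1 / p + 1 / q = (1::real)"
    and X: "(\<Sum>i\<in>I. x i powr p) \<le> X" "(\<Sum>i\<in>I. y i powr q) \<le> Y" "0 < X" "0 < Y"
  shows "(\<Sum>i\<in>I. x i * y i) \<le> X powr (1 / p) * Y powr (1 / q)"
proof -
  have nz: "x i \<noteq> 0" "y i \<noteq> 0" if "i \<in> I" for i
    using assms(2,3)[OF that] by auto
  have "(\<Sum>i\<in>I. (x i powr p) powr (1 / p) * (y i powr q) powr (1 / q) * (x i powr p) powr 0) \<le>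
    X powr (1 / p) * Y powr (1 / q) * X powr 0"
    using assms nz by (intro sum_powr3_le) auto
  moreover have "(\<Sum>i\<in>I. (x i powr p) powr (1 / p) * (y i powr q) powr (1 / q) * (x i powr p) powr 0) = (\<Sum>i\<in>I. x i * y i)"
    using assms nz by (intro sum.cong HOL.refl) (auto simp: powr_powr less_imp_le)
  ultimately show ?thesis using X by simp
qed

locale cell_tree =
  fixes le :: "'c \<Rightarrow> 'c \<Rightarrow> bool" (infix "\<sqsubseteq>" 50) and lev :: "'c \<Rightarrow> int"
  assumes refl [simp]: "Q \<sqsubseteq> Q"
    and trans: "P \<sqsubseteq> Q \<Longrightarrow> Q \<sqsubseteq> R \<Longrightarrow> P \<sqsubseteq> R"
    and lev_mono: "Q \<sqsubseteq> R \<Longrightarrow> lev Q \<le> lev R"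
    and lev_eq: "Q \<sqsubseteq> R \<Longrightarrow> lev Q = lev R \<Longrightarrow> Q = R"
    and tree: "Q \<sqsubseteq> R \<Longrightarrow> Q \<sqsubseteq> R' \<Longrightarrow> R \<sqsubseteq> R' \<or> R' \<sqsubseteq> R"
    and anc: "Q \<sqsubseteq> R \<Longrightarrow> lev Q \<le> l \<Longrightarrow> l \<le> lev R \<Longrightarrow> \<exists>P. Q \<sqsubseteq> P \<and> P \<sqsubseteq> R \<and> lev P = l"
begin

lemma antisym: "Q \<sqsubseteq> R \<Longrightarrow> R \<sqsubseteq> Q \<Longrightarrow> Q = R"
  using lev_mono lev_eq by (meson order_antisym)

definition antichain :: "'c set \<Rightarrow> bool" where
  "antichain A \<longleftrightarrow> (\<forall>Q\<in>A. \<forall>R\<in>A. Q \<sqsubseteq> R \<longrightarrow> Q = R)"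

definition supadd :: "('c \<Rightarrow> real) \<Rightarrow> bool" where
  "supadd w \<longleftrightarrow> (\<forall>Q. 0 < w Q) \<and>
    (\<forall>A R. finite A \<longrightarrow> antichain A \<longrightarrow> (\<forall>Q\<in>A. Q \<sqsubseteq> R) \<longrightarrow> sum w A \<le> w R)"

lemma supadd_pos: "supadd w \<Longrightarrow> 0 < w Q"
  by (simp add: supadd_def)

lemma supadd_sum: "supadd w \<Longrightarrow> finite A \<Longrightarrow> antichain A \<Longrightarrow> (\<And>Q. Q \<in> A \<Longrightarrow> Q \<sqsubseteq> R) \<Longrightarrow> sum w A \<le> w R"
  by (simp add: supadd_def)

lemma supadd_mono: "supadd w \<Longrightarrow> Q \<sqsubseteq> R \<Longrightarrow> w Q \<le> w R"
  using supadd_sum[of w "{Q}" R] by (simp add: antichain_def)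

definition gen :: "'c set \<Rightarrow> 'c \<Rightarrow> nat \<Rightarrow> 'c set" where
  "gen \<Q> R d = {Q \<in> \<Q>. Q \<sqsubseteq> R \<and> lev Q = lev R - int d}"

lemma antichain_gen: "antichain (gen \<Q> R d)"
  unfolding antichain_def gen_def using lev_eq by auto

lemma sum_below_gen:
  fixes g :: "'c \<Rightarrow> real"
  assumes "finite \<Q>"
  obtains N where "(\<Sum>Q\<in>{Q\<in>\<Q>. Q \<sqsubseteq> R}. g Q) = (\<Sum>d<N. \<Sum>Q\<in>gen \<Q> R d. g Q)"
proof -
  define dep where "dep Q = nat (lev R - lev Q)" for Q
  define N where "N = Suc (Max (insert 0 (dep ` \<Q>)))"
  have N: "dep Q < N" if "Q \<in> \<Q>" for Q
    unfolding N_def using assms that by (intro le_imp_less_Suc Max_ge) auto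
  have gen: "gen \<Q> R d = {Q \<in> {Q\<in>\<Q>. Q \<sqsubseteq> R}. dep Q = d}" for d
    using lev_mono by (auto simp: gen_def dep_def)
  have "(\<Sum>d<N. \<Sum>Q\<in>gen \<Q> R d. g Q) = (\<Sum>Q\<in>{Q\<in>\<Q>. Q \<sqsubseteq> R}. g Q)"
    unfolding gen using assms N by (intro sum.group) auto
  then show thesis using that by metis
qed

lemma geometric_le: "0 \<le> y \<Longrightarrow> y < 1 \<Longrightarrow> (\<Sum>d<N. y ^ d) \<le> 1 / (1 - y :: real)"
proof -
  assume y: "0 \<le> y" "y < 1"
  have "(\<Sum>d<N. y ^ d) \<le> (\<Sum>d. y ^ d)"
    using y by (intro sum_le_suminf summable_geometric) auto
  then show ?thesis using y by (simp add: suminf_geometric)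
qed

lemma sum_below_powr:
  assumes uv: "supadd u" "supadd v" "supadd vol" and vol: "\<And>Q. vol Q = \<zeta> powr lev Q" "1 < \<zeta>"
    and fin: "finite \<Q>"
    and e: "0 \<le> s" "0 \<le> t" "0 < e" "0 < \<eta>" "1 + \<eta> \<le> s + t + e"
  shows "(\<Sum>Q\<in>{Q\<in>\<Q>. Q \<sqsubseteq> R}. u Q powr s * v Q powr t * vol Q powr e) \<le>
    u R powr s * v R powr t * vol R powr e * (1 / (1 - \<zeta> powr - (min \<eta> e)))"
proof -
  define e2 e1 where "e2 = min \<eta> e" and "e1 = e - e2"
  have e12: "0 < e2" "0 \<le> e1" "1 \<le> s + t + e1" using e by (auto simp: e1_def e2_def min_def)
  let ?R = "u R powr s * v R powr t * vol R powr e"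
  have g: "(\<Sum>Q\<in>gen \<Q> R d. u Q powr s * v Q powr t * vol Q powr e) \<le> ?R * (\<zeta> powr - e2) ^ d" for d
  proof -
    have f: "finite (gen \<Q> R d)" using fin by (simp add: gen_def)
    have ve: "vol Q powr e2 = vol R powr e2 * (\<zeta> powr - e2) ^ d" if "Q \<in> gen \<Q> R d" for Q
    proof -
      have "real_of_int (lev Q) = lev R - real d" using that by (simp add: gen_def)
      then have "lev Q * e2 = lev R * e2 + (- e2) * d"
        by (simp only:) (simp add: algebra_simps)
      then have "vol Q powr e2 = \<zeta> powr (lev R * e2 + (- e2) * d)"
        unfolding vol powr_powr by simp
      also have "\<dots> = vol R powr e2 * (\<zeta> powr - e2) ^ d"
      proof -
        have "(\<zeta> powr - e2) ^ d = \<zeta> powr (- e2 * d)"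
          using vol(2) by (simp add: powr_powr powr_realpow[symmetric])
        then show ?thesis unfolding vol powr_powr powr_add by simp
      qed
      finally show ?thesis .
    qed
    have "(\<Sum>Q\<in>gen \<Q> R d. u Q powr s * v Q powr t * vol Q powr e) =
      (\<Sum>Q\<in>gen \<Q> R d. (u Q powr s * v Q powr t * vol Q powr e1) * (vol R powr e2 * (\<zeta> powr - e2) ^ d))"
    proof (rule sum.cong[OF HOL.refl])
      fix Q assume "Q \<in> gen \<Q> R d"
      from ve[OF this] show "u Q powr s * v Q powr t * vol Q powr e =
        (u Q powr s * v Q powr t * vol Q powr e1) * (vol R powr e2 * (\<zeta> powr - e2) ^ d)"
        by (simp add: e1_def powr_add[symmetric] flip: \<open>vol Q powr e2 = _\<close>)
    qed
    also have "\<dots> = (\<Sum>Q\<in>gen \<Q> R d. u Q powr s * v Q powr t * vol Q powr e1) * (vol R powr e2 * (\<zeta> powr - e2) ^ d)"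
      by (rule sum_distrib_right[symmetric])
    also have "\<dots> \<le> (u R powr s * v R powr t * vol R powr e1) * (vol R powr e2 * (\<zeta> powr - e2) ^ d)"
      using uv e e12 f
      by (intro mult_right_mono sum_powr3_le)
        (auto simp: supadd_pos intro!: supadd_sum antichain_gen, auto simp: gen_def)
    also have "\<dots> = ?R * (\<zeta> powr - e2) ^ d"
      by (simp add: e1_def powr_add[symmetric])
    finally show ?thesis .
  qed
  obtain N where N: "(\<Sum>Q\<in>{Q\<in>\<Q>. Q \<sqsubseteq> R}. u Q powr s * v Q powr t * vol Q powr e) =
     (\<Sum>d<N. \<Sum>Q\<in>gen \<Q> R d. u Q powr s * v Q powr t * vol Q powr e)"
    by (rule sum_below_gen[OF fin])
  have "\<dots> \<le> (\<Sum>d<N. ?R * (\<zeta> powr - e2) ^ d)" by (rule sum_mono) (rule g)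
  also have "\<dots> = ?R * (\<Sum>d<N. (\<zeta> powr - e2) ^ d)" by (simp add: sum_distrib_left)
  also have "\<dots> \<le> ?R * (1 / (1 - \<zeta> powr - e2))"
    using vol e12 by (intro mult_left_mono geometric_le powr_less_one) auto
  finally show ?thesis unfolding N e2_def .
qed

text \<open>The hypothesis on \<open>D\<close> is what the \<open>A_\<infinity>\<close> condition gives along a chain of cells. Since
  \<open>u\<close> decreases along chains, it forces \<open>u\<close> to halve every \<open>2 D\<close> generations, so that the sum of
  the $\varrho$-th powers costs only one factor \<open>D\<close>.\<close>

lemma sum_below_superlinear:
  assumes u: "supadd u" and D: "1 \<le> D"
    and dec: "\<And>Q R d. Q \<sqsubseteq> R \<Longrightarrow> lev Q = lev R - int d \<Longrightarrow> real d * u Q \<le> D * u R"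
    and fin: "finite \<Q>" and \<rho>: "1 < \<rho>"
  shows "(\<Sum>Q\<in>{Q\<in>\<Q>. Q \<sqsubseteq> R}. u Q powr \<rho>) \<le> 3 * D / (1 - 2 powr (1 - \<rho>)) * u R powr \<rho>"
proof -
  define N where "N = nat \<lceil>2 * D\<rceil>"
  have N: "2 * D \<le> real N" "real N \<le> 3 * D" "0 < N"
    using D by (auto simp: N_def) linarith+
  have half: "u Q \<le> (1/2) ^ k * u R" if "Q \<sqsubseteq> R" "lev Q = lev R - int (k * N)" for k Q R
    using that
  proof (induction k arbitrary: Q)
    case 0
    then show ?case using lev_eq[of Q R] by simp
  next
    case (Suc k)
    obtain P where P: "Q \<sqsubseteq> P" "P \<sqsubseteq> R" "lev P = lev R - int (k * N)"
      using anc[OF Suc.prems(1), of "lev R - int (k * N)"] Suc.prems(2) by auto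
    have "lev Q = lev P - int N" using P(3) Suc.prems(2) by simp
    have "2 * D * u Q \<le> real N * u Q"
      using N(1) supadd_pos[OF u, of Q] by (intro mult_right_mono) auto
    also have "\<dots> \<le> D * u P" by (rule dec[OF P(1)]) fact
    finally have "2 * D * u Q \<le> D * u P" .
    then have "D * (2 * u Q) \<le> D * u P" by (simp add: mult_ac)
    then have "u Q \<le> u P / 2" using D by simp
    then show ?case using Suc.IH[OF P(2,3)] by simp
  qed
  define y where "y = 2 powr (1 - \<rho>)"
  have y: "0 < y" "y < 1" using \<rho> by (auto simp: y_def powr_less_one)
  have g: "(\<Sum>Q\<in>gen \<Q> R d. u Q powr \<rho>) \<le> u R powr \<rho> * y ^ (d div N)" for d
  proof -
    have f: "finite (gen \<Q> R d)" using fin by (simp add: gen_def)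
    have "u Q powr \<rho> \<le> ((1/2) ^ (d div N) * u R) powr (\<rho> - 1) * u Q" if Q: "Q \<in> gen \<Q> R d" for Q
    proof -
      have QR: "Q \<sqsubseteq> R" "lev Q = lev R - int d" using Q by (auto simp: gen_def)
      have "int ((d div N) * N) \<le> int d" by (simp add: div_times_less_eq_dividend del: of_nat_mult)
      then obtain P where P: "Q \<sqsubseteq> P" "P \<sqsubseteq> R" "lev P = lev R - int ((d div N) * N)"
        using anc[OF QR(1), of "lev R - int ((d div N) * N)"] QR(2) by auto
      have "u Q \<le> (1/2) ^ (d div N) * u R"
        using half[OF P(2,3)] supadd_mono[OF u P(1)] by simp
      then have "u Q powr (\<rho> - 1) \<le> ((1/2) ^ (d div N) * u R) powr (\<rho> - 1)"
        using \<rho> supadd_pos[OF u, of Q] by (intro powr_mono2) auto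
      then have "u Q powr (\<rho> - 1) * u Q \<le> ((1/2) ^ (d div N) * u R) powr (\<rho> - 1) * u Q"
        using supadd_pos[OF u, of Q] by (intro mult_right_mono) auto
      moreover have "u Q powr (\<rho> - 1) * u Q = u Q powr \<rho>"
        using supadd_pos[OF u, of Q] powr_add[of "u Q" "\<rho> - 1" 1] by simp
      ultimately show ?thesis by simp
    qed
    then have "(\<Sum>Q\<in>gen \<Q> R d. u Q powr \<rho>) \<le> (\<Sum>Q\<in>gen \<Q> R d. ((1/2) ^ (d div N) * u R) powr (\<rho> - 1) * u Q)"
      by (rule sum_mono)
    also have "\<dots> = ((1/2) ^ (d div N) * u R) powr (\<rho> - 1) * (\<Sum>Q\<in>gen \<Q> R d. u Q)"
      by (rule sum_distrib_left[symmetric])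
    also have "\<dots> \<le> ((1/2) ^ (d div N) * u R) powr (\<rho> - 1) * u R"
      by (intro mult_left_mono supadd_sum u f antichain_gen) (auto simp: gen_def)
    also have "((1/2) ^ (d div N) * u R) powr (\<rho> - 1) = y ^ (d div N) * u R powr (\<rho> - 1)"
    proof -
      have "((1/2) ^ (d div N)) powr (\<rho> - 1) = ((1/2) powr (\<rho> - 1)) ^ (d div N)"
        by (simp add: powr_powr mult.commute flip: powr_realpow)
      also have "(1/2) powr (\<rho> - 1) = y"
        by (simp add: y_def powr_divide powr_diff)
      finally show ?thesis using supadd_pos[OF u, of R] by (simp add: powr_mult)
    qed
    also have "y ^ (d div N) * u R powr (\<rho> - 1) * u R = u R powr \<rho> * y ^ (d div N)"
      using supadd_pos[OF u, of R] powr_add[of "u R" "\<rho> - 1" 1] by simp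
    finally show ?thesis .
  qed
  obtain M where M: "(\<Sum>Q\<in>{Q\<in>\<Q>. Q \<sqsubseteq> R}. u Q powr \<rho>) = (\<Sum>d<M. \<Sum>Q\<in>gen \<Q> R d. u Q powr \<rho>)"
    by (rule sum_below_gen[OF fin])
  have "(\<Sum>d<M. y ^ (d div N)) \<le> (\<Sum>d<M * N. y ^ (d div N))"
    using N y by (intro sum_mono2) auto
  also have "(\<Sum>d<M * N. y ^ (d div N)) = (\<Sum>k<M. \<Sum>d=k*N..<k*N+N. y ^ (d div N))"
    by (rule sum.nat_group[symmetric])
  also have "\<dots> = (\<Sum>k<M. \<Sum>d=k*N..<k*N+N. y ^ k)"
  proof (intro sum.cong HOL.refl arg_cong[of _ _ "\<lambda>k. y ^ k"])
    fix k d assume "d \<in> {k * N..<k * N + N}"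
    then show "d div N = k" using N(3) by (intro div_nat_eqI) (auto simp: mult.commute)
  qed
  also have "\<dots> = real N * (\<Sum>k<M. y ^ k)" by (simp add: sum_distrib_left)
  also have "\<dots> \<le> 3 * D * (1 / (1 - y))"
    using N y D by (intro mult_mono geometric_le sum_nonneg) auto
  finally have "u R powr \<rho> * (\<Sum>d<M. y ^ (d div N)) \<le> u R powr \<rho> * (3 * D * (1 / (1 - y)))"
    by (intro mult_left_mono) auto
  moreover have "(\<Sum>d<M. \<Sum>Q\<in>gen \<Q> R d. u Q powr \<rho>) \<le> (\<Sum>d<M. u R powr \<rho> * y ^ (d div N))"
    by (rule sum_mono) (rule g)
  ultimately show ?thesis unfolding M y_def sum_distrib_left[symmetric] by (simp add: mult_ac)
qed

end

context cell_tree
begin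

definition top_val :: "'c set \<Rightarrow> ('c \<Rightarrow> real) \<Rightarrow> 'c \<Rightarrow> real" where
  "top_val \<Q> A Q = Max (A ` {R \<in> \<Q>. Q \<sqsubseteq> R})"

definition ilev :: "'c set \<Rightarrow> ('c \<Rightarrow> real) \<Rightarrow> 'c \<Rightarrow> int" where
  "ilev \<Q> A Q = \<lfloor>log 2 (top_val \<Q> A Q)\<rfloor>"

definition jumps :: "'c set \<Rightarrow> ('c \<Rightarrow> real) \<Rightarrow> 'c set" where
  "jumps \<Q> A = {R \<in> \<Q>. \<forall>R'\<in>\<Q>. R \<sqsubseteq> R' \<longrightarrow> ilev \<Q> A R' = ilev \<Q> A R \<longrightarrow> R' = R}"

definition maximal_bound :: "real \<Rightarrow> ('c \<Rightarrow> real) \<Rightarrow> ('c \<Rightarrow> real) \<Rightarrow> real \<Rightarrow> 'c set \<Rightarrow> bool" where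
  "maximal_bound p w A F \<Q> \<longleftrightarrow> (\<forall>\<A> i. \<A> \<subseteq> \<Q> \<longrightarrow>
     (\<forall>R\<in>\<A>. 2 powr of_int (i R) \<le> A R) \<longrightarrow>
     (\<forall>R\<in>\<A>. \<forall>R'\<in>\<A>. i R = (i R' :: int) \<longrightarrow> R \<sqsubseteq> R' \<longrightarrow> R = R') \<longrightarrow>
     (\<Sum>R\<in>\<A>. 2 powr (p * of_int (i R)) * w R) \<le> F powr p)"

lemma maximal_bound_subset: "maximal_bound p w A F \<Q> \<Longrightarrow> \<R> \<subseteq> \<Q> \<Longrightarrow> maximal_bound p w A F \<R>"
  unfolding maximal_bound_def by (meson order_trans)

lemma ex_max_lev:
  assumes "finite X" "X \<noteq> {}"
  obtains P where "P \<in> X" "\<And>R. R \<in> X \<Longrightarrow> P \<sqsubseteq> R \<Longrightarrow> R = P"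
proof -
  have "Max (lev ` X) \<in> lev ` X" using assms by (intro Max_in) auto
  then obtain P where P: "P \<in> X" "Max (lev ` X) = lev P" by blast
  have "R = P" if "R \<in> X" "P \<sqsubseteq> R" for R
  proof -
    have "lev R \<le> lev P" unfolding P(2)[symmetric] using assms that by (intro Max_ge) auto
    then show ?thesis using lev_mono[OF that(2)] lev_eq[OF that(2)] by simp
  qed
  with P(1) show thesis by (rule that)
qed

context
  fixes \<Q> :: "'c set" and A :: "'c \<Rightarrow> real"
  assumes fin: "finite \<Q>" and pos: "\<And>Q. Q \<in> \<Q> \<Longrightarrow> 0 < A Q"
begin

lemma top_val_ge: "Q \<in> \<Q> \<Longrightarrow> Q \<sqsubseteq> R \<Longrightarrow> R \<in> \<Q> \<Longrightarrow> A R \<le> top_val \<Q> A Q"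
  unfolding top_val_def using fin by (intro Max_ge) auto

lemma top_val_in: "Q \<in> \<Q> \<Longrightarrow> \<exists>R\<in>\<Q>. Q \<sqsubseteq> R \<and> top_val \<Q> A Q = A R"
proof -
  assume "Q \<in> \<Q>"
  then have "Max (A ` {R \<in> \<Q>. Q \<sqsubseteq> R}) \<in> A ` {R \<in> \<Q>. Q \<sqsubseteq> R}"
    using fin refl[of Q] by (intro Max_in) auto
  then show ?thesis unfolding top_val_def by blast
qed

lemma top_val_pos: "Q \<in> \<Q> \<Longrightarrow> 0 < top_val \<Q> A Q"
  using top_val_in pos by force

lemma top_val_mono: "Q \<in> \<Q> \<Longrightarrow> R \<in> \<Q> \<Longrightarrow> Q \<sqsubseteq> R \<Longrightarrow> top_val \<Q> A R \<le> top_val \<Q> A Q"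
  using top_val_in[of R] top_val_ge trans by metis

lemma ilev_mono: "Q \<in> \<Q> \<Longrightarrow> R \<in> \<Q> \<Longrightarrow> Q \<sqsubseteq> R \<Longrightarrow> ilev \<Q> A R \<le> ilev \<Q> A Q"
  unfolding ilev_def using top_val_mono top_val_pos by (intro floor_mono log_mono) auto

lemma ilev_le: assumes "Q \<in> \<Q>" shows "2 powr ilev \<Q> A Q \<le> top_val \<Q> A Q"
proof -
  have "2 powr ilev \<Q> A Q \<le> 2 powr log 2 (top_val \<Q> A Q)"
    unfolding ilev_def by (intro powr_mono) auto
  then show ?thesis using top_val_pos[OF assms] by simp
qed

lemma A_le_ilev: assumes "Q \<in> \<Q>" shows "A Q \<le> 2 * 2 powr ilev \<Q> A Q"
proof -
  have "A Q \<le> 2 powr log 2 (top_val \<Q> A Q)"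
    using top_val_ge[OF assms refl assms] top_val_pos[OF assms] by simp
  also have "\<dots> \<le> 2 powr (1 + ilev \<Q> A Q)"
    unfolding ilev_def by (intro powr_mono) linarith+
  also have "\<dots> = 2 * 2 powr ilev \<Q> A Q" by (simp add: powr_add)
  finally show ?thesis .
qed

lemma jumps_A: assumes R: "R \<in> jumps \<Q> A" shows "2 powr ilev \<Q> A R \<le> A R"
proof -
  have RQ: "R \<in> \<Q>" using R by (simp add: jumps_def)
  obtain R' where R': "R' \<in> \<Q>" "R \<sqsubseteq> R'" "top_val \<Q> A R = A R'" using top_val_in[OF RQ] by blast
  have "top_val \<Q> A R' = top_val \<Q> A R"
    using top_val_mono[OF RQ R'(1,2)] top_val_ge[OF R'(1) refl R'(1)] R'(3) by simp
  then have "R' = R" using R R' by (auto simp: jumps_def ilev_def)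
  then show ?thesis using ilev_le[OF RQ] R'(3) by simp
qed

lemma jumps_cover: assumes Q: "Q \<in> \<Q>" shows "\<exists>P\<in>jumps \<Q> A. Q \<sqsubseteq> P \<and> ilev \<Q> A P = ilev \<Q> A Q"
proof -
  let ?X = "{R \<in> \<Q>. Q \<sqsubseteq> R \<and> ilev \<Q> A R = ilev \<Q> A Q}"
  obtain P where P: "P \<in> ?X" "\<And>R. R \<in> ?X \<Longrightarrow> P \<sqsubseteq> R \<Longrightarrow> R = P"
  proof (rule ex_max_lev[of ?X])
    show "?X \<noteq> {}" using Q refl by blast
  qed (use fin in auto)
  then have "P \<in> jumps \<Q> A" using trans unfolding jumps_def by auto
  then show ?thesis using P(1) by blast
qed

lemma jumps_bound: "maximal_bound p w A F \<Q> \<Longrightarrow>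
    (\<Sum>R\<in>jumps \<Q> A. 2 powr (p * ilev \<Q> A R) * w R) \<le> F powr p"
  unfolding maximal_bound_def
  by (elim allE[of _ "jumps \<Q> A"] allE[of _ "ilev \<Q> A"] impE)
    (use jumps_A in \<open>auto simp: jumps_def\<close>)

end

lemma jumps_sum_le:
  assumes fin: "finite \<Q>" and posA: "\<And>Q. Q \<in> \<Q> \<Longrightarrow> 0 < A Q" and posB: "\<And>Q. Q \<in> \<Q> \<Longrightarrow> 0 < B Q"
    and uv: "supadd u" "supadd v"
    and e: "0 < p" "p < q" "0 < q'" "1 / q + 1 / q' = (1::real)"
    and D: "1 \<le> D" "\<And>Q R d. Q \<sqsubseteq> R \<Longrightarrow> lev Q = lev R - int d \<Longrightarrow> real d * u Q \<le> D * u R"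
    and mb: "maximal_bound p u A F \<Q>" "maximal_bound q' v B H \<Q>" and FH: "0 < F" "0 < H"
  shows "(\<Sum>R\<in>jumps \<Q> B. (2 powr ilev \<Q> A R * u R powr (1 / p)) * (2 powr ilev \<Q> B R * v R powr (1 / q')))
    \<le> (3 * D / (1 - 2 powr (1 - q / p))) powr (1 / q) * F * H"
proof -
  define cD where "cD = 3 * D / (1 - 2 powr (1 - q / p))"
  have y: "2 powr (1 - q / p) < (1::real)" using e by (intro powr_less_one) auto
  have cD: "0 < cD" using D y by (simp add: cD_def)
  have u: "0 < u Q" and v: "0 < v Q" for Q using uv supadd_pos by auto
  define i where "i = ilev \<Q> A"
  have sumA: "(\<Sum>R\<in>\<Q>. 2 powr (q * i R) * u R powr (q / p)) \<le> cD * F powr q"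
  proof -
    have "\<forall>Q. \<exists>P. Q \<in> \<Q> \<longrightarrow> P \<in> jumps \<Q> A \<and> Q \<sqsubseteq> P \<and> i P = i Q"
      using jumps_cover[of \<Q> A, OF fin posA] unfolding i_def by blast
    from choice[OF this] obtain \<pi> where \<pi>: "\<And>Q. Q \<in> \<Q> \<Longrightarrow> \<pi> Q \<in> jumps \<Q> A"
      "\<And>Q. Q \<in> \<Q> \<Longrightarrow> Q \<sqsubseteq> \<pi> Q" "\<And>Q. Q \<in> \<Q> \<Longrightarrow> i (\<pi> Q) = i Q" by blast
    have fJ: "finite (jumps \<Q> A)" using fin by (simp add: jumps_def)
    have "(\<Sum>R\<in>\<Q>. 2 powr (q * i R) * u R powr (q / p)) =
       (\<Sum>P\<in>jumps \<Q> A. \<Sum>R\<in>{R\<in>\<Q>. \<pi> R = P}. 2 powr (q * i R) * u R powr (q / p))"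
      using \<pi>(1) by (intro sum.group[symmetric] fin fJ) auto
    also have "\<dots> \<le> (\<Sum>P\<in>jumps \<Q> A. cD * (2 powr (p * i P) * u P) powr (q / p))"
    proof (rule sum_mono)
      fix P
      have "(\<Sum>R\<in>{R\<in>\<Q>. \<pi> R = P}. 2 powr (q * i R) * u R powr (q / p)) =
         2 powr (q * i P) * (\<Sum>R\<in>{R\<in>\<Q>. \<pi> R = P}. u R powr (q / p))"
        unfolding sum_distrib_left using \<pi>(3) by (intro sum.cong HOL.refl) auto
      also have "\<dots> \<le> 2 powr (q * i P) * (\<Sum>R\<in>{R\<in>\<Q>. R \<sqsubseteq> P}. u R powr (q / p))"
        using fin \<pi>(2) by (intro mult_left_mono sum_mono2) auto
      also have "\<dots> \<le> 2 powr (q * i P) * (cD * u P powr (q / p))"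
        unfolding cD_def using e
        by (intro mult_left_mono sum_below_superlinear[OF uv(1) D fin]) auto
      also have "\<dots> = cD * (2 powr (p * i P) * u P) powr (q / p)"
        using e u[of P] by (simp add: powr_mult powr_powr mult.commute)
      finally show "(\<Sum>R\<in>{R\<in>\<Q>. \<pi> R = P}. 2 powr (q * i R) * u R powr (q / p)) \<le>
        cD * (2 powr (p * i P) * u P) powr (q / p)" .
    qed
    also have "\<dots> = cD * (\<Sum>P\<in>jumps \<Q> A. (2 powr (p * i P) * u P) powr (q / p))"
      by (rule sum_distrib_left[symmetric])
    also have "\<dots> \<le> cD * (F powr p) powr (q / p)"
      using cD u FH e jumps_bound[OF fin posA mb(1)]
      by (intro mult_left_mono sum_powr_le_powr_sum fJ) (auto simp: i_def)
    also have "\<dots> = cD * F powr q" using e by (simp add: powr_powr)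
    finally show ?thesis .
  qed
  have fJ: "finite (jumps \<Q> B)" using fin by (simp add: jumps_def)
  have "(\<Sum>R\<in>jumps \<Q> B. (2 powr i R * u R powr (1 / p)) * (2 powr ilev \<Q> B R * v R powr (1 / q')))
    \<le> (cD * F powr q) powr (1 / q) * (H powr q') powr (1 / q')"
  proof (rule Holder_sum[OF fJ])
    have "(\<Sum>R\<in>jumps \<Q> B. (2 powr i R * u R powr (1 / p)) powr q) =
      (\<Sum>R\<in>jumps \<Q> B. 2 powr (q * i R) * u R powr (q / p))"
      using u by (intro sum.cong HOL.refl) (simp add: powr_mult powr_powr mult.commute)
    also have "\<dots> \<le> (\<Sum>R\<in>\<Q>. 2 powr (q * i R) * u R powr (q / p))"
      using fin by (intro sum_mono2) (auto simp: jumps_def)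
    finally show "(\<Sum>R\<in>jumps \<Q> B. (2 powr i R * u R powr (1 / p)) powr q) \<le> cD * F powr q"
      using sumA by simp
    have "(\<Sum>R\<in>jumps \<Q> B. (2 powr ilev \<Q> B R * v R powr (1 / q')) powr q') =
      (\<Sum>R\<in>jumps \<Q> B. 2 powr (q' * ilev \<Q> B R) * v R)"
      using v e by (intro sum.cong HOL.refl) (simp add: powr_mult powr_powr mult.commute less_imp_le)
    then show "(\<Sum>R\<in>jumps \<Q> B. (2 powr ilev \<Q> B R * v R powr (1 / q')) powr q') \<le> H powr q'"
      using jumps_bound[OF fin posB mb(2)] by simp
    show "0 < 2 powr i R * u R powr (1 / p)" for R using u[of R] by simp
    show "0 < 2 powr ilev \<Q> B R * v R powr (1 / q')" for R using v[of R] by simp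
  qed (use e cD FH in auto)
  also have "\<dots> = cD powr (1 / q) * F * H"
    using e cD FH by (simp add: powr_mult powr_powr)
  finally show ?thesis unfolding i_def cD_def .
qed

lemma class_bound:
  assumes fin: "finite \<Q>" and posA: "\<And>Q. Q \<in> \<Q> \<Longrightarrow> 0 < A Q" and posB: "\<And>Q. Q \<in> \<Q> \<Longrightarrow> 0 < B Q"
    and uv: "supadd u" "supadd v" "supadd vol" and vol: "\<And>Q. vol Q = \<zeta> powr lev Q" "1 < \<zeta>"
    and e: "0 < p" "p < q" "0 < q'" "0 < p'" "1 / q + 1 / q' = (1::real)" "1 / p + 1 / p' = (1::real)"
      "0 < \<beta>" "0 < \<gamma>"
    and Du: "1 \<le> Du" "\<And>Q R d. Q \<sqsubseteq> R \<Longrightarrow> lev Q = lev R - int d \<Longrightarrow> real d * u Q \<le> Du * u R"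
    and Dv: "1 \<le> Dv" "\<And>Q R d. Q \<sqsubseteq> R \<Longrightarrow> lev Q = lev R - int d \<Longrightarrow> real d * v Q \<le> Dv * v R"
    and mb: "maximal_bound p u A F \<Q>" "maximal_bound q' v B H \<Q>" and FH: "0 < F" "0 < H"
    and \<theta>: "1 < \<theta>" "\<theta> * \<beta> \<le> \<beta> + 1 / p" "\<theta> * \<gamma> \<le> \<gamma> + 1 / q'"
    and cls: "\<And>Q. Q \<in> \<Q> \<Longrightarrow> \<kappa> / 2 \<le> vol Q powr (- \<beta> - \<gamma>) * u Q powr \<beta> * v Q powr \<gamma>"
      "\<And>Q. Q \<in> \<Q> \<Longrightarrow> vol Q powr (- \<beta> - \<gamma>) * u Q powr \<beta> * v Q powr \<gamma> \<le> \<kappa>" and \<kappa>: "0 < \<kappa>"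
  shows "(\<Sum>Q\<in>\<Q>. (vol Q powr (- \<beta> - \<gamma>) * u Q powr (\<beta> + 1 / p) * v Q powr (\<gamma> + 1 / q')) * A Q * B Q) \<le>
     \<kappa> * (4 * 2 powr \<theta> / (1 - \<zeta> powr - (min (1 / p - 1 / q) ((\<theta> - 1) * (\<beta> + \<gamma>))))) *
     ((3 * Du / (1 - 2 powr (1 - q / p))) powr (1 / q) + (3 * Dv / (1 - 2 powr (1 - p' / q'))) powr (1 / p')) * (F * H)"
proof -
  define c where "c Q = vol Q powr (- \<beta> - \<gamma>) * u Q powr (\<beta> + 1 / p) * v Q powr (\<gamma> + 1 / q')" for Q
  define \<rho> where "\<rho> Q = vol Q powr (- \<beta> - \<gamma>) * u Q powr \<beta> * v Q powr \<gamma>" for Q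
  define cG where "cG = 1 / (1 - \<zeta> powr - (min (1 / p - 1 / q) ((\<theta> - 1) * (\<beta> + \<gamma>))))"
  have pos: "0 < u Q" "0 < v Q" "0 < vol Q" for Q using uv supadd_pos by auto
  have \<eta>: "0 < 1 / p - 1 / q" using e by (simp add: frac_less2)
  have "0 < min (1 / p - 1 / q) ((\<theta> - 1) * (\<beta> + \<gamma>))" using \<eta> \<theta> e by simp
  then have cG: "0 < cG" using vol(2) unfolding cG_def by (simp add: powr_less_one)
  define i j where "i = ilev \<Q> A" and "j = ilev \<Q> B"
  define w where "w R = u R powr (1 / p) * v R powr (1 / q')" for R
  have cw: "c Q = \<rho> Q * w Q" for Q by (simp add: c_def \<rho>_def w_def powr_add)
  define b where "b Q = u Q powr (\<beta> + 1 / p - \<theta> * \<beta>) * v Q powr (\<gamma> + 1 / q' - \<theta> * \<gamma>) * vol Q powr ((\<theta> - 1) * (\<beta> + \<gamma>))" for Q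
  have cb: "c Q = \<rho> Q powr \<theta> * b Q" for Q
  proof -
    have "\<rho> Q powr \<theta> * b Q = (vol Q powr ((- \<beta> - \<gamma>) * \<theta>) * vol Q powr ((\<theta> - 1) * (\<beta> + \<gamma>))) *
       (u Q powr (\<beta> * \<theta>) * u Q powr (\<beta> + 1 / p - \<theta> * \<beta>)) * (v Q powr (\<gamma> * \<theta>) * v Q powr (\<gamma> + 1 / q' - \<theta> * \<gamma>))"
      using pos[of Q] by (simp add: \<rho>_def b_def powr_mult powr_powr mult_ac)
    also have "\<dots> = c Q"
      unfolding powr_add[symmetric] c_def by (simp add: algebra_simps)
    finally show ?thesis by simp
  qed
  have below: "(\<Sum>Q\<in>{Q\<in>\<Q>. Q \<sqsubseteq> R}. c Q) \<le> cG * 2 powr \<theta> * \<kappa> * w R" if R: "R \<in> \<Q>" for R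
  proof -
    have "(\<Sum>Q\<in>{Q\<in>\<Q>. Q \<sqsubseteq> R}. c Q) \<le> (\<Sum>Q\<in>{Q\<in>\<Q>. Q \<sqsubseteq> R}. \<kappa> powr \<theta> * b Q)"
    proof (rule sum_mono)
      fix Q assume "Q \<in> {Q\<in>\<Q>. Q \<sqsubseteq> R}"
      then show "c Q \<le> \<kappa> powr \<theta> * b Q"
        unfolding cb using cls(2)[of Q] \<theta> pos[of Q]
        by (intro mult_right_mono powr_mono2) (auto simp: \<rho>_def b_def)
    qed
    also have "\<dots> = \<kappa> powr \<theta> * (\<Sum>Q\<in>{Q\<in>\<Q>. Q \<sqsubseteq> R}. b Q)" by (rule sum_distrib_left[symmetric])
    also have "\<dots> \<le> \<kappa> powr \<theta> * (b R * cG)"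
      unfolding b_def cG_def
    proof (intro mult_left_mono sum_below_powr[OF uv vol fin])
      have "\<beta> + 1 / p - \<theta> * \<beta> + (\<gamma> + 1 / q' - \<theta> * \<gamma>) + (\<theta> - 1) * (\<beta> + \<gamma>) = 1 / p + 1 / q'"
        by (simp add: algebra_simps)
      then show "1 + (1 / p - 1 / q) \<le> \<beta> + 1 / p - \<theta> * \<beta> + (\<gamma> + 1 / q' - \<theta> * \<gamma>) + (\<theta> - 1) * (\<beta> + \<gamma>)"
        using e by simp
    qed (use \<theta> e \<eta> in auto)
    also have "\<kappa> powr \<theta> \<le> (2 * \<rho> R) powr \<theta>"
      using cls(1)[OF R] \<kappa> \<theta> by (intro powr_mono2) (auto simp: \<rho>_def)
    then have "\<kappa> powr \<theta> * (b R * cG) \<le> (2 * \<rho> R) powr \<theta> * (b R * cG)"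
      using cG by (intro mult_right_mono) (auto simp: b_def)
    also have "\<dots> = cG * 2 powr \<theta> * c R"
      using pos[of R] by (simp add: cb powr_mult \<rho>_def)
    also have "\<dots> \<le> cG * 2 powr \<theta> * (\<kappa> * w R)"
      unfolding cw using cG cls(2)[OF R] by (intro mult_left_mono mult_right_mono) (auto simp: \<rho>_def w_def)
    finally show ?thesis by (simp add: mult_ac)
  qed
  define Tops where "Tops = {R\<in>\<Q>. \<forall>R'\<in>\<Q>. R \<sqsubseteq> R' \<longrightarrow> i R' = i R \<longrightarrow> j R' = j R \<longrightarrow> R' = R}"
  have fT: "finite Tops" using fin by (simp add: Tops_def)
  have "\<forall>Q. \<exists>P. Q \<in> \<Q> \<longrightarrow> P \<in> Tops \<and> Q \<sqsubseteq> P \<and> i P = i Q \<and> j P = j Q"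
  proof (intro allI)
    fix Q
    show "\<exists>P. Q \<in> \<Q> \<longrightarrow> P \<in> Tops \<and> Q \<sqsubseteq> P \<and> i P = i Q \<and> j P = j Q"
    proof (cases "Q \<in> \<Q>")
      case True
      let ?X = "{R \<in> \<Q>. Q \<sqsubseteq> R \<and> i R = i Q \<and> j R = j Q}"
      obtain P where P: "P \<in> ?X" "\<And>R. R \<in> ?X \<Longrightarrow> P \<sqsubseteq> R \<Longrightarrow> R = P"
      proof (rule ex_max_lev[of ?X])
        show "?X \<noteq> {}" using True refl by blast
      qed (use fin in auto)
      then have "P \<in> Tops" using trans unfolding Tops_def by auto
      then show ?thesis using P(1) by blast
    qed blast
  qed
  from choice[OF this] obtain \<pi> where \<pi>: "\<And>Q. Q \<in> \<Q> \<Longrightarrow> \<pi> Q \<in> Tops"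
    "\<And>Q. Q \<in> \<Q> \<Longrightarrow> Q \<sqsubseteq> \<pi> Q" "\<And>Q. Q \<in> \<Q> \<Longrightarrow> i (\<pi> Q) = i Q" "\<And>Q. Q \<in> \<Q> \<Longrightarrow> j (\<pi> Q) = j Q" by blast
  have Tops: "Tops \<subseteq> jumps \<Q> A \<union> jumps \<Q> B"
  proof
    fix R assume R: "R \<in> Tops"
    then have RQ: "R \<in> \<Q>" by (simp add: Tops_def)
    show "R \<in> jumps \<Q> A \<union> jumps \<Q> B"
    proof (rule ccontr)
      assume "R \<notin> jumps \<Q> A \<union> jumps \<Q> B"
      then obtain R1 R2 where 1: "R1 \<in> \<Q>" "R \<sqsubseteq> R1" "i R1 = i R" "R1 \<noteq> R"
        and 2: "R2 \<in> \<Q>" "R \<sqsubseteq> R2" "j R2 = j R" "R2 \<noteq> R"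
        using RQ unfolding jumps_def i_def j_def by blast
      from tree[OF 1(2) 2(2)] show False
      proof
        assume le: "R1 \<sqsubseteq> R2"
        have "j R2 \<le> j R1" "j R1 \<le> j R"
          unfolding j_def using ilev_mono[of \<Q> B, OF fin posB] 1 2 RQ le by blast+
        then have "j R1 = j R" using 2 by simp
        then show False using R 1 by (auto simp: Tops_def)
      next
        assume le: "R2 \<sqsubseteq> R1"
        have "i R1 \<le> i R2" "i R2 \<le> i R"
          unfolding i_def using ilev_mono[of \<Q> A, OF fin posA] 1 2 RQ le by blast+
        then have "i R2 = i R" using 1 by simp
        then show False using R 2 by (auto simp: Tops_def)
      qed
    qed
  qed
  have "(\<Sum>Q\<in>\<Q>. c Q * A Q * B Q) \<le> (\<Sum>Q\<in>\<Q>. c Q * (4 * (2 powr i Q * 2 powr j Q)))"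
  proof (rule sum_mono)
    fix Q assume Q: "Q \<in> \<Q>"
    have "A Q * B Q \<le> (2 * 2 powr i Q) * (2 * 2 powr j Q)"
      unfolding i_def j_def using posB[OF Q]
      by (intro mult_mono A_le_ilev[OF fin posA Q] A_le_ilev[OF fin posB Q]) auto
    then have "c Q * (A Q * B Q) \<le> c Q * ((2 * 2 powr i Q) * (2 * 2 powr j Q))"
      by (intro mult_left_mono) (auto simp: c_def)
    then show "c Q * A Q * B Q \<le> c Q * (4 * (2 powr i Q * 2 powr j Q))" by (simp add: mult_ac)
  qed
  also have "\<dots> = (\<Sum>P\<in>Tops. \<Sum>Q\<in>{Q\<in>\<Q>. \<pi> Q = P}. c Q * (4 * (2 powr i Q * 2 powr j Q)))"
    using \<pi>(1) by (intro sum.group[symmetric] fin fT) auto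
  also have "\<dots> \<le> (\<Sum>P\<in>Tops. cG * 2 powr \<theta> * \<kappa> * w P * (4 * (2 powr i P * 2 powr j P)))"
  proof (rule sum_mono)
    fix P assume P: "P \<in> Tops"
    have "(\<Sum>Q\<in>{Q\<in>\<Q>. \<pi> Q = P}. c Q * (4 * (2 powr i Q * 2 powr j Q))) =
      (\<Sum>Q\<in>{Q\<in>\<Q>. \<pi> Q = P}. c Q) * (4 * (2 powr i P * 2 powr j P))"
      unfolding sum_distrib_right using \<pi>(3,4) by (intro sum.cong HOL.refl) auto
    also have "(\<Sum>Q\<in>{Q\<in>\<Q>. \<pi> Q = P}. c Q) \<le> (\<Sum>Q\<in>{Q\<in>\<Q>. Q \<sqsubseteq> P}. c Q)"
      using fin \<pi>(2) by (intro sum_mono2) (auto simp: c_def)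
    also have "\<dots> \<le> cG * 2 powr \<theta> * \<kappa> * w P" using P by (intro below) (simp add: Tops_def)
    finally show "(\<Sum>Q\<in>{Q\<in>\<Q>. \<pi> Q = P}. c Q * (4 * (2 powr i Q * 2 powr j Q))) \<le>
       cG * 2 powr \<theta> * \<kappa> * w P * (4 * (2 powr i P * 2 powr j P))"
      by (simp add: mult_right_mono)
  qed
  also have "\<dots> = cG * 2 powr \<theta> * \<kappa> * 4 * (\<Sum>P\<in>Tops. w P * (2 powr i P * 2 powr j P))"
    by (simp add: sum_distrib_left mult_ac)
  also have "(\<Sum>P\<in>Tops. w P * (2 powr i P * 2 powr j P)) \<le>
      (\<Sum>P\<in>jumps \<Q> A \<union> jumps \<Q> B. w P * (2 powr i P * 2 powr j P))"
    using Tops fin by (intro sum_mono2) (auto simp: w_def jumps_def)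
  also have "\<dots> \<le> (\<Sum>P\<in>jumps \<Q> A. w P * (2 powr i P * 2 powr j P)) + (\<Sum>P\<in>jumps \<Q> B. w P * (2 powr i P * 2 powr j P))"
  proof -
    have f: "finite (jumps \<Q> A)" "finite (jumps \<Q> B)" using fin by (auto simp: jumps_def)
    have "0 \<le> (\<Sum>P\<in>jumps \<Q> A \<inter> jumps \<Q> B. w P * (2 powr i P * 2 powr j P))"
      by (intro sum_nonneg) (simp add: w_def)
    then show ?thesis
      using sum.union_inter[OF f, of "\<lambda>P. w P * (2 powr i P * 2 powr j P)"] by linarith
  qed
  also have "\<dots> \<le> (3 * Dv / (1 - 2 powr (1 - p' / q'))) powr (1 / p') * H * F +
     (3 * Du / (1 - 2 powr (1 - q / p))) powr (1 / q) * F * H"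
  proof (rule add_mono)
    have qp: "q' < p'"
    proof -
      have "1 / p' < 1 / q'" using e(5,6) \<eta> by linarith
      then show ?thesis using e(3,4) by (simp add: field_simps)
    qed
    have e6: "1 / p' + 1 / p = 1" using e(6) by simp
    show "(\<Sum>P\<in>jumps \<Q> B. w P * (2 powr i P * 2 powr j P)) \<le>
      (3 * Du / (1 - 2 powr (1 - q / p))) powr (1 / q) * F * H"
      using jumps_sum_le[where A = A and B = B, OF fin posA posB uv(1,2) e(1-3,5) Du mb FH]
      unfolding i_def j_def w_def by (simp only: mult_ac)
    show "(\<Sum>P\<in>jumps \<Q> A. w P * (2 powr i P * 2 powr j P)) \<le>
      (3 * Dv / (1 - 2 powr (1 - p' / q'))) powr (1 / p') * H * F"
      using jumps_sum_le[where A = B and B = A, OF fin posB posA uv(2,1) e(3) qp e(1) e6 Dv mb(2,1) FH(2,1)]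
      unfolding i_def j_def w_def by (simp only: mult_ac)
  qed
  finally have "(\<Sum>Q\<in>\<Q>. c Q * A Q * B Q) \<le> cG * 2 powr \<theta> * \<kappa> * 4 * ((3 * Dv / (1 - 2 powr (1 - p' / q'))) powr (1 / p') * H * F +
     (3 * Du / (1 - 2 powr (1 - q / p))) powr (1 / q) * F * H)"
    using cG \<kappa> by (simp add: mult_left_mono)
  also have "\<dots> = \<kappa> * (4 * 2 powr \<theta> * cG) *
     ((3 * Du / (1 - 2 powr (1 - q / p))) powr (1 / q) + (3 * Dv / (1 - 2 powr (1 - p' / q'))) powr (1 / p')) * (F * H)"
    by (simp only: distrib_left distrib_right mult_ac add.commute)
  finally show ?thesis unfolding c_def cG_def by simp
qed

end

context cell_tree
begin

definition tree_const :: "real \<Rightarrow> real \<Rightarrow> real \<Rightarrow> real \<Rightarrow> real \<Rightarrow> real \<Rightarrow> real" where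
  "tree_const \<zeta> \<theta> \<beta> \<gamma> p q =
     8 * 2 powr \<theta> / (1 - \<zeta> powr - (min (1 / p - 1 / q) ((\<theta> - 1) * (\<beta> + \<gamma>)))) *
     ((3 / (1 - 2 powr (1 - q / p))) powr (1 / q) + (3 / (1 - 2 powr (1 - (1 / (1 - 1 / p)) / (1 / (1 - 1 / q))))) powr (1 - 1 / p))"

theorem tree_form_bound:
  assumes fin: "finite \<Q>" and posA: "\<And>Q. Q \<in> \<Q> \<Longrightarrow> 0 < A Q" and posB: "\<And>Q. Q \<in> \<Q> \<Longrightarrow> 0 < B Q"
    and uv: "supadd u" "supadd v" "supadd vol" and vol: "\<And>Q. vol Q = \<zeta> powr lev Q" "1 < \<zeta>"
    and e: "1 < p" "p < q" "0 < \<beta>" "0 < \<gamma>"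
    and Du: "1 \<le> Du" "\<And>Q R d. Q \<sqsubseteq> R \<Longrightarrow> lev Q = lev R - int d \<Longrightarrow> real d * u Q \<le> Du * u R"
    and Dv: "1 \<le> Dv" "\<And>Q R d. Q \<sqsubseteq> R \<Longrightarrow> lev Q = lev R - int d \<Longrightarrow> real d * v Q \<le> Dv * v R"
    and mb: "maximal_bound p u A F \<Q>" "maximal_bound (1 / (1 - 1 / q)) v B H \<Q>" and FH: "0 < F" "0 < H"
    and \<theta>: "1 < \<theta>" "\<theta> * \<beta> \<le> \<beta> + 1 / p" "\<theta> * \<gamma> \<le> \<gamma> + (1 - 1 / q)"
    and K: "\<And>Q. Q \<in> \<Q> \<Longrightarrow> vol Q powr (- \<beta> - \<gamma>) * u Q powr \<beta> * v Q powr \<gamma> \<le> K"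
    and K0: "0 < K"
  shows "(\<Sum>Q\<in>\<Q>. (vol Q powr (- \<beta> - \<gamma>) * u Q powr (\<beta> + 1 / p) * v Q powr (\<gamma> + (1 - 1 / q))) * A Q * B Q) \<le>
     tree_const \<zeta> \<theta> \<beta> \<gamma> p q * K * (Du powr (1 / q) + Dv powr (1 - 1 / p)) * (F * H)"
proof -
  define p' q' where "p' = 1 / (1 - 1 / p)" and "q' = 1 / (1 - 1 / q)"
  have p1: "1 / p < 1" "1 / q < 1" using e by auto
  have pq': "0 < p'" "0 < q'" "1 / q + 1 / q' = 1" "1 / p + 1 / p' = 1"
    using p1 by (simp_all add: p'_def q'_def)
  have inv: "1 / q' = 1 - 1 / q" "1 / p' = 1 - 1 / p" using pq' by linarith+
  have e0: "0 < p" using e by simp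
  have \<eta>: "0 < 1 / p - 1 / q" using e by (simp add: frac_less2)
  have qp: "q' < p'"
  proof -
    have "1 / p' < 1 / q'" using inv \<eta> by linarith
    then show ?thesis using pq'(1,2) by (simp add: field_simps)
  qed
  define \<rho> where "\<rho> Q = vol Q powr (- \<beta> - \<gamma>) * u Q powr \<beta> * v Q powr \<gamma>" for Q
  have \<rho>: "0 < \<rho> Q" for Q using uv[THEN supadd_pos, of Q] by (simp add: \<rho>_def)
  define m where "m Q = nat \<lfloor>log 2 (K / \<rho> Q)\<rfloor>" for Q
  have m: "K / 2 ^ m Q / 2 \<le> \<rho> Q \<and> \<rho> Q \<le> K / 2 ^ m Q" if Q: "Q \<in> \<Q>" for Q
  proof -
    have 1: "1 \<le> K / \<rho> Q" using K[OF Q] \<rho>[of Q] by (simp add: \<rho>_def)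
    then have 0: "0 \<le> log 2 (K / \<rho> Q)" by simp
    have pw: "2 powr (log 2 (K / \<rho> Q)) = K / \<rho> Q" using 1 by (intro powr_log_cancel) auto
    have "2 powr (real (m Q)) \<le> 2 powr (log 2 (K / \<rho> Q))"
      unfolding m_def using 0 by (intro powr_mono) auto
    moreover have "2 powr (log 2 (K / \<rho> Q)) \<le> 2 powr (1 + real (m Q))"
      unfolding m_def using 0 by (intro powr_mono) linarith+
    ultimately have "2 powr (real (m Q)) \<le> K / \<rho> Q" "K / \<rho> Q \<le> 2 powr (1 + real (m Q))"
      by (simp_all only: pw)
    then have "2 ^ m Q \<le> K / \<rho> Q" "K / \<rho> Q \<le> 2 * 2 ^ m Q"
      by (simp_all add: powr_add powr_realpow)
    then show ?thesis using \<rho>[of Q] by (simp add: field_simps)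
  qed
  define X where "X = (4 * 2 powr \<theta> / (1 - \<zeta> powr - (min (1 / p - 1 / q) ((\<theta> - 1) * (\<beta> + \<gamma>))))) *
     ((3 * Du / (1 - 2 powr (1 - q / p))) powr (1 / q) + (3 * Dv / (1 - 2 powr (1 - p' / q'))) powr (1 / p')) * (F * H)"
  let ?c = "\<lambda>Q. (vol Q powr (- \<beta> - \<gamma>) * u Q powr (\<beta> + 1 / p) * v Q powr (\<gamma> + 1 / q')) * A Q * B Q"
  define M where "M = Suc (Max (insert 0 (m ` \<Q>)))"
  have cls: "(\<Sum>Q\<in>{Q\<in>\<Q>. m Q = k}. ?c Q) \<le> K / 2 ^ k * X" for k
    unfolding X_def mult.assoc[symmetric, of "K / 2 ^ k"]
  proof (rule class_bound[where A = A and B = B, OF _ _ _ uv vol])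
    show "maximal_bound p u A F {Q\<in>\<Q>. m Q = k}" by (rule maximal_bound_subset[OF mb(1)]) auto
    show "maximal_bound q' v B H {Q\<in>\<Q>. m Q = k}" by (rule maximal_bound_subset[OF mb(2)[folded q'_def]]) auto
    show "\<theta> * \<gamma> \<le> \<gamma> + 1 / q'" using \<theta>(3) inv by simp
    show "K / 2 ^ k / 2 \<le> vol Q powr (- \<beta> - \<gamma>) * u Q powr \<beta> * v Q powr \<gamma>" if "Q \<in> {Q\<in>\<Q>. m Q = k}" for Q
      using m[of Q] that by (auto simp: \<rho>_def)
    show "vol Q powr (- \<beta> - \<gamma>) * u Q powr \<beta> * v Q powr \<gamma> \<le> K / 2 ^ k" if "Q \<in> {Q\<in>\<Q>. m Q = k}" for Q
      using m[of Q] that by (auto simp: \<rho>_def)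
  qed (use fin posA posB e e0 pq' Du Dv FH \<theta> K0 in auto)
  have y: "\<zeta> powr - (min (1 / p - 1 / q) ((\<theta> - 1) * (\<beta> + \<gamma>))) < 1"
    using vol(2) \<eta> \<theta> e by (intro powr_less_one) auto
  have X0: "0 \<le> X"
    unfolding X_def using y FH by (intro mult_nonneg_nonneg divide_nonneg_nonneg add_nonneg_nonneg) auto
  have "(\<Sum>Q\<in>\<Q>. ?c Q) = (\<Sum>k<M. \<Sum>Q\<in>{Q\<in>\<Q>. m Q = k}. ?c Q)"
    unfolding M_def using fin by (intro sum.group[symmetric]) (auto simp: le_imp_less_Suc)
  also have "\<dots> \<le> (\<Sum>k<M. K / 2 ^ k * X)" by (rule sum_mono) (rule cls)
  also have "\<dots> = K * X * (\<Sum>k<M. (1 / 2) ^ k)"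
    unfolding sum_distrib_left by (intro sum.cong HOL.refl) (simp add: power_one_over)
  also have "\<dots> \<le> K * X * (1 / (1 - 1 / 2))"
    using K0 X0 by (intro mult_left_mono geometric_le) auto
  finally have sum_le: "(\<Sum>Q\<in>\<Q>. ?c Q) \<le> 2 * K * X" by simp
  define c1 c2 where "c1 = (3 / (1 - 2 powr (1 - q / p))) powr (1 / q)" and "c2 = (3 / (1 - 2 powr (1 - p' / q'))) powr (1 - 1 / p)"
  have "2 powr (1 - q / p) < (1::real)" "2 powr (1 - p' / q') < (1::real)"
    using e e0 qp pq' by (auto intro!: powr_less_one)
  then have c: "0 < c1" "0 < c2" by (auto simp: c1_def c2_def)
  define E where "E = 8 * 2 powr \<theta> / (1 - \<zeta> powr - (min (1 / p - 1 / q) ((\<theta> - 1) * (\<beta> + \<gamma>))))"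
  have E: "0 \<le> E" using y by (simp add: E_def)
  have d: "(3 * Du / (1 - 2 powr (1 - q / p))) powr (1 / q) = Du powr (1 / q) * c1"
    "(3 * Dv / (1 - 2 powr (1 - p' / q'))) powr (1 / p') = Dv powr (1 - 1 / p) * c2"
    unfolding c1_def c2_def inv(2)
    using powr_mult[of Du "3 / (1 - 2 powr (1 - q / p))" "1 / q"]
      powr_mult[of Dv "3 / (1 - 2 powr (1 - p' / q'))" "1 - 1 / p"] by (simp_all add: mult.commute)
  have t: "tree_const \<zeta> \<theta> \<beta> \<gamma> p q = E * (c1 + c2)"
    unfolding tree_const_def c1_def c2_def p'_def q'_def E_def ..
  have "2 * K * X = (E * K * (F * H)) * (Du powr (1 / q) * c1 + Dv powr (1 - 1 / p) * c2)"
    unfolding X_def d E_def by (simp add: mult_ac)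
  also have "\<dots> \<le> (E * K * (F * H)) * ((Du powr (1 / q) + Dv powr (1 - 1 / p)) * (c1 + c2))"
  proof (intro mult_left_mono mult_nonneg_nonneg)
    show "Du powr (1 / q) * c1 + Dv powr (1 - 1 / p) * c2 \<le> (Du powr (1 / q) + Dv powr (1 - 1 / p)) * (c1 + c2)"
      using c by (simp add: algebra_simps)
  qed (use E K0 FH in auto)
  also have "\<dots> = tree_const \<zeta> \<theta> \<beta> \<gamma> p q * K * (Du powr (1 / q) + Dv powr (1 - 1 / p)) * (F * H)"
    unfolding t by (simp only: mult_ac)
  finally have "2 * K * X \<le> tree_const \<zeta> \<theta> \<beta> \<gamma> p q * K * (Du powr (1 / q) + Dv powr (1 - 1 / p)) * (F * H)" .
  with sum_le show ?thesis unfolding inv by linarith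
qed

end

section \<open>Shifted triadic cells and weights\<close>

type_synonym 'n cell = "int \<times> (int^'n)"

definition cel :: "real^'n::finite \<Rightarrow> 'n cell \<Rightarrow> (real^'n) set" where
  "cel \<tau> Q = {x. \<forall>i. \<lfloor>x $ i / 3 powr real_of_int (fst Q) - \<tau> $ i\<rfloor> = snd Q $ i}"

definition cel_le :: "real^'n::finite \<Rightarrow> 'n cell \<Rightarrow> 'n cell \<Rightarrow> bool" where
  "cel_le \<tau> Q R \<longleftrightarrow> fst Q \<le> fst R \<and> cel \<tau> Q \<subseteq> cel \<tau> R"

definition cel_center :: "real^'n::finite \<Rightarrow> 'n cell \<Rightarrow> real^'n" where
  "cel_center \<tau> Q = (\<chi> i. 3 powr real_of_int (fst Q) * (of_int (snd Q $ i) + \<tau> $ i + 1 / 2))"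

abbreviation cel_cube :: "real^'n::finite \<Rightarrow> 'n cell \<Rightarrow> (real^'n) set" where
  "cel_cube \<tau> Q \<equiv> cube (cel_center \<tau> Q) (3 powr real_of_int (fst Q))"

lemma ennreal_divide_mult_cancel: "0 < c \<Longrightarrow> x / ennreal c * ennreal c = x"
  unfolding ennreal_divide_times by (simp add: divide_ennreal less_imp_le)

lemma mem_cel:
  "x \<in> cel \<tau> Q \<longleftrightarrow> (\<forall>i. 3 powr real_of_int (fst Q) * (of_int (snd Q $ i) + \<tau> $ i) \<le> x $ i \<and>
     x $ i < 3 powr real_of_int (fst Q) * (of_int (snd Q $ i) + \<tau> $ i + 1))"
proof -
  have "\<lfloor>y / s - t\<rfloor> = m \<longleftrightarrow> s * (of_int m + t) \<le> y \<and> y < s * (of_int m + t + 1)"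
    if "0 < s" for y s t :: real and m :: int
  proof -
    have "\<lfloor>y / s - t\<rfloor> = m \<longleftrightarrow> of_int m \<le> y / s - t \<and> y / s - t < of_int m + 1"
      by (rule floor_eq_iff)
    also have "\<dots> \<longleftrightarrow> of_int m + t \<le> y / s \<and> y / s < of_int m + t + 1" by linarith
    finally show ?thesis using that by (simp add: pos_le_divide_eq pos_divide_less_eq mult.commute)
  qed
  then show ?thesis by (simp add: cel_def)
qed

lemma mem_cube: "x \<in> cube c l \<longleftrightarrow> (\<forall>i. c $ i - l / 2 \<le> x $ i \<and> x $ i \<le> c $ i + l / 2)"
  by (simp add: cube_def mem_box_cart)

lemma cel_subset_cube: "cel \<tau> Q \<subseteq> cel_cube \<tau> Q"
  by (auto simp: mem_cel mem_cube cel_center_def algebra_simps less_imp_le)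

lemma cel_Borel [measurable]: "cel \<tau> Q \<in> sets borel"
proof -
  have "cel \<tau> Q = (\<Inter>i. {x. 3 powr real_of_int (fst Q) * (of_int (snd Q $ i) + \<tau> $ i) \<le> x $ i} \<inter>
     {x. x $ i < 3 powr real_of_int (fst Q) * (of_int (snd Q $ i) + \<tau> $ i + 1)})"
    by (auto simp: mem_cel)
  also have "\<dots> \<in> sets borel"
    by (intro sets.countable_INT'' borel_closed borel_open sets.Int closed_halfspace_component_ge_cart
        open_halfspace_component_lt_cart closed_halfspace_component_le_cart) auto
  finally show ?thesis .
qed

lemma cel_lebesgue [measurable]: "cel \<tau> Q \<in> sets lebesgue"
  using cel_Borel by (simp add: sets_completionI_sets)

lemma cube_lebesgue [measurable]: "cube c l \<in> sets lebesgue"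
  by (simp add: cube_def)

lemma cel_cube_null: "cel_cube \<tau> Q - cel \<tau> Q \<in> null_sets lebesgue"
proof -
  let ?a = "cel_center \<tau> Q - (\<chi> i. 3 powr real_of_int (fst Q) / 2)" and ?b = "cel_center \<tau> Q + (\<chi> i. 3 powr real_of_int (fst Q) / 2)"
  have "box ?a ?b \<subseteq> cel \<tau> Q"
    by (auto simp: mem_box_cart mem_cel cel_center_def algebra_simps less_imp_le)
  then have "cel_cube \<tau> Q - cel \<tau> Q \<subseteq> cbox ?a ?b - box ?a ?b"
    by (auto simp: cube_def)
  then show ?thesis
    using negligible_frontier_interval negligible_subset negligible_iff_null_sets by blast
qed

lemma emeasure_cube: "0 \<le> l \<Longrightarrow> emeasure lebesgue (cube (c::real^'n::finite) l) = ennreal (l ^ CARD('n))"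
proof -
  assume l: "0 \<le> l"
  have "emeasure lborel (cbox (c - (\<chi> i. l / 2)) (c + (\<chi> i. l / 2))) =
    ennreal (\<Prod>b\<in>Basis. ((c + (\<chi> i. l / 2)) - (c - (\<chi> i. l / 2))) \<bullet> b)"
    using l by (intro emeasure_lborel_cbox) (auto simp: Basis_vec_def inner_axis algebra_simps)
  also have "(\<Prod>b\<in>Basis. ((c + (\<chi> i. l / 2)) - (c - (\<chi> i. l / 2))) \<bullet> b) = (\<Prod>b\<in>(Basis :: (real^'n) set). l)"
    by (intro prod.cong HOL.refl) (auto simp: Basis_vec_def inner_axis)
  also have "\<dots> = l ^ CARD('n)" by simp
  finally show ?thesis by (simp add: cube_def)
qed

lemma AE_cel_cube: "AE x in lebesgue. x \<in> cel_cube \<tau> Q \<longleftrightarrow> x \<in> cel \<tau> Q"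
proof -
  have "AE x in lebesgue. x \<notin> cel_cube \<tau> Q - cel \<tau> Q"
    by (rule AE_not_in[OF cel_cube_null])
  then show ?thesis using cel_subset_cube[of \<tau> Q] by (auto elim!: eventually_mono)
qed

lemma emeasure_cel: "emeasure lebesgue (cel \<tau> (Q :: 'n::finite cell)) = ennreal ((3 powr real_of_int (fst Q)) ^ CARD('n))"
proof -
  have "emeasure lebesgue (cel \<tau> Q) = emeasure lebesgue (cel_cube \<tau> Q)"
    using AE_cel_cube[of \<tau> Q] by (intro emeasure_eq_AE) (auto elim: eventually_mono)
  also have "\<dots> = ennreal ((3 powr real_of_int (fst Q)) ^ CARD('n))"
    by (rule emeasure_cube) simp
  finally show ?thesis .
qed

lemma nn_integral_cel_cube:
  "(\<integral>\<^sup>+x\<in>cel_cube \<tau> Q. g x \<partial>lebesgue) = (\<integral>\<^sup>+x\<in>cel \<tau> Q. g x \<partial>lebesgue)"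
  using AE_cel_cube[of \<tau> Q] by (intro nn_integral_cong_AE) (auto elim!: eventually_mono simp: indicator_def)

lemma cel_nonempty: "cel \<tau> Q \<noteq> {}"
proof -
  have "(\<chi> i. 3 powr real_of_int (fst Q) * (of_int (snd Q $ i) + \<tau> $ i)) \<in> cel \<tau> Q"
    by (simp add: mem_cel)
  then show ?thesis by blast
qed

lemma cel_unique: "x \<in> cel \<tau> Q \<Longrightarrow> x \<in> cel \<tau> R \<Longrightarrow> fst Q = fst R \<Longrightarrow> Q = R"
  by (auto simp: cel_def prod_eq_iff vec_eq_iff)

definition cel_at :: "real^'n::finite \<Rightarrow> int \<Rightarrow> real^'n \<Rightarrow> 'n cell" where
  "cel_at \<tau> k x = (k, \<chi> i. \<lfloor>x $ i / 3 powr k - \<tau> $ i\<rfloor>)"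

lemma mem_cel_at: "x \<in> cel \<tau> (cel_at \<tau> k x)"
  by (simp add: cel_def cel_at_def)

lemma fst_cel_at [simp]: "fst (cel_at \<tau> k x) = k"
  by (simp add: cel_at_def)

definition half_shift :: "real^'n::finite \<Rightarrow> bool" where
  "half_shift \<tau> \<longleftrightarrow> (\<forall>i. \<tau> $ i = 0 \<or> \<tau> $ i = 1 / 2)"

text \<open>Passing from scale $3^k$ to $3^{k+1}$ changes the shift by $2\tau_i\in\{0,1\}$ cells, an integer;
  hence the shifted triadic grids are nested.\<close>

lemma cel_parent:
  assumes "half_shift \<tau>" "x \<in> cel \<tau> Q" "y \<in> cel \<tau> Q"
  shows "y \<in> cel \<tau> (cel_at \<tau> (fst Q + int d) x)"
proof (induction d)
  case 0
  have "cel_at \<tau> (fst Q) x = Q" using cel_unique[OF mem_cel_at assms(2)] by simp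
  then show ?case using assms(3) by simp
next
  case (Suc d)
  define k where "k = fst Q + int d"
  have "\<lfloor>y $ i / 3 powr (k + 1) - \<tau> $ i\<rfloor> = \<lfloor>x $ i / 3 powr (k + 1) - \<tau> $ i\<rfloor>" for i
  proof -
    obtain e :: int where e: "2 * \<tau> $ i = of_int e"
    proof -
      have "2 * \<tau> $ i = of_int 0 \<or> 2 * \<tau> $ i = of_int 1"
        using assms(1) by (auto simp: half_shift_def)
      then show thesis using that by blast
    qed
    have "\<lfloor>z / 3 powr (k + 1) - \<tau> $ i\<rfloor> = (\<lfloor>z / 3 powr k - \<tau> $ i\<rfloor> - e) div 3" for z
    proof -
      have "z / 3 powr (k + 1) - \<tau> $ i = ((z / 3 powr k - \<tau> $ i) - of_int e) / of_int 3"
        unfolding e[symmetric] by (simp add: powr_add field_simps)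
      then have "\<lfloor>z / 3 powr (k + 1) - \<tau> $ i\<rfloor> = \<lfloor>(z / 3 powr k - \<tau> $ i) - of_int e\<rfloor> div 3"
        by (simp only: floor_divide_real_eq_div[OF zero_le_numeral])
      then show ?thesis by simp
    qed
    moreover have "\<lfloor>y $ i / 3 powr k - \<tau> $ i\<rfloor> = \<lfloor>x $ i / 3 powr k - \<tau> $ i\<rfloor>"
      using Suc by (simp add: cel_def cel_at_def k_def)
    ultimately show ?thesis by simp
  qed
  then show ?case by (simp add: cel_def cel_at_def k_def add.commute add.left_commute)
qed

lemma cel_nested:
  assumes "half_shift \<tau>" "x \<in> cel \<tau> Q" "x \<in> cel \<tau> R" "fst Q \<le> fst R"
  shows "cel \<tau> Q \<subseteq> cel \<tau> R"
proof
  fix y assume "y \<in> cel \<tau> Q"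
  then have "y \<in> cel \<tau> (cel_at \<tau> (fst Q + int (nat (fst R - fst Q))) x)"
    by (rule cel_parent[OF assms(1,2)])
  moreover have "cel_at \<tau> (fst R) x = R" using cel_unique[OF mem_cel_at assms(3)] by simp
  ultimately show "y \<in> cel \<tau> R" using assms(4) by simp
qed

lemma cell_tree_cel: assumes h: "half_shift \<tau>" shows "cell_tree (cel_le \<tau>) fst"
proof
  fix P Q R R' :: "'a cell" and l :: int
  show "cel_le \<tau> Q Q" by (simp add: cel_le_def)
  show "cel_le \<tau> P Q \<Longrightarrow> cel_le \<tau> Q R \<Longrightarrow> cel_le \<tau> P R" by (auto simp: cel_le_def)
  show "cel_le \<tau> Q R \<Longrightarrow> fst Q \<le> fst R" by (simp add: cel_le_def)
  show "Q = R" if "cel_le \<tau> Q R" "fst Q = fst R"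
    using that cel_nonempty[of \<tau> Q] cel_unique[of _ \<tau> Q R] by (auto simp: cel_le_def)
  show "cel_le \<tau> R R' \<or> cel_le \<tau> R' R" if "cel_le \<tau> Q R" "cel_le \<tau> Q R'"
  proof -
    obtain x where "x \<in> cel \<tau> Q" using cel_nonempty[of \<tau> Q] by blast
    then have "x \<in> cel \<tau> R" "x \<in> cel \<tau> R'" using that by (auto simp: cel_le_def)
    then show ?thesis using cel_nested[OF h] unfolding cel_le_def by (meson linear)
  qed
  show "\<exists>P. cel_le \<tau> Q P \<and> cel_le \<tau> P R \<and> fst P = l" if "cel_le \<tau> Q R" "fst Q \<le> l" "l \<le> fst R"
  proof -
    obtain x where x: "x \<in> cel \<tau> Q" using cel_nonempty[of \<tau> Q] by blast
    then have "x \<in> cel \<tau> R" using that by (auto simp: cel_le_def)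
    then have "cel_le \<tau> Q (cel_at \<tau> l x) \<and> cel_le \<tau> (cel_at \<tau> l x) R"
      using cel_nested[OF h x mem_cel_at] cel_nested[OF h mem_cel_at[of x \<tau> l]] that
      by (simp add: cel_le_def)
    then show ?thesis by (intro exI[of _ "cel_at \<tau> l x"]) simp
  qed
qed

lemma cel_disjoint:
  assumes h: "half_shift \<tau>" "\<not> cel_le \<tau> Q R" "\<not> cel_le \<tau> R Q" shows "cel \<tau> Q \<inter> cel \<tau> R = {}"
  using assms cel_nested[OF h(1)] unfolding cel_le_def by (meson disjoint_iff linear)

lemma nn_integral_cel_sum_le:
  assumes h: "half_shift \<tau>" and g: "g \<in> borel_measurable lebesgue" and A: "finite A"
    and ac: "\<And>Q R. Q \<in> A \<Longrightarrow> R \<in> A \<Longrightarrow> cel_le \<tau> Q R \<Longrightarrow> Q = R" and S: "\<And>Q. Q \<in> A \<Longrightarrow> cel \<tau> Q \<subseteq> S"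
  shows "(\<Sum>Q\<in>A. \<integral>\<^sup>+x\<in>cel \<tau> Q. g x \<partial>lebesgue) \<le> (\<integral>\<^sup>+x\<in>S. g x \<partial>lebesgue)"
proof -
  have "(\<Sum>Q\<in>A. \<integral>\<^sup>+x\<in>cel \<tau> Q. g x \<partial>lebesgue) = (\<integral>\<^sup>+x. (\<Sum>Q\<in>A. g x * indicator (cel \<tau> Q) x) \<partial>lebesgue)"
    by (intro nn_integral_sum[symmetric] borel_measurable_times_ennreal borel_measurable_indicator cel_lebesgue g)
  also have "\<dots> \<le> (\<integral>\<^sup>+x\<in>S. g x \<partial>lebesgue)"
  proof (rule nn_integral_mono)
    fix x
    show "(\<Sum>Q\<in>A. g x * indicator (cel \<tau> Q) x) \<le> g x * indicator S x"
    proof (cases "\<exists>Q\<in>A. x \<in> cel \<tau> Q")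
      case True
      then obtain Q where Q: "Q \<in> A" "x \<in> cel \<tau> Q" by blast
      have "(\<Sum>R\<in>A. g x * indicator (cel \<tau> R) x) = (\<Sum>R\<in>{Q}. g x * indicator (cel \<tau> R) x)"
      proof (rule sum.mono_neutral_right[OF A])
        show "\<forall>R\<in>A - {Q}. g x * indicator (cel \<tau> R) x = 0"
          using cel_disjoint[OF h] ac Q by (fastforce simp: indicator_def)
      qed (use Q in auto)
      then show ?thesis using Q S[OF Q(1)] by (auto simp: indicator_def)
    next
      case False
      then have "(\<Sum>Q\<in>A. g x * indicator (cel \<tau> Q) x) = 0" by (intro sum.neutral) (auto simp: indicator_def)
      then show ?thesis by simp
    qed
  qed
  finally show ?thesis .
qed

definition cw :: "real^'n::finite \<Rightarrow> (real^'n \<Rightarrow> real) \<Rightarrow> 'n cell \<Rightarrow> real" where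
  "cw \<tau> w Q = wmeasure w (cel_cube \<tau> Q)"

lemma weight_nn_cube:
  assumes "weight w" shows "(\<integral>\<^sup>+x\<in>cube c l. ennreal (w x) \<partial>lebesgue) = ennreal (wmeasure w (cube c l))"
proof -
  have "integrable lebesgue (\<lambda>x. indicator (cube c l) x * w x)"
    using assms by (simp add: weight_def set_integrable_def)
  then have "(\<integral>\<^sup>+x. ennreal (indicator (cube c l) x * w x) \<partial>lebesgue) = ennreal (wmeasure w (cube c l))"
    unfolding wmeasure_def set_lebesgue_integral_def
    using assms by (subst nn_integral_eq_integral) (auto simp: weight_def)
  moreover have "(\<integral>\<^sup>+x. ennreal (indicator (cube c l) x * w x) \<partial>lebesgue) = (\<integral>\<^sup>+x\<in>cube c l. ennreal (w x) \<partial>lebesgue)"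
    by (intro nn_integral_cong) (auto simp: indicator_def)
  ultimately show ?thesis by simp
qed

lemma cw_nn: "weight w \<Longrightarrow> (\<integral>\<^sup>+x\<in>cel \<tau> Q. ennreal (w x) \<partial>lebesgue) = ennreal (cw \<tau> w Q)"
  using weight_nn_cube[of w "cel_center \<tau> Q" "3 powr real_of_int (fst Q)"] by (simp add: nn_integral_cel_cube cw_def)

lemma cw_pos: assumes "weight w" shows "0 < cw \<tau> w Q"
proof (rule ccontr)
  assume "\<not> 0 < cw \<tau> w Q"
  then have "(\<integral>\<^sup>+x\<in>cel \<tau> Q. ennreal (w x) \<partial>lebesgue) = 0"
    using cw_nn[OF assms, of \<tau> Q] by (simp add: ennreal_neg)
  then have "AE x in lebesgue. ennreal (w x) * indicator (cel \<tau> Q) x = 0"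
    using assms by (subst (asm) nn_integral_0_iff_AE) (auto simp: weight_def)
  moreover have "AE x in lebesgue. 0 < w x" using assms by (simp add: weight_def)
  ultimately have "AE x in lebesgue. x \<notin> cel \<tau> Q"
    by eventually_elim (auto simp: indicator_def split: if_splits)
  then have "emeasure lebesgue (cel \<tau> Q) = 0"
    by (subst (asm) AE_iff_measurable[of "cel \<tau> Q"]) auto
  then show False by (simp add: emeasure_cel)
qed

lemma cw_supadd:
  assumes h: "half_shift \<tau>" and w: "weight w"
  shows "cell_tree.supadd (cel_le \<tau>) (cw \<tau> w)"
proof -
  interpret cell_tree "cel_le \<tau>" fst by (rule cell_tree_cel[OF h])
  show ?thesis
    unfolding supadd_def
  proof (intro conjI allI impI)
    show "0 < cw \<tau> w Q" for Q by (rule cw_pos[OF w])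
    fix A R assume A: "finite A" "antichain A" "\<forall>Q\<in>A. cel_le \<tau> Q R"
    have "ennreal (\<Sum>Q\<in>A. cw \<tau> w Q) = (\<Sum>Q\<in>A. \<integral>\<^sup>+x\<in>cel \<tau> Q. ennreal (w x) \<partial>lebesgue)"
      using cw_pos[OF w] by (simp add: cw_nn[OF w] less_imp_le)
    also have "\<dots> \<le> (\<integral>\<^sup>+x\<in>cel \<tau> R. ennreal (w x) \<partial>lebesgue)"
      using A w by (intro nn_integral_cel_sum_le[OF h]) (auto simp: antichain_def cel_le_def weight_def)
    also have "\<dots> = ennreal (cw \<tau> w R)" by (rule cw_nn[OF w])
    finally show "(\<Sum>Q\<in>A. cw \<tau> w Q) \<le> cw \<tau> w R"
      using cw_pos[OF w, of \<tau> R] by (simp add: ennreal_le_iff less_imp_le)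
  qed
qed

lemma weight_1: "weight (\<lambda>x::real^'n::finite. 1)"
proof -
  have "integrable lebesgue (indicat_real (cube c l))" for c :: "real^'n" and l
    using emeasure_bounded_finite[OF bounded_cbox, of "c - (\<chi> i. l / 2)" "c + (\<chi> i. l / 2)"]
    by (intro integrable_real_indicator) (simp_all add: cube_def)
  then show ?thesis by (simp add: weight_def set_integrable_def)
qed

lemma cw_1: "cw \<tau> (\<lambda>x. 1) (Q :: 'n::finite cell) = (3 ^ CARD('n)) powr real_of_int (fst Q)"
proof -
  have "ennreal (cw \<tau> (\<lambda>x. 1) Q) = emeasure lebesgue (cel \<tau> Q)"
    using cw_nn[OF weight_1, of \<tau> Q] by simp
  also have "\<dots> = ennreal ((3 powr real_of_int (fst Q)) ^ CARD('n))" by (rule emeasure_cel)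
  also have "(3 powr real_of_int (fst Q)) ^ CARD('n) = (3 ^ CARD('n)) powr real_of_int (fst Q)"
    by (simp add: powr_powr mult.commute flip: powr_realpow)
  finally show ?thesis
    using cw_pos[OF weight_1, of \<tau> Q] by (subst (asm) ennreal_inj) (auto simp: less_imp_le)
qed

lemma Ainf_chain:
  fixes w :: "real^'n::finite \<Rightarrow> real"
  assumes h: "half_shift \<tau>" and w: "weight w" and U: "Ainf_const w \<le> ennreal U" "0 \<le> U"
    and QR: "cel_le \<tau> Q R" "fst Q = fst R - int d"
  shows "real d * cw \<tau> w Q \<le> 3 / 2 * U * cw \<tau> w R"
proof -
  obtain x where x: "x \<in> cel \<tau> Q" using cel_nonempty by blast
  define P where "P k = cel_at \<tau> (fst R - int k) x" for k
  have "x \<in> cel \<tau> R" using x QR by (auto simp: cel_le_def)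
  then have PR: "P 0 = R" using cel_unique[OF mem_cel_at[of x \<tau> "fst R"]] by (simp add: P_def)
  have PQ: "P d = Q" using cel_unique[OF mem_cel_at[of x \<tau> "fst Q"] x] QR by (simp add: P_def)
  have Pnest: "cel_le \<tau> (P k') (P k)" if "k \<le> k'" for k k'
    unfolding cel_le_def
  proof
    show "fst (P k') \<le> fst (P k)" using that by (simp add: P_def)
    then show "cel \<tau> (P k') \<subseteq> cel \<tau> (P k)"
      unfolding P_def by (intro cel_nested[OF h mem_cel_at mem_cel_at])
  qed
  have wm: "w \<in> borel_measurable lebesgue" and w0: "\<And>x. 0 \<le> w x" using w by (auto simp: weight_def)
  let ?M = "HL_maximal (\<lambda>y. w y * indicator (cel_cube \<tau> R) y)"
  define v where "v k = (3 ^ CARD('n)) powr real_of_int (fst R - int k)" for k :: nat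
  have v: "0 < v k" for k by (simp add: v_def)
  have vol: "emeasure lebesgue (cel \<tau> (P k)) = ennreal (v k)" for k
    using cw_nn[OF weight_1, of \<tau> "P k"] by (simp add: cw_1 P_def v_def)
  have M: "ennreal (cw \<tau> w Q / v k) \<le> ?M y" if y: "y \<in> cel \<tau> (P k)" and k: "k \<le> d" for k y
  proof -
    have "ennreal (cw \<tau> w Q / v k) \<le> ennreal (cw \<tau> w (P k) / v k)"
      using cell_tree.supadd_mono[OF cell_tree_cel[OF h] cw_supadd[OF h w] Pnest[OF k]] v[of k]
      by (intro ennreal_leI divide_right_mono) (auto simp: PQ)
    also have "\<dots> = (\<integral>\<^sup>+y\<in>cel_cube \<tau> (P k). ennreal \<bar>w y * indicator (cel_cube \<tau> R) y\<bar> \<partial>lebesgue)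
        / emeasure lebesgue (cel_cube \<tau> (P k))"
    proof -
      have "(\<integral>\<^sup>+y\<in>cel_cube \<tau> (P k). ennreal \<bar>w y * indicator (cel_cube \<tau> R) y\<bar> \<partial>lebesgue) =
        (\<integral>\<^sup>+y\<in>cel \<tau> (P k). ennreal \<bar>w y * indicator (cel_cube \<tau> R) y\<bar> \<partial>lebesgue)"
        by (rule nn_integral_cel_cube)
      also have "\<dots> = (\<integral>\<^sup>+y\<in>cel \<tau> (P k). ennreal (w y) \<partial>lebesgue)"
      proof (intro nn_integral_cong)
        fix y
        have "cel \<tau> (P k) \<subseteq> cel_cube \<tau> R"
          using Pnest[of 0 k] cel_subset_cube[of \<tau> R] by (auto simp: PR cel_le_def)
        then show "ennreal \<bar>w y * indicator (cel_cube \<tau> R) y\<bar> * indicator (cel \<tau> (P k)) y =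
          ennreal (w y) * indicator (cel \<tau> (P k)) y"
          using w0[of y] by (auto simp: indicator_def)
      qed
      also have "\<dots> = ennreal (cw \<tau> w (P k))" by (rule cw_nn[OF w])
      finally have 1: "(\<integral>\<^sup>+y\<in>cel_cube \<tau> (P k). ennreal \<bar>w y * indicator (cel_cube \<tau> R) y\<bar> \<partial>lebesgue) =
        ennreal (cw \<tau> w (P k))" .
      have "emeasure lebesgue (cel_cube \<tau> (P k)) = emeasure lebesgue (cel \<tau> (P k))"
        unfolding emeasure_cel by (rule emeasure_cube) simp
      then have 2: "emeasure lebesgue (cel_cube \<tau> (P k)) = ennreal (v k)" by (simp only: vol)
      show ?thesis unfolding 1 2 using v[of k] cw_pos[OF w, of \<tau> "P k"]
        by (simp add: divide_ennreal less_imp_le)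
    qed
    also have "\<dots> \<le> ?M y"
      unfolding HL_maximal_def
      using y cel_subset_cube[of \<tau> "P k"] by (intro SUP_upper2[of "(cel_center \<tau> (P k), 3 powr real_of_int (fst (P k)))"]) auto
    finally show ?thesis .
  qed
  let ?E = "\<lambda>k. cel \<tau> (P k) - cel \<tau> (P (Suc k))"
  have Eme: "emeasure lebesgue (?E k) = ennreal (v k - v (Suc k))" for k
  proof -
    have "emeasure lebesgue (?E k) = emeasure lebesgue (cel \<tau> (P k)) - emeasure lebesgue (cel \<tau> (P (Suc k)))"
    proof (rule emeasure_Diff[OF _ cel_lebesgue cel_lebesgue])
      show "emeasure lebesgue (cel \<tau> (P (Suc k))) \<noteq> \<infinity>" unfolding vol by simp
      show "cel \<tau> (P (Suc k)) \<subseteq> cel \<tau> (P k)" using Pnest[of k "Suc k"] by (simp add: cel_le_def)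
    qed
    also have "\<dots> = ennreal (v k - v (Suc k))"
      unfolding vol using v[of "Suc k"] by (intro ennreal_minus) simp
    finally show ?thesis .
  qed
  have ratio: "2 / 3 \<le> (v k - v (Suc k)) / v k" for k
  proof -
    have "v (Suc k) = v k / 3 ^ CARD('n)"
      unfolding v_def by (simp add: powr_diff powr_add field_simps)
    then have eq: "v (Suc k) * 3 ^ CARD('n) = v k" by simp
    have "(3::real) ^ 1 \<le> 3 ^ CARD('n)" by (intro power_increasing) (auto simp: Suc_leI)
    then have "v (Suc k) * 3 \<le> v (Suc k) * 3 ^ CARD('n)"
      using v[of "Suc k"] by (intro mult_left_mono) auto
    then have "2 / 3 * v k \<le> v k - v (Suc k)" unfolding eq by linarith
    then show ?thesis using v[of k] by (simp add: pos_le_divide_eq)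
  qed
  have "ennreal (real d * (2 / 3 * cw \<tau> w Q)) = ennreal (\<Sum>k<d. 2 / 3 * cw \<tau> w Q)" by simp
  also have "\<dots> = (\<Sum>k<d. ennreal (2 / 3 * cw \<tau> w Q))"
    using cw_pos[OF w, of \<tau> Q] by (intro sum_ennreal[symmetric]) simp
  also have "\<dots> \<le> (\<Sum>k<d. \<integral>\<^sup>+y. ennreal (cw \<tau> w Q / v k) * indicator (?E k) y \<partial>lebesgue)"
  proof (rule sum_mono)
    fix k assume k: "k \<in> {..<d}"
    have "ennreal (2 / 3 * cw \<tau> w Q) \<le> ennreal ((v k - v (Suc k)) / v k * cw \<tau> w Q)"
      using ratio[of k] cw_pos[OF w, of \<tau> Q] by (intro ennreal_leI mult_right_mono) auto
    also have "\<dots> = (\<integral>\<^sup>+y\<in>?E k. ennreal (cw \<tau> w Q / v k) \<partial>lebesgue)"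
    proof -
      have "(\<integral>\<^sup>+y\<in>?E k. ennreal (cw \<tau> w Q / v k) \<partial>lebesgue) = ennreal (cw \<tau> w Q / v k) * emeasure lebesgue (?E k)"
        by (rule nn_integral_cmult_indicator) (intro sets.Diff cel_lebesgue)
      also have "\<dots> = ennreal (cw \<tau> w Q / v k * (v k - v (Suc k)))"
        unfolding Eme using cw_pos[OF w, of \<tau> Q] v[of k] by (intro ennreal_mult'[symmetric]) simp
      finally show ?thesis by (simp add: mult.commute)
    qed
    finally show "ennreal (2 / 3 * cw \<tau> w Q) \<le>
      (\<integral>\<^sup>+y. ennreal (cw \<tau> w Q / v k) * indicator (?E k) y \<partial>lebesgue)" .
  qed
  also have "\<dots> = (\<integral>\<^sup>+y. (\<Sum>k<d. ennreal (cw \<tau> w Q / v k) * indicator (?E k) y) \<partial>lebesgue)"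
    by (intro nn_integral_sum[symmetric] borel_measurable_times_ennreal borel_measurable_indicator
        borel_measurable_const sets.Diff cel_lebesgue)
  also have "\<dots> \<le> (\<integral>\<^sup>+y\<in>cel_cube \<tau> R. ?M y \<partial>lebesgue)"
  proof (rule nn_integral_mono)
    fix y
    show "(\<Sum>k<d. ennreal (cw \<tau> w Q / v k) * indicator (?E k) y) \<le> ?M y * indicator (cel_cube \<tau> R) y"
    proof (cases "\<exists>k<d. y \<in> ?E k")
      case True
      then obtain k where k: "k < d" "y \<in> ?E k" by blast
      have "(\<Sum>j<d. ennreal (cw \<tau> w Q / v j) * indicator (?E j) y) =
        (\<Sum>j\<in>{k}. ennreal (cw \<tau> w Q / v j) * indicator (?E j) y)"
      proof (rule sum.mono_neutral_right)
        have "y \<notin> ?E j" if "j \<noteq> k" for j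
        proof (cases "j < k")
          case True
          then have "y \<in> cel \<tau> (P (Suc j))"
            using Pnest[of "Suc j" k] k(2) by (auto simp: cel_le_def)
          then show ?thesis by simp
        next
          case False
          then have "Suc k \<le> j" using that by simp
          then show ?thesis using Pnest[of "Suc k" j] k(2) by (auto simp: cel_le_def)
        qed
        then show "\<forall>j\<in>{..<d} - {k}. ennreal (cw \<tau> w Q / v j) * indicator (?E j) y = 0"
          by (auto simp: indicator_def)
      qed (use k in auto)
      also have "\<dots> \<le> ?M y" using M[of y k] k by simp
      also have "y \<in> cel_cube \<tau> R"
        using Pnest[of 0 k] k(2) cel_subset_cube[of \<tau> R] by (auto simp: PR cel_le_def)
      then have "?M y = ?M y * indicator (cel_cube \<tau> R) y" by simp
      finally show ?thesis .
    next
      case False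
      then have "(\<Sum>k<d. ennreal (cw \<tau> w Q / v k) * indicator (?E k) y) = 0"
        by (intro sum.neutral) (auto simp: indicator_def)
      then show ?thesis by simp
    qed
  qed
  also have "\<dots> \<le> ennreal (U * cw \<tau> w R)"
  proof -
    have "(\<integral>\<^sup>+y\<in>cel_cube \<tau> R. ?M y \<partial>lebesgue) / ennreal (cw \<tau> w R) \<le> Ainf_const w"
      unfolding Ainf_const_def cw_def by (intro SUP_upper2[of "(cel_center \<tau> R, 3 powr real_of_int (fst R))"]) auto
    then have "(\<integral>\<^sup>+y\<in>cel_cube \<tau> R. ?M y \<partial>lebesgue) / ennreal (cw \<tau> w R) \<le> ennreal U"
      using U(1) by (rule order_trans)
    then have "(\<integral>\<^sup>+y\<in>cel_cube \<tau> R. ?M y \<partial>lebesgue) / ennreal (cw \<tau> w R) * ennreal (cw \<tau> w R) \<le> ennreal U * ennreal (cw \<tau> w R)"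
      by (rule mult_right_mono) simp
    then show ?thesis
      unfolding ennreal_divide_mult_cancel[OF cw_pos[OF w]]
      using cw_pos[OF w, of \<tau> R] U(2) by (simp add: ennreal_mult)
  qed
  finally have "real d * (2 / 3 * cw \<tau> w Q) \<le> U * cw \<tau> w R"
    using U(2) cw_pos[OF w, of \<tau> R] by (subst (asm) ennreal_le_iff) (auto simp: less_imp_le)
  then show ?thesis by simp
qed

lemma sum_int_powr_le:
  fixes T \<delta> s0 :: real
  assumes J: "finite J" "\<And>j. j \<in> J \<Longrightarrow> 2 powr (of_int j * s0) < T" and "0 < s0" "0 < \<delta>"
  shows "(\<Sum>j\<in>J. 2 powr (of_int j * \<delta>)) \<le> T powr (\<delta> / s0) / (1 - 2 powr (- \<delta>))"
proof (cases "J = {}")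
  case False
  define m where "m = Max J"
  have m: "m \<in> J" "\<And>j. j \<in> J \<Longrightarrow> j \<le> m" using J(1) False by (auto simp: m_def)
  define N where "N = Suc (Max ((\<lambda>j. nat (m - j)) ` J))"
  have N: "nat (m - j) < N" if "j \<in> J" for j
    unfolding N_def using J(1) that by (intro le_imp_less_Suc Max_ge) auto
  have y: "0 < 2 powr (- \<delta>)" "2 powr (- \<delta>) < 1" using assms(4) by (auto intro: powr_less_one)
  have "(\<Sum>j\<in>J. 2 powr (of_int j * \<delta>)) = (\<Sum>j\<in>J. 2 powr (of_int m * \<delta>) * (2 powr (- \<delta>)) ^ nat (m - j))"
  proof (rule sum.cong[OF refl])
    fix j assume "j \<in> J"
    then have "real (nat (m - j)) = of_int m - of_int j" using m(2) by simp
    then have "(2 powr (- \<delta>)) ^ nat (m - j) = 2 powr (- \<delta> * (of_int m - of_int j))"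
      by (simp add: powr_powr flip: powr_realpow)
    then show "2 powr (of_int j * \<delta>) = 2 powr (of_int m * \<delta>) * (2 powr (- \<delta>)) ^ nat (m - j)"
      by (simp add: algebra_simps flip: powr_add)
  qed
  also have "\<dots> = 2 powr (of_int m * \<delta>) * (\<Sum>j\<in>J. (2 powr (- \<delta>)) ^ nat (m - j))"
    by (rule sum_distrib_left[symmetric])
  also have "(\<Sum>j\<in>J. (2 powr (- \<delta>)) ^ nat (m - j)) = (\<Sum>d\<in>(\<lambda>j. nat (m - j)) ` J. (2 powr (- \<delta>)) ^ d)"
  proof (subst sum.reindex)
    show "inj_on (\<lambda>j. nat (m - j)) J"
    proof (rule inj_onI)
      fix x y assume "x \<in> J" "y \<in> J" "nat (m - x) = nat (m - y)"
      then show "x = y" using m(2)[of x] m(2)[of y] by simp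
    qed
  qed simp
  also have "2 powr (of_int m * \<delta>) * \<dots> \<le> T powr (\<delta> / s0) * (1 / (1 - 2 powr (- \<delta>)))"
  proof (rule mult_mono)
    have "2 powr (of_int m * \<delta>) = (2 powr (of_int m * s0)) powr (\<delta> / s0)"
      using assms by (simp add: powr_powr)
    also have "\<dots> \<le> T powr (\<delta> / s0)"
      using assms J(2)[OF m(1)] by (intro powr_mono2) auto
    finally show "2 powr (of_int m * \<delta>) \<le> T powr (\<delta> / s0)" .
    have "(\<Sum>d\<in>(\<lambda>j. nat (m - j)) ` J. (2 powr (- \<delta>)) ^ d) \<le> (\<Sum>d<N. (2 powr (- \<delta>)) ^ d)"
      using N by (intro sum_mono2) auto
    also have "\<dots> \<le> (\<Sum>d. (2 powr (- \<delta>)) ^ d)"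
      using y by (intro sum_le_suminf summable_geometric) auto
    also have "\<dots> = 1 / (1 - 2 powr (- \<delta>))"
      using y by (intro suminf_geometric) auto
    finally show "(\<Sum>d\<in>(\<lambda>j. nat (m - j)) ` J. (2 powr (- \<delta>)) ^ d) \<le> 1 / (1 - 2 powr (- \<delta>))" .
  qed (auto intro: sum_nonneg)
  finally show ?thesis by simp
qed (use assms in \<open>auto intro!: divide_nonneg_nonneg simp: less_imp_le powr_less_one\<close>)

text \<open>The dyadic maximal theorem for the measure with density \<open>w\<close> and the function \<open>g / w\<close>,
  in the discretised form needed for stopping families.\<close>

lemma maximal_bound_cel:
  fixes g w :: "real^'n::finite \<Rightarrow> real"
  assumes h: "half_shift \<tau>" and w: "weight w" and g: "g \<in> borel_measurable lebesgue" "\<And>x. 0 \<le> g x"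
    and gi: "\<And>Q. (\<integral>\<^sup>+x\<in>cel \<tau> Q. ennreal (g x) \<partial>lebesgue) = ennreal (gi Q)" "\<And>Q. 0 \<le> gi Q"
    and s: "0 < s0" "s0 < s" and fin: "finite \<Q>"
    and I: "(\<integral>\<^sup>+x. ennreal (g x powr (s / s0) * w x powr (1 - s / s0)) \<partial>lebesgue) \<le> ennreal I" "0 \<le> I"
    and F: "2 * 2 powr ((s - s0) / s0) / (1 - 2 powr (- (s - s0))) * I \<le> F powr s"
  shows "cell_tree.maximal_bound (cel_le \<tau>) s (cw \<tau> w) (\<lambda>R. (gi R / cw \<tau> w R) powr (1 / s0)) F \<Q>"
  unfolding cell_tree.maximal_bound_def[OF cell_tree_cel[OF h]]
proof (intro allI impI)
  fix A and i :: "'n cell \<Rightarrow> int"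
  assume A: "A \<subseteq> \<Q>" and iA: "\<forall>R\<in>A. 2 powr of_int (i R) \<le> (gi R / cw \<tau> w R) powr (1 / s0)"
    and inj: "\<forall>R\<in>A. \<forall>R'\<in>A. i R = i R' \<longrightarrow> cel_le \<tau> R R' \<longrightarrow> R = R'"
  have finA: "finite A" using A fin finite_subset by blast
  have wm: "w \<in> borel_measurable lebesgue" and w0: "\<And>x. 0 \<le> w x" using w by (auto simp: weight_def)
  define cM where "cM = 2 * 2 powr ((s - s0) / s0) / (1 - 2 powr (- (s - s0)))"
  have y: "2 powr (- (s - s0)) < (1::real)" using s by (intro powr_less_one) auto
  have cM: "0 \<le> cM" using y by (simp add: cM_def)
  define T where "T R = {x. 2 powr (of_int (i R) * s0) * w x < 2 * g x}" for R
  have Tm: "T R \<in> sets lebesgue" for R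
  proof -
    have eq: "T R = {x \<in> space lebesgue. 2 powr (of_int (i R) * s0) * w x < 2 * g x}"
      by (simp add: T_def)
    show ?thesis
      unfolding eq by (intro borel_measurable_less borel_measurable_times borel_measurable_const wm g(1))
  qed
  define b where "b R x = 2 * 2 powr (of_int (i R) * (s - s0)) * g x * indicator (cel \<tau> R) x * indicator (T R) x" for R x
  have b0: "0 \<le> b R x" for R x using g(2) by (simp add: b_def)
  have bm: "b R \<in> borel_measurable lebesgue" for R
    unfolding b_def
    by (intro borel_measurable_times borel_measurable_const borel_measurable_indicator g(1) cel_lebesgue Tm)
  have each: "ennreal (2 powr (s * of_int (i R)) * cw \<tau> w R) \<le> (\<integral>\<^sup>+x. ennreal (b R x) \<partial>lebesgue)" if R: "R \<in> A" for R
  proof -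
    define a where "a = 2 powr (of_int (i R) * s0)"
    have a: "0 < a" by (simp add: a_def)
    have cwp: "0 < cw \<tau> w R" by (rule cw_pos[OF w])
    have "a = (2 powr of_int (i R)) powr s0" by (simp add: a_def powr_powr)
    also have "\<dots> \<le> ((gi R / cw \<tau> w R) powr (1 / s0)) powr s0"
      using iA R s by (intro powr_mono2) auto
    also have "\<dots> = gi R / cw \<tau> w R" using s gi(2)[of R] cwp by (simp add: powr_powr)
    finally have a_le: "a * cw \<tau> w R \<le> gi R" using cwp by (simp add: field_simps)
    define X where "X = (\<integral>\<^sup>+x. ennreal (g x * indicator (cel \<tau> R) x * indicator (T R) x) \<partial>lebesgue)"
    have "ennreal (gi R) = (\<integral>\<^sup>+x\<in>cel \<tau> R. ennreal (g x) \<partial>lebesgue)" by (rule gi(1)[symmetric])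
    also have "\<dots> \<le> (\<integral>\<^sup>+x. ennreal (g x * indicator (cel \<tau> R) x * indicator (T R) x) +
        ennreal (a / 2) * (ennreal (w x) * indicator (cel \<tau> R) x) \<partial>lebesgue)"
    proof (rule nn_integral_mono)
      fix x
      have "g x \<le> a / 2 * w x" if "x \<notin> T R" using that by (simp add: T_def a_def)
      then show "ennreal (g x) * indicator (cel \<tau> R) x \<le> ennreal (g x * indicator (cel \<tau> R) x * indicator (T R) x) +
        ennreal (a / 2) * (ennreal (w x) * indicator (cel \<tau> R) x)"
        using a w0[of x] by (auto simp: indicator_def intro!: ennreal_leI simp flip: ennreal_mult)
    qed
    also have "\<dots> = X + ennreal (a / 2) * ennreal (cw \<tau> w R)"
    proof -
      have m1: "(\<lambda>x. ennreal (g x * indicator (cel \<tau> R) x * indicator (T R) x)) \<in> borel_measurable lebesgue"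
        by (intro measurable_compose[OF _ measurable_ennreal] borel_measurable_times borel_measurable_indicator g(1) cel_lebesgue Tm)
      have m2: "(\<lambda>x. ennreal (w x) * indicator (cel \<tau> R) x) \<in> borel_measurable lebesgue"
        by (intro borel_measurable_times_ennreal measurable_compose[OF wm measurable_ennreal] borel_measurable_indicator cel_lebesgue)
      have m3: "(\<lambda>x. ennreal (a / 2) * (ennreal (w x) * indicator (cel \<tau> R) x)) \<in> borel_measurable lebesgue"
        by (intro borel_measurable_times_ennreal borel_measurable_const m2)
      show ?thesis
        unfolding nn_integral_add[OF m1 m3] nn_integral_cmult[OF m2] X_def cw_nn[OF w] ..
    qed
    finally have le: "ennreal (gi R) \<le> X + ennreal (a / 2) * ennreal (cw \<tau> w R)" .
    have half: "ennreal (a * cw \<tau> w R) \<le> 2 * X"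
    proof (cases X)
      case (real xr)
      have "ennreal (gi R) \<le> ennreal (xr + a / 2 * cw \<tau> w R)"
        using le real a cwp by (simp add: less_imp_le flip: ennreal_mult ennreal_plus)
      then have "gi R \<le> xr + a / 2 * cw \<tau> w R"
        using real a cwp by (subst (asm) ennreal_le_iff) auto
      then have "a * cw \<tau> w R \<le> 2 * xr" using a_le by simp
      then have "ennreal (a * cw \<tau> w R) \<le> ennreal (2 * xr)" by (rule ennreal_leI)
      then show ?thesis using real by (simp add: ennreal_mult)
    qed (simp add: ennreal_mult_top)
    define c where "c = 2 powr (of_int (i R) * (s - s0))"
    have "ennreal (2 powr (s * of_int (i R)) * cw \<tau> w R) = ennreal c * ennreal (a * cw \<tau> w R)"
      using cwp by (simp add: c_def a_def algebra_simps less_imp_le flip: ennreal_mult powr_add)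
    also have "\<dots> \<le> ennreal c * (2 * X)" by (rule mult_left_mono[OF half]) simp
    also have "\<dots> = ennreal (2 * c) * X"
      by (simp add: ennreal_mult c_def mult_ac)
    also have "\<dots> = (\<integral>\<^sup>+x. ennreal (b R x) \<partial>lebesgue)"
    proof -
      have m1: "(\<lambda>x. ennreal (g x * indicator (cel \<tau> R) x * indicator (T R) x)) \<in> borel_measurable lebesgue"
        by (intro measurable_compose[OF _ measurable_ennreal] borel_measurable_times borel_measurable_indicator g(1) cel_lebesgue Tm)
      have "ennreal (2 * c) * ennreal (g x * indicator (cel \<tau> R) x * indicator (T R) x) = ennreal (b R x)" for x
        using g(2)[of x] by (subst ennreal_mult[symmetric]) (auto simp: b_def c_def mult_ac)
      then show ?thesis unfolding X_def nn_integral_cmult[OF m1, symmetric] by simp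
    qed
    finally show ?thesis .
  qed
  have AEw: "AE x in lebesgue. 0 < w x" using w by (simp add: weight_def)
  have pw: "(\<Sum>R\<in>A. ennreal (b R x)) \<le> ennreal (cM * (g x powr (s / s0) * w x powr (1 - s / s0)))" if wx: "0 < w x" for x
  proof -
    define B where "B = {R \<in> A. x \<in> cel \<tau> R \<and> x \<in> T R}"
    have finB: "finite B" using finA by (simp add: B_def)
    have "(\<Sum>R\<in>A. b R x) = (\<Sum>R\<in>B. b R x)"
      using finA by (intro sum.mono_neutral_right) (auto simp: B_def b_def indicator_def)
    also have "\<dots> = (\<Sum>R\<in>B. 2 * g x * 2 powr (of_int (i R) * (s - s0)))"
      by (intro sum.cong refl) (simp add: B_def b_def)
    also have "\<dots> = 2 * g x * (\<Sum>R\<in>B. 2 powr (of_int (i R) * (s - s0)))"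
      by (rule sum_distrib_left[symmetric])
    also have "(\<Sum>R\<in>B. 2 powr (of_int (i R) * (s - s0))) = (\<Sum>j\<in>i ` B. 2 powr (of_int j * (s - s0)))"
    proof (subst sum.reindex)
      show "inj_on i B"
      proof (rule inj_onI)
        fix R R' assume R: "R \<in> B" "R' \<in> B" "i R = i R'"
        then have "cel \<tau> R \<inter> cel \<tau> R' \<noteq> {}" by (auto simp: B_def)
        then have "cel_le \<tau> R R' \<or> cel_le \<tau> R' R" using cel_disjoint[OF h] by blast
        then show "R = R'" using inj R R(3)[symmetric] unfolding B_def by blast
      qed
    qed simp
    also have "2 * g x * \<dots> \<le> 2 * g x * ((2 * g x / w x) powr ((s - s0) / s0) / (1 - 2 powr (- (s - s0))))"
    proof (intro mult_left_mono sum_int_powr_le)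
      show "2 powr (of_int j * s0) < 2 * g x / w x" if "j \<in> i ` B" for j
        using that wx by (auto simp: B_def T_def pos_less_divide_eq)
    qed (use finB s g(2)[of x] in auto)
    also have "\<dots> = cM * (g x powr (s / s0) * w x powr (1 - s / s0))"
    proof (cases "g x = 0")
      case False
      then have gx: "0 < g x" using g(2)[of x] by simp
      define t where "t = (s - s0) / s0"
      have t: "s / s0 = 1 + t" "1 - s / s0 = - t" using s by (simp_all add: t_def field_simps)
      have "(2 * g x / w x) powr t = 2 powr t * g x powr t * w x powr (- t)"
        using gx wx by (simp add: powr_divide powr_mult powr_minus_divide)
      then show ?thesis unfolding t cM_def t_def[symmetric] using gx by (simp add: powr_add)
    qed simp
    finally have "(\<Sum>R\<in>A. b R x) \<le> cM * (g x powr (s / s0) * w x powr (1 - s / s0))" .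
    then show ?thesis using b0 by (simp add: ennreal_leI sum_ennreal)
  qed
  have "ennreal (\<Sum>R\<in>A. 2 powr (s * of_int (i R)) * cw \<tau> w R) = (\<Sum>R\<in>A. ennreal (2 powr (s * of_int (i R)) * cw \<tau> w R))"
    using cw_pos[OF w] by (intro sum_ennreal[symmetric]) (simp add: less_imp_le)
  also have "\<dots> \<le> (\<Sum>R\<in>A. \<integral>\<^sup>+x. ennreal (b R x) \<partial>lebesgue)" by (rule sum_mono[OF each])
  also have "\<dots> = (\<integral>\<^sup>+x. (\<Sum>R\<in>A. ennreal (b R x)) \<partial>lebesgue)"
    by (intro nn_integral_sum[symmetric] measurable_compose[OF bm measurable_ennreal])
  also have "\<dots> \<le> (\<integral>\<^sup>+x. ennreal (cM * (g x powr (s / s0) * w x powr (1 - s / s0))) \<partial>lebesgue)"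
    using AEw by (intro nn_integral_mono_AE) (auto elim!: eventually_mono intro: pw)
  also have "\<dots> = ennreal cM * (\<integral>\<^sup>+x. ennreal (g x powr (s / s0) * w x powr (1 - s / s0)) \<partial>lebesgue)"
  proof -
    have m: "(\<lambda>x. ennreal (g x powr (s / s0) * w x powr (1 - s / s0))) \<in> borel_measurable lebesgue"
      by (intro measurable_compose[OF _ measurable_ennreal] borel_measurable_times powr_real_measurable borel_measurable_const g(1) wm)
    have "ennreal (cM * (g x powr (s / s0) * w x powr (1 - s / s0))) = ennreal cM * ennreal (g x powr (s / s0) * w x powr (1 - s / s0))" for x
      using cM by (intro ennreal_mult) auto
    then show ?thesis by (simp only: nn_integral_cmult[OF m])
  qed
  also have "\<dots> \<le> ennreal cM * ennreal I" by (intro mult_left_mono I) simp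
  also have "\<dots> \<le> ennreal (F powr s)" using F cM I(2) by (simp add: cM_def ennreal_leI flip: ennreal_mult)
  finally show "(\<Sum>R\<in>A. 2 powr (s * of_int (i R)) * cw \<tau> w R) \<le> F powr s"
    by (subst (asm) ennreal_le_iff) auto
qed

lemma nn_integral_count_space_le:
  fixes f :: "'c::countable \<Rightarrow> ennreal"
  assumes "\<And>A. finite A \<Longrightarrow> sum f A \<le> B"
  shows "(\<integral>\<^sup>+x. f x \<partial>count_space UNIV) \<le> B"
proof -
  define A where "A n = {x::'c. to_nat x < n}" for n
  have finA: "finite (A n)" for n
    unfolding A_def by (rule finite_imageD[of to_nat]) (auto intro: finite_subset[of _ "{..<n}"] inj_on_subset[OF inj_to_nat])
  have "f x = (SUP n. f x * indicator (A n) x)" for x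
  proof (rule antisym)
    show "f x \<le> (SUP n. f x * indicator (A n) x)"
      by (rule SUP_upper2[of "Suc (to_nat x)"]) (auto simp: A_def)
    show "(SUP n. f x * indicator (A n) x) \<le> f x"
      by (rule SUP_least) (auto simp: indicator_def)
  qed
  then have "(\<integral>\<^sup>+x. f x \<partial>count_space UNIV) = (\<integral>\<^sup>+x. (SUP n. f x * indicator (A n) x) \<partial>count_space UNIV)" by simp
  also have "\<dots> = (SUP n. \<integral>\<^sup>+x. f x * indicator (A n) x \<partial>count_space UNIV)"
    by (intro nn_integral_monotone_convergence_SUP) (auto simp: incseq_def le_fun_def A_def indicator_def)
  also have "\<dots> \<le> B"
  proof (rule SUP_least)
    fix n
    have "(\<integral>\<^sup>+x. f x * indicator (A n) x \<partial>count_space UNIV) = sum f (A n)"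
      using finA[of n] by (simp add: nn_integral_count_space_indicator[symmetric] nn_integral_count_space_finite)
    then show "(\<integral>\<^sup>+x. f x * indicator (A n) x \<partial>count_space UNIV) \<le> B" using assms finA by simp
  qed
  finally show ?thesis .
qed

definition max_const :: "real \<Rightarrow> real \<Rightarrow> real" where
  "max_const s0 s = 2 * 2 powr ((s - s0) / s0) / (1 - 2 powr (- (s - s0)))"

theorem grid_form_bound:
  fixes u v g h :: "real^'n::finite \<Rightarrow> real"
  assumes \<tau>: "half_shift \<tau>" and u: "weight u" and v: "weight v"
    and g: "g \<in> borel_measurable lebesgue" "\<And>x. 0 \<le> g x"
    and gi: "\<And>Q. (\<integral>\<^sup>+x\<in>cel \<tau> Q. ennreal (g x) \<partial>lebesgue) = ennreal (gi Q)" "\<And>Q. 0 \<le> gi Q"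
    and h: "h \<in> borel_measurable lebesgue" "\<And>x. 0 \<le> h x"
    and hi: "\<And>Q. (\<integral>\<^sup>+x\<in>cel \<tau> Q. ennreal (h x) \<partial>lebesgue) = ennreal (hi Q)" "\<And>Q. 0 \<le> hi Q"
    and e: "1 < p" "p < q" "0 < p0" "p0 < p" "0 < r0" "r0 < 1 / (1 - 1 / q)"
    and \<beta>: "\<beta> = 1 / p0 - 1 / p" and \<gamma>: "\<gamma> = 1 / r0 - (1 - 1 / q)"
    and Du: "1 \<le> Du" "\<And>Q R d. cel_le \<tau> Q R \<Longrightarrow> fst Q = fst R - int d \<Longrightarrow> real d * cw \<tau> u Q \<le> Du * cw \<tau> u R"
    and Dv: "1 \<le> Dv" "\<And>Q R d. cel_le \<tau> Q R \<Longrightarrow> fst Q = fst R - int d \<Longrightarrow> real d * cw \<tau> v Q \<le> Dv * cw \<tau> v R"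
    and K: "\<And>Q. cw \<tau> (\<lambda>x. 1) Q powr (- \<beta> - \<gamma>) * cw \<tau> u Q powr \<beta> * cw \<tau> v Q powr \<gamma> \<le> K" "0 < K"
    and \<theta>: "1 < \<theta>" "\<theta> * \<beta> \<le> 1 / p0" "\<theta> * \<gamma> \<le> 1 / r0"
    and I: "(\<integral>\<^sup>+x. ennreal (g x powr (p / p0) * u x powr (1 - p / p0)) \<partial>lebesgue) \<le> ennreal I" "0 < I"
    and J: "(\<integral>\<^sup>+x. ennreal (h x powr ((1 / (1 - 1 / q)) / r0) * v x powr (1 - (1 / (1 - 1 / q)) / r0)) \<partial>lebesgue) \<le> ennreal J" "0 < J"
  shows "(\<integral>\<^sup>+Q. ennreal (cw \<tau> (\<lambda>x. 1) Q powr (- \<beta> - \<gamma>) * gi Q powr (1 / p0) * hi Q powr (1 / r0)) \<partial>count_space UNIV) \<le>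
    ennreal (cell_tree.tree_const (3 ^ CARD('n)) \<theta> \<beta> \<gamma> p q * K * (Du powr (1 / q) + Dv powr (1 - 1 / p)) *
      ((max_const p0 p * I) powr (1 / p) * (max_const r0 (1 / (1 - 1 / q)) * J) powr (1 - 1 / q)))"
proof (rule nn_integral_count_space_le)
  fix \<Q>' :: "'n cell set" assume fin': "finite \<Q>'"
  interpret cell_tree "cel_le \<tau>" fst by (rule cell_tree_cel[OF \<tau>])
  define q' where "q' = 1 / (1 - 1 / q)"
  have q': "0 < q'" "1 / q' = 1 - 1 / q" using e by (auto simp: q'_def)
  let ?vol = "cw \<tau> (\<lambda>x. 1)"
  define A where "A R = (gi R / cw \<tau> u R) powr (1 / p0)" for R
  define B where "B R = (hi R / cw \<tau> v R) powr (1 / r0)" for R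
  define F where "F = (max_const p0 p * I) powr (1 / p)"
  define H where "H = (max_const r0 q' * J) powr (1 / q')"
  have mc: "0 < max_const s0 s" if "0 < s0" "s0 < s" for s0 s :: real
    using that unfolding max_const_def by (intro divide_pos_pos mult_pos_pos) (auto simp: powr_less_one)
  have mcu: "0 < max_const p0 p" using e by (intro mc) auto
  have mcv: "0 < max_const r0 q'" using e by (intro mc) (auto simp: q'_def)
  have FH: "0 < F" "0 < H" using mcu mcv I J by (auto simp: F_def H_def)
  define \<Q> where "\<Q> = {Q \<in> \<Q>'. 0 < gi Q \<and> 0 < hi Q}"
  have fin: "finite \<Q>" using fin' by (simp add: \<Q>_def)
  have up: "0 < cw \<tau> u Q" "0 < cw \<tau> v Q" for Q by (rule cw_pos[OF u], rule cw_pos[OF v])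
  have mbu: "maximal_bound p (cw \<tau> u) A F \<Q>"
    unfolding A_def
  proof (rule maximal_bound_cel[OF \<tau> u g gi _ _ fin I(1)])
    show "2 * 2 powr ((p - p0) / p0) / (1 - 2 powr - (p - p0)) * I \<le> F powr p"
    proof -
      have "F powr p = max_const p0 p * I" using mcu I e by (simp add: F_def powr_powr)
      then show ?thesis unfolding max_const_def by simp
    qed
  qed (use e I in auto)
  have mbv: "maximal_bound q' (cw \<tau> v) B H \<Q>"
    unfolding B_def
  proof (rule maximal_bound_cel[OF \<tau> v h hi _ _ fin J(1)[folded q'_def]])
    show "2 * 2 powr ((q' - r0) / r0) / (1 - 2 powr - (q' - r0)) * J \<le> H powr q'"
    proof -
      have "H powr q' = max_const r0 q' * J" using mcv J(2) q'(1) by (simp add: H_def powr_powr)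
      then show ?thesis unfolding max_const_def by simp
    qed
  qed (use e J in \<open>auto simp: q'_def\<close>)
  have \<beta>\<gamma>: "0 < \<beta>" "0 < \<gamma>"
  proof -
    show "0 < \<beta>" unfolding \<beta> using e by (simp add: frac_less2)
    have "1 / q' < 1 / r0" using e(5,6) q'(1) unfolding q'_def[symmetric] by (simp add: frac_less2)
    then show "0 < \<gamma>" unfolding \<gamma> q'(2)[symmetric] by simp
  qed
  have ex: "\<beta> + 1 / p = 1 / p0" "\<gamma> + (1 - 1 / q) = 1 / r0" by (simp_all add: \<beta> \<gamma>)
  have main: "(\<Sum>Q\<in>\<Q>. (?vol Q powr (- \<beta> - \<gamma>) * cw \<tau> u Q powr (\<beta> + 1 / p) * cw \<tau> v Q powr (\<gamma> + (1 - 1 / q))) * A Q * B Q) \<le>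
     tree_const (3 ^ CARD('n)) \<theta> \<beta> \<gamma> p q * K * (Du powr (1 / q) + Dv powr (1 - 1 / p)) * (F * H)"
  proof (rule tree_form_bound[where A = A and B = B, OF fin _ _ cw_supadd[OF \<tau> u] cw_supadd[OF \<tau> v] cw_supadd[OF \<tau> weight_1]
        cw_1 _ e(1,2) \<beta>\<gamma> Du Dv mbu mbv[unfolded q'_def] FH \<theta>(1) _ _ K])
    show "0 < A Q" "0 < B Q" if "Q \<in> \<Q>" for Q
      using that up[of Q] by (auto simp: A_def B_def \<Q>_def)
    have "(3::real) ^ 1 \<le> 3 ^ CARD('n)" by (intro power_increasing) (auto simp: Suc_leI)
    then show "(1::real) < 3 ^ CARD('n)" by simp
    show "\<theta> * \<beta> \<le> \<beta> + 1 / p" "\<theta> * \<gamma> \<le> \<gamma> + (1 - 1 / q)" unfolding ex by (fact \<theta>)+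
  qed auto
  have "(\<Sum>Q\<in>\<Q>'. ennreal (?vol Q powr (- \<beta> - \<gamma>) * gi Q powr (1 / p0) * hi Q powr (1 / r0))) =
    ennreal (\<Sum>Q\<in>\<Q>'. ?vol Q powr (- \<beta> - \<gamma>) * gi Q powr (1 / p0) * hi Q powr (1 / r0))"
    by (intro sum_ennreal) auto
  also have "(\<Sum>Q\<in>\<Q>'. ?vol Q powr (- \<beta> - \<gamma>) * gi Q powr (1 / p0) * hi Q powr (1 / r0)) =
    (\<Sum>Q\<in>\<Q>. ?vol Q powr (- \<beta> - \<gamma>) * gi Q powr (1 / p0) * hi Q powr (1 / r0))"
    using fin' gi(2) hi(2) by (intro sum.mono_neutral_right) (auto simp: \<Q>_def order.strict_iff_order)
  also have "\<dots> = (\<Sum>Q\<in>\<Q>. (?vol Q powr (- \<beta> - \<gamma>) * cw \<tau> u Q powr (\<beta> + 1 / p) * cw \<tau> v Q powr (\<gamma> + (1 - 1 / q))) * A Q * B Q)"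
  proof (rule sum.cong[OF HOL.refl])
    fix Q
    have "gi Q powr (1 / p0) = cw \<tau> u Q powr (1 / p0) * A Q" "hi Q powr (1 / r0) = cw \<tau> v Q powr (1 / r0) * B Q"
      using up[of Q] gi(2)[of Q] hi(2)[of Q] by (simp_all add: A_def B_def powr_divide)
    then show "?vol Q powr (- \<beta> - \<gamma>) * gi Q powr (1 / p0) * hi Q powr (1 / r0) =
      (?vol Q powr (- \<beta> - \<gamma>) * cw \<tau> u Q powr (\<beta> + 1 / p) * cw \<tau> v Q powr (\<gamma> + (1 - 1 / q))) * A Q * B Q"
      unfolding ex by simp
  qed
  also have "ennreal \<dots> \<le> ennreal (tree_const (3 ^ CARD('n)) \<theta> \<beta> \<gamma> p q * K * (Du powr (1 / q) + Dv powr (1 - 1 / p)) * (F * H))"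
    by (rule ennreal_leI[OF main])
  finally show "(\<Sum>Q\<in>\<Q>'. ennreal (?vol Q powr (- \<beta> - \<gamma>) * gi Q powr (1 / p0) * hi Q powr (1 / r0))) \<le>
    ennreal (tree_const (3 ^ CARD('n)) \<theta> \<beta> \<gamma> p q * K * (Du powr (1 / q) + Dv powr (1 - 1 / p)) *
      ((max_const p0 p * I) powr (1 / p) * (max_const r0 (1 / (1 - 1 / q)) * J) powr (1 - 1 / q)))"
    unfolding F_def H_def q'(2) unfolding q'_def .
qed

lemma Ainf_ge_1:
  fixes w :: "real^'n::finite \<Rightarrow> real"
  assumes w: "weight w" shows "1 \<le> Ainf_const w"
proof -
  have w0: "\<And>x. 0 \<le> w x" using w by (auto simp: weight_def)
  have main: "1 \<le> Ainf_const w" if l: "0 < l" and W: "0 < wmeasure w (cube c l)" for c :: "real^'n" and l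
  proof -
    let ?Q = "cube c l" and ?W = "wmeasure w (cube c l)" and ?v = "l ^ CARD('n)"
    let ?M = "HL_maximal (\<lambda>y. w y * indicator (cube c l) y)"
    have v: "0 < ?v" using l by simp
    have e: "emeasure lebesgue ?Q = ennreal ?v" using l by (intro emeasure_cube) simp
    have "(\<integral>\<^sup>+y\<in>?Q. ennreal \<bar>w y * indicator ?Q y\<bar> \<partial>lebesgue) = (\<integral>\<^sup>+y\<in>?Q. ennreal (w y) \<partial>lebesgue)"
    proof (rule nn_integral_cong)
      fix y
      show "ennreal \<bar>w y * indicator ?Q y\<bar> * indicator ?Q y = ennreal (w y) * indicator ?Q y"
        using w0[of y] by (cases "y \<in> ?Q") simp_all
    qed
    also have "\<dots> = ennreal ?W" by (rule weight_nn_cube[OF w])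
    finally have "ennreal (?W / ?v) = (\<integral>\<^sup>+y\<in>?Q. ennreal \<bar>w y * indicator ?Q y\<bar> \<partial>lebesgue) / emeasure lebesgue ?Q"
      unfolding e using W v by (simp only: divide_ennreal less_imp_le)
    then have "ennreal (?W / ?v) \<le> ?M y" if "y \<in> ?Q" for y
      unfolding HL_maximal_def using that l by (intro SUP_upper2[of "(c, l)"]) auto
    then have "(\<integral>\<^sup>+y. ennreal (?W / ?v) * indicator ?Q y \<partial>lebesgue) \<le> (\<integral>\<^sup>+y\<in>?Q. ?M y \<partial>lebesgue)"
      by (intro nn_integral_mono) (auto simp: indicator_def)
    moreover have "(\<integral>\<^sup>+y. ennreal (?W / ?v) * indicator ?Q y \<partial>lebesgue) = ennreal (?W / ?v) * ennreal ?v"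
      unfolding e[symmetric] by (rule nn_integral_cmult_indicator) (rule cube_lebesgue)
    moreover have "ennreal (?W / ?v) * ennreal ?v = ennreal ?W"
      using W v l by (simp flip: ennreal_mult)
    ultimately have "ennreal ?W / ennreal ?W \<le> (\<integral>\<^sup>+y\<in>?Q. ?M y \<partial>lebesgue) / ennreal ?W"
      by (intro divide_right_mono_ennreal) simp
    also have "\<dots> \<le> Ainf_const w"
      unfolding Ainf_const_def using l by (intro SUP_upper2[of "(c, l)"]) auto
    finally show ?thesis using W by (simp add: divide_ennreal)
  qed
  have "0 < cw 0 w (0 :: int, 0 :: int^'n)" by (rule cw_pos[OF w])
  then show ?thesis
    unfolding cw_def by (rule main[rotated]) simp
qed

section \<open>Off-diagonal bounds and the bilinear form of the semigroup\<close>

lemma epow_ennreal: "0 \<le> x \<Longrightarrow> epow (ennreal x) r = ennreal (x powr r)"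
  by (simp add: epow_def)

lemma nn_integral_eq_0_of_power:
  fixes f :: "'a \<Rightarrow> real"
  assumes "f \<in> borel_measurable M" "\<And>x. 0 \<le> f x" "(\<integral>\<^sup>+x. ennreal (f x powr q) \<partial>M) = 0"
  shows "AE x in M. f x = 0"
proof -
  have "AE x in M. ennreal (f x powr q) = 0"
    using assms by (subst (asm) nn_integral_0_iff_AE)
      (auto intro!: measurable_compose[OF _ measurable_ennreal] powr_real_measurable)
  then show ?thesis by eventually_elim (simp add: ennreal_eq_0_iff)
qed

lemma nn_integral_Holder:
  fixes a b :: "'a \<Rightarrow> real"
  assumes m: "a \<in> borel_measurable M" "b \<in> borel_measurable M"
    and nn: "\<And>x. 0 \<le> a x" "\<And>x. 0 \<le> b x" and qr: "1 < q" "1 < r" "1 / q + 1 / r = (1::real)"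
  shows "(\<integral>\<^sup>+x. ennreal (a x * b x) \<partial>M) \<le>
    epow (\<integral>\<^sup>+x. ennreal (a x powr q) \<partial>M) (1 / q) * epow (\<integral>\<^sup>+x. ennreal (b x powr r) \<partial>M) (1 / r)"
proof -
  let ?A = "\<integral>\<^sup>+x. ennreal (a x powr q) \<partial>M" and ?B = "\<integral>\<^sup>+x. ennreal (b x powr r) \<partial>M"
  have zero: "(\<integral>\<^sup>+x. ennreal (a x * b x) \<partial>M) = 0" if "?A = 0 \<or> ?B = 0"
  proof -
    have "AE x in M. ennreal (a x * b x) = 0"
      using that
    proof
      assume "?A = 0"
      from nn_integral_eq_0_of_power[OF m(1) nn(1) this] show ?thesis by eventually_elim simp
    next
      assume "?B = 0"
      from nn_integral_eq_0_of_power[OF m(2) nn(2) this] show ?thesis by eventually_elim simp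
    qed
    then show ?thesis by (simp add: nn_integral_cong_AE)
  qed
  show ?thesis
  proof (cases "?A = 0 \<or> ?B = 0")
    case True
    then show ?thesis using zero by simp
  next
    case False
    show ?thesis
    proof (cases "?A = \<infinity> \<or> ?B = \<infinity>")
      case True
      have "0 < epow x s" if "x \<noteq> 0" for x s
        using that by (auto simp: epow_def enn2real_eq_0_iff)
      then have "epow ?A (1 / q) * epow ?B (1 / r) = \<infinity>"
        using True False by (auto simp: epow_def ennreal_mult_eq_top_iff enn2real_eq_0_iff)
      then show ?thesis by simp
    next
      case fin: False
      then obtain A B where AB: "?A = ennreal A" "?B = ennreal B" "0 < A" "0 < B"
        using False by (cases ?A; cases ?B) auto
      define ca cb where "ca = A powr (1 / q)" and "cb = B powr (1 / r)"
      have c: "0 < ca" "0 < cb" "ca powr q = A" "cb powr r = B"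
        using AB qr by (auto simp: ca_def cb_def powr_powr)
      have "(\<integral>\<^sup>+x. ennreal (a x * b x) \<partial>M) \<le>
        (\<integral>\<^sup>+x. ennreal (ca * cb / (q * A)) * ennreal (a x powr q) + ennreal (ca * cb / (r * B)) * ennreal (b x powr r) \<partial>M)"
      proof (rule nn_integral_mono)
        fix x
        have "(a x / ca) * (b x / cb) \<le> (a x / ca) powr q / q + (b x / cb) powr r / r"
          using c nn qr by (intro Youngs_inequality) auto
        also have "\<dots> = a x powr q / (q * A) + b x powr r / (r * B)"
          using c nn[of x] by (simp add: powr_divide mult.commute)
        finally have "(ca * cb) * ((a x / ca) * (b x / cb)) \<le> (ca * cb) * (a x powr q / (q * A) + b x powr r / (r * B))"
          using c by (intro mult_left_mono) auto
        then have "a x * b x \<le> ca * cb / (q * A) * a x powr q + ca * cb / (r * B) * b x powr r"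
          using c by (simp add: distrib_left)
        then have "ennreal (a x * b x) \<le> ennreal (ca * cb / (q * A) * a x powr q + ca * cb / (r * B) * b x powr r)"
          by (rule ennreal_leI)
        also have "\<dots> = ennreal (ca * cb / (q * A)) * ennreal (a x powr q) + ennreal (ca * cb / (r * B)) * ennreal (b x powr r)"
        proof -
          have "ennreal (c * d + c' * d') = ennreal c * ennreal d + ennreal c' * ennreal d'"
            if "0 \<le> c" "0 \<le> d" "0 \<le> c'" "0 \<le> d'" for c c' d d' :: real
            using that by (simp add: ennreal_mult ennreal_plus)
          from this[of "ca * cb / (q * A)" "a x powr q" "ca * cb / (r * B)" "b x powr r"] show ?thesis
            using c AB qr by simp
        qed
        finally show "ennreal (a x * b x) \<le>
          ennreal (ca * cb / (q * A)) * ennreal (a x powr q) + ennreal (ca * cb / (r * B)) * ennreal (b x powr r)" .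
      qed
      also have "\<dots> = ennreal (ca * cb / (q * A)) * ?A + ennreal (ca * cb / (r * B)) * ?B"
      proof -
        have ma: "(\<lambda>x. ennreal (a x powr q)) \<in> borel_measurable M" "(\<lambda>x. ennreal (b x powr r)) \<in> borel_measurable M"
          by (intro measurable_compose[OF _ measurable_ennreal] powr_real_measurable borel_measurable_const m)+
        show ?thesis
          unfolding nn_integral_add[OF borel_measurable_times_ennreal[OF borel_measurable_const ma(1)]
              borel_measurable_times_ennreal[OF borel_measurable_const ma(2)]]
            nn_integral_cmult[OF ma(1)] nn_integral_cmult[OF ma(2)] ..
      qed
      also have "\<dots> = ennreal (ca * cb / (q * A) * A + ca * cb / (r * B) * B)"
        unfolding AB using c AB(3,4) qr by (simp add: ennreal_plus flip: ennreal_mult)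
      also have "ca * cb / (q * A) * A + ca * cb / (r * B) * B = ca * cb * (1 / q + 1 / r)"
        using AB by (simp add: distrib_left)
      also have "\<dots> = ca * cb" using qr by simp
      also have "ennreal (ca * cb) = epow ?A (1 / q) * epow ?B (1 / r)"
        unfolding AB ca_def cb_def using AB by (simp add: epow_ennreal ennreal_mult less_imp_le)
      finally show ?thesis .
    qed
  qed
qed

text \<open>For \<open>q0 = \<infinity>\<close> the conjugate exponent \<open>1 / (1 - rcp q0)\<close> is \<open>1\<close>.\<close>

lemma Lnorm_Holder:
  fixes F :: "'a \<Rightarrow> complex" and b :: "'a \<Rightarrow> real"
  assumes F: "F \<in> borel_measurable M" and b: "b \<in> borel_measurable M" "\<And>x. 0 \<le> b x"
    and q0: "1 < q0"
  shows "(\<integral>\<^sup>+x. ennreal (norm (F x) * b x) \<partial>M) \<le>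
    Lnorm M q0 F * epow (\<integral>\<^sup>+x. ennreal (b x powr (1 / (1 - rcp q0))) \<partial>M) (1 - rcp q0)"
proof (cases "q0 = \<infinity>")
  case True
  have "AE x in M. ennreal (norm (F x) * b x) \<le> esssup M (\<lambda>x. ennreal (norm (F x))) * ennreal (b x)"
    using esssup_AE[of "\<lambda>x. ennreal (norm (F x))" M]
    by eventually_elim (use b(2) in \<open>simp add: ennreal_mult mult_right_mono\<close>)
  then have "(\<integral>\<^sup>+x. ennreal (norm (F x) * b x) \<partial>M) \<le> (\<integral>\<^sup>+x. esssup M (\<lambda>x. ennreal (norm (F x))) * ennreal (b x) \<partial>M)"
    by (rule nn_integral_mono_AE)
  also have "\<dots> = esssup M (\<lambda>x. ennreal (norm (F x))) * (\<integral>\<^sup>+x. ennreal (b x) \<partial>M)"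
    by (intro nn_integral_cmult measurable_compose[OF b(1) measurable_ennreal])
  also have "(\<integral>\<^sup>+x. ennreal (b x) \<partial>M) = epow (\<integral>\<^sup>+x. ennreal (b x powr (1 / (1 - rcp q0))) \<partial>M) (1 - rcp q0)"
  proof -
    have "epow X 1 = X" for X by (cases X) (auto simp: epow_def)
    then show ?thesis using True b(2) by (simp add: rcp_def)
  qed
  finally show ?thesis using True by (simp add: Lnorm_def)
next
  case False
  define q where "q = enn2real q0"
  have q: "q0 = ennreal q" "1 < q"
  proof -
    show "q0 = ennreal q" using False by (simp add: q_def less_top)
    then show "1 < q" using q0 by (metis ennreal_1 ennreal_less_iff zero_le_one)
  qed
  have rcp: "rcp q0 = 1 / q" using q by (simp add: rcp_def inverse_ennreal inverse_eq_divide)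
  have "1 < 1 / (1 - 1 / q)" "1 / q + 1 / (1 / (1 - 1 / q)) = 1" using q(2) by (auto simp: field_simps)
  from nn_integral_Holder[OF measurable_compose[OF F borel_measurable_norm] b(1) norm_ge_zero b(2) q(2) this]
  show ?thesis
    using False by (simp add: Lnorm_def rcp flip: q_def)
qed

lemma Linf_c_measurable: "f \<in> Linf_c \<Longrightarrow> f \<in> borel_measurable lebesgue"
  by (simp add: Linf_c_def)

lemma Linf_c_bounds:
  assumes "f \<in> Linf_c"
  obtains B a where "0 < B" "\<And>x. norm (f x) \<le> B" "0 < a" "\<And>x. x \<notin> cbox (- a *\<^sub>R One) (a *\<^sub>R One) \<Longrightarrow> f x = 0"
    "\<And>x. f x \<noteq> 0 \<Longrightarrow> norm x \<le> a"
proof -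
  obtain B where B: "0 < B" "\<And>y. y \<in> range f \<Longrightarrow> norm y \<le> B"
    using assms bounded_pos[of "range f"] by (auto simp: Linf_c_def)
  obtain K where K: "compact K" "\<And>x. x \<notin> K \<Longrightarrow> f x = 0" using assms by (auto simp: Linf_c_def)
  obtain r where r: "0 < r" "\<And>x. x \<in> K \<Longrightarrow> norm x \<le> r"
    using compact_imp_bounded[OF K(1)] bounded_pos[of K] by auto
  show thesis
  proof (rule that[OF B(1) _ r(1)])
    show "norm (f x) \<le> B" for x using B(2) by blast
    show "f x = 0" if "x \<notin> cbox (- r *\<^sub>R One) (r *\<^sub>R One)" for x
    proof (rule K(2), rule notI)
      assume "x \<in> K"
      then have "norm x \<le> r" by (rule r(2))
      then have "\<bar>x \<bullet> i\<bar> \<le> r" if "i \<in> Basis" for i using Basis_le_norm[OF that, of x] by linarith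
      then have "x \<in> cbox (- r *\<^sub>R One) (r *\<^sub>R One)"
        by (force simp: mem_box inner_sum_left_Basis)
      then show False using that by blast
    qed
    show "norm x \<le> r" if "f x \<noteq> 0" for x using that K(2) r(2) by blast
  qed
qed

lemma Linf_c_restrict:
  assumes "f \<in> Linf_c" "E \<in> sets lebesgue"
  shows "(\<lambda>x. if x \<in> E then f x else 0) \<in> Linf_c"
proof -
  obtain K where K: "compact K" "\<And>x. x \<notin> K \<Longrightarrow> f x = 0" using assms by (auto simp: Linf_c_def)
  have "bounded (insert 0 (range f))" using assms by (simp add: Linf_c_def)
  then have "bounded (range (\<lambda>x. if x \<in> E then f x else 0))"
    by (rule bounded_subset) auto
  moreover have "(\<lambda>x. if x \<in> E then f x else 0) \<in> borel_measurable lebesgue"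
    using assms(2) Linf_c_measurable[OF assms(1)]
    by (intro measurable_If_set borel_measurable_const) (auto simp: sets.Int_space_eq2)
  ultimately show ?thesis using K by (auto simp: Linf_c_def intro!: exI[of _ K])
qed

lemma Linf_c_finite:
  assumes f: "f \<in> Linf_c" and p: "0 < p" shows "(\<integral>\<^sup>+x. ennreal (norm (f x) powr p) \<partial>lebesgue) < \<infinity>"
proof -
  obtain B a where B: "0 < B" "\<And>x. norm (f x) \<le> B" "0 < a" "\<And>x. x \<notin> cbox (- a *\<^sub>R One) (a *\<^sub>R One) \<Longrightarrow> f x = 0"
    by (rule Linf_c_bounds[OF f]) blast
  let ?K = "cbox (- a *\<^sub>R One) (a *\<^sub>R One) :: (real^'a) set"
  have "(\<integral>\<^sup>+x. ennreal (norm (f x) powr p) \<partial>lebesgue) \<le> (\<integral>\<^sup>+x. ennreal (B powr p) * indicator ?K x \<partial>lebesgue)"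
  proof (rule nn_integral_mono)
    fix x
    show "ennreal (norm (f x) powr p) \<le> ennreal (B powr p) * indicator ?K x"
    proof (cases "x \<in> ?K")
      case True
      have "norm (f x) powr p \<le> B powr p" using B(2)[of x] p by (intro powr_mono2) auto
      then show ?thesis using True by (simp add: ennreal_leI)
    next
      case False
      then show ?thesis using B(4)[OF False] by simp
    qed
  qed
  also have "\<dots> = ennreal (B powr p) * emeasure lebesgue ?K"
    by (rule nn_integral_cmult_indicator) simp
  also have "\<dots> < \<infinity>"
    using emeasure_bounded_finite[OF bounded_cbox, of "- a *\<^sub>R One" "a *\<^sub>R One :: real^'a"]
    by (simp add: ennreal_mult_less_top)
  finally show ?thesis .
qed

definition Nint :: "real \<Rightarrow> 'n::finite cfun \<Rightarrow> (real^'n) set \<Rightarrow> real" where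
  "Nint p f E = enn2real (\<integral>\<^sup>+x\<in>E. ennreal (norm (f x) powr p) \<partial>lebesgue)"

lemma Nint_nonneg [simp]: "0 \<le> Nint p f E"
  by (simp add: Nint_def)

lemma Nint_eq:
  assumes "f \<in> Linf_c" "0 < p"
  shows "(\<integral>\<^sup>+x\<in>E. ennreal (norm (f x) powr p) \<partial>lebesgue) = ennreal (Nint p f E)"
proof -
  have "(\<integral>\<^sup>+x\<in>E. ennreal (norm (f x) powr p) \<partial>lebesgue) \<le> (\<integral>\<^sup>+x. ennreal (norm (f x) powr p) \<partial>lebesgue)"
    by (intro nn_integral_mono) (auto simp: indicator_def)
  also have "\<dots> < \<infinity>" by (rule Linf_c_finite[OF assms])
  finally show ?thesis by (simp add: Nint_def)
qed

lemma Nint_mono: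
  assumes "f \<in> Linf_c" "0 < p" "E \<subseteq> E'" shows "Nint p f E \<le> Nint p f E'"
proof -
  have "ennreal (Nint p f E) \<le> ennreal (Nint p f E')"
    unfolding Nint_eq[OF assms(1,2), symmetric]
    using assms(3) by (intro nn_integral_mono) (auto simp: indicator_def)
  then show ?thesis by (simp add: ennreal_le_iff)
qed

lemma nn_restrict:
  "0 < p \<Longrightarrow> (\<integral>\<^sup>+x. ennreal (norm (if x \<in> E then f x else (0::complex)) powr p) \<partial>lebesgue) =
    (\<integral>\<^sup>+x\<in>E. ennreal (norm (f x) powr p) \<partial>lebesgue)"
  by (intro nn_integral_cong) (auto simp: indicator_def)

lemma Lnorm_restrict:
  assumes "f \<in> Linf_c" "0 < p"
  shows "Lnorm lebesgue (ennreal p) (\<lambda>x. if x \<in> E then f x else 0) = ennreal (Nint p f E powr (1 / p))"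
  using assms by (simp add: Lnorm_def nn_restrict Nint_eq epow_ennreal)

lemma Linf_c_Lp: assumes "f \<in> Linf_c" "0 < p" shows "f \<in> Lp (ennreal p)"
proof -
  have "Lnorm lebesgue (ennreal p) (\<lambda>x. if x \<in> UNIV then f x else 0) = ennreal (Nint p f UNIV powr (1 / p))"
    by (rule Lnorm_restrict[OF assms])
  then show ?thesis using Linf_c_measurable[OF assms(1)] by (simp add: Lp_def)
qed

lemma Linf_c_L2: assumes "f \<in> Linf_c" shows "f \<in> L2"
  using Linf_c_Lp[OF assms, of 2] by simp

lemma Lavg_restrict:
  assumes f: "f \<in> Linf_c" "0 < p" and E: "E \<in> sets lebesgue" "emeasure lebesgue E = ennreal V" "0 < V"
  shows "Lavg (ennreal p) E (\<lambda>x. if x \<in> E then f x else 0) = ennreal ((Nint p f E / V) powr (1 / p))"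
proof -
  let ?g = "\<lambda>x. ennreal (norm (if x \<in> E then f x else 0) powr p)"
  have m: "?g \<in> borel_measurable lebesgue"
    by (intro measurable_compose[OF _ measurable_ennreal] powr_real_measurable borel_measurable_const
        measurable_compose[OF _ borel_measurable_norm] Linf_c_measurable[OF Linf_c_restrict[OF f(1) E(1)]])
  have "(\<integral>\<^sup>+x. ?g x \<partial>uniform_measure lebesgue E) = (\<integral>\<^sup>+x\<in>E. ?g x \<partial>lebesgue) / emeasure lebesgue E"
    by (rule nn_integral_uniform_measure[OF m E(1)])
  also have "(\<integral>\<^sup>+x\<in>E. ?g x \<partial>lebesgue) = ennreal (Nint p f E)"
    unfolding Nint_eq[OF f, symmetric] by (intro nn_integral_cong) (auto simp: indicator_def)
  also have "ennreal (Nint p f E) / emeasure lebesgue E = ennreal (Nint p f E / V)"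
    unfolding E(2) using E(3) by (simp add: divide_ennreal)
  finally show ?thesis using f(2) E(3) by (simp add: Lavg_def Lnorm_def epow_ennreal)
qed

lemma Holder_cube:
  assumes F: "F \<in> borel_measurable lebesgue" and \<phi>: "\<phi> \<in> Linf_c" and q0: "1 < q0" and r: "r = 1 - rcp q0" "0 < r"
    and E: "E \<in> sets lebesgue" "emeasure lebesgue E = ennreal V" "0 < V"
  shows "(\<integral>\<^sup>+x\<in>E. ennreal (norm (F x) * norm (\<phi> x)) \<partial>lebesgue) \<le> Lnorm lebesgue q0 F * ennreal (Nint (1 / r) \<phi> E powr r)"
    and "(\<integral>\<^sup>+x\<in>E. ennreal (norm (F x) * norm (\<phi> x)) \<partial>lebesgue) \<le>
      Lavg q0 E F * ennreal (V powr (1 - r) * Nint (1 / r) \<phi> E powr r)"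
proof -
  let ?b = "\<lambda>x. norm (if x \<in> E then \<phi> x else 0)"
  have r1: "0 < 1 / r" using r by simp
  have bm: "?b \<in> borel_measurable lebesgue"
    by (intro measurable_compose[OF _ borel_measurable_norm] Linf_c_measurable Linf_c_restrict \<phi> E)
  have eq: "(\<integral>\<^sup>+x\<in>E. ennreal (norm (F x) * norm (\<phi> x)) \<partial>lebesgue) = (\<integral>\<^sup>+x. ennreal (norm (F x) * ?b x) \<partial>lebesgue)"
    by (intro nn_integral_cong) (auto simp: indicator_def)
  also have "\<dots> \<le> Lnorm lebesgue q0 F * epow (\<integral>\<^sup>+x. ennreal (?b x powr (1 / r)) \<partial>lebesgue) r"
    unfolding r(1) by (rule Lnorm_Holder[OF F bm norm_ge_zero q0])
  also have "epow (\<integral>\<^sup>+x. ennreal (?b x powr (1 / r)) \<partial>lebesgue) r = ennreal (Nint (1 / r) \<phi> E powr r)"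
    unfolding nn_restrict[OF r1] Nint_eq[OF \<phi> r1] by (simp add: epow_ennreal)
  finally show "(\<integral>\<^sup>+x\<in>E. ennreal (norm (F x) * norm (\<phi> x)) \<partial>lebesgue) \<le> Lnorm lebesgue q0 F * ennreal (Nint (1 / r) \<phi> E powr r)" .
  let ?U = "uniform_measure lebesgue E"
  let ?h = "\<lambda>x. ennreal (norm (F x) * ?b x)" and ?k = "\<lambda>x. ennreal (?b x powr (1 / r))"
  have sets: "measurable ?U N = measurable lebesgue N" for N by (rule measurable_cong_sets) auto
  have hm: "?h \<in> borel_measurable lebesgue"
    by (intro measurable_compose[OF _ measurable_ennreal] borel_measurable_times measurable_compose[OF _ borel_measurable_norm] F
        Linf_c_measurable Linf_c_restrict \<phi> E)
  have km: "?k \<in> borel_measurable lebesgue"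
    by (intro measurable_compose[OF _ measurable_ennreal] powr_real_measurable borel_measurable_const bm)
  have "(\<integral>\<^sup>+x. ?h x \<partial>?U) \<le> Lnorm ?U q0 F * epow (\<integral>\<^sup>+x. ?k x \<partial>?U) r"
    unfolding r(1) by (rule Lnorm_Holder) (use F bm q0 in \<open>simp_all add: sets\<close>)
  moreover have "(\<integral>\<^sup>+x. ?h x \<partial>?U) = (\<integral>\<^sup>+x\<in>E. ennreal (norm (F x) * norm (\<phi> x)) \<partial>lebesgue) / ennreal V"
    unfolding nn_integral_uniform_measure[OF hm E(1)] E(2)
    by (intro arg_cong[of _ _ "\<lambda>x. x / ennreal V"] nn_integral_cong) (auto simp: indicator_def)
  moreover have "(\<integral>\<^sup>+x. ?k x \<partial>?U) = ennreal (Nint (1 / r) \<phi> E / V)"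
  proof -
    have "(\<integral>\<^sup>+x. ?k x \<partial>?U) = (\<integral>\<^sup>+x\<in>E. ?k x \<partial>lebesgue) / ennreal V"
      unfolding nn_integral_uniform_measure[OF km E(1)] E(2) ..
    also have "(\<integral>\<^sup>+x\<in>E. ?k x \<partial>lebesgue) = ennreal (Nint (1 / r) \<phi> E)"
      unfolding Nint_eq[OF \<phi> r1, symmetric] by (intro nn_integral_cong) (auto simp: indicator_def)
    finally show ?thesis using E(3) by (simp add: divide_ennreal)
  qed
  ultimately have le: "(\<integral>\<^sup>+x\<in>E. ennreal (norm (F x) * norm (\<phi> x)) \<partial>lebesgue) / ennreal V \<le>
      Lavg q0 E F * ennreal ((Nint (1 / r) \<phi> E / V) powr r)"
    using E(3) by (simp add: Lavg_def epow_ennreal)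
  have "(\<integral>\<^sup>+x\<in>E. ennreal (norm (F x) * norm (\<phi> x)) \<partial>lebesgue) / ennreal V * ennreal V \<le>
      Lavg q0 E F * ennreal ((Nint (1 / r) \<phi> E / V) powr r) * ennreal V"
    by (rule mult_right_mono[OF le]) simp
  also have "\<dots> = Lavg q0 E F * ennreal ((Nint (1 / r) \<phi> E / V) powr r * V)"
    using E(3) by (simp add: ennreal_mult mult.assoc)
  also have "(Nint (1 / r) \<phi> E / V) powr r * V = V powr (1 - r) * Nint (1 / r) \<phi> E powr r"
    using E(3) by (simp add: powr_divide powr_diff)
  finally show "(\<integral>\<^sup>+x\<in>E. ennreal (norm (F x) * norm (\<phi> x)) \<partial>lebesgue) \<le>
      Lavg q0 E F * ennreal (V powr (1 - r) * Nint (1 / r) \<phi> E powr r)"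
    unfolding ennreal_divide_mult_cancel[OF E(3)] .
qed

lemma rcp_ennreal: "0 < p \<Longrightarrow> rcp (ennreal p) = 1 / p"
  by (simp add: rcp_def inverse_ennreal inverse_eq_divide)

lemma Nint_cel_cube: "Nint p f (cel_cube \<tau> Q) = Nint p f (cel \<tau> Q)"
  by (simp add: Nint_def nn_integral_cel_cube)

lemma cube_mono: assumes "l \<le> l'" shows "cube c l \<subseteq> cube c l'"
proof
  fix x assume x: "x \<in> cube c l"
  have "c $ i - l' / 2 \<le> x $ i \<and> x $ i \<le> c $ i + l' / 2" for i
    using x[unfolded mem_cube, rule_format, of i] assms by linarith
  then show "x \<in> cube c l'" unfolding mem_cube by blast
qed

lemma heat_deriv_0: "heat_deriv L 0 t f = heat L t f"
  by (simp add: heat_deriv_def)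

lemma third_covering:
  fixes c :: "real^'n::finite"
  shows "\<exists>\<tau> R. half_shift \<tau> \<and> fst R = l \<and> cube c (3 powr of_int (l - 1)) \<subseteq> cel \<tau> R"
proof -
  define y where "y i = c $ i / 3 powr of_int l" for i
  define \<tau> :: "real^'n" where "\<tau> = (\<chi> i. if 1 / 6 \<le> frac (y i) \<and> frac (y i) < 5 / 6 then 0 else 1 / 2)"
  have "half_shift \<tau>" by (simp add: half_shift_def \<tau>_def)
  moreover have "cube c (3 powr of_int (l - 1)) \<subseteq> cel \<tau> (cel_at \<tau> l c)"
  proof
    fix x assume x: "x \<in> cube c (3 powr of_int (l - 1))"
    have "\<lfloor>x $ i / 3 powr of_int l - \<tau> $ i\<rfloor> = \<lfloor>y i - \<tau> $ i\<rfloor>" for i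
    proof -
      have s: "3 powr of_int (l - 1) = 3 powr of_int l / (3::real)" by (simp add: powr_diff)
      have p: "(0::real) < 3 powr of_int l" by simp
      have "c $ i - 3 powr of_int l / 6 \<le> x $ i" "x $ i \<le> c $ i + 3 powr of_int l / 6"
        using x[unfolded mem_cube s, rule_format, of i] by linarith+
      then have "(c $ i - 3 powr of_int l / 6) / 3 powr of_int l \<le> x $ i / 3 powr of_int l"
        "x $ i / 3 powr of_int l \<le> (c $ i + 3 powr of_int l / 6) / 3 powr of_int l"
        by (simp_all add: divide_right_mono)
      then have b: "y i - 1 / 6 \<le> x $ i / 3 powr of_int l" "x $ i / 3 powr of_int l \<le> y i + 1 / 6"
        using p by (simp_all add: y_def diff_divide_distrib add_divide_distrib)
      have f: "0 \<le> frac (y i)" "frac (y i) < 1" "y i = of_int \<lfloor>y i\<rfloor> + frac (y i)"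
        by (simp_all add: frac_lt_1) (simp add: frac_def)
      define k where "k = (if 1 / 6 \<le> frac (y i) then \<lfloor>y i\<rfloor> else \<lfloor>y i\<rfloor> - 1)"
      have t: "of_int k + 1 / 6 \<le> y i - \<tau> $ i" "y i - \<tau> $ i < of_int k + 5 / 6"
        using f by (auto simp: \<tau>_def k_def split: if_splits) linarith+
      have "\<lfloor>y i - \<tau> $ i\<rfloor> = k" "\<lfloor>x $ i / 3 powr of_int l - \<tau> $ i\<rfloor> = k"
        using t b by (intro floor_unique; linarith)+
      then show ?thesis by simp
    qed
    then show "x \<in> cel \<tau> (cel_at \<tau> l c)" by (simp add: cel_def cel_at_def y_def)
  qed
  ultimately show ?thesis by (intro exI[of _ \<tau>] exI[of _ "cel_at \<tau> l c"]) simp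
qed

lemma finite_half_shift: "finite {\<tau> :: real^'n::finite. half_shift \<tau>}"
proof -
  have "{\<tau> :: real^'n. half_shift \<tau>} \<subseteq> (\<lambda>f. \<chi> i. f i) ` (PiE UNIV (\<lambda>_. {0, 1/2}))"
  proof
    fix \<tau> :: "real^'n" assume "\<tau> \<in> {\<tau>. half_shift \<tau>}"
    then show "\<tau> \<in> (\<lambda>f. \<chi> i. f i) ` (PiE UNIV (\<lambda>_. {0, 1/2}))"
      by (intro image_eqI[of _ _ "\<lambda>i. \<tau> $ i"]) (auto simp: half_shift_def PiE_def)
  qed
  then show ?thesis by (rule finite_subset) (intro finite_imageI finite_PiE; simp)
qed

locale heat_setup =
  fixes L :: "'n::finite oper" and p0 \<epsilon> \<kappa> :: real and q0 :: ennreal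
  assumes p0: "1 \<le> p0" and pq0: "ennreal p0 < q0" and eps: "0 < \<epsilon>" and kap: "0 < \<kappa>"
    and A1: "cond_A1 L" and A2: "cond_A2 L (ennreal p0) q0 \<epsilon> \<kappa>"
begin

abbreviation "P \<equiv> 1 / p0"
definition "r = 1 - rcp q0"

lemma rcp_bounds: "0 \<le> rcp q0" "rcp q0 < P"
proof -
  show "0 \<le> rcp q0" by (simp add: rcp_def)
  show "rcp q0 < P"
  proof (cases q0)
    case (real q)
    then have "p0 < q" using pq0 p0 by (simp add: ennreal_less_iff)
    then show ?thesis using real p0 by (simp add: rcp_ennreal frac_less2)
  qed (use p0 in \<open>simp add: rcp_def\<close>)
qed

lemma q0_gt_1: "1 < q0"
proof -
  have "ennreal 1 \<le> ennreal p0" using p0 by (intro ennreal_leI) simp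
  then have "1 \<le> ennreal p0" unfolding ennreal_1 .
  then show ?thesis using pq0 by (rule le_less_trans)
qed

lemma r_bounds: "0 < r" "r \<le> 1" "rcp q0 = 1 - r" "P \<le> 1" "0 < P"
  using rcp_bounds p0 by (auto simp: r_def intro: less_le_trans)

lemma heat_L2: "0 \<le> t \<Longrightarrow> f \<in> L2 \<Longrightarrow> heat L t f \<in> L2"
  using semigroup_heat[OF A1] unfolding semigroup_of_def by blast

lemma heat_add: "0 \<le> t \<Longrightarrow> f \<in> L2 \<Longrightarrow> g \<in> L2 \<Longrightarrow>
    AE x in lebesgue. heat L t (\<lambda>y. f y + g y) x = heat L t f x + heat L t g x"
  using semigroup_heat[OF A1] unfolding semigroup_of_def by blast

definition kfac :: "real \<Rightarrow> real \<Rightarrow> nat \<Rightarrow> real" where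
  "kfac t l j = max ((3 ^ j * l / t powr (1 / \<kappa>)) powr real CARD('n)) ((3 ^ j * l / t powr (1 / \<kappa>)) powr (real CARD('n) * P)) *
     (1 + t powr (1 / \<kappa>) / l) powr (real CARD('n) * rcp q0) * (1 + 3 ^ j * l / t powr (1 / \<kappa>)) powr (- real CARD('n) - \<epsilon>)"

lemma A2_bounds:
  obtains C where "0 \<le> C"
    "\<And>(t::real) f. 0 < t \<Longrightarrow> f \<in> Linf_c \<Longrightarrow> Lnorm lebesgue q0 (heat L t f) \<le>
       ennreal (C * t powr (- (real CARD('n) / \<kappa>) * (P - rcp q0))) * Lnorm lebesgue (ennreal p0) f"
    "\<And>(t::real) c l j f. 0 < t \<Longrightarrow> 0 < l \<Longrightarrow> 2 \<le> j \<Longrightarrow> f \<in> Linf_c \<Longrightarrow> (\<And>x. x \<notin> annulus j c l \<Longrightarrow> f x = 0) \<Longrightarrow>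
       Lavg q0 (cube c l) (heat L t f) \<le> ennreal (C * kfac t l j) * Lavg (ennreal p0) (annulus j c l) f"
proof -
  have rp: "rcp (ennreal p0) = P" using p0 by (simp add: rcp_ennreal)
  have le: "ennreal p0 \<le> ennreal p0 \<and> ennreal p0 \<le> q0 \<and> q0 \<le> q0" using pq0 by simp
  from A2[unfolded cond_A2_def, rule_format, OF le, of 0]
  obtain C where C: "\<And>t. 0 < t \<Longrightarrow>
      (\<forall>f \<in> L2 \<inter> Lp (ennreal p0). Lnorm lebesgue q0 (heat L t f)
             \<le> ennreal (C * t powr (- (real CARD('n) / \<kappa>) * (P - rcp q0))) * Lnorm lebesgue (ennreal p0) f) \<and>
      (\<forall>c l j. 0 < l \<and> 2 \<le> j \<longrightarrow>
             (\<forall>f \<in> L2 \<inter> Lp (ennreal p0). (\<forall>x. x \<notin> annulus j c l \<longrightarrow> f x = 0) \<longrightarrow>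
                Lavg q0 (cube c l) (heat L t f)
                \<le> ennreal (C * max ((3 ^ j * l / t powr (1 / \<kappa>)) powr real CARD('n)) ((3 ^ j * l / t powr (1 / \<kappa>)) powr (real CARD('n) * P)) *
                     (1 + t powr (1 / \<kappa>) / l) powr (real CARD('n) * rcp q0) *
                     (1 + 3 ^ j * l / t powr (1 / \<kappa>)) powr (- real CARD('n) - \<epsilon>))
                  * Lavg (ennreal p0) (annulus j c l) f))"
    unfolding rp heat_deriv_0 by blast
  have mem: "f \<in> L2 \<inter> Lp (ennreal p0)" if "f \<in> Linf_c" for f :: "'n cfun"
    using Linf_c_L2[OF that] Linf_c_Lp[OF that, of p0] p0 by simp
  show thesis
  proof (rule that[of "\<bar>C\<bar>"])
    fix t :: real and f :: "'n cfun" assume t: "0 < t" and f: "f \<in> Linf_c"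
    have "Lnorm lebesgue q0 (heat L t f) \<le> ennreal (C * t powr (- (real CARD('n) / \<kappa>) * (P - rcp q0))) * Lnorm lebesgue (ennreal p0) f"
      using C[OF t] mem[OF f] by blast
    also have "\<dots> \<le> ennreal (\<bar>C\<bar> * t powr (- (real CARD('n) / \<kappa>) * (P - rcp q0))) * Lnorm lebesgue (ennreal p0) f"
      by (intro mult_right_mono ennreal_leI) auto
    finally show "Lnorm lebesgue q0 (heat L t f) \<le> ennreal (\<bar>C\<bar> * t powr (- (real CARD('n) / \<kappa>) * (P - rcp q0))) * Lnorm lebesgue (ennreal p0) f" .
  next
    fix t l :: real and c and j :: nat and f :: "'n cfun"
    assume t: "0 < t" "0 < l" "2 \<le> j" and f: "f \<in> Linf_c" "\<And>x. x \<notin> annulus j c l \<Longrightarrow> f x = 0"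
    have "Lavg q0 (cube c l) (heat L t f) \<le> ennreal (C * kfac t l j) * Lavg (ennreal p0) (annulus j c l) f"
      using C[OF t(1)] mem[OF f(1)] f(2) t(2,3) unfolding kfac_def mult.assoc by blast
    also have "\<dots> \<le> ennreal (\<bar>C\<bar> * kfac t l j) * Lavg (ennreal p0) (annulus j c l) f"
      by (intro mult_right_mono ennreal_leI) (auto simp: kfac_def le_max_iff_disj)
    finally show "Lavg q0 (cube c l) (heat L t f) \<le> ennreal (\<bar>C\<bar> * kfac t l j) * Lavg (ennreal p0) (annulus j c l) f" .
  qed simp
qed

lemma kfac_le:
  assumes t: "0 < t" "0 < l" "l \<le> t powr (1 / \<kappa>)" "t powr (1 / \<kappa>) \<le> 3 * l"
  shows "kfac t l (Suc j) \<le> 4 powr real CARD('n) * (3 powr - \<epsilon>) ^ j"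
proof -
  define x where "x = 3 ^ Suc j * l / t powr (1 / \<kappa>)"
  define y where "y = t powr (1 / \<kappa>) / l"
  have tp: "0 < t powr (1 / \<kappa>)" using t by simp
  have xj: "3 ^ j \<le> x"
  proof -
    have "3 ^ j * t powr (1 / \<kappa>) \<le> 3 ^ j * (3 * l)" by (intro mult_left_mono t) simp
    then show ?thesis using tp by (simp add: x_def pos_le_divide_eq mult_ac)
  qed
  have x1: "1 \<le> x" using xj one_le_power[of "3::real" j] by linarith
  have "y \<le> 3" unfolding y_def using t by (subst pos_divide_le_eq) auto
  then have y: "0 \<le> y" "1 + y \<le> 4" using t tp by (auto simp: y_def)
  have "real CARD('n) * P \<le> real CARD('n) * 1" using r_bounds by (intro mult_left_mono) auto
  then have NP: "real CARD('n) / p0 \<le> real CARD('n)" by simp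
  have mx: "max (x powr real CARD('n)) (x powr (real CARD('n) * P)) = x powr real CARD('n)"
    using x1 r_bounds using NP by (intro max_absorb1 powr_mono) auto
  have "kfac t l (Suc j) = x powr real CARD('n) * (1 + y) powr (real CARD('n) * rcp q0) * (1 + x) powr (- real CARD('n) - \<epsilon>)"
    unfolding kfac_def x_def[symmetric] y_def[symmetric] mx ..
  also have "\<dots> \<le> x powr real CARD('n) * 4 powr real CARD('n) * x powr (- real CARD('n) - \<epsilon>)"
  proof (intro mult_mono)
    have "rcp q0 \<le> 1" using r_bounds(1,3) by linarith
    then have "real CARD('n) * rcp q0 \<le> real CARD('n) * 1" by (intro mult_left_mono) auto
    then have "(1 + y) powr (real CARD('n) * rcp q0) \<le> (1 + y) powr real CARD('n)"
      using y by (intro powr_mono) auto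
    also have "\<dots> \<le> 4 powr real CARD('n)" using y by (intro powr_mono2) auto
    finally show "(1 + y) powr (real CARD('n) * rcp q0) \<le> 4 powr real CARD('n)" .
    show "(1 + x) powr (- real CARD('n) - \<epsilon>) \<le> x powr (- real CARD('n) - \<epsilon>)"
      using x1 eps by (intro powr_mono2') auto
  qed auto
  also have "\<dots> = 4 powr real CARD('n) * x powr - \<epsilon>"
    using x1 by (simp add: powr_diff powr_minus field_simps)
  also have "x powr - \<epsilon> \<le> (3 ^ j) powr - \<epsilon>"
    using xj eps by (intro powr_mono2') auto
  also have "(3 ^ j) powr - \<epsilon> = (3 powr - \<epsilon>) ^ j"
    by (simp add: powr_powr mult.commute flip: powr_realpow)
  finally show ?thesis by simp
qed

definition bd :: "real \<Rightarrow> 'n cfun \<Rightarrow> 'n cfun \<Rightarrow> real^'n \<Rightarrow> real \<Rightarrow> nat \<Rightarrow> real" where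
  "bd C f \<phi> c l j = C * 4 powr real CARD('n) * (3 powr - \<epsilon>) ^ j * ((3 ^ j * l) ^ CARD('n)) powr (- P) * (l ^ CARD('n)) powr (1 - r) *
     Nint p0 f (cube c (3 ^ Suc j * l)) powr P * Nint (1 / r) \<phi> (cube c l) powr r"

definition region :: "real^'n \<Rightarrow> real \<Rightarrow> nat \<Rightarrow> (real^'n) set" where
  "region c l j = (if j = 0 then cube c (3 * l) else annulus (Suc j) c l)"

lemma annulus_lebesgue: "annulus j c l \<in> sets lebesgue"
  unfolding annulus_def by (intro sets.Diff cube_lebesgue)

lemma region_lebesgue: "region c l j \<in> sets lebesgue"
  by (simp add: region_def annulus_lebesgue cube_lebesgue del: sets_completion)

lemma local_bounds:
  obtains C where "0 \<le> C" "\<And>t l c f \<phi> j. 0 < t \<Longrightarrow> 0 < l \<Longrightarrow> l \<le> t powr (1 / \<kappa>) \<Longrightarrow> t powr (1 / \<kappa>) \<le> 3 * l \<Longrightarrow>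
    f \<in> Linf_c \<Longrightarrow> \<phi> \<in> Linf_c \<Longrightarrow>
    (\<integral>\<^sup>+x\<in>cube c l. ennreal (norm (heat L t (\<lambda>x. if x \<in> region c l j then f x else 0) x) * norm (\<phi> x)) \<partial>lebesgue)
     \<le> ennreal (bd C f \<phi> c l j)"
proof -
  obtain C where C: "0 \<le> C"
    "\<And>(t::real) f. 0 < t \<Longrightarrow> f \<in> Linf_c \<Longrightarrow> Lnorm lebesgue q0 (heat L t f) \<le>
       ennreal (C * t powr (- (real CARD('n) / \<kappa>) * (P - rcp q0))) * Lnorm lebesgue (ennreal p0) f"
    "\<And>(t::real) c l j f. 0 < t \<Longrightarrow> 0 < l \<Longrightarrow> 2 \<le> j \<Longrightarrow> f \<in> Linf_c \<Longrightarrow> (\<And>x. x \<notin> annulus j c l \<Longrightarrow> f x = 0) \<Longrightarrow>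
       Lavg q0 (cube c l) (heat L t f) \<le> ennreal (C * kfac t l j) * Lavg (ennreal p0) (annulus j c l) f"
    by (rule A2_bounds) blast
  show thesis
  proof (rule that[OF C(1)])
    fix t l :: real and c j and f \<phi> :: "'n cfun"
    assume t: "0 < t" "0 < l" "l \<le> t powr (1 / \<kappa>)" "t powr (1 / \<kappa>) \<le> 3 * l" and f: "f \<in> Linf_c" and \<phi>: "\<phi> \<in> Linf_c"
    let ?fE = "\<lambda>x. if x \<in> region c l j then f x else 0"
    have fE: "?fE \<in> Linf_c" by (rule Linf_c_restrict[OF f region_lebesgue])
    have Tm: "heat L t ?fE \<in> borel_measurable lebesgue"
      using heat_L2[of t ?fE] t(1) Linf_c_L2[OF fE] L2_measurable by simp
    have V: "emeasure lebesgue (cube c l) = ennreal (l ^ CARD('n))" "0 < l ^ CARD('n)"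
      using t(2) emeasure_cube[of l c] by simp_all
    have p00: "0 < p0" using p0 by simp
    define N M where "N = Nint p0 f (cube c (3 ^ Suc j * l))" and "M = Nint (1 / r) \<phi> (cube c l)"
    show "(\<integral>\<^sup>+x\<in>cube c l. ennreal (norm (heat L t ?fE x) * norm (\<phi> x)) \<partial>lebesgue) \<le> ennreal (bd C f \<phi> c l j)"
    proof (cases "j = 0")
      case True
      have "(\<integral>\<^sup>+x\<in>cube c l. ennreal (norm (heat L t ?fE x) * norm (\<phi> x)) \<partial>lebesgue) \<le>
         Lnorm lebesgue q0 (heat L t ?fE) * ennreal (M powr r)"
        unfolding M_def by (rule Holder_cube(1)[OF Tm \<phi> q0_gt_1 r_def r_bounds(1) cube_lebesgue V])
      also have "\<dots> \<le> ennreal (C * t powr (- (real CARD('n) / \<kappa>) * (P - rcp q0))) * Lnorm lebesgue (ennreal p0) ?fE * ennreal (M powr r)"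
        by (intro mult_right_mono C(2) t fE) simp
      also have "Lnorm lebesgue (ennreal p0) ?fE = ennreal (N powr P)"
        using Lnorm_restrict[OF f p00, of "region c l j"] True by (simp add: region_def N_def)
      also have "ennreal (C * t powr (- (real CARD('n) / \<kappa>) * (P - rcp q0))) * ennreal (N powr P) * ennreal (M powr r) =
          ennreal (C * t powr (- (real CARD('n) / \<kappa>) * (P - rcp q0)) * N powr P * M powr r)"
        using C(1) by (simp add: ennreal_mult)
      also have "\<dots> \<le> ennreal (bd C f \<phi> c l j)"
      proof (rule ennreal_leI)
        have "t powr (- (real CARD('n) / \<kappa>) * (P - rcp q0)) = (t powr (1 / \<kappa>)) powr (- real CARD('n) * (P - rcp q0))"
          by (simp add: powr_powr)
        also have "\<dots> \<le> l powr (- real CARD('n) * (P - rcp q0))"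
          using t rcp_bounds by (intro powr_mono2') (auto simp: mult_nonneg_nonneg)
        also have "\<dots> = (l ^ CARD('n)) powr (- P) * (l ^ CARD('n)) powr (1 - r)"
          using t(2) by (simp add: powr_powr r_bounds(3) algebra_simps flip: powr_realpow powr_add)
        also have "\<dots> \<le> 4 powr real CARD('n) * ((l ^ CARD('n)) powr (- P) * (l ^ CARD('n)) powr (1 - r))"
          using mult_right_mono[OF ge_one_powr_ge_zero[of 4 "real CARD('n)"], of "(l ^ CARD('n)) powr (- P) * (l ^ CARD('n)) powr (1 - r)"] by simp
        finally have "C * t powr (- (real CARD('n) / \<kappa>) * (P - rcp q0)) * (N powr P * M powr r) \<le>
           C * (4 powr real CARD('n) * ((l ^ CARD('n)) powr (- P) * (l ^ CARD('n)) powr (1 - r))) * (N powr P * M powr r)"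
          using C(1) by (intro mult_right_mono mult_left_mono) auto
        then show "C * t powr (- (real CARD('n) / \<kappa>) * (P - rcp q0)) * N powr P * M powr r \<le> bd C f \<phi> c l j"
          using True by (simp add: bd_def N_def M_def mult_ac)
      qed
      finally show ?thesis .
    next
      case False
      have reg: "region c l j = annulus (Suc j) c l" using False by (simp add: region_def)
      define VA where "VA = (3 ^ Suc j * l) ^ CARD('n) - (3 ^ j * l) ^ CARD('n)"
      have VA: "(3 ^ j * l) ^ CARD('n) \<le> VA" "0 < VA"
      proof -
        have "(3::real) ^ 1 \<le> 3 ^ CARD('n)" by (intro power_increasing) (auto simp: Suc_leI)
        then have "3 * (3 ^ j * l) ^ CARD('n) \<le> 3 ^ CARD('n) * (3 ^ j * l) ^ CARD('n)"
          using t by (intro mult_right_mono) auto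
        moreover have "3 ^ CARD('n) * (3 ^ j * l) ^ CARD('n) = (3 ^ Suc j * l) ^ CARD('n)"
          by (simp add: power_mult_distrib)
        moreover have "0 < (3 ^ j * l) ^ CARD('n)" using t by simp
        ultimately show "(3 ^ j * l) ^ CARD('n) \<le> VA" "0 < VA" unfolding VA_def by linarith+
      qed
      have Vann: "emeasure lebesgue (annulus (Suc j) c l) = ennreal VA"
      proof -
        have e: "emeasure lebesgue (cube c (3 ^ i * l)) = ennreal ((3 ^ i * l) ^ CARD('n))" for i
          using t by (intro emeasure_cube) simp
        have "emeasure lebesgue (cube c (3 ^ Suc j * l) - cube c (3 ^ j * l)) =
          emeasure lebesgue (cube c (3 ^ Suc j * l)) - emeasure lebesgue (cube c (3 ^ j * l))"
        proof (rule emeasure_Diff[OF _ cube_lebesgue cube_lebesgue])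
          show "emeasure lebesgue (cube c (3 ^ j * l)) \<noteq> \<infinity>" unfolding e by simp
          show "cube c (3 ^ j * l) \<subseteq> cube c (3 ^ Suc j * l)" using t by (intro cube_mono) simp
        qed
        also have "\<dots> = ennreal VA" unfolding e VA_def using t by (intro ennreal_minus) simp
        finally show ?thesis by (simp only: annulus_def diff_Suc_1)
      qed
      define NA where "NA = Nint p0 f (annulus (Suc j) c l)"
      have NA: "NA \<le> N" "0 \<le> NA" unfolding NA_def N_def
        by (intro Nint_mono[OF f p00]) (auto simp: annulus_def)
      have "(\<integral>\<^sup>+x\<in>cube c l. ennreal (norm (heat L t ?fE x) * norm (\<phi> x)) \<partial>lebesgue) \<le>
         Lavg q0 (cube c l) (heat L t ?fE) * ennreal ((l ^ CARD('n)) powr (1 - r) * M powr r)"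
        unfolding M_def by (rule Holder_cube(2)[OF Tm \<phi> q0_gt_1 r_def r_bounds(1) cube_lebesgue V])
      also have "\<dots> \<le> ennreal (C * kfac t l (Suc j)) * Lavg (ennreal p0) (annulus (Suc j) c l) ?fE *
         ennreal ((l ^ CARD('n)) powr (1 - r) * M powr r)"
        using False reg by (intro mult_right_mono C(3) t fE) auto
      also have "Lavg (ennreal p0) (annulus (Suc j) c l) ?fE = ennreal ((NA / VA) powr P)"
        unfolding reg NA_def by (rule Lavg_restrict[OF f p00 annulus_lebesgue Vann VA(2)])
      also have "ennreal (C * kfac t l (Suc j)) * ennreal ((NA / VA) powr P) * ennreal ((l ^ CARD('n)) powr (1 - r) * M powr r) =
        ennreal (C * kfac t l (Suc j) * (NA / VA) powr P * ((l ^ CARD('n)) powr (1 - r) * M powr r))"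
        using C(1) by (simp add: ennreal_mult kfac_def le_max_iff_disj)
      also have "\<dots> \<le> ennreal (bd C f \<phi> c l j)"
      proof (rule ennreal_leI)
        have "(NA / VA) powr P \<le> (N / (3 ^ j * l) ^ CARD('n)) powr P"
          using NA VA t r_bounds by (intro powr_mono2 frac_le) auto
        also have "\<dots> = ((3 ^ j * l) ^ CARD('n)) powr (- P) * N powr P"
          using t NA by (simp add: powr_divide powr_minus_divide)
        finally have 1: "(NA / VA) powr P \<le> ((3 ^ j * l) ^ CARD('n)) powr (- P) * N powr P" .
        have "C * kfac t l (Suc j) * (NA / VA) powr P * ((l ^ CARD('n)) powr (1 - r) * M powr r) \<le>
          C * (4 powr real CARD('n) * (3 powr - \<epsilon>) ^ j) * (((3 ^ j * l) ^ CARD('n)) powr (- P) * N powr P) * ((l ^ CARD('n)) powr (1 - r) * M powr r)"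
          using C(1) by (intro mult_right_mono mult_mono mult_left_mono kfac_le[OF t] 1) auto
        then show "C * kfac t l (Suc j) * (NA / VA) powr P * ((l ^ CARD('n)) powr (1 - r) * M powr r) \<le> bd C f \<phi> c l j"
          by (simp add: bd_def N_def M_def mult_ac)
      qed
      finally show ?thesis .
    qed
  qed
qed

lemma cube_bound:
  obtains C where "0 \<le> C" "\<And>t l c f \<phi>. 0 < t \<Longrightarrow> 0 < l \<Longrightarrow> l \<le> t powr (1 / \<kappa>) \<Longrightarrow> t powr (1 / \<kappa>) \<le> 3 * l \<Longrightarrow>
    f \<in> Linf_c \<Longrightarrow> \<phi> \<in> Linf_c \<Longrightarrow>
    (\<integral>\<^sup>+x\<in>cube c l. ennreal (norm (heat L t f x) * norm (\<phi> x)) \<partial>lebesgue) \<le> (\<Sum>j. ennreal (bd C f \<phi> c l j))"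
proof -
  obtain C where C: "0 \<le> C" "\<And>t l c f \<phi> j. 0 < t \<Longrightarrow> 0 < l \<Longrightarrow> l \<le> t powr (1 / \<kappa>) \<Longrightarrow> t powr (1 / \<kappa>) \<le> 3 * l \<Longrightarrow>
    f \<in> Linf_c \<Longrightarrow> \<phi> \<in> Linf_c \<Longrightarrow>
    (\<integral>\<^sup>+x\<in>cube c l. ennreal (norm (heat L t (\<lambda>x. if x \<in> region c l j then f x else 0) x) * norm (\<phi> x)) \<partial>lebesgue)
     \<le> ennreal (bd C f \<phi> c l j)"
    by (rule local_bounds) blast
  show thesis
  proof (rule that[OF C(1)])
    fix t l :: real and c and f \<phi> :: "'n cfun"
    assume t: "0 < t" "0 < l" "l \<le> t powr (1 / \<kappa>)" "t powr (1 / \<kappa>) \<le> 3 * l" and f: "f \<in> Linf_c" and \<phi>: "\<phi> \<in> Linf_c"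
    define S where "S m = (\<lambda>x. if x \<in> cube c (3 ^ Suc m * l) then f x else 0)" for m
    have SL: "S m \<in> Linf_c" for m unfolding S_def by (rule Linf_c_restrict[OF f cube_lebesgue])
    have \<phi>m: "(\<lambda>x. norm (\<phi> x)) \<in> borel_measurable lebesgue"
      by (rule measurable_compose[OF Linf_c_measurable[OF \<phi>] borel_measurable_norm])
    have hm: "(\<lambda>x. ennreal (norm (heat L t g x) * norm (\<phi> x)) * indicator (cube c l) x) \<in> borel_measurable lebesgue"
      if "g \<in> Linf_c" for g
      by (intro borel_measurable_times_ennreal measurable_compose[OF _ measurable_ennreal] borel_measurable_times \<phi>m
          measurable_compose[OF _ borel_measurable_norm] L2_measurable heat_L2 Linf_c_L2 that
          borel_measurable_indicator cube_lebesgue) (use t in simp)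
    have ind: "(\<integral>\<^sup>+x\<in>cube c l. ennreal (norm (heat L t (S m) x) * norm (\<phi> x)) \<partial>lebesgue) \<le> (\<Sum>j<Suc m. ennreal (bd C f \<phi> c l j))" for m
    proof (induction m)
      case 0
      have "S 0 = (\<lambda>x. if x \<in> region c l 0 then f x else 0)" by (simp add: S_def region_def)
      then show ?case using C(2)[OF t f \<phi>, of c 0] by simp
    next
      case (Suc m)
      let ?g = "\<lambda>x. if x \<in> region c l (Suc m) then f x else 0"
      have gL: "?g \<in> Linf_c" by (rule Linf_c_restrict[OF f region_lebesgue])
      have sub: "cube c (3 ^ Suc m * l) \<subseteq> cube c (3 ^ Suc (Suc m) * l)" using t by (intro cube_mono) simp
      have eq: "S (Suc m) = (\<lambda>x. S m x + ?g x)"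
        using sub by (auto simp: S_def region_def annulus_def fun_eq_iff simp del: power_Suc)
      have "AE x in lebesgue. heat L t (S (Suc m)) x = heat L t (S m) x + heat L t ?g x"
        unfolding eq using t by (intro heat_add Linf_c_L2 SL gL) simp
      then have "(\<integral>\<^sup>+x\<in>cube c l. ennreal (norm (heat L t (S (Suc m)) x) * norm (\<phi> x)) \<partial>lebesgue) \<le>
        (\<integral>\<^sup>+x. ennreal (norm (heat L t (S m) x) * norm (\<phi> x)) * indicator (cube c l) x +
           ennreal (norm (heat L t ?g x) * norm (\<phi> x)) * indicator (cube c l) x \<partial>lebesgue)"
      proof (intro nn_integral_mono_AE, eventually_elim)
        case (elim x)
        have "norm (heat L t (S (Suc m)) x) * norm (\<phi> x) \<le> norm (heat L t (S m) x) * norm (\<phi> x) + norm (heat L t ?g x) * norm (\<phi> x)"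
          unfolding elim distrib_right[symmetric] by (intro mult_right_mono norm_triangle_ineq) simp
        then have "ennreal (norm (heat L t (S (Suc m)) x) * norm (\<phi> x)) \<le>
          ennreal (norm (heat L t (S m) x) * norm (\<phi> x)) + ennreal (norm (heat L t ?g x) * norm (\<phi> x))"
          by (simp add: ennreal_leI flip: ennreal_plus)
        then show ?case by (cases "x \<in> cube c l") simp_all
      qed
      also have "\<dots> = (\<integral>\<^sup>+x\<in>cube c l. ennreal (norm (heat L t (S m) x) * norm (\<phi> x)) \<partial>lebesgue) +
          (\<integral>\<^sup>+x\<in>cube c l. ennreal (norm (heat L t ?g x) * norm (\<phi> x)) \<partial>lebesgue)"
        by (rule nn_integral_add[OF hm[OF SL] hm[OF gL]])
      also have "\<dots> \<le> (\<Sum>j<Suc m. ennreal (bd C f \<phi> c l j)) + ennreal (bd C f \<phi> c l (Suc m))"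
        by (intro add_mono Suc C(2)[OF t f \<phi>])
      finally show ?case by simp
    qed
    obtain a where a: "\<And>x. f x \<noteq> 0 \<Longrightarrow> norm x \<le> a" by (rule Linf_c_bounds[OF f]) blast
    obtain m where m: "2 * (\<bar>a\<bar> + norm c) / l < 3 ^ m" using real_arch_pow[of 3] by auto
    have "S m = f"
    proof
      fix x
      have "x \<in> cube c (3 ^ Suc m * l)" if "f x \<noteq> 0"
      proof -
        have "2 * (\<bar>a\<bar> + norm c) < 3 ^ m * l" using m t by (simp add: pos_divide_less_eq)
        also have "\<dots> \<le> 3 ^ Suc m * l" using t by simp
        finally have b: "\<bar>a\<bar> + norm c < 3 ^ Suc m * l / 2" by simp
        have "\<bar>x $ i - c $ i\<bar> \<le> \<bar>a\<bar> + norm c" for i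
          using component_le_norm_cart[of x i] component_le_norm_cart[of c i] a[OF that] by linarith
        then have "\<bar>x $ i - c $ i\<bar> \<le> 3 ^ Suc m * l / 2" for i using b less_imp_le le_less_trans by blast
        then have "c $ i - 3 ^ Suc m * l / 2 \<le> x $ i \<and> x $ i \<le> c $ i + 3 ^ Suc m * l / 2" for i
          unfolding abs_le_iff by (metis add.commute diff_le_eq le_diff_eq minus_diff_eq)
        then show ?thesis unfolding mem_cube by blast
      qed
      then show "S m x = f x" by (auto simp: S_def)
    qed
    then have "(\<integral>\<^sup>+x\<in>cube c l. ennreal (norm (heat L t f x) * norm (\<phi> x)) \<partial>lebesgue) \<le> (\<Sum>j<Suc m. ennreal (bd C f \<phi> c l j))"
      using ind[of m] by simp
    also have "\<dots> \<le> (\<Sum>j. ennreal (bd C f \<phi> c l j))" by (intro sum_le_suminf) auto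
    finally show "(\<integral>\<^sup>+x\<in>cube c l. ennreal (norm (heat L t f x) * norm (\<phi> x)) \<partial>lebesgue) \<le> (\<Sum>j. ennreal (bd C f \<phi> c l j))" .
  qed
qed

end

lemma sum_le_nn_count_space:
  assumes "finite B" shows "sum f B \<le> (\<integral>\<^sup>+x. f x \<partial>count_space UNIV)"
proof -
  have "sum f B = (\<integral>\<^sup>+x. f x * indicator B x \<partial>count_space UNIV)"
    using assms by (simp add: nn_integral_count_space_indicator[symmetric] nn_integral_count_space_finite)
  also have "\<dots> \<le> (\<integral>\<^sup>+x. f x \<partial>count_space UNIV)"
    by (intro nn_integral_mono) (auto simp: indicator_def)
  finally show ?thesis .
qed

lemma nn_integral_cells:
  fixes h :: "real^'n::finite \<Rightarrow> ennreal"
  assumes h: "h \<in> borel_measurable lebesgue"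
  shows "(\<integral>\<^sup>+x. h x \<partial>lebesgue) = (\<integral>\<^sup>+m. (\<integral>\<^sup>+x\<in>cel \<tau> (k, m). h x \<partial>lebesgue) \<partial>count_space (UNIV :: (int^'n) set))"
proof -
  have "h x = (\<integral>\<^sup>+m. h x * indicator (cel \<tau> (k, m)) x \<partial>count_space UNIV)" for x
  proof -
    define m0 where "m0 = snd (cel_at \<tau> k x)"
    have m0: "cel_at \<tau> k x = (k, m0)" by (simp add: m0_def prod_eq_iff)
    have "x \<in> cel \<tau> (k, m) \<longleftrightarrow> m = m0" for m
      using mem_cel_at[of x \<tau> k] cel_unique[of x \<tau> "(k, m)" "(k, m0)"] unfolding m0 by auto
    then have "(\<integral>\<^sup>+m. h x * indicator (cel \<tau> (k, m)) x \<partial>count_space UNIV) = (\<integral>\<^sup>+m. h x * indicator {m0} m \<partial>count_space UNIV)"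
      by (intro nn_integral_cong) (simp add: indicator_def)
    also have "\<dots> = h x" by (subst nn_integral_indicator_singleton) auto
    finally show ?thesis by simp
  qed
  then have "(\<integral>\<^sup>+x. h x \<partial>lebesgue) = (\<integral>\<^sup>+x. (\<integral>\<^sup>+m. h x * indicator (cel \<tau> (k, m)) x \<partial>count_space (UNIV :: (int^'n) set)) \<partial>lebesgue)"
    by (rule nn_integral_cong)
  also have "\<dots> = (\<integral>\<^sup>+m. (\<integral>\<^sup>+x\<in>cel \<tau> (k, m). h x \<partial>lebesgue) \<partial>count_space UNIV)"
    by (intro nn_integral_count_space_nn_integral borel_measurable_times_ennreal h borel_measurable_indicator cel_lebesgue) auto
  finally show ?thesis .
qed

lemma half_shift_0: "half_shift 0"
  by (simp add: half_shift_def)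

lemma sub_sum:
  fixes f :: "'n::finite cfun"
  assumes f: "f \<in> Linf_c" and r: "0 < r" "r \<le> 1" and B: "finite B" "\<And>m. m \<in> B \<Longrightarrow> cel 0 (k, m) \<subseteq> cel \<tau> R"
    and R: "fst R = k + int d"
  shows "(\<Sum>m\<in>B. Nint (1 / r) f (cel 0 (k, m)) powr r) \<le> (3 ^ CARD('n)) powr (real d * (1 - r)) * Nint (1 / r) f (cel \<tau> R) powr r"
proof -
  let ?M = "\<lambda>m. Nint (1 / r) f (cel 0 (k, m))" and ?X = "Nint (1 / r) f (cel \<tau> R)"
  define B' where "B' = {m\<in>B. 0 < ?M m}"
  have fin: "finite B'" using B by (simp add: B'_def)
  have r1: "0 < 1 / r" using r by simp
  have "(\<Sum>m\<in>B. ?M m powr r) = (\<Sum>m\<in>B'. ?M m powr r)"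
    unfolding B'_def by (rule sum.mono_neutral_right[OF B(1)]) (auto simp: not_less antisym)
  also have "\<dots> \<le> (3 ^ CARD('n)) powr (real d * (1 - r)) * ?X powr r"
  proof (cases "B' = {}")
    case False
    then obtain m where m: "m \<in> B'" by blast
    have X: "0 < ?X" using m Nint_mono[OF f r1 B(2)[of m]] by (auto simp: B'_def)
    have inj: "inj_on (Pair k) B'" by (simp add: inj_on_def)
    have sum_le: "(\<Sum>m\<in>B'. \<integral>\<^sup>+x\<in>cel 0 (k, m). g x \<partial>lebesgue) \<le> (\<integral>\<^sup>+x\<in>cel \<tau> R. g x \<partial>lebesgue)"
      if g: "g \<in> borel_measurable lebesgue" for g
    proof -
      have "(\<Sum>Q\<in>Pair k ` B'. \<integral>\<^sup>+x\<in>cel 0 Q. g x \<partial>lebesgue) \<le> (\<integral>\<^sup>+x\<in>cel \<tau> R. g x \<partial>lebesgue)"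
      proof (rule nn_integral_cel_sum_le[OF half_shift_0 g])
        fix Q Q' assume Q: "Q \<in> Pair k ` B'" "Q' \<in> Pair k ` B'" "cel_le 0 Q Q'"
        then obtain x where "x \<in> cel 0 Q" "x \<in> cel 0 Q'" using cel_nonempty[of 0 Q] by (auto simp: cel_le_def)
        then show "Q = Q'" using Q by (intro cel_unique) auto
      qed (use fin B(2) in \<open>auto simp: B'_def\<close>)
      then show ?thesis by (simp add: sum.reindex[OF inj])
    qed
    have "ennreal (\<Sum>m\<in>B'. ?M m) \<le> ennreal ?X"
    proof -
      have "(\<lambda>x. ennreal (norm (f x) powr (1 / r))) \<in> borel_measurable lebesgue"
        by (intro measurable_compose[OF _ measurable_ennreal] powr_real_measurable borel_measurable_const
            measurable_compose[OF _ borel_measurable_norm] Linf_c_measurable[OF f])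
      from sum_le[OF this] show ?thesis unfolding Nint_eq[OF f r1] by (simp add: sum_ennreal)
    qed
    then have 1: "(\<Sum>m\<in>B'. ?M m) \<le> ?X" using X by (subst (asm) ennreal_le_iff) auto
    have "(\<Sum>m\<in>B'. ennreal ((3 powr k) ^ CARD('n))) \<le> ennreal ((3 powr real_of_int (fst R)) ^ CARD('n))"
    proof -
      have i: "(\<integral>\<^sup>+x\<in>cel s Q. 1 \<partial>lebesgue) = emeasure lebesgue (cel s Q)" for s and Q :: "'n cell"
        by (simp only: mult_1_left nn_integral_indicator[OF cel_lebesgue])
      from sum_le[of "\<lambda>x. 1"] show ?thesis unfolding i emeasure_cel fst_conv by simp
    qed
    then have "real (card B') * (3 powr k) ^ CARD('n) \<le> (3 powr real_of_int (fst R)) ^ CARD('n)"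
      by (simp add: ennreal_of_nat_eq_real_of_nat flip: ennreal_mult)
    also have "(3 powr real_of_int (fst R)) ^ CARD('n) = (3 ^ CARD('n)) ^ d * (3 powr k) ^ CARD('n)"
    proof -
      have "3 powr real_of_int (fst R) = 3 ^ d * 3 powr real_of_int k"
        by (simp add: R powr_add powr_realpow)
      then show ?thesis by (simp add: power_mult_distrib power_mult[symmetric] mult.commute)
    qed
    finally have 2: "real (card B') \<le> (3 ^ CARD('n)) ^ d" by simp
    have "(\<Sum>m\<in>B'. ?M m powr r * 1 powr (1 - r) * 1 powr 0) \<le> ?X powr r * ((3 ^ CARD('n)) ^ d) powr (1 - r) * ((3 ^ CARD('n)) ^ d) powr 0"
      by (rule sum_powr3_le) (use fin 1 2 X r in \<open>auto simp: B'_def\<close>)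
    also have "\<dots> = (3 ^ CARD('n)) powr (real d * (1 - r)) * ?X powr r"
      by (simp add: powr_powr mult.assoc flip: powr_realpow)
    finally show ?thesis by simp
  qed simp
  finally show ?thesis .
qed

context heat_setup
begin

definition cterm :: "real \<Rightarrow> 'n cfun \<Rightarrow> 'n cfun \<Rightarrow> real^'n \<Rightarrow> 'n cell \<Rightarrow> real" where
  "cterm a f \<phi> \<tau> Q = cw \<tau> (\<lambda>x. 1) Q powr a * Nint p0 f (cel \<tau> Q) powr P * Nint (1 / r) \<phi> (cel \<tau> Q) powr r"

definition lev :: "real \<Rightarrow> 'n cfun \<Rightarrow> 'n cfun \<Rightarrow> int \<Rightarrow> ennreal" where
  "lev a f \<phi> l = (\<Sum>\<tau>\<in>Collect half_shift. \<integral>\<^sup>+m. ennreal (cterm a f \<phi> \<tau> (l, m)) \<partial>count_space UNIV)"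

lemma cterm_nonneg: "0 \<le> cterm a f \<phi> \<tau> Q"
  by (simp add: cterm_def)

lemma bd_level:
  assumes C: "0 \<le> C" and f: "f \<in> Linf_c" and \<phi>: "\<phi> \<in> Linf_c" and a: "a = \<alpha> / real CARD('n) - P + rcp q0"
  shows "(\<integral>\<^sup>+m. ennreal (bd C f \<phi> (cel_center 0 (k, m)) (3 powr real_of_int k) j) \<partial>count_space UNIV) \<le>
    ennreal (C * 4 powr real CARD('n) * 3 powr (2 * real CARD('n) * P) * (3 powr - \<epsilon>) ^ j * 3 powr (- real_of_int (k + int j + 2) * \<alpha>)) *
      lev a f \<phi> (k + int j + 2)"
proof (rule nn_integral_count_space_le)
  fix A :: "(int^'n) set" assume A: "finite A"
  define l where "l = k + int j + 2"
  let ?N = "real CARD('n)"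
  define K where "K = C * 4 powr ?N * 3 powr (2 * ?N * P) * (3 powr - \<epsilon>) ^ j * 3 powr (- real_of_int l * \<alpha>)"
  define c0 where "c0 = C * 4 powr ?N * (3 powr - \<epsilon>) ^ j * ((3 ^ j * 3 powr real_of_int k) ^ CARD('n)) powr (- P) *
     ((3 powr real_of_int k) ^ CARD('n)) powr (1 - r)"
  have c0: "0 \<le> c0" using C by (simp add: c0_def)
  have r1: "0 < 1 / r" and p00: "0 < p0" using r_bounds p0 by auto
  have "\<forall>m::int^'n. \<exists>y. half_shift (fst y) \<and> cube (cel_center 0 (k, m)) (3 powr real_of_int (l - 1)) \<subseteq> cel (fst y) (l, snd y)"
  proof
    fix m :: "int^'n"
    obtain \<tau> R where "half_shift \<tau>" "fst R = l" "cube (cel_center 0 (k, m)) (3 powr real_of_int (l - 1)) \<subseteq> cel \<tau> R"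
      using third_covering[of l "cel_center 0 (k, m)"] by blast
    then show "\<exists>y. half_shift (fst y) \<and> cube (cel_center 0 (k, m)) (3 powr real_of_int (l - 1)) \<subseteq> cel (fst y) (l, snd y)"
      by (intro exI[of _ "(\<tau>, snd R)"]) (metis fst_conv snd_conv prod.collapse)
  qed
  from choice[OF this] obtain g :: "int^'n \<Rightarrow> (real^'n) \<times> (int^'n)" where
    g: "\<And>m. half_shift (fst (g m))" "\<And>m. cube (cel_center 0 (k, m)) (3 powr real_of_int (l - 1)) \<subseteq> cel (fst (g m)) (l, snd (g m))"
    by blast
  have sub: "cel 0 (k, m) \<subseteq> cel (fst (g m)) (l, snd (g m))" for m
  proof -
    have "cel 0 (k, m) \<subseteq> cube (cel_center 0 (k, m)) (3 powr real_of_int k)" using cel_subset_cube[of 0 "(k, m)"] by simp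
    also have "\<dots> \<subseteq> cube (cel_center 0 (k, m)) (3 powr real_of_int (l - 1))" by (intro cube_mono) (simp add: l_def)
    finally show ?thesis using g(2)[of m] by blast
  qed
  define Nf where "Nf y = Nint p0 f (cel (fst y) (l, snd y)) powr P" for y :: "(real^'n) \<times> (int^'n)"
  define Mf where "Mf y = Nint (1 / r) \<phi> (cel (fst y) (l, snd y)) powr r" for y :: "(real^'n) \<times> (int^'n)"
  have bdm: "bd C f \<phi> (cel_center 0 (k, m)) (3 powr real_of_int k) j \<le> c0 * Nf (g m) * Nint (1 / r) \<phi> (cel 0 (k, m)) powr r" for m
  proof -
    have s: "3 ^ Suc j * 3 powr real_of_int k = (3::real) powr real_of_int (l - 1)"
      by (simp add: l_def powr_add powr_realpow)
    have M: "Nint (1 / r) \<phi> (cube (cel_center 0 (k, m)) (3 powr real_of_int k)) = Nint (1 / r) \<phi> (cel 0 (k, m))"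
      using Nint_cel_cube[of "1 / r" \<phi> 0 "(k, m)"] by simp
    have "Nint p0 f (cube (cel_center 0 (k, m)) (3 ^ Suc j * 3 powr real_of_int k)) powr P \<le> Nf (g m)"
      unfolding Nf_def s using Nint_mono[OF f p00 g(2)[of m]] r_bounds by (intro powr_mono2) auto
    then show ?thesis
      unfolding bd_def M c0_def[symmetric] using c0 by (intro mult_right_mono mult_left_mono) auto
  qed
  have coef: "c0 * (3 ^ CARD('n)) powr (real (j + 2) * (1 - r)) = K * cw \<tau> (\<lambda>x. 1) (l, m) powr a" for \<tau> :: "real^'n" and m
  proof -
    have nz: "?N \<noteq> 0" by simp
    have 1: "((3 ^ j * 3 powr real_of_int k) ^ CARD('n)) powr (- P) = 3 powr ((real j + real_of_int k) * ?N * (- P))"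
      by (simp add: powr_powr mult_ac add.commute flip: powr_realpow powr_add)
    have 2: "((3 powr real_of_int k) ^ CARD('n)) powr (1 - r) = 3 powr (real_of_int k * ?N * (1 - r))"
      by (simp add: powr_powr mult_ac flip: powr_realpow)
    have 3: "(3 ^ CARD('n)) powr (real (j + 2) * (1 - r)) = (3::real) powr (?N * (real (j + 2) * (1 - r)))"
      by (simp add: powr_powr mult_ac flip: powr_realpow)
    have 4: "cw \<tau> (\<lambda>x. 1) (l, m) powr a = 3 powr (?N * real_of_int l * a)"
      unfolding cw_1 by (simp add: powr_powr mult_ac flip: powr_realpow)
    have "3 powr ((real j + real_of_int k) * ?N * (- P)) * 3 powr (real_of_int k * ?N * (1 - r)) * 3 powr (?N * (real (j + 2) * (1 - r))) =
      (3::real) powr (2 * ?N * P) * 3 powr (- real_of_int l * \<alpha>) * 3 powr (?N * real_of_int l * a)"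
      unfolding powr_add[symmetric]
    proof (rule arg_cong[of _ _ "\<lambda>x. 3 powr x"])
      have "?N * real_of_int l * a = real_of_int l * (\<alpha> - ?N * P + ?N * (1 - r))"
        unfolding a r_bounds(3) using nz by (simp add: field_simps)
      then show "(real j + real_of_int k) * ?N * (- P) + real_of_int k * ?N * (1 - r) + ?N * (real (j + 2) * (1 - r)) =
        2 * ?N * P + - real_of_int l * \<alpha> + ?N * real_of_int l * a"
        by (simp only:) (simp add: l_def algebra_simps)
    qed
    then show ?thesis unfolding c0_def K_def 1 2 3 4 by (simp add: mult_ac)
  qed
  have "(\<Sum>m\<in>A. bd C f \<phi> (cel_center 0 (k, m)) (3 powr real_of_int k) j) \<le>
     (\<Sum>m\<in>A. c0 * Nf (g m) * Nint (1 / r) \<phi> (cel 0 (k, m)) powr r)"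
    by (intro sum_mono bdm)
  also have "\<dots> = (\<Sum>y\<in>g ` A. \<Sum>m\<in>{m\<in>A. g m = y}. c0 * Nf (g m) * Nint (1 / r) \<phi> (cel 0 (k, m)) powr r)"
    by (rule sum.image_gen[OF A])
  also have "\<dots> \<le> (\<Sum>y\<in>g ` A. K * cterm a f \<phi> (fst y) (l, snd y))"
  proof (rule sum_mono)
    fix y assume "y \<in> g ` A"
    have "(\<Sum>m\<in>{m\<in>A. g m = y}. c0 * Nf (g m) * Nint (1 / r) \<phi> (cel 0 (k, m)) powr r) =
      c0 * Nf y * (\<Sum>m\<in>{m\<in>A. g m = y}. Nint (1 / r) \<phi> (cel 0 (k, m)) powr r)"
      unfolding sum_distrib_left by (intro sum.cong) auto
    also have "\<dots> \<le> c0 * Nf y * ((3 ^ CARD('n)) powr (real (j + 2) * (1 - r)) * Mf y)"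
      unfolding Mf_def
    proof (rule mult_left_mono[OF sub_sum[OF \<phi> r_bounds(1,2)]])
      show "cel 0 (k, m) \<subseteq> cel (fst y) (l, snd y)" if "m \<in> {m\<in>A. g m = y}" for m using sub[of m] that by simp
    qed (use A c0 in \<open>auto simp: l_def Nf_def\<close>)
    also have "\<dots> = (c0 * (3 ^ CARD('n)) powr (real (j + 2) * (1 - r))) * Nf y * Mf y" by (simp only: mult_ac)
    also have "\<dots> = K * cterm a f \<phi> (fst y) (l, snd y)"
      unfolding coef[of "fst y" "snd y"] by (simp add: cterm_def Nf_def Mf_def)
    finally show "(\<Sum>m\<in>{m\<in>A. g m = y}. c0 * Nf (g m) * Nint (1 / r) \<phi> (cel 0 (k, m)) powr r) \<le> K * cterm a f \<phi> (fst y) (l, snd y)" .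
  qed
  finally have main: "(\<Sum>m\<in>A. bd C f \<phi> (cel_center 0 (k, m)) (3 powr real_of_int k) j) \<le> K * (\<Sum>y\<in>g ` A. cterm a f \<phi> (fst y) (l, snd y))"
    by (simp add: sum_distrib_left)
  have K0: "0 \<le> K" using C by (simp add: K_def)
  have bd0: "0 \<le> bd C f \<phi> c s j" if "0 \<le> s" for c s using C that by (simp add: bd_def)
  have "(\<Sum>m\<in>A. ennreal (bd C f \<phi> (cel_center 0 (k, m)) (3 powr real_of_int k) j)) =
     ennreal (\<Sum>m\<in>A. bd C f \<phi> (cel_center 0 (k, m)) (3 powr real_of_int k) j)"
    by (rule sum_ennreal) (rule bd0, simp)
  also have "\<dots> \<le> ennreal K * (\<Sum>y\<in>g ` A. ennreal (cterm a f \<phi> (fst y) (l, snd y)))"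
    using main K0 by (simp add: sum_ennreal cterm_nonneg sum_nonneg ennreal_leI flip: ennreal_mult)
  also have "\<dots> \<le> ennreal K * lev a f \<phi> l"
  proof (rule mult_left_mono)
    have "(\<Sum>y\<in>g ` A. ennreal (cterm a f \<phi> (fst y) (l, snd y))) \<le>
      (\<Sum>y\<in>Collect half_shift \<times> snd ` g ` A. ennreal (cterm a f \<phi> (fst y) (l, snd y)))"
    proof (rule sum_mono2)
      show "g ` A \<subseteq> Collect half_shift \<times> snd ` g ` A" 
      proof
        fix y assume "y \<in> g ` A"
        then obtain m where m: "m \<in> A" "y = g m" by blast
        show "y \<in> Collect half_shift \<times> snd ` g ` A" unfolding m(2) mem_Times_iff using g(1) m(1) by blast
      qed
    qed (use A finite_half_shift in auto)
    also have "\<dots> = (\<Sum>\<tau>\<in>Collect half_shift. \<Sum>m\<in>snd ` g ` A. ennreal (cterm a f \<phi> \<tau> (l, m)))"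
      by (simp add: sum.cartesian_product case_prod_unfold)
    also have "\<dots> \<le> lev a f \<phi> l"
      unfolding lev_def using A by (intro sum_mono sum_le_nn_count_space) auto
    finally show "(\<Sum>y\<in>g ` A. ennreal (cterm a f \<phi> (fst y) (l, snd y))) \<le> lev a f \<phi> l" .
  qed simp
  finally show "(\<Sum>m\<in>A. ennreal (bd C f \<phi> (cel_center 0 (k, m)) (3 powr real_of_int k) j)) \<le>
     ennreal (C * 4 powr ?N * 3 powr (2 * ?N * P) * (3 powr - \<epsilon>) ^ j * 3 powr (- real_of_int (k + int j + 2) * \<alpha>)) * lev a f \<phi> (k + int j + 2)"
    unfolding K_def l_def .
qed

lemma heat_prod_measurable:
  assumes "0 \<le> t" "f \<in> Linf_c" "\<phi> \<in> Linf_c"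
  shows "(\<lambda>x. ennreal (norm (heat L t f x) * norm (\<phi> x))) \<in> borel_measurable lebesgue"
  by (intro measurable_compose[OF _ measurable_ennreal] borel_measurable_times
      measurable_compose[OF _ borel_measurable_norm] L2_measurable heat_L2 Linf_c_L2 Linf_c_measurable assms)

theorem heat_form:
  assumes \<alpha>: "0 < \<alpha>" and a: "a = \<alpha> / real CARD('n) - P + rcp q0"
  obtains C where "0 \<le> C" "\<And>f \<phi>. f \<in> Linf_c \<Longrightarrow> \<phi> \<in> Linf_c \<Longrightarrow>
    (\<integral>\<^sup>+t\<in>{0<..}. ennreal (t powr (\<alpha> / \<kappa> - 1)) * (\<integral>\<^sup>+x. ennreal (norm (heat L t f x) * norm (\<phi> x)) \<partial>lebesgue) \<partial>lborel) \<le>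
    ennreal C * (\<Sum>\<tau>\<in>Collect half_shift. \<integral>\<^sup>+Q. ennreal (cterm a f \<phi> \<tau> Q) \<partial>count_space UNIV)"
proof -
  obtain C where C: "0 \<le> C" "\<And>(t::real) l c f \<phi>. 0 < t \<Longrightarrow> 0 < l \<Longrightarrow> l \<le> t powr (1 / \<kappa>) \<Longrightarrow> t powr (1 / \<kappa>) \<le> 3 * l \<Longrightarrow>
    f \<in> Linf_c \<Longrightarrow> \<phi> \<in> Linf_c \<Longrightarrow>
    (\<integral>\<^sup>+x\<in>cube c l. ennreal (norm (heat L t f x) * norm (\<phi> x)) \<partial>lebesgue) \<le> (\<Sum>j. ennreal (bd C f \<phi> c l j))"
    by (rule cube_bound) blast
  define C1 where "C1 = C * 4 powr real CARD('n) * 3 powr (2 * real CARD('n) * P)"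
  define e where "e = 3 powr - \<epsilon>"
  have C1: "0 \<le> C1" using C by (simp add: C1_def)
  have e: "0 \<le> e" "e < 1" using eps by (auto simp: e_def intro: powr_less_one)
  define W where "W = 3 powr (\<alpha> + \<kappa>)"
  show thesis
  proof (rule that[of "W * C1 * (1 / (1 - e))"])
    show "0 \<le> W * C1 * (1 / (1 - e))" using C1 e by (simp add: W_def)
    fix f \<phi> :: "'n cfun" assume f: "f \<in> Linf_c" and \<phi>: "\<phi> \<in> Linf_c"
    define X where "X t = (\<integral>\<^sup>+x. ennreal (norm (heat L t f x) * norm (\<phi> x)) \<partial>lebesgue)" for t
    define B where "B k = (\<Sum>j. ennreal (C1 * e ^ j * 3 powr (- real_of_int (k + int j + 2) * \<alpha>)) * lev a f \<phi> (k + int j + 2))" for k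
    have XB: "X t \<le> B k" if t: "0 < t" "3 powr real_of_int k \<le> t powr (1 / \<kappa>)" "t powr (1 / \<kappa>) \<le> 3 * 3 powr real_of_int k" for t k
    proof -
      have "X t = (\<integral>\<^sup>+m. (\<integral>\<^sup>+x\<in>cel 0 (k, m). ennreal (norm (heat L t f x) * norm (\<phi> x)) \<partial>lebesgue) \<partial>count_space UNIV)"
        unfolding X_def using t f \<phi> by (intro nn_integral_cells heat_prod_measurable) auto
      also have "\<dots> \<le> (\<integral>\<^sup>+m. (\<Sum>j. ennreal (bd C f \<phi> (cel_center 0 (k, m)) (3 powr real_of_int k) j)) \<partial>count_space UNIV)"
      proof (rule nn_integral_mono)
        fix m :: "int^'n"
        have "(\<integral>\<^sup>+x\<in>cel 0 (k, m). ennreal (norm (heat L t f x) * norm (\<phi> x)) \<partial>lebesgue) \<le>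
          (\<integral>\<^sup>+x\<in>cube (cel_center 0 (k, m)) (3 powr real_of_int k). ennreal (norm (heat L t f x) * norm (\<phi> x)) \<partial>lebesgue)"
          using cel_subset_cube[of 0 "(k, m)"] by (intro nn_integral_mono) (auto simp: indicator_def)
        also have "\<dots> \<le> (\<Sum>j. ennreal (bd C f \<phi> (cel_center 0 (k, m)) (3 powr real_of_int k) j))"
          using t f \<phi> by (intro C(2)) auto
        finally show "(\<integral>\<^sup>+x\<in>cel 0 (k, m). ennreal (norm (heat L t f x) * norm (\<phi> x)) \<partial>lebesgue) \<le>
          (\<Sum>j. ennreal (bd C f \<phi> (cel_center 0 (k, m)) (3 powr real_of_int k) j))" .
      qed
      also have "\<dots> = (\<Sum>j. \<integral>\<^sup>+m. ennreal (bd C f \<phi> (cel_center 0 (k, m)) (3 powr real_of_int k) j) \<partial>count_space UNIV)"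
        by (rule nn_integral_suminf) simp
      also have "\<dots> \<le> B k"
        unfolding B_def C1_def e_def by (intro suminf_le bd_level C f \<phi> a) auto
      finally show ?thesis .
    qed
    define S where "S k = {3 powr (real_of_int k * \<kappa>)..3 powr ((real_of_int k + 1) * \<kappa>)}" for k
    have Sm: "S k \<in> sets lborel" for k by (simp add: S_def)
    have "(\<integral>\<^sup>+t\<in>{0<..}. ennreal (t powr (\<alpha> / \<kappa> - 1)) * X t \<partial>lborel) \<le>
      (\<integral>\<^sup>+t. (\<integral>\<^sup>+k. B k * (ennreal (t powr (\<alpha> / \<kappa> - 1)) * indicator (S k) t) \<partial>count_space UNIV) \<partial>lborel)"
    proof (rule nn_integral_mono)
      fix t :: real
      show "ennreal (t powr (\<alpha> / \<kappa> - 1)) * X t * indicator {0<..} t \<le>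
        (\<integral>\<^sup>+k. B k * (ennreal (t powr (\<alpha> / \<kappa> - 1)) * indicator (S k) t) \<partial>count_space UNIV)"
      proof (cases "0 < t")
        case True
        define k where "k = \<lfloor>log 3 (t powr (1 / \<kappa>))\<rfloor>"
        have tp: "0 < t powr (1 / \<kappa>)" using True by simp
        have k: "3 powr real_of_int k \<le> t powr (1 / \<kappa>)" "t powr (1 / \<kappa>) \<le> 3 powr (real_of_int k + 1)"
          using tp by (simp_all add: k_def le_log_iff[symmetric] log_le_iff[symmetric] flip: powr_le_cancel_iff log_less_iff)
        have tt: "t = (t powr (1 / \<kappa>)) powr \<kappa>" using True kap by (simp add: powr_powr)
        have "(3 powr real_of_int k) powr \<kappa> \<le> (t powr (1 / \<kappa>)) powr \<kappa>" "(t powr (1 / \<kappa>)) powr \<kappa> \<le> (3 powr (real_of_int k + 1)) powr \<kappa>"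
          using k kap by (auto intro!: powr_mono2)
        then have "t \<in> S k" unfolding tt[symmetric] by (simp add: S_def powr_powr)
        moreover have "X t \<le> B k" using True k by (intro XB) (auto simp: powr_add)
        ultimately have "ennreal (t powr (\<alpha> / \<kappa> - 1)) * X t * indicator {0<..} t \<le> (\<Sum>k\<in>{k}. B k * (ennreal (t powr (\<alpha> / \<kappa> - 1)) * indicator (S k) t))"
          using True by (simp add: mult.commute mult_right_mono)
        also have "\<dots> \<le> (\<integral>\<^sup>+k. B k * (ennreal (t powr (\<alpha> / \<kappa> - 1)) * indicator (S k) t) \<partial>count_space UNIV)"
          by (rule sum_le_nn_count_space) simp
        finally show ?thesis .
      qed simp
    qed
    also have "\<dots> = (\<integral>\<^sup>+k. (\<integral>\<^sup>+t. B k * (ennreal (t powr (\<alpha> / \<kappa> - 1)) * indicator (S k) t) \<partial>lborel) \<partial>count_space UNIV)"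
      by (rule nn_integral_count_space_nn_integral) (auto simp: S_def)
    also have "\<dots> \<le> (\<integral>\<^sup>+k. (\<Sum>j. ennreal (W * C1 * e ^ j) * lev a f \<phi> (k + (int j + 2))) \<partial>count_space UNIV)"
    proof (rule nn_integral_mono)
      fix k :: int
      have "(\<integral>\<^sup>+t. B k * (ennreal (t powr (\<alpha> / \<kappa> - 1)) * indicator (S k) t) \<partial>lborel) =
        B k * (\<integral>\<^sup>+t. ennreal (t powr (\<alpha> / \<kappa> - 1)) * indicator (S k) t \<partial>lborel)"
        by (rule nn_integral_cmult) (simp add: S_def)
      also have "(\<integral>\<^sup>+t. ennreal (t powr (\<alpha> / \<kappa> - 1)) * indicator (S k) t \<partial>lborel) \<le>
        (\<integral>\<^sup>+t. ennreal (3 powr ((real_of_int k + 1) * \<alpha>) / 3 powr (real_of_int k * \<kappa>)) * indicator (S k) t \<partial>lborel)"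
      proof (rule nn_integral_mono)
        fix t
        show "ennreal (t powr (\<alpha> / \<kappa> - 1)) * indicator (S k) t \<le>
          ennreal (3 powr ((real_of_int k + 1) * \<alpha>) / 3 powr (real_of_int k * \<kappa>)) * indicator (S k) t"
        proof (cases "t \<in> S k")
          case True
          then have t: "3 powr (real_of_int k * \<kappa>) \<le> t" "t \<le> 3 powr ((real_of_int k + 1) * \<kappa>)" by (auto simp: S_def)
          have p: "0 < 3 powr (real_of_int k * \<kappa>)" by simp
          have t0: "0 < t" using p t(1) by linarith
          have "t powr (\<alpha> / \<kappa>) \<le> (3 powr ((real_of_int k + 1) * \<kappa>)) powr (\<alpha> / \<kappa>)"
            using t t0 \<alpha> kap by (intro powr_mono2) auto
          also have "\<dots> = 3 powr ((real_of_int k + 1) * \<alpha>)" using kap by (simp add: powr_powr)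
          finally have 1: "t powr (\<alpha> / \<kappa>) \<le> 3 powr ((real_of_int k + 1) * \<alpha>)" .
          have "t powr (\<alpha> / \<kappa> - 1) = t powr (\<alpha> / \<kappa>) / t" using t0 by (simp add: powr_diff)
          also have "\<dots> \<le> 3 powr ((real_of_int k + 1) * \<alpha>) / 3 powr (real_of_int k * \<kappa>)"
            using t t0 1 by (intro frac_le) auto
          finally show ?thesis using True by (simp add: ennreal_leI)
        qed simp
      qed
      also have "\<dots> = ennreal (3 powr ((real_of_int k + 1) * \<alpha>) / 3 powr (real_of_int k * \<kappa>)) * emeasure lborel (S k)"
        by (rule nn_integral_cmult_indicator[OF Sm])
      also have "\<dots> \<le> ennreal (W * 3 powr (real_of_int k * \<alpha>))"
      proof -
        have "real_of_int k * \<kappa> \<le> (real_of_int k + 1) * \<kappa>" using kap by (simp add: distrib_right)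
        then have "emeasure lborel (S k) = ennreal (3 powr ((real_of_int k + 1) * \<kappa>) - 3 powr (real_of_int k * \<kappa>))"
          unfolding S_def by (intro emeasure_lborel_Icc) simp
        also have "\<dots> \<le> ennreal (3 powr ((real_of_int k + 1) * \<kappa>))" by (intro ennreal_leI) simp
        finally have "ennreal (3 powr ((real_of_int k + 1) * \<alpha>) / 3 powr (real_of_int k * \<kappa>)) * emeasure lborel (S k) \<le>
          ennreal (3 powr ((real_of_int k + 1) * \<alpha>) / 3 powr (real_of_int k * \<kappa>)) * ennreal (3 powr ((real_of_int k + 1) * \<kappa>))"
          by (rule mult_left_mono) simp
        also have "\<dots> = ennreal (W * 3 powr (real_of_int k * \<alpha>))"
          by (simp add: W_def algebra_simps flip: ennreal_mult powr_diff powr_add)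
        finally show ?thesis .
      qed
      also have "B k * ennreal (W * 3 powr (real_of_int k * \<alpha>)) = (\<Sum>j. ennreal (C1 * e ^ j * 3 powr (- real_of_int (k + int j + 2) * \<alpha>)) * lev a f \<phi> (k + int j + 2) * ennreal (W * 3 powr (real_of_int k * \<alpha>)))"
        unfolding B_def by (rule ennreal_suminf_multc[symmetric])
      also have "\<dots> \<le> (\<Sum>j. ennreal (W * C1 * e ^ j) * lev a f \<phi> (k + (int j + 2)))"
      proof (intro suminf_le allI)
        fix j
        have "ennreal (C1 * e ^ j * 3 powr (- real_of_int (k + int j + 2) * \<alpha>)) * ennreal (W * 3 powr (real_of_int k * \<alpha>)) \<le> ennreal (W * C1 * e ^ j)"
        proof -
          have "3 powr (- real_of_int (k + int j + 2) * \<alpha>) * 3 powr (real_of_int k * \<alpha>) = (3::real) powr (- (real j + 2) * \<alpha>)"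
            by (simp add: algebra_simps flip: powr_add)
          also have "\<dots> \<le> 3 powr 0" using \<alpha> by (intro powr_mono mult_nonpos_nonneg) auto
          finally have "W * C1 * e ^ j * (3 powr (- real_of_int (k + int j + 2) * \<alpha>) * 3 powr (real_of_int k * \<alpha>)) \<le> W * C1 * e ^ j * 1"
            using C1 e by (intro mult_left_mono) (auto simp: W_def)
          then have "C1 * e ^ j * 3 powr (- real_of_int (k + int j + 2) * \<alpha>) * (W * 3 powr (real_of_int k * \<alpha>)) \<le> W * C1 * e ^ j"
            by (simp only: mult_ac mult_1_right)
          then show ?thesis using C1 e by (simp add: ennreal_leI W_def flip: ennreal_mult)
        qed
        from mult_right_mono[OF this, of "lev a f \<phi> (k + (int j + 2))"]
        show "ennreal (C1 * e ^ j * 3 powr (- real_of_int (k + int j + 2) * \<alpha>)) * lev a f \<phi> (k + int j + 2) * ennreal (W * 3 powr (real_of_int k * \<alpha>)) \<le>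
          ennreal (W * C1 * e ^ j) * lev a f \<phi> (k + (int j + 2))"
          by (simp add: mult_ac add.assoc)
      qed auto
      finally show "(\<integral>\<^sup>+t. B k * (ennreal (t powr (\<alpha> / \<kappa> - 1)) * indicator (S k) t) \<partial>lborel) \<le>
        (\<Sum>j. ennreal (W * C1 * e ^ j) * lev a f \<phi> (k + (int j + 2)))"
        by (simp add: mult_left_mono)
    qed
    also have "\<dots> = (\<Sum>j. \<integral>\<^sup>+k. ennreal (W * C1 * e ^ j) * lev a f \<phi> (k + (int j + 2)) \<partial>count_space UNIV)"
      by (rule nn_integral_suminf) simp
    also have "\<dots> = (\<Sum>j. ennreal (W * C1 * e ^ j) * (\<integral>\<^sup>+k. lev a f \<phi> k \<partial>count_space UNIV))"
    proof (rule suminf_cong)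
      fix j
      have "bij_betw (\<lambda>k. k + (int j + 2)) UNIV UNIV"
        by (rule bij_betw_byWitness[where f' = "\<lambda>k. k - (int j + 2)"]) auto
      from nn_integral_bij_count_space[OF this, of "lev a f \<phi>"]
      show "(\<integral>\<^sup>+k. ennreal (W * C1 * e ^ j) * lev a f \<phi> (k + (int j + 2)) \<partial>count_space UNIV) =
        ennreal (W * C1 * e ^ j) * (\<integral>\<^sup>+k. lev a f \<phi> k \<partial>count_space UNIV)"
        by (simp add: nn_integral_cmult)
    qed
    also have "\<dots> = (\<Sum>j. ennreal (W * C1 * e ^ j)) * (\<integral>\<^sup>+k. lev a f \<phi> k \<partial>count_space UNIV)"
      by (rule ennreal_suminf_multc)
    also have "(\<Sum>j. ennreal (W * C1 * e ^ j)) = ennreal (\<Sum>j. W * C1 * e ^ j)"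
      by (rule suminf_ennreal2) (use C1 e in \<open>auto simp: W_def intro!: summable_mult summable_geometric\<close>)
    also have "(\<Sum>j. W * C1 * e ^ j) = W * C1 * (1 / (1 - e))"
      using e suminf_geometric[of e] summable_geometric[of e] by (simp add: suminf_mult)
    also have "(\<integral>\<^sup>+k. lev a f \<phi> k \<partial>count_space UNIV) = (\<Sum>\<tau>\<in>Collect half_shift. \<integral>\<^sup>+Q. ennreal (cterm a f \<phi> \<tau> Q) \<partial>count_space UNIV)"
    proof -
      have "(\<integral>\<^sup>+k. lev a f \<phi> k \<partial>count_space UNIV) =
        (\<Sum>\<tau>\<in>Collect half_shift. \<integral>\<^sup>+k. (\<integral>\<^sup>+m. ennreal (cterm a f \<phi> \<tau> (k, m)) \<partial>count_space UNIV) \<partial>count_space UNIV)"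
        unfolding lev_def by (rule nn_integral_sum) simp
      also have "\<dots> = (\<Sum>\<tau>\<in>Collect half_shift. \<integral>\<^sup>+Q. ennreal (cterm a f \<phi> \<tau> Q) \<partial>count_space UNIV)"
        by (rule sum.cong[OF HOL.refl]) (rule nn_integral_fst_count_space)
      finally show ?thesis .
    qed
    finally show "(\<integral>\<^sup>+t\<in>{0<..}. ennreal (t powr (\<alpha> / \<kappa> - 1)) * (\<integral>\<^sup>+x. ennreal (norm (heat L t f x) * norm (\<phi> x)) \<partial>lebesgue) \<partial>lborel) \<le>
      ennreal (W * C1 * (1 / (1 - e))) * (\<Sum>\<tau>\<in>Collect half_shift. \<integral>\<^sup>+Q. ennreal (cterm a f \<phi> \<tau> Q) \<partial>count_space UNIV)"
      by (simp only: X_def)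
  qed
qed

end

section \<open>Fractional powers\<close>

lemma nrm2_commute: "nrm2 (\<lambda>x. f x - g x) = nrm2 (\<lambda>x. g x - f x)"
  by (simp add: nrm2_def norm_minus_commute)

lemma nrm2_triangle:
  assumes "f \<in> L2" "g \<in> L2" "h \<in> L2"
  shows "nrm2 (\<lambda>x. f x - h x) \<le> nrm2 (\<lambda>x. f x - g x) + nrm2 (\<lambda>x. g x - h x)"
  using nrm2_add[OF L2_diff[OF assms(1,2)] L2_diff[OF assms(2,3)]] by simp

text \<open>Only right continuity of \<open>T\<close> is available, so \<open>T s\<close> is approximated by the values of \<open>T\<close> at
  grid points to the right of \<open>s\<close>; the mesh is chosen depending on \<open>s\<close>, fine enough for almost
  everywhere convergence.\<close>

theorem L2_joint_version:
  fixes T :: "real \<Rightarrow> 'n::finite cfun"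
  assumes TL: "\<And>t. 0 < t \<Longrightarrow> T t \<in> L2"
    and rc: "\<And>s. 0 < s \<Longrightarrow> ((\<lambda>t. nrm2 (\<lambda>x. T t x - T s x)) \<longlongrightarrow> 0) (at_right s)"
  obtains G where "G \<in> borel_measurable (lborel \<Otimes>\<^sub>M lebesgue)" "\<And>s. 0 < s \<Longrightarrow> AE x in lebesgue. G (s, x) = T s x"
proof -
  define idx where "idx m s = \<lfloor>real (Suc m) * s\<rfloor>" for m s
  have idxm: "idx m \<in> measurable borel (count_space UNIV)" for m
    unfolding idx_def by (intro measurable_compose[OF _ measurable_real_floor]) simp
  define V where "V m i = (if 0 < i + 1 then T (real_of_int (i + 1) / real (Suc m)) else (\<lambda>x. 0))" for m i
  have V: "V m i \<in> L2" for m i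
    unfolding V_def using L2_zero by (auto intro!: TL)
  define D where "D m1 m2 s = nrm2 (\<lambda>x. V m1 (idx m1 s) x - V m2 (idx m2 s) x)" for m1 m2 s
  have Dm: "D m1 m2 \<in> borel_measurable borel" for m1 m2
    unfolding D_def
    by (rule measurable_compose_countable[OF measurable_compose_countable[OF _ idxm] idxm]) simp
  define P where "P k m s \<longleftrightarrow> (\<forall>m1 m2. m \<le> m1 \<longrightarrow> m \<le> m2 \<longrightarrow> D m1 m2 s \<le> (1 / 8) ^ k)" for k m s
  have Pm: "(\<lambda>s. P k m s) \<in> measurable borel (count_space UNIV)" for k m
    unfolding P_def using Dm by measurable
  define M where "M k s = (LEAST m. P k m s)" for k s
  have Mm: "M k \<in> measurable borel (count_space UNIV)" for k
    unfolding M_def by (rule measurable_Least[OF Pm])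
  define g where "g k p = V (M k (fst p)) (idx (M k (fst p)) (fst p)) (snd p)" for k and p :: "real \<times> (real^'n)"
  have fstm: "fst \<in> measurable (lborel \<Otimes>\<^sub>M (lebesgue :: (real^'n) measure)) borel"
    using measurable_fst[of lborel] by (simp add: measurable_lborel1 cong: measurable_cong_sets)
  have gm: "g k \<in> borel_measurable (lborel \<Otimes>\<^sub>M lebesgue)" for k
  proof -
    have 1: "(\<lambda>p. V m i (snd p)) \<in> borel_measurable (lborel \<Otimes>\<^sub>M lebesgue)" for m i
      by (rule measurable_compose[OF measurable_snd L2_measurable[OF V]])
    have 2: "(\<lambda>p. V m (idx m (fst p)) (snd p)) \<in> borel_measurable (lborel \<Otimes>\<^sub>M lebesgue)" for m
      by (rule measurable_compose_countable[OF 1 measurable_compose[OF fstm idxm]])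
    show ?thesis
      unfolding g_def by (rule measurable_compose_countable[OF 2 measurable_compose[OF fstm Mm]])
  qed
  define G where "G p = lim (\<lambda>k. g k p)" for p
  show thesis
  proof (rule that[of G])
    show "G \<in> borel_measurable (lborel \<Otimes>\<^sub>M lebesgue)"
      unfolding G_def by (rule borel_measurable_lim_metric[OF gm])
    fix s :: real assume s: "0 < s"
    define e where "e m = nrm2 (\<lambda>x. V m (idx m s) x - T s x)" for m
    have e0: "e \<longlonglongrightarrow> 0"
    proof -
      define d where "d m = real_of_int (idx m s + 1) / real (Suc m)" for m
      have d: "s < d m" "d m \<le> s + 1 / real (Suc m)" for m
      proof -
        have "real (Suc m) * s < real_of_int (idx m s + 1)" "real_of_int (idx m s + 1) \<le> real (Suc m) * s + 1"
          unfolding idx_def by linarith+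
        moreover define M where "M = real (Suc m)"
        moreover have M: "0 < M" by (simp add: M_def)
        ultimately have "M * s < real_of_int (idx m s + 1)" "real_of_int (idx m s + 1) / M \<le> (M * s + 1) / M"
          by (auto intro: divide_right_mono simp del: of_int_add)
        moreover have "(M * s + 1) / M = s + 1 / M" using M by (simp add: add_divide_distrib)
        ultimately show "s < d m" "d m \<le> s + 1 / real (Suc m)"
          unfolding d_def M_def[symmetric] using M by (simp_all only: pos_less_divide_eq mult.commute[of s])
      qed
      have "(\<lambda>m. s + 1 / real (Suc m)) \<longlonglongrightarrow> s + 0"
        by (intro tendsto_add tendsto_const LIMSEQ_Suc[OF lim_1_over_n])
      then have lim: "(\<lambda>m. s + 1 / real (Suc m)) \<longlonglongrightarrow> s" by (simp only: add_0_right)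
      have "\<forall>\<^sub>F m in sequentially. s \<le> d m" "\<forall>\<^sub>F m in sequentially. d m \<le> s + 1 / real (Suc m)"
        by (rule always_eventually, use less_imp_le[OF d(1)] in blast) (rule always_eventually, use d(2) in blast)
      from tendsto_sandwich[OF this tendsto_const lim] have "d \<longlonglongrightarrow> s" .
      then have "filterlim d (at_right s) sequentially"
        by (rule filterlim_at_withinI) (use d(1) in \<open>auto simp: less_imp_neq[symmetric]\<close>)
      from filterlim_compose[OF rc[OF s] this]
      have "(\<lambda>m. nrm2 (\<lambda>x. T (d m) x - T s x)) \<longlonglongrightarrow> 0" .
      moreover have "V m (idx m s) = T (d m)" for m
      proof -
        have "0 < d m" using s d(1)[of m] by linarith
        then have "0 < idx m s + 1" by (simp add: d_def zero_less_divide_iff)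
        then show ?thesis by (simp add: V_def d_def)
      qed
      ultimately show ?thesis by (simp add: e_def[abs_def])
    qed
    have e_nn: "0 \<le> e m" for m unfolding e_def by (rule nrm2_nonneg)
    have De: "D m1 m2 s \<le> e m1 + e m2" for m1 m2
      unfolding D_def e_def using nrm2_triangle[OF V[of m1] TL[OF s] V[of m2]]
      by (subst (2) nrm2_commute) simp
    have eD: "e m1 \<le> D m1 m2 s + e m2" for m1 m2
      unfolding D_def e_def by (rule nrm2_triangle[OF V V TL[OF s]])
    have ex: "\<exists>m. P k m s" for k
    proof -
      have "0 < (1 / 8 :: real) ^ k / 2" by simp
      from order_tendstoD(2)[OF e0 this] obtain m where m: "\<And>m'. m \<le> m' \<Longrightarrow> e m' < (1 / 8) ^ k / 2"
        by (auto simp: eventually_sequentially)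
      have "D m1 m2 s \<le> (1 / 8) ^ k" if "m \<le> m1" "m \<le> m2" for m1 m2
        using De[of m1 m2] m[OF that(1)] m[OF that(2)] by linarith
      then show ?thesis unfolding P_def by blast
    qed
    have PM: "P k (M k s) s" for k unfolding M_def by (rule LeastI_ex[OF ex])
    have eM: "e (M k s) \<le> (1 / 8) ^ k" for k
    proof -
      have "\<forall>\<^sub>F m in sequentially. e (M k s) \<le> (1 / 8) ^ k + e m"
        using eventually_ge_at_top[of "M k s"]
      proof eventually_elim
        case (elim m)
        then have "D (M k s) m s \<le> (1 / 8) ^ k" using PM[of k] unfolding P_def by blast
        then show ?case using eD[of "M k s" m] by linarith
      qed
      moreover have "(\<lambda>m. (1 / 8) ^ k + e m) \<longlonglongrightarrow> (1 / 8) ^ k + 0"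
        by (intro tendsto_intros e0)
      ultimately show ?thesis using tendsto_lowerbound[of _ _ sequentially "e (M k s)"] by simp
    qed
    define h where "h j = (if even j then (\<lambda>x. g (j div 2) (s, x)) else T s)" for j :: nat
    have gV: "(\<lambda>x. g k (s, x)) = V (M k s) (idx (M k s) s)" for k by (simp add: g_def)
    have hL: "h j \<in> L2" for j unfolding h_def gV using V TL[OF s] by simp
    have bound: "(nrm2 (\<lambda>x. g k (s, x) - T s x))\<^sup>2 \<le> (1 / 8) ^ (2 * k)" for k
    proof -
      have "nrm2 (\<lambda>x. g k (s, x) - T s x) \<le> (1 / 8) ^ k" using eM[of k] by (simp add: e_def g_def)
      then have "(nrm2 (\<lambda>x. g k (s, x) - T s x))\<^sup>2 \<le> ((1 / 8) ^ k)\<^sup>2" by (intro power_mono nrm2_nonneg)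
      then show ?thesis by (simp add: power_mult[symmetric] mult.commute)
    qed
    have "AE x in lebesgue. convergent (\<lambda>j. h j x)"
    proof (rule L2_complete_aux[OF hL])
      fix j
      show "(nrm2 (\<lambda>x. h (Suc j) x - h j x))\<^sup>2 \<le> (1 / 8) ^ j"
      proof (cases "even j")
        case True
        then obtain k where j: "j = 2 * k" by blast
        have "(nrm2 (\<lambda>x. h (Suc j) x - h j x))\<^sup>2 = (nrm2 (\<lambda>x. g k (s, x) - T s x))\<^sup>2"
          by (subst nrm2_commute) (simp add: h_def j)
        then show ?thesis using bound[of k] j by simp
      next
        case False
        then obtain k where j: "j = 2 * k + 1" by (blast elim: oddE)
        have "(nrm2 (\<lambda>x. h (Suc j) x - h j x))\<^sup>2 = (nrm2 (\<lambda>x. g (Suc k) (s, x) - T s x))\<^sup>2"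
          by (simp add: h_def j)
        also have "\<dots> \<le> (1 / 8) ^ (2 * Suc k)" by (rule bound)
        also have "\<dots> \<le> (1 / 8) ^ j" unfolding j by (rule power_decreasing) auto
        finally show ?thesis .
      qed
    qed
    then show "AE x in lebesgue. G (s, x) = T s x"
    proof eventually_elim
      case (elim x)
      then obtain l where l: "(\<lambda>j. h j x) \<longlonglongrightarrow> l" by (auto simp: convergent_def)
      have even: "(\<lambda>k. h (2 * k) x) \<longlonglongrightarrow> l" and odd: "(\<lambda>k. h (2 * k + 1) x) \<longlonglongrightarrow> l"
        using LIMSEQ_subseq_LIMSEQ[OF l, of "\<lambda>k. 2 * k"] LIMSEQ_subseq_LIMSEQ[OF l, of "\<lambda>k. 2 * k + 1"]
        by (simp_all add: strict_mono_def comp_def)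
      have "l = T s x" using LIMSEQ_unique[OF odd] by (simp add: h_def)
      then have "(\<lambda>k. g k (s, x)) \<longlonglongrightarrow> T s x" using even by (simp add: h_def)
      then show ?case unfolding G_def by (rule limI)
    qed
  qed
qed

lemma sigma_finite_lebesgue: "sigma_finite_measure (lebesgue :: 'a::euclidean_space measure)"
proof -
  obtain A :: "'a set set" where A: "countable A" "A \<subseteq> sets lborel" "\<Union> A = space lborel" "\<And>a. a \<in> A \<Longrightarrow> emeasure lborel a \<noteq> \<infinity>"
    using lborel.sigma_finite_countable by metis
  show ?thesis
  proof
    show "\<exists>A::'a set set. countable A \<and> A \<subseteq> sets lebesgue \<and> \<Union> A = space lebesgue \<and> (\<forall>a\<in>A. emeasure lebesgue a \<noteq> \<infinity>)"
    proof (intro exI[of _ A] conjI ballI A(1))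
      show "A \<subseteq> sets lebesgue" using A(2) by (auto intro: sets_completionI_sets)
      show "\<Union> A = space lebesgue" using A(3) by simp
      fix a assume a: "a \<in> A"
      then have "a \<in> sets lborel" using A(2) by blast
      then have "emeasure lebesgue a = emeasure lborel a"
        by (simp only: emeasure_completion[OF sets_completionI_sets] main_part)
      then show "emeasure lebesgue a \<noteq> \<infinity>" using A(4)[OF a] by simp
    qed
  qed
qed

lemma semigroup_right_continuous:
  assumes A1: "cond_A1 L" and f: "f \<in> L2" and s: "0 < s"
  shows "((\<lambda>t. nrm2 (\<lambda>x. heat L t f x - heat L s f x)) \<longlongrightarrow> 0) (at_right s)"
proof -
  note sg = semigroup_heat[OF A1, unfolded semigroup_of_def]
  have TL: "heat L t h \<in> L2" if "0 \<le> t" "h \<in> L2" for t h using sg that by blast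
  have add: "AE x in lebesgue. heat L (a + b) f x = heat L a (heat L b f) x" if "0 \<le> a" "0 \<le> b" for a b
    using sg that f by blast
  have Ts: "heat L s f \<in> L2" using TL s f by simp
  have "((\<lambda>t. L2norm (\<lambda>x. heat L t (heat L s f) x - heat L s f x)) \<longlongrightarrow> 0) (at_right 0)"
    using sg Ts by blast
  moreover have "\<forall>\<^sub>F t in at_right 0. L2norm (\<lambda>x. heat L t (heat L s f) x - heat L s f x) = ennreal (nrm2 (\<lambda>x. heat L (t + s) f x - heat L s f x))"
    using eventually_at_right_less[of 0]
  proof eventually_elim
    case (elim t)
    have "L2norm (\<lambda>x. heat L t (heat L s f) x - heat L s f x) = ennreal (nrm2 (\<lambda>x. heat L t (heat L s f) x - heat L s f x))"
      using elim by (intro L2norm_eq L2_diff TL Ts) auto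
    also have "nrm2 (\<lambda>x. heat L t (heat L s f) x - heat L s f x) = nrm2 (\<lambda>x. heat L (t + s) f x - heat L s f x)"
      using add[of t s] elim s
      by (intro nrm2_cong L2_diff TL Ts f) (auto elim!: eventually_mono)
    finally show ?case .
  qed
  ultimately have "((\<lambda>t. ennreal (nrm2 (\<lambda>x. heat L (t + s) f x - heat L s f x))) \<longlongrightarrow> ennreal 0) (at_right 0)"
    by (simp add: tendsto_cong)
  then have "((\<lambda>t. nrm2 (\<lambda>x. heat L (t + s) f x - heat L s f x)) \<longlongrightarrow> 0) (at_right 0)"
    by (rule tendsto_ennrealD) (auto simp: nrm2_nonneg)
  then show ?thesis
    unfolding filterlim_at_right_to_0[of "\<lambda>t. nrm2 (\<lambda>x. heat L t f x - heat L s f x)" _ s] .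
qed

lemma rcp_less: assumes "0 < s" "ennreal s < q0" shows "rcp q0 < 1 / s"
proof (cases q0)
  case (real q)
  then have "s < q" using assms by (simp add: ennreal_less_iff)
  then show ?thesis using real assms by (simp add: rcp_ennreal frac_less2)
qed (use assms in \<open>simp add: rcp_def\<close>)

context heat_setup
begin

definition hform :: "real \<Rightarrow> 'n cfun \<Rightarrow> 'n cfun \<Rightarrow> ennreal" where
  "hform \<alpha> f \<phi> = (\<integral>\<^sup>+t\<in>{0<..}. ennreal (t powr (\<alpha> / \<kappa> - 1)) * (\<integral>\<^sup>+x. ennreal (norm (heat L t f x) * norm (\<phi> x)) \<partial>lebesgue) \<partial>lborel)"

theorem heat_grid:
  assumes e: "p0 < p" "p < q" "ennreal q < q0" and \<alpha>: "\<alpha> = real CARD('n) * (1 / p - 1 / q)"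
  obtains C where "0 \<le> C" "\<And>u v Du Dv K I J f \<phi>. weight u \<Longrightarrow> weight v \<Longrightarrow> 1 \<le> Du \<Longrightarrow> 1 \<le> Dv \<Longrightarrow>
     (\<And>(\<tau> :: real^'n) Q R d. half_shift \<tau> \<Longrightarrow> cel_le \<tau> Q R \<Longrightarrow> fst Q = fst R - int d \<Longrightarrow> real d * cw \<tau> u Q \<le> Du * cw \<tau> u R) \<Longrightarrow>
     (\<And>(\<tau> :: real^'n) Q R d. half_shift \<tau> \<Longrightarrow> cel_le \<tau> Q R \<Longrightarrow> fst Q = fst R - int d \<Longrightarrow> real d * cw \<tau> v Q \<le> Dv * cw \<tau> v R) \<Longrightarrow>
     (\<And>(\<tau> :: real^'n) Q. half_shift \<tau> \<Longrightarrow> cw \<tau> (\<lambda>x. 1) Q powr (\<alpha> / real CARD('n) - P + rcp q0) *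
        cw \<tau> u Q powr (P - 1 / p) * cw \<tau> v Q powr (1 / q - rcp q0) \<le> K) \<Longrightarrow> 0 < K \<Longrightarrow>
     f \<in> Linf_c \<Longrightarrow> \<phi> \<in> Linf_c \<Longrightarrow>
     (\<integral>\<^sup>+x. ennreal (norm (f x) powr p * u x powr (1 - p / p0)) \<partial>lebesgue) \<le> ennreal I \<Longrightarrow> 0 < I \<Longrightarrow>
     (\<integral>\<^sup>+x. ennreal (norm (\<phi> x) powr (1 / (1 - 1 / q)) * v x powr (1 - 1 / (1 - 1 / q) * r)) \<partial>lebesgue) \<le> ennreal J \<Longrightarrow> 0 < J \<Longrightarrow>
     hform \<alpha> f \<phi> \<le> ennreal (C * K * (Du powr (1 / q) + Dv powr (1 - 1 / p)) * (I powr (1 / p) * J powr (1 - 1 / q)))"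
proof -
  define a where "a = \<alpha> / real CARD('n) - P + rcp q0"
  define \<beta> where "\<beta> = 1 / p0 - 1 / p"
  define r0 where "r0 = 1 / r"
  define \<gamma> where "\<gamma> = 1 / r0 - (1 - 1 / q)"
  define q' where "q' = 1 / (1 - 1 / q)"
  have pos: "1 < p" "1 < q" "0 < p0" "0 < p" "0 < q" using e p0 by auto
  have \<alpha>0: "0 < \<alpha>" using e pos by (simp add: \<alpha> frac_less2)
  have rq: "rcp q0 < 1 / q" by (rule rcp_less[OF pos(5) e(3)])
  have r0: "0 < r0" "1 / r0 = r" "r0 < q'"
  proof -
    have "1 - 1 / q < r" "0 < 1 - 1 / q" using rq pos by (auto simp: r_def)
    then show "r0 < q'" unfolding r0_def q'_def by (intro frac_less2) auto
  qed (use r_bounds in \<open>auto simp: r0_def\<close>)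
  have \<gamma>e: "\<gamma> = 1 / q - rcp q0" by (simp add: \<gamma>_def r0 r_def)
  have \<beta>\<gamma>: "0 < \<beta>" "0 < \<gamma>" using e pos rq by (auto simp: \<beta>_def \<gamma>e frac_less2)
  have a_eq: "a = - \<beta> - \<gamma>" by (simp add: a_def \<alpha> \<beta>_def \<gamma>e)
  define \<theta> where "\<theta> = min ((1 / p0) / \<beta>) ((1 / r0) / \<gamma>)"
  have \<theta>: "1 < \<theta>" "\<theta> * \<beta> \<le> 1 / p0" "\<theta> * \<gamma> \<le> 1 / r0"
  proof -
    have "\<beta> < 1 / p0" "\<gamma> < 1 / r0" using pos by (auto simp: \<beta>_def \<gamma>_def)
    then have "1 < (1 / p0) / \<beta>" "1 < (1 / r0) / \<gamma>" using \<beta>\<gamma> by (simp_all only: pos_less_divide_eq mult_1)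
    then show "1 < \<theta>" unfolding \<theta>_def by (simp only: min_less_iff_conj)
    have "\<theta> \<le> (1 / p0) / \<beta>" "\<theta> \<le> (1 / r0) / \<gamma>" unfolding \<theta>_def by (rule min.cobounded1, rule min.cobounded2)
    then show "\<theta> * \<beta> \<le> 1 / p0" "\<theta> * \<gamma> \<le> 1 / r0" using \<beta>\<gamma> by (simp_all only: pos_le_divide_eq)
  qed
  obtain C1 where C1: "0 \<le> C1" "\<And>f \<phi>. f \<in> Linf_c \<Longrightarrow> \<phi> \<in> Linf_c \<Longrightarrow>
    hform \<alpha> f \<phi> \<le> ennreal C1 * (\<Sum>\<tau>\<in>Collect half_shift. \<integral>\<^sup>+Q. ennreal (cterm a f \<phi> \<tau> Q) \<partial>count_space UNIV)"
    unfolding hform_def by (rule heat_form[OF \<alpha>0 a_def]) blast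
  define TC where "TC = max 0 (cell_tree.tree_const (3 ^ CARD('n)) \<theta> \<beta> \<gamma> p q)"
  define mc where "mc = max_const p0 p powr (1 / p) * max_const r0 q' powr (1 - 1 / q)"
  define N where "N = real (card (Collect half_shift :: (real^'n) set))"
  have C0: "0 \<le> N * (TC * mc)" by (simp add: TC_def mc_def N_def)
  show thesis
  proof (rule that[of "C1 * (N * (TC * mc))"])
    show "0 \<le> C1 * (N * (TC * mc))" using C1(1) C0 by simp
    fix u v :: "real^'n \<Rightarrow> real" and Du Dv K I J :: real and f \<phi> :: "'n cfun"
    assume w: "weight u" "weight v" and D1: "1 \<le> Du" "1 \<le> Dv"
      and Du: "\<And>(\<tau> :: real^'n) Q R d. half_shift \<tau> \<Longrightarrow> cel_le \<tau> Q R \<Longrightarrow> fst Q = fst R - int d \<Longrightarrow> real d * cw \<tau> u Q \<le> Du * cw \<tau> u R"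
      and Dv: "\<And>(\<tau> :: real^'n) Q R d. half_shift \<tau> \<Longrightarrow> cel_le \<tau> Q R \<Longrightarrow> fst Q = fst R - int d \<Longrightarrow> real d * cw \<tau> v Q \<le> Dv * cw \<tau> v R"
      and K: "\<And>(\<tau> :: real^'n) Q. half_shift \<tau> \<Longrightarrow> cw \<tau> (\<lambda>x. 1) Q powr (\<alpha> / real CARD('n) - P + rcp q0) *
        cw \<tau> u Q powr (P - 1 / p) * cw \<tau> v Q powr (1 / q - rcp q0) \<le> K" "0 < K"
      and f: "f \<in> Linf_c" and \<phi>: "\<phi> \<in> Linf_c"
      and I: "(\<integral>\<^sup>+x. ennreal (norm (f x) powr p * u x powr (1 - p / p0)) \<partial>lebesgue) \<le> ennreal I" "0 < I"
      and J: "(\<integral>\<^sup>+x. ennreal (norm (\<phi> x) powr (1 / (1 - 1 / q)) * v x powr (1 - 1 / (1 - 1 / q) * r)) \<partial>lebesgue) \<le> ennreal J" "0 < J"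
    define DD where "DD = Du powr (1 / q) + Dv powr (1 - 1 / p)"
    define Z where "Z = I powr (1 / p) * J powr (1 - 1 / q)"
    have DZ: "0 \<le> DD" "0 \<le> Z" by (simp_all add: DD_def Z_def)
    have each: "(\<integral>\<^sup>+Q. ennreal (cterm a f \<phi> \<tau> Q) \<partial>count_space UNIV) \<le> ennreal (TC * mc * K * DD * Z)" if \<tau>: "half_shift \<tau>" for \<tau>
    proof -
      have K': "\<And>Q. cw \<tau> (\<lambda>x. 1) Q powr (- \<beta> - \<gamma>) * cw \<tau> u Q powr \<beta> * cw \<tau> v Q powr \<gamma> \<le> K"
        using K(1)[OF \<tau>] unfolding a_def[symmetric] a_eq \<gamma>e \<beta>_def .
      have nI: "(\<integral>\<^sup>+x. ennreal ((norm (f x) powr p0) powr (p / p0) * u x powr (1 - p / p0)) \<partial>lebesgue) \<le> ennreal I"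
        using I(1) pos by (simp add: powr_powr)
      have r0q: "1 / (1 - 1 / q) / r0 = 1 / (1 - 1 / q) * r" using r0(2) by (metis times_divide_eq_right mult.right_neutral)
      have nJ: "(\<integral>\<^sup>+x. ennreal ((norm (\<phi> x) powr (1 / r)) powr ((1 / (1 - 1 / q)) / r0) * v x powr (1 - (1 / (1 - 1 / q)) / r0)) \<partial>lebesgue) \<le> ennreal J"
      proof -
        have "(y powr (1 / r)) powr ((1 / (1 - 1 / q)) / r0) = y powr (1 / (1 - 1 / q))" for y
          unfolding r0q powr_powr using r_bounds(1) by simp
        then show ?thesis using J(1) unfolding r0q by simp
      qed
      have mf: "(\<lambda>x. norm (g x) powr s) \<in> borel_measurable lebesgue" if "g \<in> Linf_c" for g :: "'n cfun" and s
        by (intro powr_real_measurable borel_measurable_const measurable_compose[OF _ borel_measurable_norm] Linf_c_measurable that)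
      have r1: "0 < 1 / r" using r_bounds by simp
      have "(\<integral>\<^sup>+Q. ennreal (cterm a f \<phi> \<tau> Q) \<partial>count_space UNIV) =
        (\<integral>\<^sup>+Q. ennreal (cw \<tau> (\<lambda>x. 1) Q powr (- \<beta> - \<gamma>) * Nint p0 f (cel \<tau> Q) powr (1 / p0) * Nint (1 / r) \<phi> (cel \<tau> Q) powr (1 / r0)) \<partial>count_space UNIV)"
        unfolding cterm_def a_eq r0(2) by (rule HOL.refl)
      also have "\<dots> \<le> ennreal (cell_tree.tree_const (3 ^ CARD('n)) \<theta> \<beta> \<gamma> p q * K * (Du powr (1 / q) + Dv powr (1 - 1 / p)) *
          ((max_const p0 p * I) powr (1 / p) * (max_const r0 (1 / (1 - 1 / q)) * J) powr (1 - 1 / q)))"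
        by (rule grid_form_bound[OF \<tau> w mf[OF f] powr_ge_zero Nint_eq[OF f pos(3)] Nint_nonneg
              mf[OF \<phi>] powr_ge_zero Nint_eq[OF \<phi> r1] Nint_nonneg pos(1) e(2) pos(3) e(1) r0(1) r0(3)[unfolded q'_def]
              \<beta>_def \<gamma>_def D1(1) Du[OF \<tau>] D1(2) Dv[OF \<tau>] K' K(2) \<theta> nI I(2) nJ J(2)])
      also have "\<dots> = ennreal (cell_tree.tree_const (3 ^ CARD('n)) \<theta> \<beta> \<gamma> p q * (K * DD * (mc * Z)))"
      proof -
        have "(max_const p0 p * I) powr (1 / p) = max_const p0 p powr (1 / p) * I powr (1 / p)"
          by (rule powr_mult)
        moreover have "(max_const r0 q' * J) powr (1 - 1 / q) = max_const r0 q' powr (1 - 1 / q) * J powr (1 - 1 / q)"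
          by (rule powr_mult)
        ultimately show ?thesis unfolding q'_def[symmetric] mc_def DD_def Z_def by (simp only: mult_ac)
      qed
      also have "\<dots> \<le> ennreal (TC * (K * DD * (mc * Z)))"
        using K(2) DZ by (intro ennreal_leI mult_right_mono) (auto simp: TC_def mc_def)
      finally show ?thesis by (simp only: mult_ac)
    qed
    have "hform \<alpha> f \<phi> \<le> ennreal C1 * (\<Sum>\<tau>\<in>Collect half_shift. \<integral>\<^sup>+Q. ennreal (cterm a f \<phi> \<tau> Q) \<partial>count_space UNIV)"
      by (rule C1(2)[OF f \<phi>])
    also have "\<dots> \<le> ennreal C1 * (\<Sum>\<tau>\<in>(Collect half_shift :: (real^'n) set). ennreal (TC * mc * K * DD * Z))"
      by (intro mult_left_mono sum_mono each) auto
    also have "\<dots> = ennreal C1 * (ennreal N * ennreal (TC * mc * K * DD * Z))"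
      by (simp add: N_def ennreal_of_nat_eq_real_of_nat)
    also have "\<dots> = ennreal (C1 * (N * (TC * mc * K * DD * Z)))"
      using C1(1) K(2) DZ by (simp add: N_def TC_def mc_def ennreal_mult)
    also have "C1 * (N * (TC * mc * K * DD * Z)) = C1 * (N * (TC * mc)) * K * DD * Z" by (simp only: mult_ac)
    finally show "hform \<alpha> f \<phi> \<le> ennreal (C1 * (N * (TC * mc)) * K * (Du powr (1 / q) + Dv powr (1 - 1 / p)) * (I powr (1 / p) * J powr (1 - 1 / q)))"
      by (simp only: DD_def Z_def)
  qed
qed

lemma hform_finite:
  assumes e: "p0 < p" "p < q" "ennreal q < q0" and \<alpha>: "\<alpha> = real CARD('n) * (1 / p - 1 / q)"
    and f: "f \<in> Linf_c" and \<phi>: "\<phi> \<in> Linf_c"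
  shows "hform \<alpha> f \<phi> < \<infinity>"
proof -
  define q' where "q' = 1 / (1 - 1 / q)"
  have pos: "0 < p" "0 < q'" using e p0 by (auto simp: q'_def)
  obtain C where C: "\<And>u v Du Dv K I J f \<phi>. weight u \<Longrightarrow> weight v \<Longrightarrow> 1 \<le> Du \<Longrightarrow> 1 \<le> Dv \<Longrightarrow>
     (\<And>(\<tau> :: real^'n) Q R d. half_shift \<tau> \<Longrightarrow> cel_le \<tau> Q R \<Longrightarrow> fst Q = fst R - int d \<Longrightarrow> real d * cw \<tau> u Q \<le> Du * cw \<tau> u R) \<Longrightarrow>
     (\<And>(\<tau> :: real^'n) Q R d. half_shift \<tau> \<Longrightarrow> cel_le \<tau> Q R \<Longrightarrow> fst Q = fst R - int d \<Longrightarrow> real d * cw \<tau> v Q \<le> Dv * cw \<tau> v R) \<Longrightarrow>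
     (\<And>(\<tau> :: real^'n) Q. half_shift \<tau> \<Longrightarrow> cw \<tau> (\<lambda>x. 1) Q powr (\<alpha> / real CARD('n) - P + rcp q0) *
        cw \<tau> u Q powr (P - 1 / p) * cw \<tau> v Q powr (1 / q - rcp q0) \<le> K) \<Longrightarrow> 0 < K \<Longrightarrow>
     f \<in> Linf_c \<Longrightarrow> \<phi> \<in> Linf_c \<Longrightarrow>
     (\<integral>\<^sup>+x. ennreal (norm (f x) powr p * u x powr (1 - p / p0)) \<partial>lebesgue) \<le> ennreal I \<Longrightarrow> 0 < I \<Longrightarrow>
     (\<integral>\<^sup>+x. ennreal (norm (\<phi> x) powr (1 / (1 - 1 / q)) * v x powr (1 - 1 / (1 - 1 / q) * r)) \<partial>lebesgue) \<le> ennreal J \<Longrightarrow> 0 < J \<Longrightarrow>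
     hform \<alpha> f \<phi> \<le> ennreal (C * K * (Du powr (1 / q) + Dv powr (1 - 1 / p)) * (I powr (1 / p) * J powr (1 - 1 / q)))"
    by (rule heat_grid[OF e \<alpha>]) blast
  have chain: "real d * cw \<tau> (\<lambda>x. 1) Q \<le> 1 * cw \<tau> (\<lambda>x. 1) R" if "fst Q = fst R - int d" for \<tau> :: "real^'n" and Q R d
  proof -
    define B where "B = (3::real) ^ CARD('n)"
    have B: "3 ^ 1 \<le> B" unfolding B_def by (intro power_increasing) (auto simp: Suc_leI)
    have "real d \<le> 2 ^ d" by (simp add: less_imp_le)
    also have "\<dots> \<le> B ^ d" using B by (intro power_mono) auto
    finally have d: "real d \<le> B ^ d" .
    have "B powr real_of_int (fst R) = B ^ d * B powr real_of_int (fst Q)"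
      using B by (simp add: that powr_diff powr_realpow)
    then show ?thesis unfolding cw_1 B_def[symmetric] using d by (simp add: mult_right_mono)
  qed
  have K: "cw \<tau> (\<lambda>x. 1) Q powr (\<alpha> / real CARD('n) - P + rcp q0) * cw \<tau> (\<lambda>x. 1) Q powr (P - 1 / p) *
      cw \<tau> (\<lambda>x. 1) Q powr (1 / q - rcp q0) \<le> 1" for \<tau> :: "real^'n" and Q
  proof -
    have "\<alpha> / real CARD('n) - P + rcp q0 + (P - 1 / p) + (1 / q - rcp q0) = 0" by (simp add: \<alpha>)
    then show ?thesis using cw_pos[OF weight_1, of \<tau> Q] by (simp flip: powr_add)
  qed
  have bnd: "\<exists>I>0. (\<integral>\<^sup>+x. ennreal (norm (g x) powr s * 1 powr z) \<partial>lebesgue) \<le> ennreal I" if g: "g \<in> Linf_c" and s: "0 < s" for g :: "'n cfun" and s z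
  proof -
    define I where "I = enn2real (\<integral>\<^sup>+x. ennreal (norm (g x) powr s) \<partial>lebesgue)"
    have "(\<integral>\<^sup>+x. ennreal (norm (g x) powr s) \<partial>lebesgue) = ennreal I"
      unfolding I_def using Linf_c_finite[OF g s] by simp
    also have "\<dots> \<le> ennreal (I + 1)" by (intro ennreal_leI) simp
    finally show ?thesis by (intro exI[of _ "I + 1"]) (simp add: I_def add_nonneg_pos)
  qed
  obtain I J where IJ: "0 < I" "(\<integral>\<^sup>+x. ennreal (norm (f x) powr p * 1 powr (1 - p / p0)) \<partial>lebesgue) \<le> ennreal I"
    "0 < J" "(\<integral>\<^sup>+x. ennreal (norm (\<phi> x) powr (1 / (1 - 1 / q)) * 1 powr (1 - 1 / (1 - 1 / q) * r)) \<partial>lebesgue) \<le> ennreal J"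
    using bnd[OF f pos(1)] bnd[OF \<phi> pos(2)] unfolding q'_def by blast
  have "hform \<alpha> f \<phi> \<le> ennreal (C * 1 * (1 powr (1 / q) + 1 powr (1 - 1 / p)) * (I powr (1 / p) * J powr (1 - 1 / q)))"
    by (rule C[OF weight_1 weight_1 order_refl order_refl chain chain K zero_less_one f \<phi> IJ(2,1,4,3)])
  also have "\<dots> < \<infinity>" by simp
  finally show ?thesis .
qed

lemma frac_power_exists:
  assumes \<alpha>: "0 < \<alpha>" and f: "f \<in> Linf_c" and fin: "\<And>\<phi>. \<phi> \<in> Linf_c \<Longrightarrow> hform \<alpha> f \<phi> < \<infinity>"
  shows "\<exists>g. is_frac_power L (\<alpha> / \<kappa>) f g"
proof -
  define a where "a = \<alpha> / \<kappa>"
  obtain G where G: "G \<in> borel_measurable (lborel \<Otimes>\<^sub>M lebesgue)" "\<And>s. 0 < s \<Longrightarrow> AE x in lebesgue. G (s, x) = heat L s f x"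
  proof (rule L2_joint_version[of "\<lambda>s. heat L s f"])
    show "0 < t \<Longrightarrow> heat L t f \<in> L2" for t using heat_L2 Linf_c_L2[OF f] by simp
    show "0 < s \<Longrightarrow> ((\<lambda>t. nrm2 (\<lambda>x. heat L t f x - heat L s f x)) \<longlongrightarrow> 0) (at_right s)" for s
      by (rule semigroup_right_continuous[OF A1 Linf_c_L2[OF f]])
  qed blast
  interpret M2: sigma_finite_measure "lebesgue :: (real^'n) measure" by (rule sigma_finite_lebesgue)
  interpret PP: pair_sigma_finite "lborel :: real measure" "lebesgue :: (real^'n) measure" ..
  define c where "c s = complex_of_real (indicator {0<..} s * s powr (a - 1))" for s
  define A where "A s x = c s * G (s, x)" for s x
  have Am: "case_prod A \<in> borel_measurable (lborel \<Otimes>\<^sub>M lebesgue)"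
  proof -
    have "c \<in> borel_measurable lborel" unfolding c_def by measurable
    from measurable_compose[OF measurable_fst this]
    have "(\<lambda>p. c (fst p) * G p) \<in> borel_measurable (lborel \<Otimes>\<^sub>M lebesgue)"
      by (rule borel_measurable_times[OF _ G(1)])
    then show ?thesis by (simp add: A_def case_prod_unfold)
  qed
  have Gs: "(\<lambda>x. G (s, x)) \<in> borel_measurable lebesgue" for s
    by (rule measurable_Pair2[OF G(1)]) simp
  have int: "integrable (lborel \<Otimes>\<^sub>M lebesgue) (case_prod (\<lambda>s x. A s x * \<phi> x))" if \<phi>: "\<phi> \<in> Linf_c" for \<phi>
  proof (rule integrableI_bounded)
    have "(\<lambda>p. case_prod A p * \<phi> (snd p)) \<in> borel_measurable (lborel \<Otimes>\<^sub>M lebesgue)"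
      by (intro borel_measurable_times Am measurable_compose[OF measurable_snd Linf_c_measurable[OF \<phi>]])
    then show m: "case_prod (\<lambda>s x. A s x * \<phi> x) \<in> borel_measurable (lborel \<Otimes>\<^sub>M lebesgue)"
      by (simp add: case_prod_unfold)
    have "(\<integral>\<^sup>+p. ennreal (norm (case_prod (\<lambda>s x. A s x * \<phi> x) p)) \<partial>(lborel \<Otimes>\<^sub>M lebesgue)) =
      (\<integral>\<^sup>+s. (\<integral>\<^sup>+x. ennreal (norm (A s x * \<phi> x)) \<partial>lebesgue) \<partial>lborel)"
      using M2.nn_integral_fst[OF measurable_compose[OF measurable_compose[OF m borel_measurable_norm] measurable_ennreal]] by simp
    also have "\<dots> \<le> hform \<alpha> f \<phi>"
      unfolding hform_def
    proof (rule nn_integral_mono)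
      fix s :: real
      show "(\<integral>\<^sup>+x. ennreal (norm (A s x * \<phi> x)) \<partial>lebesgue) \<le>
        ennreal (s powr (\<alpha> / \<kappa> - 1)) * (\<integral>\<^sup>+x. ennreal (norm (heat L s f x) * norm (\<phi> x)) \<partial>lebesgue) * indicator {0<..} s"
      proof (cases "0 < s")
        case True
        have "(\<integral>\<^sup>+x. ennreal (norm (A s x * \<phi> x)) \<partial>lebesgue) = (\<integral>\<^sup>+x. ennreal (s powr (a - 1)) * ennreal (norm (heat L s f x) * norm (\<phi> x)) \<partial>lebesgue)"
          using G(2)[OF True] True
          by (intro nn_integral_cong_AE) (auto elim!: eventually_mono simp: A_def c_def norm_mult ennreal_mult mult.assoc)
        also have "\<dots> = ennreal (s powr (a - 1)) * (\<integral>\<^sup>+x. ennreal (norm (heat L s f x) * norm (\<phi> x)) \<partial>lebesgue)"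
          using True f \<phi> by (intro nn_integral_cmult heat_prod_measurable) auto
        finally show ?thesis using True by (simp add: a_def)
      qed (simp add: A_def c_def)
    qed
    also have "\<dots> < \<infinity>" by (rule fin[OF \<phi>])
    finally show "(\<integral>\<^sup>+p. ennreal (norm (case_prod (\<lambda>s x. A s x * \<phi> x) p)) \<partial>(lborel \<Otimes>\<^sub>M lebesgue)) < \<infinity>" .
  qed
  define g where "g x = 1 / of_real (Gamma a) * (LINT s|lborel. A s x)" for x
  have gm: "g \<in> borel_measurable lebesgue"
    unfolding g_def
  proof (intro borel_measurable_times borel_measurable_const lborel.borel_measurable_lebesgue_integral)
    show "case_prod (\<lambda>x s. A s x) \<in> borel_measurable (lebesgue \<Otimes>\<^sub>M lborel)"
      using measurable_pair_swap[OF Am] by (simp add: case_prod_unfold)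
  qed
  have g\<phi>: "g x * \<phi> x = 1 / of_real (Gamma a) * (LINT s|lborel. A s x * \<phi> x)" for x \<phi>
    by (simp add: g_def)
  have ig: "integrable lebesgue (\<lambda>x. g x * \<phi> x)" if "\<phi> \<in> Linf_c" for \<phi>
    unfolding g\<phi> by (intro integrable_mult_right PP.integrable_snd int that)
  have "is_frac_power L a f g"
    unfolding is_frac_power_def
  proof (intro conjI allI ballI gm)
    fix b :: "real^'n" and l
    have "(\<lambda>x. if x \<in> cube b l then 1 else 0) \<in> Linf_c"
    proof -
      have "bounded (range (\<lambda>x. if x \<in> cube b l then 1 else (0::complex)))"
        by (rule boundedI[of _ 1]) auto
      moreover have "(\<lambda>x. if x \<in> cube b l then 1 else (0::complex)) \<in> borel_measurable lebesgue"
        by (intro measurable_If_set borel_measurable_const) (simp add: cube_lebesgue sets.Int_space_eq2 del: sets_completion)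
      moreover have "compact (cube b l)" by (simp add: cube_def)
      ultimately show ?thesis by (auto simp: Linf_c_def intro!: exI[of _ "cube b l"])
    qed
    from ig[OF this] show "set_integrable lebesgue (cube b l) g"
      unfolding set_integrable_def
      by (rule back_subst[of "integrable lebesgue"]) (auto simp: fun_eq_iff)
  next
    fix \<phi> :: "'n cfun" assume \<phi>: "\<phi> \<in> Linf_c"
    have eq: "indicator {0<..} s *\<^sub>R (of_real (s powr (a - 1)) * (LINT x|lebesgue. heat L s f x * \<phi> x)) = (LINT x|lebesgue. A s x * \<phi> x)" for s :: real
    proof (cases "0 < s")
      case True
      have hm: "heat L s f \<in> borel_measurable lebesgue"
        using True by (intro L2_measurable heat_L2 Linf_c_L2 f) simp
      have "(LINT x|lebesgue. A s x * \<phi> x) = (LINT x|lebesgue. of_real (s powr (a - 1)) * (heat L s f x * \<phi> x))"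
      proof (rule integral_cong_AE)
        have "(\<lambda>x. A s x) \<in> borel_measurable lebesgue"
          unfolding A_def by (intro borel_measurable_times borel_measurable_const Gs)
        then show "(\<lambda>x. A s x * \<phi> x) \<in> borel_measurable lebesgue"
          by (rule borel_measurable_times[OF _ Linf_c_measurable[OF \<phi>]])
        show "(\<lambda>x. of_real (s powr (a - 1)) * (heat L s f x * \<phi> x)) \<in> borel_measurable lebesgue"
          by (intro borel_measurable_times borel_measurable_const hm Linf_c_measurable[OF \<phi>])
        show "AE x in lebesgue. A s x * \<phi> x = of_real (s powr (a - 1)) * (heat L s f x * \<phi> x)"
          using G(2)[OF True] by eventually_elim (use True in \<open>simp add: A_def c_def\<close>)
      qed
      then show ?thesis using True by simp
    qed (simp add: A_def c_def)
    show "set_integrable lborel {0<..} (\<lambda>s. of_real (s powr (a - 1)) * (LINT x|lebesgue. heat L s f x * \<phi> x))"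
      unfolding set_integrable_def eq by (rule PP.integrable_fst[OF int[OF \<phi>]])
    have "(LINT x|lebesgue. g x * \<phi> x) = 1 / of_real (Gamma a) * (LINT x|lebesgue. (LINT s|lborel. A s x * \<phi> x))"
      unfolding g\<phi> by (rule integral_mult_right_zero)
    also have "(LINT x|lebesgue. (LINT s|lborel. A s x * \<phi> x)) = (LINT s|lborel. (LINT x|lebesgue. A s x * \<phi> x))"
      by (rule PP.Fubini_integral[OF int[OF \<phi>]])
    finally show "(LINT x|lebesgue. g x * \<phi> x) = 1 / of_real (Gamma a) *
      (LBINT s:{0<..}. of_real (s powr (a - 1)) * (LINT x|lebesgue. heat L s f x * \<phi> x))"
      unfolding set_lebesgue_integral_def eq .
  qed
  then show ?thesis unfolding a_def by blast
qed

text \<open>Testing against \<open>cnj (sgn g) * norm \<phi>\<close> removes the cancellation.\<close>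

lemma frac_power_dual:
  assumes \<alpha>: "0 < \<alpha>" and g: "is_frac_power L (\<alpha> / \<kappa>) f g" and f: "f \<in> Linf_c" and \<phi>: "\<phi> \<in> Linf_c"
  shows "(\<integral>\<^sup>+x. ennreal (norm (g x) * norm (\<phi> x)) \<partial>lebesgue) \<le> ennreal (1 / Gamma (\<alpha> / \<kappa>)) * hform \<alpha> f \<phi>"
proof -
  define a where "a = \<alpha> / \<kappa>"
  have \<Gamma>: "0 < Gamma a" using \<alpha> kap by (intro Gamma_real_pos) (simp add: a_def)
  have gm: "g \<in> borel_measurable lebesgue" and gi: "\<And>c l. set_integrable lebesgue (cube c l) g"
    using g by (auto simp: is_frac_power_def)
  obtain B b where B: "0 < B" "\<And>x. norm (\<phi> x) \<le> B" "\<And>x. \<phi> x \<noteq> 0 \<Longrightarrow> norm x \<le> b"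
    by (rule Linf_c_bounds[OF \<phi>]) blast
  define \<psi> where "\<psi> x = cnj (g x) / of_real (norm (g x)) * of_real (norm (\<phi> x))" for x
  have \<psi>n: "norm (\<psi> x) \<le> norm (\<phi> x)" for x by (simp add: \<psi>_def norm_mult norm_divide)
  have g\<psi>: "g x * \<psi> x = complex_of_real (norm (g x) * norm (\<phi> x))" for x
  proof (cases "g x = 0")
    case False
    have "g x * cnj (g x) = of_real (norm (g x)) * of_real (norm (g x))"
      using complex_norm_square[of "g x"] by (simp add: power2_eq_square)
    then have "g x * \<psi> x = of_real (norm (g x)) * of_real (norm (g x)) / of_real (norm (g x)) * of_real (norm (\<phi> x))"
      by (simp only: \<psi>_def times_divide_eq_right mult.assoc[symmetric])
    then show ?thesis using False by simp
  qed simp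
  have \<phi>m: "\<phi> \<in> borel_measurable lebesgue" by (rule Linf_c_measurable[OF \<phi>])
  have nm: "(\<lambda>x. norm (h x)) \<in> borel_measurable lebesgue" if "h \<in> borel_measurable lebesgue" for h :: "'n cfun"
    by (rule measurable_compose[OF that borel_measurable_norm])
  have rm: "(\<lambda>x. complex_of_real (norm (h x))) \<in> borel_measurable lebesgue" if "h \<in> borel_measurable lebesgue" for h :: "'n cfun"
    by (rule measurable_compose[OF nm[OF that] borel_measurable_of_real]) 
  have \<psi>: "\<psi> \<in> Linf_c"
  proof -
    have "\<psi> \<in> borel_measurable lebesgue"
      unfolding \<psi>_def
      by (intro borel_measurable_times borel_measurable_divide rm gm \<phi>m
          measurable_compose[OF gm borel_measurable_continuous_onI[OF continuous_on_cnj[OF continuous_on_id]]])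
    moreover have "bounded (range \<psi>)"
      by (rule boundedI[of _ B]) (use B(2) \<psi>n order_trans in blast)
    moreover obtain K where "compact K" "\<And>x. x \<notin> K \<Longrightarrow> \<phi> x = 0" using \<phi> by (auto simp: Linf_c_def)
    ultimately show ?thesis by (auto simp: Linf_c_def \<psi>_def intro!: exI[of _ K])
  qed
  have int: "integrable lebesgue (\<lambda>x. norm (g x) * norm (\<phi> x))"
  proof (rule Bochner_Integration.integrable_bound)
    show "integrable lebesgue (\<lambda>x. B *\<^sub>R (indicator (cube 0 (2 * b)) x *\<^sub>R g x))"
      using gi[of 0 "2 * b"] unfolding set_integrable_def by (rule integrable_scaleR_right)
    show "(\<lambda>x. norm (g x) * norm (\<phi> x)) \<in> borel_measurable lebesgue"
      by (intro borel_measurable_times nm gm \<phi>m)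
    show "AE x in lebesgue. norm (norm (g x) * norm (\<phi> x)) \<le> norm (B *\<^sub>R (indicator (cube 0 (2 * b)) x *\<^sub>R g x))"
    proof (rule AE_I2)
      fix x
      show "norm (norm (g x) * norm (\<phi> x)) \<le> norm (B *\<^sub>R (indicator (cube 0 (2 * b)) x *\<^sub>R g x))"
      proof (cases "\<phi> x = 0")
        case False
        then have "norm x \<le> b" by (rule B(3))
        then have "\<bar>x $ i\<bar> \<le> b" for i using component_le_norm_cart[of x i] by linarith
        then have "x \<in> cube 0 (2 * b)" by (simp add: mem_cube abs_le_iff minus_le_iff)
        then show ?thesis using B(1) B(2)[of x] by (simp add: mult.commute mult_right_mono)
      qed simp
    qed
  qed
  define h where "h s = of_real (s powr (a - 1)) * (LINT x|lebesgue. heat L s f x * \<psi> x)" for s :: real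
  have hi: "integrable lborel (\<lambda>s. indicator {0<..} s *\<^sub>R h s)"
    and gh: "(LINT x|lebesgue. g x * \<psi> x) = 1 / of_real (Gamma a) * (LINT s|lborel. indicator {0<..} s *\<^sub>R h s)"
    using g \<psi> unfolding is_frac_power_def a_def[symmetric] h_def set_integrable_def set_lebesgue_integral_def by blast+
  have "(\<integral>\<^sup>+x. ennreal (norm (g x) * norm (\<phi> x)) \<partial>lebesgue) = ennreal (LINT x|lebesgue. norm (g x) * norm (\<phi> x))"
    using int by (intro nn_integral_eq_integral) auto
  also have "(LINT x|lebesgue. norm (g x) * norm (\<phi> x)) = norm (LINT x|lebesgue. g x * \<psi> x)"
    unfolding g\<psi> integral_complex_of_real by (simp add: integral_nonneg_AE)
  also have "\<dots> = 1 / Gamma a * norm (LINT s|lborel. indicator {0<..} s *\<^sub>R h s)"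
    unfolding gh using \<Gamma> by (simp add: norm_mult norm_divide)
  also have "ennreal \<dots> = ennreal (1 / Gamma a) * ennreal (norm (LINT s|lborel. indicator {0<..} s *\<^sub>R h s))"
    using \<Gamma> by (intro ennreal_mult) auto
  also have "\<dots> \<le> ennreal (1 / Gamma a) * (\<integral>\<^sup>+s. ennreal (norm (indicator {0<..} s *\<^sub>R h s)) \<partial>lborel)"
    by (intro mult_left_mono integral_norm_bound_ennreal hi) simp
  also have "\<dots> \<le> ennreal (1 / Gamma a) * hform \<alpha> f \<phi>"
  proof (rule mult_left_mono)
    show "(\<integral>\<^sup>+s. ennreal (norm (indicator {0<..} s *\<^sub>R h s)) \<partial>lborel) \<le> hform \<alpha> f \<phi>"
      unfolding hform_def
    proof (rule nn_integral_mono)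
      fix s :: real
      show "ennreal (norm (indicator {0<..} s *\<^sub>R h s)) \<le>
        ennreal (s powr (\<alpha> / \<kappa> - 1)) * (\<integral>\<^sup>+x. ennreal (norm (heat L s f x) * norm (\<phi> x)) \<partial>lebesgue) * indicator {0<..} s"
      proof (cases "0 < s")
        case True
        have "ennreal (norm (LINT x|lebesgue. heat L s f x * \<psi> x)) \<le> (\<integral>\<^sup>+x. ennreal (norm (heat L s f x * \<psi> x)) \<partial>lebesgue)"
        proof (cases "integrable lebesgue (\<lambda>x. heat L s f x * \<psi> x)")
          case False
          then show ?thesis by (simp add: not_integrable_integral_eq)
        qed (rule integral_norm_bound_ennreal)
        also have "\<dots> \<le> (\<integral>\<^sup>+x. ennreal (norm (heat L s f x) * norm (\<phi> x)) \<partial>lebesgue)"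
          by (intro nn_integral_mono ennreal_leI) (simp add: norm_mult mult_left_mono \<psi>n)
        finally show ?thesis using True by (simp add: h_def norm_mult ennreal_mult mult_left_mono a_def)
      qed simp
    qed
  qed simp
  finally show ?thesis unfolding a_def .
qed

end

theorem theorem1p2:
  fixes L :: "'n::finite oper"
    and p0 p q \<epsilon> \<kappa> \<alpha> :: real and q0 :: ennreal
  assumes "1 \<le> p0" and "ennreal p0 < q0" and "0 < \<epsilon>" and "0 < \<kappa>"
    and "cond_A1 L" and "cond_A2 L (ennreal p0) q0 \<epsilon> \<kappa>"
    and "p0 < p" and "p < q" and "ennreal q < q0"
    and "\<alpha> = real CARD('n) * (1 / p - 1 / q)"
  shows "\<exists>C>0. \<forall>(mu :: real^'n \<Rightarrow> real) (lam :: real^'n \<Rightarrow> real) u v.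
    weight mu \<and> weight lam \<and>
    u = (\<lambda>x. mu x powr (p0 * p / (p0 - p))) \<and>
    v = (\<lambda>x. lam x powr v_exponent q0 q) \<and>
    A_inf u \<and> A_inf v \<and>
    pair_const (\<alpha> / real CARD('n) - 1 / p0 + rcp q0) (1 / p0 - 1 / p) (1 / q - rcp q0) u v < \<infinity>
    \<longrightarrow> (\<forall>f\<in>Linf_c.
      wnorm q (\<lambda>x. lam x powr q) (neg_power L (\<alpha> / \<kappa>) f)
      \<le> ennreal C
        * pair_const (\<alpha> / real CARD('n) - 1 / p0 + rcp q0)
            (1 / p0 - 1 / p) (1 / q - rcp q0) u v
        * (epow (Ainf_const u) (1 / q) + epow (Ainf_const v) (1 - 1 / p))
        * wnorm p (\<lambda>x. mu x powr p) f)"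
proof -
  note e = assms(7-9) and \<alpha> = assms(10)
  interpret heat_setup L p0 \<epsilon> \<kappa> q0 by unfold_locales fact+
  have pos: "1 < p" "1 < q" "0 < p0" "0 < p" "0 < q" using e p0 by auto
  have \<alpha>0: "0 < \<alpha>" using e pos by (simp add: \<alpha> frac_less2)
  have rq: "rcp q0 < 1 / q" by (rule rcp_less[OF pos(5) e(3)])
  define q' where "q' = 1 / (1 - 1 / q)"
  have q': "0 < q'" "(q - 1) * q' = q" "q * q' - q' = q" "0 < 1 - 1 / q"
  proof -
    have q'e: "q' = q / (q - 1)" using pos by (simp add: q'_def field_simps)
    then show "0 < q'" "(q - 1) * q' = q" using pos by simp_all
    then show "q * q' - q' = q" by (simp add: algebra_simps)
    show "0 < 1 - 1 / q" using pos by simp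
  qed
  obtain C where C: "0 \<le> C" "\<And>u v Du Dv K I J f \<phi>. weight u \<Longrightarrow> weight v \<Longrightarrow> 1 \<le> Du \<Longrightarrow> 1 \<le> Dv \<Longrightarrow>
     (\<And>(\<tau> :: real^'n) Q R d. half_shift \<tau> \<Longrightarrow> cel_le \<tau> Q R \<Longrightarrow> fst Q = fst R - int d \<Longrightarrow> real d * cw \<tau> u Q \<le> Du * cw \<tau> u R) \<Longrightarrow>
     (\<And>(\<tau> :: real^'n) Q R d. half_shift \<tau> \<Longrightarrow> cel_le \<tau> Q R \<Longrightarrow> fst Q = fst R - int d \<Longrightarrow> real d * cw \<tau> v Q \<le> Dv * cw \<tau> v R) \<Longrightarrow>
     (\<And>(\<tau> :: real^'n) Q. half_shift \<tau> \<Longrightarrow> cw \<tau> (\<lambda>x. 1) Q powr (\<alpha> / real CARD('n) - 1 / p0 + rcp q0) *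
        cw \<tau> u Q powr (1 / p0 - 1 / p) * cw \<tau> v Q powr (1 / q - rcp q0) \<le> K) \<Longrightarrow> 0 < K \<Longrightarrow>
     f \<in> Linf_c \<Longrightarrow> \<phi> \<in> Linf_c \<Longrightarrow>
     (\<integral>\<^sup>+x. ennreal (norm (f x) powr p * u x powr (1 - p / p0)) \<partial>lebesgue) \<le> ennreal I \<Longrightarrow> 0 < I \<Longrightarrow>
     (\<integral>\<^sup>+x. ennreal (norm (\<phi> x) powr (1 / (1 - 1 / q)) * v x powr (1 - 1 / (1 - 1 / q) * r)) \<partial>lebesgue) \<le> ennreal J \<Longrightarrow> 0 < J \<Longrightarrow>
     hform \<alpha> f \<phi> \<le> ennreal (C * K * (Du powr (1 / q) + Dv powr (1 - 1 / p)) * (I powr (1 / p) * J powr (1 - 1 / q)))"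
    by (rule heat_grid[OF e \<alpha>]) blast
  define \<Gamma> where "\<Gamma> = Gamma (\<alpha> / \<kappa>)"
  have \<Gamma>: "0 < \<Gamma>" unfolding \<Gamma>_def using \<alpha>0 kap by (intro Gamma_real_pos) simp
  have ve: "v_exponent q0 q * (1 - q' * r) = - q'"
  proof -
    have 1: "v_exponent q0 q * (1 / q - rcp q0) = 1"
    proof (cases q0)
      case (real z)
      then have "q < z" using e(3) pos by (simp add: ennreal_less_iff)
      then show ?thesis using real pos by (simp add: v_exponent_def rcp_ennreal field_simps)
    qed (use pos in \<open>simp add: v_exponent_def rcp_def\<close>)
    have "q' * (1 - 1 / q) = 1" using q'(4) pos by (simp add: q'_def)
    then have "1 - q' * r = - q' * (1 / q - rcp q0)" by (simp add: r_def algebra_simps)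
    then have "v_exponent q0 q * (1 - q' * r) = - q' * (v_exponent q0 q * (1 / q - rcp q0))" by simp
    then show ?thesis unfolding 1 by simp
  qed
  have ue: "p0 * p / (p0 - p) * (1 - p / p0) = p"
    using e pos by (simp add: field_simps)
  show ?thesis
  proof (intro exI[of _ "(C + 1) * (3 / 2) / \<Gamma>"] conjI allI impI ballI)
    show "0 < (C + 1) * (3 / 2) / \<Gamma>" using C(1) \<Gamma> by simp
    fix mu lam u v :: "real^'n \<Rightarrow> real" and f :: "'n cfun"
    let ?pc = "pair_const (\<alpha> / real CARD('n) - 1 / p0 + rcp q0) (1 / p0 - 1 / p) (1 / q - rcp q0) u v"
    assume asm: "weight mu \<and> weight lam \<and> u = (\<lambda>x. mu x powr (p0 * p / (p0 - p))) \<and>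
      v = (\<lambda>x. lam x powr v_exponent q0 q) \<and> A_inf u \<and> A_inf v \<and> ?pc < \<infinity>" and f: "f \<in> Linf_c"
    then have w: "weight u" "weight v" "weight lam" and fin: "Ainf_const u < \<infinity>" "Ainf_const v < \<infinity>" "?pc < \<infinity>"
      and u: "u = (\<lambda>x. mu x powr (p0 * p / (p0 - p)))" and v: "v = (\<lambda>x. lam x powr v_exponent q0 q)"
      unfolding A_inf_def by blast+
    have lm: "lam \<in> borel_measurable lebesgue" "\<And>x. 0 \<le> lam x" using w(3) by (auto simp: weight_def)
    define U V K where "U = enn2real (Ainf_const u)" and "V = enn2real (Ainf_const v)" and "K = enn2real ?pc"
    have UVK: "Ainf_const u = ennreal U" "Ainf_const v = ennreal V" "?pc = ennreal K"
      using fin by (simp_all add: U_def V_def K_def)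
    have UV: "1 \<le> U" "1 \<le> V"
      using Ainf_ge_1[OF w(1)] Ainf_ge_1[OF w(2)] unfolding UVK by (simp_all add: ennreal_ge_1)
    have K0: "0 \<le> K" by (simp add: K_def)
    have Kcell: "cw \<tau> (\<lambda>x. 1) Q powr (\<alpha> / real CARD('n) - 1 / p0 + rcp q0) *
        cw \<tau> u Q powr (1 / p0 - 1 / p) * cw \<tau> v Q powr (1 / q - rcp q0) \<le> K" for \<tau> :: "real^'n" and Q
    proof -
      have "measure lebesgue (cel_cube \<tau> Q) = (3 powr real_of_int (fst Q)) ^ CARD('n)"
        using emeasure_cube[of "3 powr real_of_int (fst Q)" "cel_center \<tau> Q"] by (simp only: measure_def enn2real_ennreal powr_ge_zero zero_le_power)
      also have "\<dots> = cw \<tau> (\<lambda>x. 1) Q"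
        unfolding cw_1 by (simp add: powr_powr mult.commute flip: powr_realpow)
      finally have m: "measure lebesgue (cel_cube \<tau> Q) = cw \<tau> (\<lambda>x. 1) Q" .
      have "ennreal (cw \<tau> (\<lambda>x. 1) Q powr (\<alpha> / real CARD('n) - 1 / p0 + rcp q0) *
        cw \<tau> u Q powr (1 / p0 - 1 / p) * cw \<tau> v Q powr (1 / q - rcp q0)) \<le> ?pc"
        unfolding pair_const_def
        by (rule SUP_upper2[of "(cel_center \<tau> Q, 3 powr real_of_int (fst Q))"]) (simp, unfold case_prod_conv m cw_def, rule order_refl)
      then show ?thesis unfolding UVK(3) using K0 by (subst (asm) ennreal_le_iff) auto
    qed
    have Kpos: "0 < K"
    proof -
      have "0 < cw 0 (\<lambda>x. 1) (0, 0 :: int^'n) powr (\<alpha> / real CARD('n) - 1 / p0 + rcp q0) *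
        cw 0 u (0, 0) powr (1 / p0 - 1 / p) * cw 0 v (0, 0) powr (1 / q - rcp q0)"
        using cw_pos[OF weight_1, of 0 "(0, 0 :: int^'n)"] cw_pos[OF w(1), of 0 "(0, 0)"] cw_pos[OF w(2), of 0 "(0, 0)"]
        by (intro mult_pos_pos) auto
      then show ?thesis using Kcell[of 0 "(0, 0)"] by linarith
    qed
    define DD where "DD = (3 / 2 * U) powr (1 / q) + (3 / 2 * V) powr (1 - 1 / p)"
    define S where "S = U powr (1 / q) + V powr (1 - 1 / p)"
    have DDS: "0 \<le> DD" "0 < S" "DD \<le> 3 / 2 * S"
    proof -
      have le: "(3 / 2 * z) powr s \<le> 3 / 2 * z powr s" if "1 \<le> z" "0 \<le> s" "s \<le> 1" for z s :: real
      proof -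
        have "(3 / 2 :: real) powr s \<le> (3 / 2) powr 1" using that by (intro powr_mono) auto
        then have "(3 / 2) powr s * z powr s \<le> (3 / 2) powr 1 * z powr s" by (rule mult_right_mono) simp
        then show ?thesis using that by (subst powr_mult) auto
      qed
      show "DD \<le> 3 / 2 * S"
        unfolding DD_def S_def distrib_left using UV pos by (intro add_mono le) auto
      show "0 < S" unfolding S_def using UV by (intro add_pos_nonneg) auto
    qed (simp add: DD_def)
    define C0 where "C0 = 1 / \<Gamma> * (C * K * DD)"
    have C0: "0 \<le> C0" "C0 \<le> (C + 1) * (3 / 2) / \<Gamma> * K * S"
    proof -
      show "0 \<le> C0" unfolding C0_def using \<Gamma> C(1) K0 DDS by simp
      have "C * K * DD \<le> (C + 1) * K * (3 / 2 * S)"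
        using C(1) K0 DDS by (intro mult_mono) auto
      then have "1 / \<Gamma> * (C * K * DD) \<le> 1 / \<Gamma> * ((C + 1) * K * (3 / 2 * S))"
        using \<Gamma> by (intro mult_left_mono) auto
      then show "C0 \<le> (C + 1) * (3 / 2) / \<Gamma> * K * S" unfolding C0_def by (simp add: mult_ac)
    qed
    define g where "g = neg_power L (\<alpha> / \<kappa>) f"
    have g: "is_frac_power L (\<alpha> / \<kappa>) f g"
      unfolding g_def neg_power_def
      by (rule someI_ex[OF frac_power_exists[OF \<alpha>0 f hform_finite[OF e \<alpha> f]]])
    have gm: "g \<in> borel_measurable lebesgue" using g by (simp add: is_frac_power_def)
    define h where "h x = ennreal (norm (g x) powr q * lam x powr q)" for x
    have hm: "h \<in> borel_measurable lebesgue"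
      unfolding h_def
      by (intro measurable_compose[OF _ measurable_ennreal] borel_measurable_times powr_real_measurable borel_measurable_const
          measurable_compose[OF gm borel_measurable_norm] lm)
    define E where "E N = cube 0 (real N) \<inter> ({x \<in> space lebesgue. norm (g x) \<le> real N} \<inter> {x \<in> space lebesgue. lam x \<le> real N})" for N
    have Em: "E N \<in> sets lebesgue" for N
      unfolding E_def
      by (intro sets.Int cube_lebesgue borel_measurable_le measurable_compose[OF gm borel_measurable_norm] lm borel_measurable_const)
    have memE: "x \<in> E N \<longleftrightarrow> x \<in> cube 0 (real N) \<and> norm (g x) \<le> real N \<and> lam x \<le> real N" for x N
      by (auto simp: E_def)
    have bound: "(\<integral>\<^sup>+x. h x \<partial>lebesgue) \<le> ennreal ((C0 * I powr (1 / p)) powr q)"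
      if I: "(\<integral>\<^sup>+x. ennreal (norm (f x) powr p * mu x powr p) \<partial>lebesgue) \<le> ennreal I" "0 < I" for I
    proof -
      have AN: "(\<integral>\<^sup>+x\<in>E N. h x \<partial>lebesgue) \<le> ennreal ((C0 * I powr (1 / p)) powr q)" for N
      proof -
        define \<phi> where "\<phi> x = (if x \<in> E N then complex_of_real (norm (g x) powr (q - 1) * lam x powr q) else 0)" for x
        define Z where "Z = enn2real (\<integral>\<^sup>+x\<in>E N. h x \<partial>lebesgue)"
        have Zfin: "(\<integral>\<^sup>+x\<in>E N. h x \<partial>lebesgue) = ennreal Z"
        proof -
          have "(\<integral>\<^sup>+x\<in>E N. h x \<partial>lebesgue) \<le> (\<integral>\<^sup>+x. ennreal (real N powr q * real N powr q) * indicator (cube (0 :: real^'n) (real N)) x \<partial>lebesgue)"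
          proof (rule nn_integral_mono)
            fix x
            show "h x * indicator (E N) x \<le> ennreal (real N powr q * real N powr q) * indicator (cube 0 (real N)) x"
            proof (cases "x \<in> E N")
              case True
              then have "h x \<le> ennreal (real N powr q * real N powr q)"
                unfolding h_def memE using lm(2)[of x] pos by (intro ennreal_leI mult_mono powr_mono2) auto
              then show ?thesis using True by (simp add: memE)
            qed simp
          qed
          also have "\<dots> = ennreal (real N powr q * real N powr q) * emeasure lebesgue (cube 0 (real N) :: (real^'n) set)"
            by (rule nn_integral_cmult_indicator[OF cube_lebesgue])
          also have "\<dots> < \<infinity>" by (simp add: emeasure_cube ennreal_mult_less_top del: emeasure_completion)
          finally show ?thesis unfolding Z_def by simp
        qed
        have \<phi>L: "\<phi> \<in> Linf_c"
        proof -
          have m: "(\<lambda>x. complex_of_real (norm (g x) powr (q - 1) * lam x powr q)) \<in> borel_measurable lebesgue"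
            by (intro measurable_compose[OF _ borel_measurable_of_real] borel_measurable_times powr_real_measurable borel_measurable_const
                measurable_compose[OF gm borel_measurable_norm] lm)
          have "\<phi> \<in> borel_measurable lebesgue"
            unfolding \<phi>_def using Em[of N]
            by (intro measurable_If_set m borel_measurable_const) (simp add: sets.Int_space_eq2 del: sets_completion)
          moreover have "bounded (range \<phi>)"
          proof (rule boundedI)
            fix y assume "y \<in> range \<phi>"
            then obtain x where y: "y = \<phi> x" by blast
            show "norm y \<le> real N powr (q - 1) * real N powr q"
            proof (cases "x \<in> E N")
              case True
              then show ?thesis
                unfolding y \<phi>_def memE using lm(2)[of x] pos by (auto simp: norm_mult intro!: mult_mono powr_mono2)
            qed (simp add: y \<phi>_def)
          qed
          moreover have "compact (cube 0 (real N) :: (real^'n) set)" by (simp add: cube_def)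
          ultimately show ?thesis by (auto simp: Linf_c_def \<phi>_def memE intro!: exI[of _ "cube 0 (real N)"])
        qed
        have 1: "(\<integral>\<^sup>+x. ennreal (norm (g x) * norm (\<phi> x)) \<partial>lebesgue) = ennreal Z"
          unfolding Zfin[symmetric]
        proof (rule nn_integral_cong)
          fix x
          have "norm (g x) * norm (g x) powr (q - 1) = norm (g x) powr q" by (subst powr_mult_base) auto
          then show "ennreal (norm (g x) * norm (\<phi> x)) = h x * indicator (E N) x"
            by (simp add: \<phi>_def h_def norm_mult mult.assoc[symmetric])
        qed
        have 2: "(\<integral>\<^sup>+x. ennreal (norm (\<phi> x) powr q' * v x powr (1 - q' * r)) \<partial>lebesgue) = ennreal Z"
          unfolding Zfin[symmetric]
        proof (rule nn_integral_cong)
          fix x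
          have vx: "v x powr (1 - q' * r) = lam x powr - q'" unfolding v powr_powr ve ..
          show "ennreal (norm (\<phi> x) powr q' * v x powr (1 - q' * r)) = h x * indicator (E N) x"
          proof (cases "x \<in> E N \<and> 0 < lam x")
            case True
            have "norm (\<phi> x) powr q' * v x powr (1 - q' * r) = (norm (g x) powr (q - 1) * lam x powr q) powr q' * lam x powr - q'"
              unfolding vx using True by (simp add: \<phi>_def norm_mult)
            also have "\<dots> = norm (g x) powr ((q - 1) * q') * (lam x powr (q * q') * lam x powr - q')"
              by (subst powr_mult) (simp_all add: powr_powr)
            also have "lam x powr (q * q') * lam x powr - q' = lam x powr (q * q' - q')"
              by (simp flip: powr_add)
            finally have "norm (\<phi> x) powr q' * v x powr (1 - q' * r) = norm (g x) powr q * lam x powr q"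
              unfolding q'(2,3) .
            then show ?thesis using True by (simp add: h_def)
          next
            case False
            then have "lam x = 0 \<or> x \<notin> E N" using lm(2)[of x] by auto
            then show ?thesis by (auto simp: \<phi>_def h_def)
          qed
        qed
        show ?thesis
        proof (cases "0 < Z")
          case True
          have I': "(\<integral>\<^sup>+x. ennreal (norm (f x) powr p * u x powr (1 - p / p0)) \<partial>lebesgue) \<le> ennreal I"
            using I(1) unfolding u powr_powr ue .
          have D: "1 \<le> 3 / 2 * U" "1 \<le> 3 / 2 * V" using UV by auto
          have "hform \<alpha> f \<phi> \<le> ennreal (C * K * ((3 / 2 * U) powr (1 / q) + (3 / 2 * V) powr (1 - 1 / p)) * (I powr (1 / p) * Z powr (1 - 1 / q)))"
            using UV UVK
            by (intro C(2)[OF w(1,2) D _ _ Kcell Kpos f \<phi>L I' I(2) 2[unfolded q'_def, THEN eq_refl] True] Ainf_chain w) auto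
          then have "ennreal (1 / \<Gamma>) * hform \<alpha> f \<phi> \<le> ennreal (1 / \<Gamma>) * ennreal (C * K * DD * (I powr (1 / p) * Z powr (1 - 1 / q)))"
            unfolding DD_def by (rule mult_left_mono) simp
          also have "\<dots> = ennreal (C0 * I powr (1 / p) * Z powr (1 - 1 / q))"
            using \<Gamma> C(1) K0 DDS by (simp add: C0_def mult.assoc flip: ennreal_mult)
          finally have "ennreal Z \<le> ennreal (C0 * I powr (1 / p) * Z powr (1 - 1 / q))"
            using frac_power_dual[OF \<alpha>0 g f \<phi>L] unfolding 1 \<Gamma>_def[symmetric] by (rule order_trans[rotated])
          then have "Z \<le> C0 * I powr (1 / p) * Z powr (1 - 1 / q)"
            using C0 by (subst (asm) ennreal_le_iff) auto
          moreover have "Z = Z powr (1 / q) * Z powr (1 - 1 / q)" using True by (simp flip: powr_add)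
          ultimately have "Z powr (1 / q) * Z powr (1 - 1 / q) \<le> C0 * I powr (1 / p) * Z powr (1 - 1 / q)" by simp
          then have "Z powr (1 / q) \<le> C0 * I powr (1 / p)"
            by (rule mult_right_le_imp_le) (use True in simp)
          then have "(Z powr (1 / q)) powr q \<le> (C0 * I powr (1 / p)) powr q"
            using pos by (intro powr_mono2) auto
          then have "Z \<le> (C0 * I powr (1 / p)) powr q" using True pos by (simp add: powr_powr)
          then show ?thesis unfolding Zfin by (rule ennreal_leI)
        next
          case False
          then show ?thesis unfolding Zfin by (simp add: ennreal_neg)
        qed
      qed
      have sup: "h x = (SUP N. h x * indicator (E N) x)" for x
      proof (rule antisym)
        obtain N where N: "2 * norm x + norm (g x) + lam x \<le> real N" using real_arch_simple by blast
        have "\<bar>x $ i\<bar> \<le> real N / 2" for i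
          using component_le_norm_cart[of x i] N lm(2)[of x] norm_ge_zero[of "g x"] by linarith
        then have "- (real N / 2) \<le> x $ i \<and> x $ i \<le> real N / 2" for i by (metis abs_le_iff minus_le_iff)
        moreover have "norm (g x) \<le> real N" "lam x \<le> real N"
          using N lm(2)[of x] norm_ge_zero[of "g x"] norm_ge_zero[of x] by linarith+
        ultimately have "x \<in> E N" by (simp add: memE mem_cube)
        then show "h x \<le> (SUP N. h x * indicator (E N) x)" by (intro SUP_upper2[of N]) auto
        show "(SUP N. h x * indicator (E N) x) \<le> h x" by (rule SUP_least) (auto simp: indicator_def)
      qed
      have sub: "E M \<subseteq> E N" if "M \<le> N" for M N
        using that cube_mono[of "real M" "real N" "0 :: real^'n"] by (fastforce simp: memE)
      have "(\<integral>\<^sup>+x. h x \<partial>lebesgue) = (\<integral>\<^sup>+x. (SUP N. h x * indicator (E N) x) \<partial>lebesgue)"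
        by (rule nn_integral_cong) (rule sup)
      also have "\<dots> = (SUP N. \<integral>\<^sup>+x\<in>E N. h x \<partial>lebesgue)"
      proof (rule nn_integral_monotone_convergence_SUP)
        show "incseq (\<lambda>N x. h x * indicator (E N) x)"
          using sub by (auto simp: incseq_def le_fun_def indicator_def)
        show "(\<lambda>x. h x * indicator (E N) x) \<in> borel_measurable lebesgue" for N
          by (intro borel_measurable_times_ennreal hm borel_measurable_indicator Em)
      qed
      also have "\<dots> \<le> ennreal ((C0 * I powr (1 / p)) powr q)" by (rule SUP_least) (rule AN)
      finally show ?thesis .
    qed
    have key: "wnorm q (\<lambda>x. lam x powr q) g \<le> ennreal (C0 * I powr (1 / p))"
      if I: "(\<integral>\<^sup>+x. ennreal (norm (f x) powr p * mu x powr p) \<partial>lebesgue) \<le> ennreal I" "0 < I" for I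
    proof -
      let ?B = "C0 * I powr (1 / p)"
      have B: "0 \<le> ?B" using C0 by simp
      obtain x where x: "0 \<le> x" "(\<integral>\<^sup>+x. h x \<partial>lebesgue) = ennreal x" "x \<le> ?B powr q"
        using bound[OF I] by (cases "\<integral>\<^sup>+x. h x \<partial>lebesgue") (auto simp: top_unique)
      have "wnorm q (\<lambda>x. lam x powr q) g = ennreal (x powr (1 / q))"
        unfolding wnorm_def h_def[symmetric] x(2) by (rule epow_ennreal[OF x(1)])
      also have "x powr (1 / q) \<le> (?B powr q) powr (1 / q)" using x pos by (intro powr_mono2) auto
      then have "ennreal (x powr (1 / q)) \<le> ennreal ((?B powr q) powr (1 / q))" by (rule ennreal_leI)
      also have "(?B powr q) powr (1 / q) = ?B" using B pos by (simp add: powr_powr)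
      finally show ?thesis .
    qed
    define F where "F = (\<integral>\<^sup>+x. ennreal (norm (f x) powr p * mu x powr p) \<partial>lebesgue)"
    define C3 where "C3 = (C + 1) * (3 / 2) / \<Gamma> * K * S"
    have C3: "0 < C3" unfolding C3_def using C(1) \<Gamma> Kpos DDS by simp
    have rhs: "ennreal ((C + 1) * (3 / 2) / \<Gamma>) * ?pc * (epow (Ainf_const u) (1 / q) + epow (Ainf_const v) (1 - 1 / p)) *
        wnorm p (\<lambda>x. mu x powr p) f = ennreal C3 * epow F (1 / p)"
    proof -
      have S: "epow (Ainf_const u) (1 / q) + epow (Ainf_const v) (1 - 1 / p) = ennreal S"
        unfolding UVK S_def using UV by (simp add: epow_ennreal ennreal_plus)
      have c: "0 \<le> (C + 1) * (3 / 2) / \<Gamma>" using C(1) \<Gamma> by simp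
      show ?thesis
        unfolding UVK(3) C3_def wnorm_def F_def[symmetric] S
        by (simp only: ennreal_mult[OF mult_nonneg_nonneg[OF c K0] less_imp_le[OF DDS(2)]] ennreal_mult[OF c K0])
    qed
    have "wnorm q (\<lambda>x. lam x powr q) g \<le> ennreal C3 * epow F (1 / p)"
    proof (cases F)
      case (real I)
      show ?thesis
      proof (cases "0 < I")
        case True
        have "wnorm q (\<lambda>x. lam x powr q) g \<le> ennreal (C0 * I powr (1 / p))"
          using real True by (intro key) (auto simp: F_def)
        also have "\<dots> \<le> ennreal (C3 * I powr (1 / p))"
          using C0 by (intro ennreal_leI mult_right_mono) (auto simp: C3_def)
        also have "\<dots> = ennreal C3 * epow F (1 / p)"
          using real C3 by (simp add: epow_ennreal ennreal_mult)
        finally show ?thesis .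
      next
        case False
        then have F0: "F = 0" using real by simp
        have small: "wnorm q (\<lambda>x. lam x powr q) g \<le> 0 + ennreal \<delta>" if "0 < \<delta>" for \<delta> :: real
        proof -
          define I where "I = (\<delta> / (C0 + 1)) powr p"
          have d: "0 < \<delta> / (C0 + 1)" using that C0 by simp
          have "(y powr p) powr (1 / p) = y" if "0 < y" for y using pos that by (simp add: powr_powr)
          from this[OF d] have I: "I powr (1 / p) = \<delta> / (C0 + 1)" unfolding I_def .
          have I0: "0 < I" unfolding I_def powr_gt_zero using d by (rule less_imp_neq[symmetric])
          have "wnorm q (\<lambda>x. lam x powr q) g \<le> ennreal (C0 * I powr (1 / p))"
            using F0 I0 by (intro key) (auto simp: F_def)
          also have "C0 * I powr (1 / p) \<le> \<delta>"
            unfolding I using C0 that by (simp add: field_simps)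
          then have "ennreal (C0 * I powr (1 / p)) \<le> ennreal \<delta>" by (rule ennreal_leI)
          finally show ?thesis by simp
        qed
        have "wnorm q (\<lambda>x. lam x powr q) g \<le> 0"
          by (rule ennreal_le_epsilon) (rule small, assumption)
        then show ?thesis by simp
      qed
    next
      case top
      then have "ennreal C3 * epow F (1 / p) = \<infinity>" using C3 by (simp add: epow_def ennreal_mult_top)
      then show ?thesis by simp
    qed
    then show "wnorm q (\<lambda>x. lam x powr q) (neg_power L (\<alpha> / \<kappa>) f) \<le>
      ennreal ((C + 1) * (3 / 2) / \<Gamma>) * ?pc * (epow (Ainf_const u) (1 / q) + epow (Ainf_const v) (1 - 1 / p)) *
        wnorm p (\<lambda>x. mu x powr p) f"
      unfolding rhs g_def .
  qed
qed

end
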